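(* There is an algorithm that, given an undirected simple graph $G=(V,E)$ with $n=|V|$ and $m=|E|$ and an integer $k$, enumerates (outputs each exactly once) all $k$-subtrees of $G$ in $O(n+m+k\cdot N)$ time and $O(n+m)$ space, where $N$ is the number of $k$-subtrees of $G$.
   Context: For $F\subseteq E$, the subgraph induced by $F$ is $G[F]=(U,F)$ where $U$ is the set of endpoints of edges in $F$. A $k$-subtree of $G$ is a subgraph $G[F]$ induced by a set $F$ of exactly $k$ edges that is connected and has no cycles; it is output by listing $F$. The graph is given in adjacency-list form (standard RAM model), supporting iteration over neighbours of $v$ in $O(\deg(v))$ time and edge insertion/deletion in $O(1)$ time. *)

theory Defs
  imports Main
begin

section \<open>Undirected simple graphs and k-subtrees\<close>

type_synonym 'v ugraph = "'v set \<times> 'v set set"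

definition simple_graph :: "'v ugraph \<Rightarrow> bool" where
  "simple_graph G \<longleftrightarrow> finite (fst G) \<and> (\<forall>e\<in>snd G. e \<subseteq> fst G \<and> card e = 2)"

definition edge_induced :: "'v set set \<Rightarrow> 'v ugraph" where
  "edge_induced F = (\<Union>F, F)"

definition walk :: "'v ugraph \<Rightarrow> 'v list \<Rightarrow> bool" where
  "walk G p \<longleftrightarrow> p \<noteq> [] \<and> set p \<subseteq> fst G \<and> successively (\<lambda>u v. {u, v} \<in> snd G) p"

definition connected_graph :: "'v ugraph \<Rightarrow> bool" where
  "connected_graph G \<longleftrightarrow>
     (\<forall>u\<in>fst G. \<forall>v\<in>fst G. \<exists>p. walk G p \<and> hd p = u \<and> last p = v)"

definition is_cycle :: "'v ugraph \<Rightarrow> 'v list \<Rightarrow> bool" where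
  "is_cycle G p \<longleftrightarrow> walk G p \<and> distinct p \<and> 3 \<le> length p \<and> {last p, hd p} \<in> snd G"

definition acyclic_graph :: "'v ugraph \<Rightarrow> bool" where
  "acyclic_graph G \<longleftrightarrow> (\<nexists>p. is_cycle G p)"

text \<open>A k-subtree is identified with its edge set. For \<open>k = 0\<close> the empty edge set induces the
  null graph, which is connected and acyclic by the definitions above.\<close>

definition k_subtrees :: "'v ugraph \<Rightarrow> nat \<Rightarrow> 'v set set set" where
  "k_subtrees G k = {F. F \<subseteq> snd G \<and> card F = k \<and>
     connected_graph (edge_induced F) \<and> acyclic_graph (edge_induced F)}"


section \<open>Random access machine\<close>

text \<open>Unit-cost RAM: a finite program, registers, a memory addressed indirectly through registers,
  and a write-only output tape. A finite program mentions only finitely many registers, so the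
  registers contribute \<open>O(1)\<close> to the space. Subtraction is truncated.
  The machine halts when the program counter leaves the program.\<close>

datatype instr =
    Const nat nat        \<comment> \<open>\<open>R i := c\<close>\<close>
  | Move nat nat         \<comment> \<open>\<open>R i := R j\<close>\<close>
  | Add nat nat nat      \<comment> \<open>\<open>R i := R j + R l\<close>\<close>
  | Sub nat nat nat      \<comment> \<open>\<open>R i := R j - R l\<close>\<close>
  | Load nat nat         \<comment> \<open>\<open>R i := M (R j)\<close>\<close>
  | Store nat nat        \<comment> \<open>\<open>M (R i) := R j\<close>\<close>
  | Jump nat
  | JumpZero nat nat     \<comment> \<open>jump to the second argument if \<open>R i = 0\<close>\<close>
  | Output nat           \<comment> \<open>append \<open>R i\<close> to the output tape\<close>

record config =
  pc :: nat
  reg :: "nat \<Rightarrow> nat"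
  mem :: "nat \<Rightarrow> nat"
  out :: "nat list"

fun exec :: "instr \<Rightarrow> config \<Rightarrow> config" where
  "exec (Const i c) s = s\<lparr>pc := pc s + 1, reg := (reg s)(i := c)\<rparr>"
| "exec (Move i j) s = s\<lparr>pc := pc s + 1, reg := (reg s)(i := reg s j)\<rparr>"
| "exec (Add i j l) s = s\<lparr>pc := pc s + 1, reg := (reg s)(i := reg s j + reg s l)\<rparr>"
| "exec (Sub i j l) s = s\<lparr>pc := pc s + 1, reg := (reg s)(i := reg s j - reg s l)\<rparr>"
| "exec (Load i j) s = s\<lparr>pc := pc s + 1, reg := (reg s)(i := mem s (reg s j))\<rparr>"
| "exec (Store i j) s = s\<lparr>pc := pc s + 1, mem := (mem s)(reg s i := reg s j)\<rparr>"
| "exec (Jump l) s = s\<lparr>pc := l\<rparr>"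
| "exec (JumpZero i l) s = s\<lparr>pc := (if reg s i = 0 then l else pc s + 1)\<rparr>"
| "exec (Output i) s = s\<lparr>pc := pc s + 1, out := out s @ [reg s i]\<rparr>"

definition halted :: "instr list \<Rightarrow> config \<Rightarrow> bool" where
  "halted P s \<longleftrightarrow> length P \<le> pc s"

definition step :: "instr list \<Rightarrow> config \<Rightarrow> config" where
  "step P s = (if halted P s then s else exec (P ! pc s) s)"

definition run :: "instr list \<Rightarrow> nat \<Rightarrow> config \<Rightarrow> config" where
  "run P t s = (step P ^^ t) s"

fun instr_addresses :: "instr \<Rightarrow> config \<Rightarrow> nat set" where
  "instr_addresses (Load i j) s = {reg s j}"
| "instr_addresses (Store i j) s = {reg s i}"
| "instr_addresses _ s = {}"

text \<open>Memory addresses accessed by the next step.\<close>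

definition accessed :: "instr list \<Rightarrow> config \<Rightarrow> nat set" where
  "accessed P s = (if halted P s then {} else instr_addresses (P ! pc s) s)"

text \<open>Space is measured by the highest memory address in use.\<close>

definition runs_within_space :: "instr list \<Rightarrow> config \<Rightarrow> nat \<Rightarrow> nat \<Rightarrow> bool" where
  "runs_within_space P s t S \<longleftrightarrow> (\<forall>i<t. accessed P (run P i s) \<subseteq> {..<S})"

text \<open>Every register and memory cell holds a word below \<open>W\<close> at all times, so that unit cost per
  operation and per cell is not exploited by packing data into large numbers.\<close>

definition runs_within_words :: "instr list \<Rightarrow> config \<Rightarrow> nat \<Rightarrow> nat \<Rightarrow> bool" where
  "runs_within_words P s t W \<longleftrightarrow>
     (\<forall>i\<le>t. (\<forall>r. reg (run P i s) r < W) \<and> (\<forall>a. mem (run P i s) a < W))"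


section \<open>Input: adjacency lists\<close>

text \<open>The vertices are \<open>0, \<dots>, n - 1\<close>. Cell \<open>v < n\<close> holds the address of the first node of the doubly
  linked adjacency list of \<open>v\<close>. Each edge \<open>{v, w}\<close> has one node in the list of \<open>v\<close> and one in the list
  of \<open>w\<close>. The node at address \<open>x\<close> consists of four cells: the neighbour (\<open>x\<close>), the next
  node (\<open>x + 1\<close>), the previous node (\<open>x + 2\<close>), and the node of the same edge in the neighbour's
  list (\<open>x + 3\<close>), which makes edge deletion possible in constant time. The \<open>2m\<close> nodes occupy
  \<open>n, \<dots>, n + 8m - 1\<close> in arbitrary order, so \<open>0\<close> is free to serve as the null pointer.\<close>

fun linked_list :: "(nat \<Rightarrow> nat) \<Rightarrow> nat \<Rightarrow> nat \<Rightarrow> nat list \<Rightarrow> bool" where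
  "linked_list M prev a [] \<longleftrightarrow> a = 0"
| "linked_list M prev a (x # xs) \<longleftrightarrow>
     a = x \<and> M (x + 2) = prev \<and> linked_list M x (M (x + 1)) xs"

definition adjacency_lists :: "nat \<Rightarrow> nat set set \<Rightarrow> (nat \<Rightarrow> nat) \<Rightarrow> bool" where
  "adjacency_lists n E M \<longleftrightarrow>
     (\<exists>L. \<forall>v<n.
        linked_list M 0 (M v) (L v) \<and> distinct (L v) \<and>
        set (L v) \<subseteq> {n + 4 * i |i. i < 2 * card E} \<and>
        bij_betw M (set (L v)) {w. {v, w} \<in> E} \<and>
        (\<forall>x\<in>set (L v). M (x + 3) \<in> set (L (M x)) \<and> M (M (x + 3)) = v)) \<and>
     (\<forall>a\<ge>n + 8 * card E. M a = 0)"

definition initial_config :: "nat \<Rightarrow> nat \<Rightarrow> nat \<Rightarrow> (nat \<Rightarrow> nat) \<Rightarrow> config" where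
  "initial_config n m k M =
     \<lparr>pc = 0, reg = (\<lambda>_. 0)(0 := n, 1 := m, 2 := k), mem = M, out = []\<rparr>"


section \<open>Output: listings of edge sets\<close>

definition listed_edges :: "(nat \<times> nat) list \<Rightarrow> nat set list" where
  "listed_edges es = map (\<lambda>(u, v). {u, v}) es"

text \<open>An edge list is written as its length followed by the endpoints of its edges.\<close>

definition encode_edges :: "(nat \<times> nat) list \<Rightarrow> nat list" where
  "encode_edges es = length es # concat (map (\<lambda>(u, v). [u, v]) es)"

definition enumerates :: "nat list \<Rightarrow> nat set set set \<Rightarrow> bool" where
  "enumerates ws \<F> \<longleftrightarrow>
     (\<exists>sols. ws = concat (map encode_edges sols) \<and>
        (\<forall>es\<in>set sols. distinct (listed_edges es)) \<and>
        distinct (map (\<lambda>es. set (listed_edges es)) sols) \<and>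
        set (map (\<lambda>es. set (listed_edges es)) sols) = \<F>)"

end

theory Submission
  imports Defs
begin

text \<open>The k-subtrees through a root are enumerated by binary partition. Breadth-first search from
  the current tree stops after \<open>k + 2\<close> vertices or at the first edge closing a cycle, hence after
  \<open>O(k)\<close> steps. If it stops for neither reason, there is exactly one solution. Otherwise the path
  from the current tree to the place where it stopped is followed: as long as its next edge cannot be
  deleted without leaving fewer than \<open>k + 1\<close> reachable vertices, that edge belongs to every solution
  and is added; the first other edge is branched on. Including and excluding that edge both leave a
  solution, so the search tree has \<open>2N - 1\<close> nodes.

  Testing an edge, and deleting the edges that its inclusion makes internal to the tree, may take more
  than \<open>O(k)\<close> steps. By an exchange argument all but \<open>O(k)\<close> of the edges inspected lie in pairwise
  different solutions that include the branching edge. A solution is charged this way only when it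
  gains an edge, that is \<open>O(k)\<close> times in total.

  The vertices of a component serve as roots in reverse breadth-first order and are deleted after
  use. The remaining ones stay connected, so every root used while more than \<open>k\<close> vertices remain
  has a solution to pay for it.\<close>

section \<open>A while language and its compilation\<close>

text \<open>The obstacle is vertices of large degree: a search that costs \<open>O(k)\<close> must
  not walk through a long adjacency list. Hence the current tree is kept free of non-tree edges
  between its own vertices, and a scan meets only edges of the growing search tree until it stops.
  Deletions exist to restore this property after an inclusion. The charging becomes a potential:
  with \<open>sz\<close> vertices in the tree and \<open>N\<close> solutions below a node,
  \<open>60 * (Suc k - sz) * N\<close> releases at least \<open>60\<close> per solution of the
  include child, and \<open>600 * Suc k * (2 * N - 1)\<close> pays \<open>O(k)\<close> at every
  node. The limit of \<open>k + 2\<close> vertices is one more than a solution has, so that the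
  vertex queued last can be spared. When a path edge turns out to be forced, the search that tested
  it is resumed for the next edge instead of restarted. Deleted list nodes keep their own pointers
  and are put back in reverse order, so undoing needs to know no more than the node, and the space
  stays linear. An explicit stack with one entry per edge deleted or included by the search replaces
  recursion.\<close>

datatype exp = Lit nat | Var nat | Plus exp exp | Minus exp exp | Arr nat exp

datatype com =
    Skip
  | Assign nat exp
  | Write nat exp exp
  | Emit exp
  | Seq com com  (infixr ";;" 60)
  | Cond exp com com
  | While exp com

record store =
  var :: "nat => nat"
  arr :: "nat => nat => nat"
  emitted :: "nat list"
  ticks :: nat

fun ev :: "exp => store => nat" where
  "ev (Lit c) s = c"
| "ev (Var r) s = var s r"
| "ev (Plus a b) s = ev a s + ev b s"
| "ev (Minus a b) s = ev a s - ev b s"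
| "ev (Arr a e) s = arr s a (ev e s)"

text \<open>\<open>W\<close> bounds words and \<open>Z\<close> the length of an array. Literals and
  sums are the only sources of new large values: differences are truncated, and variables and cells
  hold words already.\<close>

fun safe :: "nat => nat => exp => store => bool" where
  "safe W Z (Lit c) s \<longleftrightarrow> c < W"
| "safe W Z (Var r) s \<longleftrightarrow> True"
| "safe W Z (Plus a b) s \<longleftrightarrow> safe W Z a s \<and> safe W Z b s \<and> ev a s + ev b s < W"
| "safe W Z (Minus a b) s \<longleftrightarrow> safe W Z a s \<and> safe W Z b s"
| "safe W Z (Arr a e) s \<longleftrightarrow> safe W Z e s \<and> ev e s < Z"

abbreviation tick :: "store => store" where
  "tick s \<equiv> s\<lparr>ticks := Suc (ticks s)\<rparr>"

text \<open>One tick is charged for each assignment, array write, output and test, whatever the size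
  of its expressions, since a fixed program contains only expressions of bounded size. Unsafe steps
  have no rule, so a derivation certifies termination as well as the bounds on words and
  indices.\<close>

inductive big :: "nat => nat => com => store => store => bool" for W Z where
  Skip: "big W Z Skip s s"
| Assign: "safe W Z e s ==>
    big W Z (Assign r e) s (s\<lparr>var := (var s)(r := ev e s), ticks := Suc (ticks s)\<rparr>)"
| Write: "safe W Z i s ==> safe W Z e s ==> ev i s < Z ==>
    big W Z (Write a i e) s
      (s\<lparr>arr := (arr s)(a := (arr s a)(ev i s := ev e s)), ticks := Suc (ticks s)\<rparr>)"
| Emit: "safe W Z e s ==>
    big W Z (Emit e) s (s\<lparr>emitted := emitted s @ [ev e s], ticks := Suc (ticks s)\<rparr>)"
| Seq: "big W Z c1 s s1 ==> big W Z c2 s1 s2 ==> big W Z (c1 ;; c2) s s2"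
| CondT: "safe W Z e s ==> ev e s \<noteq> 0 ==> big W Z c1 (tick s) s' ==> big W Z (Cond e c1 c2) s s'"
| CondF: "safe W Z e s ==> ev e s = 0 ==> big W Z c2 (tick s) s' ==> big W Z (Cond e c1 c2) s s'"
| WhileF: "safe W Z e s ==> ev e s = 0 ==> big W Z (While e c) s (tick s)"
| WhileT: "safe W Z e s ==> ev e s \<noteq> 0 ==> big W Z c (tick s) s1 ==>
    big W Z (While e c) s1 s' ==> big W Z (While e c) s s'"

text \<open>Register layout: program variables below 50, the base address of array \<open>a\<close> in register
  \<open>50 + a\<close>, temporaries from 70 on. Array \<open>a\<close> occupies the cells \<open>a * Z, \<dots>, a * Z + Z - 1\<close>.\<close>

fun cexp :: "exp => nat => instr list" where
  "cexp (Lit c) d = [Const d c]"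
| "cexp (Var r) d = [Move d r]"
| "cexp (Plus a b) d = cexp a d @ cexp b (Suc d) @ [Add d d (Suc d)]"
| "cexp (Minus a b) d = cexp a d @ cexp b (Suc d) @ [Sub d d (Suc d)]"
| "cexp (Arr a e) d = cexp e d @ [Add d d (50 + a), Load d d]"

fun clen :: "com => nat" where
  "clen Skip = 0"
| "clen (Assign r e) = length (cexp e 70) + 1"
| "clen (Write a i e) = length (cexp i 70) + length (cexp e 71) + 2"
| "clen (Emit e) = length (cexp e 70) + 1"
| "clen (c1 ;; c2) = clen c1 + clen c2"
| "clen (Cond e c1 c2) = length (cexp e 70) + 1 + clen c1 + 1 + clen c2"
| "clen (While e c) = length (cexp e 70) + 1 + clen c + 1"

fun ccom :: "nat => com => instr list" where
  "ccom p Skip = []"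
| "ccom p (Assign r e) = cexp e 70 @ [Move r 70]"
| "ccom p (Write a i e) = cexp i 70 @ cexp e 71 @ [Add 70 70 (50 + a), Store 70 71]"
| "ccom p (Emit e) = cexp e 70 @ [Output 70]"
| "ccom p (c1 ;; c2) = ccom p c1 @ ccom (p + clen c1) c2"
| "ccom p (Cond e c1 c2) = (let le = length (cexp e 70) in
     cexp e 70 @ [JumpZero 70 (p + le + 1 + clen c1 + 1)] @ ccom (p + le + 1) c1 @
     [Jump (p + le + 1 + clen c1 + 1 + clen c2)] @ ccom (p + le + 1 + clen c1 + 1) c2)"
| "ccom p (While e c) = (let le = length (cexp e 70) in
     cexp e 70 @ [JumpZero 70 (p + le + 1 + clen c + 1)] @ ccom (p + le + 1) c @ [Jump p])"

lemma length_ccom [simp]: "length (ccom p c) = clen c"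
  by (induction c arbitrary: p) (auto simp: Let_def)

fun wfe :: "exp => bool" where
  "wfe (Lit c) \<longleftrightarrow> True"
| "wfe (Var r) \<longleftrightarrow> r < 50"
| "wfe (Plus a b) \<longleftrightarrow> wfe a \<and> wfe b"
| "wfe (Minus a b) \<longleftrightarrow> wfe a \<and> wfe b"
| "wfe (Arr a e) \<longleftrightarrow> a < 16 \<and> wfe e"

fun wfc :: "com => bool" where
  "wfc Skip \<longleftrightarrow> True"
| "wfc (Assign r e) \<longleftrightarrow> r < 50 \<and> wfe e"
| "wfc (Write a i e) \<longleftrightarrow> a < 16 \<and> wfe i \<and> wfe e"
| "wfc (Emit e) \<longleftrightarrow> wfe e"
| "wfc (c1 ;; c2) \<longleftrightarrow> wfc c1 \<and> wfc c2"
| "wfc (Cond e c1 c2) \<longleftrightarrow> wfe e \<and> wfc c1 \<and> wfc c2"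
| "wfc (While e c) \<longleftrightarrow> wfe e \<and> wfc c"

section \<open>Placement of code and simulation of stores by machine configurations\<close>

definition code_at :: "instr list => nat => instr list => bool" where
  "code_at P p cs \<longleftrightarrow> (\<forall>i<length cs. p + i < length P \<and> P ! (p + i) = cs ! i)"

lemma code_at_Nil [simp]: "code_at P p []"
  by (simp add: code_at_def)

lemma code_at_Cons [simp]:
  "code_at P p (c # cs) \<longleftrightarrow> p < length P \<and> P ! p = c \<and> code_at P (Suc p) cs"
  unfolding code_at_def by (auto simp: less_Suc_eq_0_disj all_conj_distrib)

lemma code_at_append [simp]:
  "code_at P p (as @ bs) \<longleftrightarrow> code_at P p as \<and> code_at P (p + length as) bs"
  by (induction as arbitrary: p) auto

lemma code_at_length: "code_at P p cs ==> length cs \<le> length P"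
proof (cases "length cs")
  case (Suc l)
  moreover assume "code_at P p cs"
  ultimately have "p + l < length P" by (auto simp: code_at_def)
  then show ?thesis using Suc by simp
qed simp

definition words_ok :: "nat => config => bool" where
  "words_ok W c \<longleftrightarrow> (\<forall>r. reg c r < W) \<and> (\<forall>a. mem c a < W)"

definition steps :: "instr list => nat => nat => config => nat => config => bool" where
  "steps P W B c t c' \<longleftrightarrow> run P t c = c' \<and> runs_within_space P c t B \<and> runs_within_words P c t W"

lemma run_add: "run P (a + b) c = run P b (run P a c)"
  by (simp add: run_def funpow_add add.commute[of a b])

lemma steps_0 [intro]: "words_ok W c ==> steps P W B c 0 c"
  by (simp add: steps_def run_def runs_within_space_def runs_within_words_def words_ok_def)

lemma steps_words: "steps P W B c t c' ==> words_ok W c'"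
  by (auto simp: steps_def runs_within_words_def words_ok_def)

lemma steps_trans:
  assumes "steps P W B c a c1" and "steps P W B c1 b c2"
  shows "steps P W B c (a + b) c2"
proof -
  have r: "run P (a + j) c = run P j c1" for j
    using assms(1) by (simp add: run_add steps_def)
  have "accessed P (run P i c) \<subseteq> {..<B}" if "i < a + b" for i
  proof (cases "i < a")
    case False
    then have "i = a + (i - a)" "i - a < b" using that by auto
    then show ?thesis using assms(2) r[of "i - a"] unfolding steps_def runs_within_space_def by metis
  qed (use assms(1) in \<open>auto simp: steps_def runs_within_space_def\<close>)
  moreover have "words_ok W (run P i c)" if "i \<le> a + b" for i
  proof (cases "i \<le> a")
    case False
    then have "i = a + (i - a)" "i - a \<le> b" using that by auto
    then show ?thesis
      using assms(2) r[of "i - a"] unfolding steps_def runs_within_words_def words_ok_def by metis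
  qed (use assms(1) in \<open>auto simp: steps_def runs_within_words_def words_ok_def\<close>)
  ultimately show ?thesis
    using assms(2) r[of b]
    by (simp add: steps_def runs_within_space_def runs_within_words_def words_ok_def)
qed

lemma steps_one:
  assumes "code_at P (pc c) [i]" and "instr_addresses i c \<subseteq> {..<B}"
    and "words_ok W c" and "words_ok W (exec i c)"
  shows "steps P W B c 1 (exec i c)"
proof -
  have "run P (Suc 0) c = exec i c" "run P 0 c = c" "accessed P c = instr_addresses i c"
    using assms(1) by (auto simp: run_def step_def halted_def accessed_def)
  then show ?thesis
    using assms
    by (auto simp: steps_def runs_within_space_def runs_within_words_def words_ok_def le_Suc_eq)
qed

text \<open>Array \<open>0\<close> has base address \<open>0\<close>, so the adjacency lists of the
  input are array \<open>0\<close> in place and need not be copied.\<close>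

definition sim :: "nat => nat => store => config => bool" where
  "sim W Z s c \<longleftrightarrow> (\<forall>r<50. reg c r = var s r) \<and> (\<forall>a<16. reg c (50 + a) = a * Z) \<and>
     (\<forall>a<16. \<forall>i<Z. mem c (a * Z + i) = arr s a i) \<and> out c = emitted s \<and> words_ok W c"

lemma array_address_less: "a < 16 ==> i < Z ==> a * Z + i < 16 * (Z::nat)"
proof -
  assume "a < 16" "i < Z"
  then have "Suc a * Z \<le> 16 * Z" by (intro mult_right_mono) linarith+
  then show ?thesis using \<open>i < Z\<close> by (simp only: mult_Suc)
qed

text \<open>Dividing an address by \<open>Z\<close> recovers the array, so a write to one array
  cannot disturb another.\<close>

lemma array_address_inj:
  assumes "a * Z + i = b * Z + j" "i < Z" "j < (Z::nat)"
  shows "a = b" "i = j"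
proof -
  have "(c * Z + l) div Z = c" if "l < Z" for c l using that by auto
  then show "a = b" using assms by metis
  then show "i = j" using assms(1) by simp
qed

lemma sim_temp: "sim W Z s c ==> 70 \<le> d ==> v < W ==> sim W Z s (c\<lparr>pc := p, reg := (reg c)(d := v)\<rparr>)"
  by (auto simp: sim_def words_ok_def)

lemma sim_pc: "sim W Z s c ==> sim W Z s (c\<lparr>pc := p\<rparr>)"
  by (auto simp: sim_def words_ok_def)

lemma sim_tick [simp]: "sim W Z (s\<lparr>ticks := t\<rparr>) c = sim W Z s c"
  by (simp add: sim_def)

text \<open>The temporaries from \<open>d\<close> on form an expression stack. That registers below
  \<open>d\<close> survive is what keeps the left operand of a binary operation alive while the
  right one is evaluated.\<close>

lemma cexp_correct:
  assumes "code_at P (pc c) (cexp e d)" "sim W Z s c" "70 \<le> d" "wfe e" "safe W Z e s" "16 * Z \<le> W"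
  shows "\<exists>c'. steps P W (16 * Z) c (length (cexp e d)) c' \<and> pc c' = pc c + length (cexp e d) \<and>
    sim W Z s c' \<and> reg c' d = ev e s \<and> (\<forall>r<d. reg c' r = reg c r)"
  using assms(1-5)
proof (induction e arbitrary: c d)
  case (Lit x)
  then have "steps P W (16 * Z) c 1 (exec (Const d x) c)"
    by (intro steps_one) (auto simp: sim_def words_ok_def)
  then show ?case using Lit by (intro exI[of _ "exec (Const d x) c"]) (auto intro: sim_temp)
next
  case (Var r)
  have "reg c r = var s r" using Var(2,4) by (simp add: sim_def)
  moreover have "reg c r < W" using Var(2) unfolding sim_def words_ok_def by blast
  ultimately have *: "var s r < W" by simp
  from Var have "steps P W (16 * Z) c 1 (exec (Move d r) c)"
    using * by (intro steps_one) (auto simp: sim_def words_ok_def)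
  then show ?case using Var *
    by (intro exI[of _ "exec (Move d r) c"]) (auto simp: sim_def words_ok_def)
next
  case (Plus a b)
  obtain c1 where c1: "steps P W (16 * Z) c (length (cexp a d)) c1" "pc c1 = pc c + length (cexp a d)"
    "sim W Z s c1" "reg c1 d = ev a s" "\<forall>r<d. reg c1 r = reg c r"
    using Plus.IH(1)[of c d] Plus.prems by auto
  obtain c2 where c2: "steps P W (16 * Z) c1 (length (cexp b (Suc d))) c2"
    "pc c2 = pc c1 + length (cexp b (Suc d))"
    "sim W Z s c2" "reg c2 (Suc d) = ev b s" "\<forall>r<Suc d. reg c2 r = reg c1 r"
    using Plus.IH(2)[of c1 "Suc d"] Plus.prems c1 by auto
  let ?c = "exec (Add d d (Suc d)) c2"
  have sim: "sim W Z s ?c" using c1 c2 Plus.prems by (auto intro!: sim_temp)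
  then have "steps P W (16 * Z) c2 1 ?c"
    using c1 c2 Plus.prems by (intro steps_one) (auto simp: sim_def)
  from steps_trans[OF steps_trans[OF c1(1) c2(1)] this] show ?case
    using c1 c2 sim by (intro exI[of _ ?c]) (auto simp: add.assoc)
next
  case (Minus a b)
  obtain c1 where c1: "steps P W (16 * Z) c (length (cexp a d)) c1" "pc c1 = pc c + length (cexp a d)"
    "sim W Z s c1" "reg c1 d = ev a s" "\<forall>r<d. reg c1 r = reg c r"
    using Minus.IH(1)[of c d] Minus.prems by auto
  obtain c2 where c2: "steps P W (16 * Z) c1 (length (cexp b (Suc d))) c2"
    "pc c2 = pc c1 + length (cexp b (Suc d))"
    "sim W Z s c2" "reg c2 (Suc d) = ev b s" "\<forall>r<Suc d. reg c2 r = reg c1 r"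
    using Minus.IH(2)[of c1 "Suc d"] Minus.prems c1 by auto
  let ?c = "exec (Sub d d (Suc d)) c2"
  have "reg c2 d - reg c2 (Suc d) < W"
    using c2(3) by (auto simp: sim_def words_ok_def intro: le_less_trans[OF diff_le_self])
  then have sim: "sim W Z s ?c" using c1 c2 Minus.prems by (auto intro!: sim_temp)
  then have "steps P W (16 * Z) c2 1 ?c"
    using c1 c2 Minus.prems by (intro steps_one) (auto simp: sim_def)
  from steps_trans[OF steps_trans[OF c1(1) c2(1)] this] show ?case
    using c1 c2 sim by (intro exI[of _ ?c]) (auto simp: add.assoc)
next
  case (Arr a e)
  obtain c1 where c1: "steps P W (16 * Z) c (length (cexp e d)) c1" "pc c1 = pc c + length (cexp e d)"
    "sim W Z s c1" "reg c1 d = ev e s" "\<forall>r<d. reg c1 r = reg c r"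
    using Arr.IH[of c d] Arr.prems by auto
  let ?c2 = "exec (Add d d (50 + a)) c1"
  have adr: "ev e s + a * Z < 16 * Z"
    using array_address_less[of a "ev e s" Z] Arr.prems by (auto simp: add.commute)
  have base: "reg c1 (50 + a) = a * Z" using c1(3) Arr.prems by (auto simp: sim_def)
  have sim2: "sim W Z s ?c2" using c1 base adr Arr.prems assms(6) by (auto intro!: sim_temp)
  have s2: "steps P W (16 * Z) c1 1 ?c2"
    using c1 sim2 Arr.prems by (intro steps_one) (auto simp: sim_def)
  have m2: "mem c1 (a * Z + ev e s) = arr s a (ev e s)" using c1(3) Arr.prems by (auto simp: sim_def)
  let ?c3 = "exec (Load d d) ?c2"
  have sim3: "sim W Z s ?c3"
    unfolding exec.simps(5)
    by (rule sim_temp[OF sim2]) (use Arr.prems sim2 in \<open>auto simp only: sim_def words_ok_def\<close>)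
  have "steps P W (16 * Z) ?c2 1 ?c3"
    using c1 sim2 sim3 Arr.prems adr base by (intro steps_one) (auto simp: sim_def)
  from steps_trans[OF steps_trans[OF c1(1) s2] this] show ?case
    using c1 m2 sim3 base by (intro exI[of _ ?c3]) (auto simp: add.commute)
qed

text \<open>The instructions that a command contributes itself, apart from its parts, lie in
  \<open>P\<close> and are executed at most once per tick, so \<open>length P\<close> instructions
  per tick suffice. The bound is additive in the ticks before and after, which lets it telescope
  over sequences and iterations.\<close>

lemma ccom_correct:
  assumes "big W Z c s s'" and "code_at P p (ccom p c)" "sim W Z s cf" "pc cf = p" "wfc c"
    and W: "16 * Z \<le> W" and K: "length P \<le> K"
  shows "\<exists>t cf'. steps P W (16 * Z) cf t cf' \<and> t + K * ticks s \<le> K * ticks s' \<and>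
    pc cf' = p + clen c \<and> sim W Z s' cf'"
  using assms(1-5)
proof (induction arbitrary: p cf rule: big.induct)
  case (Skip s)
  then show ?case by (intro exI[of _ 0] exI[of _ cf]) (auto simp: sim_def)
next
  case (Assign e s r)
  obtain c1 where c1: "steps P W (16 * Z) cf (length (cexp e 70)) c1" "pc c1 = p + length (cexp e 70)"
    "sim W Z s c1" "reg c1 70 = ev e s"
    using cexp_correct[of P cf e 70 W Z s] Assign W by auto
  let ?c = "exec (Move r 70) c1"
  have sim: "sim W Z (s\<lparr>var := (var s)(r := ev e s), ticks := Suc (ticks s)\<rparr>) ?c"
    using c1 Assign.prems unfolding c1(4)[symmetric] by (auto simp: sim_def words_ok_def)
  then have "steps P W (16 * Z) c1 1 ?c"
    using c1 Assign.prems by (intro steps_one) (auto simp: sim_def)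
  from steps_trans[OF c1(1) this] show ?case
    using c1 sim code_at_length[OF Assign.prems(1)] K by (intro exI[of _ ?c] exI) (auto intro: sim)
next
  case (Write i s e a)
  obtain c1 where c1: "steps P W (16 * Z) cf (length (cexp i 70)) c1" "pc c1 = p + length (cexp i 70)"
    "sim W Z s c1" "reg c1 70 = ev i s"
    using cexp_correct[of P cf i 70 W Z s] Write W by auto
  obtain c2 where c2: "steps P W (16 * Z) c1 (length (cexp e 71)) c2" "pc c2 = pc c1 + length (cexp e 71)"
    "sim W Z s c2" "reg c2 71 = ev e s" "\<forall>r<71. reg c2 r = reg c1 r"
    using cexp_correct[of P c1 e 71 W Z s] Write W c1 by auto
  let ?c3 = "exec (Add 70 70 (50 + a)) c2"
  have a: "a < 16" using Write.prems by simp
  have adr: "ev i s + a * Z < 16 * Z"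
    using array_address_less[of a "ev i s" Z] Write by (auto simp: add.commute)
  have base: "reg c2 (50 + a) = a * Z" using c2(3) a by (auto simp: sim_def)
  have sim3: "sim W Z s ?c3" using c1 c2 base adr W by (auto intro!: sim_temp)
  have s3: "steps P W (16 * Z) c2 1 ?c3"
    using c1 c2 sim3 Write.prems by (intro steps_one) (auto simp: sim_def)
  let ?c4 = "exec (Store 70 71) ?c3"
  have m4: "mem ?c4 = (mem c2)(a * Z + ev i s := ev e s)" using c1 c2 base a by (auto simp: add.commute)
  have sim4: "sim W Z (s\<lparr>arr := (arr s)(a := (arr s a)(ev i s := ev e s)), ticks := Suc (ticks s)\<rparr>) ?c4"
  proof -
    have "mem ?c4 (b * Z + j) = ((arr s)(a := (arr s a)(ev i s := ev e s))) b j"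
      if "b < 16" "j < Z" for b j
    proof (cases "b = a \<and> j = ev i s")
      case False
      then have "b * Z + j \<noteq> a * Z + ev i s" using array_address_inj[of b Z j a "ev i s"] that Write(3) by auto
      then show ?thesis using m4 False c2(3) that by (auto simp: sim_def)
    qed (use m4 in auto)
    moreover have "\<forall>x. mem ?c4 x < W" using c2(3) m4 unfolding c2(4)[symmetric]
      by (auto simp: sim_def words_ok_def)
    moreover have "reg ?c4 = reg ?c3" "out ?c4 = out ?c3" by auto
    ultimately show ?thesis using sim3 by (auto simp: sim_def words_ok_def)
  qed
  have "steps P W (16 * Z) ?c3 1 ?c4"
    using c1 c2 sim3 sim4 Write.prems adr base a by (intro steps_one) (auto simp: sim_def)
  from steps_trans[OF steps_trans[OF steps_trans[OF c1(1) c2(1)] s3] this] show ?case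
    using c1 c2 sim4 code_at_length[OF Write.prems(1)] K
    by (intro exI[of _ ?c4] exI) (auto intro: sim4)
next
  case (Emit e s)
  obtain c1 where c1: "steps P W (16 * Z) cf (length (cexp e 70)) c1" "pc c1 = p + length (cexp e 70)"
    "sim W Z s c1" "reg c1 70 = ev e s"
    using cexp_correct[of P cf e 70 W Z s] Emit W by auto
  let ?c = "exec (Output 70) c1"
  have sim: "sim W Z (s\<lparr>emitted := emitted s @ [ev e s], ticks := Suc (ticks s)\<rparr>) ?c"
    using c1 Emit.prems by (auto simp: sim_def words_ok_def)
  then have "steps P W (16 * Z) c1 1 ?c"
    using c1 Emit.prems by (intro steps_one) (auto simp: sim_def)
  from steps_trans[OF c1(1) this] show ?case
    using c1 sim code_at_length[OF Emit.prems(1)] K by (intro exI[of _ ?c] exI) (auto intro: sim)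
next
  case (Seq c1 s s1 c2 s2)
  obtain t1 f1 where 1: "steps P W (16 * Z) cf t1 f1" "t1 + K * ticks s \<le> K * ticks s1"
    "pc f1 = p + clen c1" "sim W Z s1 f1"
    using Seq.IH(1)[of p cf] Seq.prems by auto
  obtain t2 f2 where 2: "steps P W (16 * Z) f1 t2 f2" "t2 + K * ticks s1 \<le> K * ticks s2"
    "pc f2 = p + clen c1 + clen c2" "sim W Z s2 f2"
    using Seq.IH(2)[of "p + clen c1" f1] Seq.prems 1 by auto
  show ?case using steps_trans[OF 1(1) 2(1)] 1 2
    by (intro exI[of _ "t1 + t2"] exI[of _ f2]) auto
next
  case (CondT e s c1 s' c2)
  let ?le = "length (cexp e 70)"
  obtain f1 where f1: "steps P W (16 * Z) cf ?le f1" "pc f1 = p + ?le" "sim W Z s f1" "reg f1 70 = ev e s"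
    using cexp_correct[of P cf e 70 W Z s] CondT W by (auto simp: Let_def)
  let ?f2 = "exec (JumpZero 70 (p + ?le + 1 + clen c1 + 1)) f1"
  have sim2: "sim W Z s ?f2" using f1 by (auto intro: sim_pc)
  have s2: "steps P W (16 * Z) f1 1 ?f2"
    using f1 CondT.prems sim2 by (intro steps_one) (auto simp: sim_def Let_def)
  obtain t3 f3 where f3: "steps P W (16 * Z) ?f2 t3 f3" "t3 + K * Suc (ticks s) \<le> K * ticks s'"
    "pc f3 = p + ?le + 1 + clen c1" "sim W Z s' f3"
    using CondT.IH[of "p + ?le + 1" ?f2] CondT f1 sim2 by (auto simp: Let_def)
  let ?f4 = "exec (Jump (p + ?le + 1 + clen c1 + 1 + clen c2)) f3"
  have sim4: "sim W Z s' ?f4" using f3 by (auto intro: sim_pc)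
  have "steps P W (16 * Z) f3 1 ?f4"
    using f3 CondT.prems sim4 by (intro steps_one) (auto simp: sim_def Let_def)
  from steps_trans[OF steps_trans[OF steps_trans[OF f1(1) s2] f3(1)] this] show ?case
    using f3 sim4 code_at_length[OF CondT.prems(1)] K
    by (intro exI[of _ ?f4] exI) (auto intro: sim4 simp: Let_def)
next
  case (CondF e s c2 s' c1)
  let ?le = "length (cexp e 70)"
  obtain f1 where f1: "steps P W (16 * Z) cf ?le f1" "pc f1 = p + ?le" "sim W Z s f1" "reg f1 70 = ev e s"
    using cexp_correct[of P cf e 70 W Z s] CondF W by (auto simp: Let_def)
  let ?f2 = "exec (JumpZero 70 (p + ?le + 1 + clen c1 + 1)) f1"
  have sim2: "sim W Z s ?f2" using f1 by (auto intro: sim_pc)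
  have s2: "steps P W (16 * Z) f1 1 ?f2"
    using f1 CondF.prems sim2 by (intro steps_one) (auto simp: sim_def Let_def)
  obtain t3 f3 where f3: "steps P W (16 * Z) ?f2 t3 f3" "t3 + K * Suc (ticks s) \<le> K * ticks s'"
    "pc f3 = p + ?le + 1 + clen c1 + 1 + clen c2" "sim W Z s' f3"
    using CondF.IH[of "p + ?le + 1 + clen c1 + 1" ?f2] CondF f1 sim2 by (auto simp: Let_def)
  from steps_trans[OF steps_trans[OF f1(1) s2] f3(1)] show ?case
    using f3 code_at_length[OF CondF.prems(1)] K
    by (intro exI[of _ f3] exI) (auto simp: Let_def)
next
  case (WhileF e s c)
  let ?le = "length (cexp e 70)"
  obtain f1 where f1: "steps P W (16 * Z) cf ?le f1" "pc f1 = p + ?le" "sim W Z s f1" "reg f1 70 = ev e s"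
    using cexp_correct[of P cf e 70 W Z s] WhileF W by (auto simp: Let_def)
  let ?f2 = "exec (JumpZero 70 (p + ?le + 1 + clen c + 1)) f1"
  have sim2: "sim W Z s ?f2" using f1 by (auto intro: sim_pc)
  have s2: "steps P W (16 * Z) f1 1 ?f2"
    using f1 WhileF.prems sim2 by (intro steps_one) (auto simp: sim_def Let_def)
  from steps_trans[OF f1(1) s2] show ?case
    using f1 WhileF sim2 code_at_length[OF WhileF.prems(1)] K
    by (intro exI[of _ ?f2] exI) (auto simp: Let_def)
next
  case (WhileT e s c s1 s')
  let ?le = "length (cexp e 70)"
  obtain f1 where f1: "steps P W (16 * Z) cf ?le f1" "pc f1 = p + ?le" "sim W Z s f1" "reg f1 70 = ev e s"
    using cexp_correct[of P cf e 70 W Z s] WhileT W by (auto simp: Let_def)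
  let ?f2 = "exec (JumpZero 70 (p + ?le + 1 + clen c + 1)) f1"
  have sim2: "sim W Z s ?f2" using f1 by (auto intro: sim_pc)
  have s2: "steps P W (16 * Z) f1 1 ?f2"
    using f1 WhileT.prems sim2 by (intro steps_one) (auto simp: sim_def Let_def)
  obtain t3 f3 where f3: "steps P W (16 * Z) ?f2 t3 f3" "t3 + K * Suc (ticks s) \<le> K * ticks s1"
    "pc f3 = p + ?le + 1 + clen c" "sim W Z s1 f3"
    using WhileT.IH(1)[of "p + ?le + 1" ?f2] WhileT f1 sim2 by (auto simp: Let_def)
  let ?f4 = "exec (Jump p) f3"
  have sim4: "sim W Z s1 ?f4" using f3 by (auto intro: sim_pc)
  have s4: "steps P W (16 * Z) f3 1 ?f4"
    using f3 WhileT.prems sim4 by (intro steps_one) (auto simp: sim_def Let_def)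
  obtain t5 f5 where f5: "steps P W (16 * Z) ?f4 t5 f5" "t5 + K * ticks s1 \<le> K * ticks s'"
    "pc f5 = p + clen (While e c)" "sim W Z s' f5"
    using WhileT.IH(2)[of p ?f4] WhileT.prems sim4 by auto
  from steps_trans[OF steps_trans[OF steps_trans[OF steps_trans[OF f1(1) s2] f3(1)] s4] f5(1)] show ?case
    using f3 f5 code_at_length[OF WhileT.prems(1)] K
    by (intro exI[of _ f5] exI) (auto simp: Let_def)
qed

section \<open>Weakest preconditions for total correctness\<close>

definition wp :: "nat => nat => com => (store => bool) => store => bool" where
  "wp W Z c Q s \<longleftrightarrow> (\<exists>s'. big W Z c s s' \<and> Q s')"

inductive_cases big_SkipE: "big W Z Skip s s'"
inductive_cases big_AssignE: "big W Z (Assign r e) s s'"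
inductive_cases big_WriteE: "big W Z (Write a i e) s s'"
inductive_cases big_EmitE: "big W Z (Emit e) s s'"
inductive_cases big_SeqE: "big W Z (c1 ;; c2) s s'"
inductive_cases big_CondE: "big W Z (Cond e c1 c2) s s'"

lemma wp_Skip [simp]: "wp W Z Skip Q s \<longleftrightarrow> Q s"
  by (auto simp: wp_def intro: big.intros elim: big_SkipE)

lemma wp_Assign [simp]: "wp W Z (Assign r e) Q s \<longleftrightarrow>
    safe W Z e s \<and> Q (s\<lparr>var := (var s)(r := ev e s), ticks := Suc (ticks s)\<rparr>)"
  by (auto simp: wp_def intro: big.intros elim: big_AssignE)

lemma wp_Write [simp]: "wp W Z (Write a i e) Q s \<longleftrightarrow> safe W Z i s \<and> safe W Z e s \<and> ev i s < Z \<and>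
    Q (s\<lparr>arr := (arr s)(a := (arr s a)(ev i s := ev e s)), ticks := Suc (ticks s)\<rparr>)"
  by (auto simp: wp_def intro: big.intros elim: big_WriteE)

lemma wp_Emit [simp]: "wp W Z (Emit e) Q s \<longleftrightarrow>
    safe W Z e s \<and> Q (s\<lparr>emitted := emitted s @ [ev e s], ticks := Suc (ticks s)\<rparr>)"
  by (auto simp: wp_def intro: big.intros elim: big_EmitE)

lemma wp_Seq [simp]: "wp W Z (c1 ;; c2) Q s \<longleftrightarrow> wp W Z c1 (wp W Z c2 Q) s"
  by (auto simp: wp_def intro: big.intros elim!: big_SeqE)

lemma wp_Cond [simp]: "wp W Z (Cond e c1 c2) Q s \<longleftrightarrow>
    safe W Z e s \<and> (if ev e s \<noteq> 0 then wp W Z c1 Q (tick s) else wp W Z c2 Q (tick s))"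
  by (auto simp: wp_def intro: big.intros elim!: big_CondE)

lemma wp_mono: "wp W Z c Q s ==> (\<And>s'. Q s' ==> Q' s') ==> wp W Z c Q' s"
  by (auto simp: wp_def)

lemma wp_While_unfold: "safe W Z e s ==>
    (ev e s = 0 ==> Q (tick s)) ==>
    (ev e s \<noteq> 0 ==> wp W Z c (wp W Z (While e c) Q) (tick s)) ==> wp W Z (While e c) Q s"
  by (cases "ev e s = 0") (auto simp: wp_def intro: big.intros)

text \<open>The invariant carries a value \<open>a\<close> that need not be stored by the program,
  such as the length of the list still to be scanned, and the measure is taken from it.\<close>

lemma wp_While:
  fixes f :: "'a => nat"
  assumes "I a s" and "\<And>a s. I a s ==> safe W Z e s"
    and "\<And>a s. I a s ==> ev e s = 0 ==> Q (tick s)"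
    and "\<And>a s. I a s ==> ev e s \<noteq> 0 ==> wp W Z c (\<lambda>s'. \<exists>a'. I a' s' \<and> f a' < f a) (tick s)"
  shows "wp W Z (While e c) Q s"
  using assms(1)
proof (induction "f a" arbitrary: a s rule: less_induct)
  case less
  show ?case
  proof (rule wp_While_unfold)
    assume "ev e s \<noteq> 0"
    from assms(4)[OF less.prems this] show "wp W Z c (wp W Z (While e c) Q) (tick s)"
      by (rule wp_mono) (use less.hyps in blast)
  qed (use less.prems assms in auto)
qed

fun mods :: "com => nat set" where
  "mods Skip = {}"
| "mods (Assign r e) = {r}"
| "mods (Write a i e) = {}"
| "mods (Emit e) = {}"
| "mods (c1 ;; c2) = mods c1 \<union> mods c2"
| "mods (Cond e c1 c2) = mods c1 \<union> mods c2"
| "mods (While e c) = mods c"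

fun amods :: "com => nat set" where
  "amods Skip = {}"
| "amods (Assign r e) = {}"
| "amods (Write a i e) = {a}"
| "amods (Emit e) = {}"
| "amods (c1 ;; c2) = amods c1 \<union> amods c2"
| "amods (Cond e c1 c2) = amods c1 \<union> amods c2"
| "amods (While e c) = amods c"

fun silent :: "com => bool" where
  "silent (Emit e) = False"
| "silent (c1 ;; c2) \<longleftrightarrow> silent c1 \<and> silent c2"
| "silent (Cond e c1 c2) \<longleftrightarrow> silent c1 \<and> silent c2"
| "silent (While e c) \<longleftrightarrow> silent c"
| "silent _ = True"

lemma big_frame:
  assumes "big W Z c s s'"
  shows "r \<notin> mods c ==> var s' r = var s r" "a \<notin> amods c ==> arr s' a = arr s a"
    "silent c ==> emitted s' = emitted s"
  using assms by (induction rule: big.induct) auto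

text \<open>Variables, arrays and output that a command cannot touch are recovered from its syntax,
  so that specifications mention only what changes.\<close>

lemma wp_frame:
  assumes "wp W Z c Q s"
    and "\<And>s'. Q s' ==> (\<And>r. r \<notin> mods c ==> var s' r = var s r) ==>
      (\<And>a. a \<notin> amods c ==> arr s' a = arr s a) ==>
      (silent c ==> emitted s' = emitted s) ==> Q' s'"
  shows "wp W Z c Q' s"
  using assms big_frame unfolding wp_def by metis

section \<open>Trees grown edge by edge\<close>

text \<open>Growth by one leaf edge at a time builds in acyclicity, so the search arguments never
  mention cycles. The start \<open>V0\<close>, \<open>T0\<close> is a parameter in order to speak
  about all completions of a partial tree.\<close>

inductive ext :: "'v set => 'v set set => 'v set => 'v set set => bool" for V0 T0 where
  ext_refl: "ext V0 T0 V0 T0"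
| ext_step: "ext V0 T0 V T ==> u \<in> V ==> v \<notin> V ==> ext V0 T0 (insert v V) (insert {u, v} T)"

abbreviation tree :: "'v => 'v set => 'v set set => bool" where
  "tree r V T \<equiv> ext {r} {} V T"

lemma ext_trans: "ext V1 T1 V2 T2 ==> ext V0 T0 V1 T1 ==> ext V0 T0 V2 T2"
  by (induction rule: ext.induct) (auto intro: ext.intros)

lemma ext_mono: "ext V0 T0 V T ==> V0 \<subseteq> V \<and> T0 \<subseteq> T"
  by (induction rule: ext.induct) auto

text \<open>Every added edge brings a vertex outside the set covered so far, so an edge inside
  \<open>V0\<close> cannot be a later addition.\<close>

lemma ext_new_edges: "ext V0 T0 V T ==> e \<in> T ==> e \<subseteq> V0 ==> e \<in> T0"
  by (induction rule: ext.induct) (auto dest: ext_mono)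

lemma tree_facts:
  assumes "tree r V T"
  shows "finite V" "finite T" "card V = Suc (card T)" "r \<in> V" "V = insert r (\<Union>T)"
    "\<And>e. e \<in> T ==> e \<subseteq> V \<and> card e = 2"
proof -
  have *: "finite V \<and> finite T \<and> card V = Suc (card T) \<and> r \<in> V \<and> V = insert r (\<Union>T) \<and>
    (\<forall>e\<in>T. e \<subseteq> V \<and> card e = 2)"
    using assms
  proof (induction rule: ext.induct)
    case (ext_step V T u v)
    then have "{u, v} \<notin> T" "u \<noteq> v" by auto
    then have "card {u, v} = 2" by simp
    then show ?case using ext_step \<open>{u, v} \<notin> T\<close> by auto
  qed auto
  then show "finite V" "finite T" "card V = Suc (card T)" "r \<in> V" "V = insert r (\<Union>T)"
    "\<And>e. e \<in> T ==> e \<subseteq> V \<and> card e = 2" by blast+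
qed

section \<open>Reachable vertices and growing a tree to a given size\<close>

inductive_set reach :: "'v set set => 'v set => 'v set" for E A where
  reach_base: "a \<in> A ==> a \<in> reach E A"
| reach_step: "u \<in> reach E A ==> {u, v} \<in> E ==> v \<in> reach E A"

lemma reach_mono: "E \<subseteq> E' ==> A \<subseteq> A' ==> reach E A \<subseteq> reach E' A'"
proof
  fix v assume "v \<in> reach E A" "E \<subseteq> E'" "A \<subseteq> A'"
  then show "v \<in> reach E' A'" by (induction) (auto intro: reach.intros)
qed

lemma reach_least:
  assumes "A \<subseteq> U" "\<And>u v. u \<in> U ==> {u, v} \<in> E ==> v \<in> U"
  shows "reach E A \<subseteq> U"
proof
  fix v assume "v \<in> reach E A"
  then show "v \<in> U" by induction (use assms in auto)
qed

lemma reach_subset_Union: "reach E A \<subseteq> A \<union> \<Union>E"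
  by (rule reach_least) auto

lemma reach_idem: "A \<subseteq> reach E B ==> reach E A \<subseteq> reach E B"
  by (rule reach_least) (auto intro: reach.intros)

lemma reach_sym: "v \<in> reach E {u} ==> u \<in> reach E {v}"
proof (induction rule: reach.induct)
  case (reach_step w v)
  have "w \<in> reach E {v}" 
    using reach.reach_step[of v E "{v}" w] reach_step(2) by (auto intro: reach_base simp: insert_commute)
  then show ?case using reach_idem[of "{w}" E "{v}"] reach_step by auto
qed (auto intro: reach.intros)

lemma tree_reach: "tree r V T ==> T \<subseteq> E ==> V \<subseteq> reach E {r}"
  by (induction rule: ext.induct) (auto intro: reach.intros)

text \<open>While fewer than \<open>card (reach E V)\<close> vertices are covered, some edge leaves
  the covered set; otherwise that set would be closed under edges and contain
  \<open>reach E V\<close>. Hence every size in between is attained exactly.\<close>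

lemma ext_exists:
  assumes "card V \<le> j" "j \<le> card (reach E V)" "finite (reach E V)"
  shows "\<exists>V' T'. ext V S V' T' \<and> card V' = j \<and> T' \<subseteq> S \<union> E \<and> V' \<subseteq> reach E V"
  using assms(1,2)
proof (induction j rule: dec_induct)
  case base
  then show ?case using reach_base[of _ V E] by (intro exI[of _ V] exI[of _ S]) (auto intro: ext_refl)
next
  case (step j)
  then obtain V' T' where *: "ext V S V' T'" "card V' = j" "T' \<subseteq> S \<union> E" "V' \<subseteq> reach E V" by auto
  have "\<exists>u v. u \<in> V' \<and> {u, v} \<in> E \<and> v \<notin> V'"
  proof (rule ccontr)
    assume "\<not> ?thesis"
    then have "reach E V \<subseteq> V'" using ext_mono[OF *(1)] by (intro reach_least) auto
    then have "card (reach E V) \<le> card V'"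
      using *(4) assms(3) finite_subset by (intro card_mono) auto
    then show False using step *(2) by simp
  qed
  then obtain u v where uv: "u \<in> V'" "{u, v} \<in> E" "v \<notin> V'" by auto
  have "finite V'" using *(4) assms(3) finite_subset by auto
  moreover have "v \<in> reach E V" using * uv by (auto intro: reach.intros)
  ultimately show ?case
    using * uv by (intro exI[of _ "insert v V'"] exI[of _ "insert {u, v} T'"]) (auto intro: ext_step)
qed

text \<open>Grow \<open>S\<close> with edges of \<open>T\<close> as far as possible. All of
  \<open>V'\<close> is reached because \<open>T\<close> is connected, and since a tree has one edge
  less than vertices, the grown tree already uses all of \<open>T\<close>.\<close>

lemma subtree_ext:
  assumes S: "tree r V S" and T: "tree r V' T" and "S \<subseteq> T"
  shows "ext V S V' T"
proof -
  have "V \<subseteq> V'" using tree_facts(5)[OF S] tree_facts(5)[OF T] \<open>S \<subseteq> T\<close> by auto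
  have "V' \<subseteq> reach T V" using tree_reach[OF T order_refl] reach_mono[of T T "{r}" V] tree_facts(4)[OF S] by auto
  moreover have "reach T V \<subseteq> V'" using reach_subset_Union[of T V] \<open>V \<subseteq> V'\<close> tree_facts(5)[OF T] by auto
  ultimately have r: "reach T V = V'" by auto
  obtain V'' T'' where *: "ext V S V'' T''" "card V'' = card V'" "T'' \<subseteq> S \<union> T" "V'' \<subseteq> reach T V"
    using ext_exists[of V "card V'" T S] r tree_facts(1)[OF T] \<open>V \<subseteq> V'\<close> by (auto intro: card_mono)
  have V: "V'' = V'" using *(2,4) r tree_facts(1)[OF T] card_subset_eq[of V' V''] by simp
  have "card T'' = card T" using tree_facts(3)[OF ext_trans[OF *(1) S]] tree_facts(3)[OF T] V by simp
  then have "T'' = T" using *(3) \<open>S \<subseteq> T\<close> tree_facts(2)[OF T] by (intro card_subset_eq) auto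
  then show ?thesis using * V by simp
qed

section \<open>Solutions that extend a partial tree\<close>

definition Sol :: "'v set set => nat => 'v => 'v set set => 'v set set set" where
  "Sol E k r S = {T. (\<exists>V. tree r V T) \<and> S \<subseteq> T \<and> T \<subseteq> E \<and> card T = k}"

lemma finite_Sol: "finite E ==> finite (Sol E k r S)"
  by (rule finite_subset[of _ "Pow E"]) (auto simp: Sol_def)

text \<open>This is the feasibility test of the algorithm: counting the vertices reachable from a
  partial tree replaces searching for a completion.\<close>

lemma Sol_exists:
  assumes "tree r V S" "S \<subseteq> E" "card V \<le> Suc k" "Suc k \<le> card (reach E V)" "finite (reach E V)"
  shows "\<exists>V' T. tree r V' T \<and> ext V S V' T \<and> S \<subseteq> T \<and> T \<subseteq> E \<and> card T = k \<and> V' \<subseteq> reach E V"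
proof -
  obtain V' T where *: "ext V S V' T" "card V' = Suc k" "T \<subseteq> S \<union> E" "V' \<subseteq> reach E V"
    using ext_exists[OF assms(3-5)] by blast
  have "tree r V' T" using ext_trans *(1) assms(1) by blast
  then show ?thesis
    using * assms(2) tree_facts(3)[of r V' T] ext_mono[OF *(1)]
    by (intro exI[of _ V'] exI[of _ T]) auto
qed

text \<open>Every edge \<open>f\<close> near a solution \<open>T0\<close> can be exchanged into it; since \<open>f\<close> is the only new edge,
  different \<open>f\<close> give different solutions.\<close>

lemma exchange:
  assumes S: "tree r V S" and T0: "tree r V0 T0" and sub: "S \<subseteq> T0" and k: "card T0 = k" "card S < k"
    and f: "f = {a, b}" "a \<noteq> b" "\<not> f \<subseteq> V" "f \<inter> V \<noteq> {} \<or> f \<subseteq> V0" "f \<notin> T0"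
  shows "\<exists>V' T. tree r V' T \<and> S \<subseteq> T \<and> f \<in> T \<and> T \<subseteq> insert f T0 \<and> card T = k"
proof -
  \<comment> \<open>Attach \<open>f\<close> to a partial tree \<open>A\<close> at its endpoint
    \<open>c\<close> and refill to \<open>k\<close> edges from \<open>T0\<close>: with
    \<open>f\<close> allowed, all \<open>k + 1\<close> vertices of \<open>T0\<close> are reachable
    from the enlarged tree.\<close>
  have finish: ?thesis if A: "tree r A X" "S \<subseteq> X" "X \<subseteq> T0" "c \<in> A" "d \<notin> A" "{c, d} = f" "card A \<le> k" for A X c d
  proof -
    have t: "tree r (insert d A) (insert f X)" using ext_step[OF A(1,4,5)] A(6) by simp
    have "V0 \<subseteq> reach T0 {r}" using tree_reach[OF T0 order_refl] .
    also have "\<dots> \<subseteq> reach (insert f T0) (insert d A)" by (rule reach_mono) (use tree_facts(4)[OF A(1)] in auto)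
    finally have sub: "V0 \<subseteq> reach (insert f T0) (insert d A)" .
    have fin: "finite (reach (insert f T0) (insert d A))"
      by (rule finite_subset[OF reach_subset_Union]) (use tree_facts(1,5)[OF T0] tree_facts(1)[OF A(1)] f in auto)
    have "Suc k \<le> card (reach (insert f T0) (insert d A))"
      using card_mono[OF fin sub] tree_facts(3)[OF T0] k by simp
    moreover have "insert f X \<subseteq> insert f T0" "card (insert d A) \<le> Suc k"
      using A tree_facts(1)[OF A(1)] by (auto simp: card_insert_if)
    ultimately show ?thesis using Sol_exists[OF t _ _ _ fin, of k] A(2) by blast
  qed
  show ?thesis
  proof (cases "f \<inter> V = {}")
    case False
    then obtain c d where "c \<in> V" "d \<notin> V" "{c, d} = f" using f by auto
    then show ?thesis using finish[OF S] sub k tree_facts(3)[OF S] by auto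
  next
    case True
    \<comment> \<open>Grow \<open>S\<close> towards \<open>T0\<close> until the first endpoint of \<open>f\<close> is absorbed.\<close>
    have grow: "f \<inter> A = {} \<or> (\<exists>A X c d. ext V S A X \<and> X \<subseteq> T0 \<and> c \<in> A \<and> d \<notin> A \<and> {c, d} = f)"
      if "ext V S A X" "X \<subseteq> T0" for A X
      using that
    proof (induction rule: ext.induct)
      case (ext_step A X u v)
      show ?case
      proof (cases "f \<inter> A = {} \<and> v \<in> f")
        case True
        then obtain d where "{v, d} = f" "d \<notin> insert v A" using f(1,2) by auto
        then show ?thesis
          using ext.ext_step[OF ext_step.hyps] ext_step.prems by (metis insertI1)
      qed (use ext_step in auto)
    qed (use True in simp)
    have "f \<inter> V0 \<noteq> {}" "f \<subseteq> V0" using f True by auto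
    then obtain A X c d where A: "ext V S A X" "X \<subseteq> T0" "c \<in> A" "d \<notin> A" "{c, d} = f"
      using grow[OF subtree_ext[OF S T0 sub] order_refl] by auto
    have tA: "tree r A X" using ext_trans[OF A(1) S] .
    have "A \<subset> V0" using tree_facts(5)[OF tA] tree_facts(4,5)[OF T0] A \<open>f \<subseteq> V0\<close> by auto
    then have "card A < card V0" using tree_facts(1)[OF T0] by (rule psubset_card_mono[rotated])
    then show ?thesis
      using finish[OF tA _ A(2-5)] ext_mono[OF A(1)] tree_facts(3)[OF T0] k by auto
  qed
qed

lemma Sol_count:
  assumes S: "tree r V S" and T0: "tree r V0 T0" and sub: "S \<subseteq> T0" and k: "card T0 = k" "card S < k"
    and "T0 \<subseteq> E" "finite E"
    and F: "\<And>f. f \<in> F ==> f \<in> E \<and> card f = 2 \<and> \<not> f \<subseteq> V \<and> (f \<inter> V \<noteq> {} \<or> f \<subseteq> V0) \<and> f \<notin> T0"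
  shows "card F \<le> card (Sol E k r S)"
proof -
  have "\<forall>f\<in>F. \<exists>T. T \<in> Sol E k r S \<and> f \<in> T \<and> T \<subseteq> insert f T0"
  proof
    fix f assume f: "f \<in> F"
    then obtain a b where "f = {a, b}" "a \<noteq> b" using F card_2_iff by metis
    then obtain V' T where "tree r V' T" "S \<subseteq> T" "f \<in> T" "T \<subseteq> insert f T0" "card T = k"
      using exchange[OF S T0 sub k] F[OF f] by metis
    then show "\<exists>T. T \<in> Sol E k r S \<and> f \<in> T \<and> T \<subseteq> insert f T0"
      using F[OF f] \<open>T0 \<subseteq> E\<close> by (intro exI[of _ T]) (auto simp: Sol_def)
  qed
  then obtain g where g: "\<And>f. f \<in> F ==> g f \<in> Sol E k r S \<and> f \<in> g f \<and> g f \<subseteq> insert f T0" by metis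
  have "inj_on g F"
  proof (rule inj_onI)
    fix f f' assume *: "f \<in> F" "f' \<in> F" "g f = g f'"
    then have "f \<in> insert f' T0" using g[of f] g[of f'] by auto
    then show "f = f'" using F[OF *(1)] by auto
  qed
  then show ?thesis using g finite_Sol[OF \<open>finite E\<close>] by (intro card_inj_on_le[of g]) auto
qed

lemma Sol_split: "p \<notin> S ==> Sol E k r S = Sol E k r (insert p S) \<union> Sol (E - {p}) k r S"
    "Sol E k r (insert p S) \<inter> Sol (E - {p}) k r S = {}"
  by (auto simp: Sol_def)

text \<open>A solution that avoids \<open>p\<close> would have its \<open>k + 1\<close> vertices
  reachable from \<open>V\<close> without \<open>p\<close>.\<close>

lemma Sol_forced:
  assumes "tree r V S" "S \<subseteq> E - {p}" "card (reach (E - {p}) V) \<le> k" "finite (reach (E - {p}) V)"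
  shows "Sol E k r S = Sol E k r (insert p S)"
proof -
  have "p \<in> T" if T: "T \<in> Sol E k r S" for T
  proof (rule ccontr)
    assume "p \<notin> T"
    obtain V' where "tree r V' T" using T by (auto simp: Sol_def)
    then have "V' \<subseteq> reach (E - {p}) {r}" using \<open>p \<notin> T\<close> T by (intro tree_reach) (auto simp: Sol_def)
    also have "\<dots> \<subseteq> reach (E - {p}) V" using tree_facts(4)[OF assms(1)] by (intro reach_mono) auto
    finally have "card V' \<le> k" using card_mono[OF assms(4)] assms(3) le_trans by blast
    then show False using tree_facts(3)[OF \<open>tree r V' T\<close>] T by (simp add: Sol_def)
  qed
  then show ?thesis by (auto simp: Sol_def)
qed

text \<open>Growth from \<open>r\<close> starts inside \<open>V\<close>, and every edge met there
  belongs to \<open>T0\<close>, so no other tree can ever leave \<open>T0\<close>.\<close>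

lemma Sol_unique:
  assumes T0: "tree r V T0" "S \<subseteq> T0" "T0 \<subseteq> E" "card T0 = k"
    and cl: "\<And>e. e \<in> E ==> e \<inter> V \<noteq> {} ==> e \<in> T0"
  shows "Sol E k r S = {T0}"
proof -
  have "T = T0" if "tree r V' T" "T \<subseteq> E" "card T = k" for V' T
  proof -
    have "T \<subseteq> T0 \<and> V' \<subseteq> V" using that(1,2)
    proof (induction rule: ext.induct)
      case (ext_step V' T u v)
      then have "{u, v} \<in> T0" using cl[of "{u, v}"] by auto
      then show ?case using ext_step tree_facts(6)[OF T0(1)] by auto
    qed (use tree_facts(4)[OF T0(1)] in auto)
    then show ?thesis using that(3) tree_facts(2)[OF T0(1)] T0(4) card_subset_eq[of T0 T] by simp
  qed
  then have "Sol E k r S \<subseteq> {T0}" unfolding Sol_def by blast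
  moreover have "T0 \<in> Sol E k r S" unfolding Sol_def using T0 by blast
  ultimately show ?thesis by blast
qed

text \<open>An edge between two vertices already covered can never be added by growth, so its
  deletion is invisible to the completions of \<open>S\<close>.\<close>

lemma Sol_delete_internal:
  assumes S: "tree r V S" and D: "\<And>e. e \<in> D ==> e \<subseteq> V \<and> e \<notin> S"
  shows "Sol (E - D) k r S = Sol E k r S"
proof -
  have "T \<inter> D = {}" if "tree r V' T" "S \<subseteq> T" for V' T
    using ext_new_edges[OF subtree_ext[OF S that]] D by blast
  then show ?thesis unfolding Sol_def by blast
qed

text \<open>The endpoints of a deleted edge lie in \<open>V\<close> and are reached without any
  edge.\<close>

lemma reach_delete_internal:
  assumes S: "tree r V S" "S \<subseteq> E" and D: "\<And>e. e \<in> D ==> e \<subseteq> V \<and> e \<notin> S"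
  shows "reach (E - D) V = reach E V"
proof
  show "reach E V \<subseteq> reach (E - D) V"
  proof (rule reach_least)
    fix u v assume *: "u \<in> reach (E - D) V" "{u, v} \<in> E"
    show "v \<in> reach (E - D) V"
    proof (cases "{u, v} \<in> D")
      case True
      then show ?thesis using D[of "{u, v}"] by (auto intro: reach_base)
    qed (use * in \<open>auto intro: reach_step\<close>)
  qed (auto intro: reach_base)
qed (rule reach_mono, auto)

section \<open>Trees and k-subtrees\<close>

lemma tree_path:
  assumes "tree r V T" "a \<in> V" "b \<in> V"
  shows "\<exists>p. walk (V, T) p \<and> distinct p \<and> hd p = a \<and> last p = b"
  using assms
proof (induction arbitrary: a b rule: ext.induct)
  case ext_refl
  then show ?case by (intro exI[of _ "[r]"]) (auto simp: walk_def)
next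
  case (ext_step V T u v)
  have mono: "walk (insert v V, insert {u, v} T) p" if "walk (V, T) p" for p
    using that by (auto simp: walk_def elim: successively_mono)
  have up: "\<exists>p. walk (insert v V, insert {u, v} T) p \<and> distinct p \<and> hd p = v \<and> last p = b" if b: "b \<in> V" for b
  proof -
    obtain p where p: "walk (V, T) p" "distinct p" "hd p = u" "last p = b"
      using ext_step.IH[OF ext_step.hyps(2) b] by auto
    then show ?thesis using mono[OF p(1)] ext_step.hyps
      by (intro exI[of _ "v # p"]) (auto simp: walk_def successively_Cons insert_commute)
  qed
  have down: "\<exists>p. walk (insert v V, insert {u, v} T) p \<and> distinct p \<and> hd p = b \<and> last p = v" if b: "b \<in> V" for b
  proof -
    obtain p where p: "walk (V, T) p" "distinct p" "hd p = b" "last p = u"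
      using ext_step.IH[OF b ext_step.hyps(2)] by auto
    then show ?thesis using mono[OF p(1)] ext_step.hyps
      by (intro exI[of _ "p @ [v]"]) (auto simp: walk_def successively_append_iff)
  qed
  show ?case
  proof (cases "a = v \<and> b = v")
    case True
    then show ?thesis by (intro exI[of _ "[v]"]) (auto simp: walk_def)
  next
    case False
    then show ?thesis using ext_step.prems ext_step.IH[of a b] mono up[of b] down[of a] by blast
  qed
qed

text \<open>With at least one edge the root is an endpoint, so the vertex set of the induced graph
  is all of \<open>V\<close> and \<open>tree_path\<close> applies.\<close>

lemma tree_connected:
  assumes "tree r V T" "T \<noteq> {}"
  shows "connected_graph (edge_induced T)"
proof -
  have "r \<in> \<Union>T" using assms
  proof (induction rule: ext.induct)
    case (ext_step V T u v)
    then show ?case by (cases "T = {}") (auto dest: tree_facts(5))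
  qed simp
  then have "V = \<Union>T" using tree_facts(5)[OF assms(1)] by auto
  then show ?thesis using tree_path[OF assms(1)] by (auto simp: connected_graph_def edge_induced_def)
qed

text \<open>A cycle through the last vertex attached would use two different edges at it.\<close>

lemma tree_acyclic: "tree r V T ==> \<not> is_cycle (V, T) p"
proof (induction arbitrary: p rule: ext.induct)
  case ext_refl
  then show ?case by (auto simp: is_cycle_def)
next
  case (ext_step V T u v)
  have only: "x = u" if "{v, x} \<in> insert {u, v} T \<or> {x, v} \<in> insert {u, v} T" for x
    using that tree_facts(6)[OF ext_step.hyps(1), of "{v, x}"] ext_step.hyps
    by (auto simp: doubleton_eq_iff insert_commute)
  show ?case
  proof
    assume c: "is_cycle (insert v V, insert {u, v} T) p"
    then have w: "p \<noteq> []" "set p \<subseteq> insert v V" "successively (\<lambda>a b. {a, b} \<in> insert {u, v} T) p"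
      "distinct p" "3 \<le> length p" "{last p, hd p} \<in> insert {u, v} T"
      by (auto simp: is_cycle_def walk_def)
    show False
    proof (cases "v \<in> set p")
      case False
      then have "successively (\<lambda>a b. {a, b} \<in> T) p"
        by (intro successively_mono[OF w(3)]) (auto simp: doubleton_eq_iff)
      moreover have "{last p, hd p} \<noteq> {u, v}" using False w(1) by (metis hd_in_set insertCI last_in_set doubleton_eq_iff)
      ultimately have "is_cycle (V, T) p" using w False by (auto simp: is_cycle_def walk_def)
      then show False using ext_step.IH by blast
    next
      case True
      then obtain xs ys where p: "p = xs @ v # ys" by (meson split_list)
      show False
      proof (cases "xs = []")
        case True
        then have "last ys = u" "hd ys = u" "ys \<noteq> []"
          using w p only[of "last ys"] only[of "hd ys"] by (auto simp: successively_Cons split: if_splits)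
        then show False using w p True by (cases ys) (auto split: if_splits)
      next
        case False
        then have l: "last xs = u"
          using w p only[of "last xs"] by (auto simp: successively_append_iff)
        show False
        proof (cases "ys = []")
          case True
          then have "hd xs = u" using w p only[of "hd xs"] False by auto
          then show False using l w p True False by (cases xs) (auto split: if_splits)
        next
          case ys: False
          then have "hd ys = u" using w p only[of "hd ys"] by (auto simp: successively_append_iff successively_Cons)
          then show False using l w p ys False by (auto dest: last_in_set hd_in_set)
        qed
      qed
    qed
  qed
qed

text \<open>Grow a tree from \<open>r\<close> inside \<open>F\<close> until it covers every vertex.
  An edge of \<open>F\<close> left over would close a cycle with the tree path between its
  endpoints.\<close>

lemma connected_acyclic_tree:
  assumes F: "finite F" "\<And>e. e \<in> F ==> card e = 2" and r: "r \<in> \<Union>F"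
    and con: "connected_graph (edge_induced F)" and acy: "acyclic_graph (edge_induced F)"
  shows "tree r (\<Union>F) F"
proof -
  have fin: "finite (\<Union>F)" using F by (metis card.infinite finite_Union zero_neq_numeral)
  have "\<Union>F \<subseteq> reach F {r}"
  proof
    fix v assume v: "v \<in> \<Union>F"
    then obtain p where p: "walk (edge_induced F) p" "hd p = r" "last p = v"
      using con r unfolding connected_graph_def edge_induced_def fst_conv by blast
    have "q \<noteq> [] ==> successively (\<lambda>u v. {u, v} \<in> F) q ==> hd q \<in> reach F {r} ==> last q \<in> reach F {r}" for q
    proof (induction q rule: induct_list012)
      case (3 x y zs)
      then have "y \<in> reach F {r}" using reach_step[of x F "{r}" y] by simp
      then show ?case using 3 by simp
    qed auto
    then show "v \<in> reach F {r}" using p by (auto simp: walk_def edge_induced_def intro: reach.intros)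
  qed
  moreover have "reach F {r} \<subseteq> \<Union>F" using reach_subset_Union[of F "{r}"] r by auto
  ultimately have re: "reach F {r} = \<Union>F" by auto
  have "0 < card (\<Union>F)" using fin r by (auto simp: card_gt_0_iff)
  then obtain V T where T: "tree r V T" "card V = card (\<Union>F)" "T \<subseteq> F" "V \<subseteq> \<Union>F"
    using ext_exists[of "{r}" "card (\<Union>F)" F "{}"] re fin by auto
  have V: "V = \<Union>F" using card_subset_eq[OF fin T(4)] T(2) by simp
  have "F \<subseteq> T"
  proof
    fix e assume e: "e \<in> F"
    then obtain a b where ab: "e = {a, b}" "a \<noteq> b" using F card_2_iff by metis
    obtain p where p: "walk (V, T) p" "distinct p" "hd p = a" "last p = b"
      using tree_path[OF T(1), of a b] ab e V by auto
    show "e \<in> T"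
    proof (rule ccontr)
      assume "e \<notin> T"
      obtain x xs where px: "p = x # xs" using p(1) by (cases p) (auto simp: walk_def)
      obtain y ys where xs: "xs = y # ys" using px p ab by (cases xs) auto
      \<comment> \<open>The path has a third vertex: a path of \<open>a\<close> and \<open>b\<close>
        alone would make \<open>e\<close> a tree edge.\<close>
      have "ys \<noteq> []" using p px xs ab \<open>e \<notin> T\<close> by (auto simp: walk_def)
      then have "3 \<le> length p" using px xs by (cases ys) auto
      moreover have "walk (edge_induced F) p"
        using p(1) T V by (auto simp: walk_def edge_induced_def elim: successively_mono)
      ultimately have "is_cycle (edge_induced F) p"
        using p ab e by (auto simp: is_cycle_def edge_induced_def insert_commute)
      then show False using acy by (auto simp: acyclic_graph_def)
    qed
  qed
  then show ?thesis using T V by auto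
qed

lemma k_subtrees_tree:
  assumes "0 < k" "finite E" "\<And>e. e \<in> E ==> card e = 2"
  shows "k_subtrees (U, E) k = {T. (\<exists>r V. tree r V T) \<and> T \<subseteq> E \<and> card T = k}"
proof (intro set_eqI iffI)
  fix F assume "F \<in> k_subtrees (U, E) k"
  then have F: "F \<subseteq> E" "card F = k" "connected_graph (edge_induced F)" "acyclic_graph (edge_induced F)"
    by (auto simp: k_subtrees_def)
  have "F \<noteq> {}" "{} \<notin> F" using F assms by force+
  then obtain r where "r \<in> \<Union>F" by (metis Union_iff ex_in_conv)
  then have "tree r (\<Union>F) F"
    using F assms finite_subset by (intro connected_acyclic_tree) auto
  then show "F \<in> {T. (\<exists>r V. tree r V T) \<and> T \<subseteq> E \<and> card T = k}" using F by auto
next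
  fix F assume "F \<in> {T. (\<exists>r V. tree r V T) \<and> T \<subseteq> E \<and> card T = k}"
  then obtain r V where F: "tree r V F" "F \<subseteq> E" "card F = k" by auto
  then have ne: "F \<noteq> {}" using assms by auto
  have "acyclic_graph (edge_induced F)"
  proof -
    have "is_cycle (V, F) p" if "is_cycle (edge_induced F) p" for p
      using that tree_facts(5)[OF F(1)] by (auto simp: is_cycle_def walk_def edge_induced_def)
    then show ?thesis using tree_acyclic[OF F(1)] by (auto simp: acyclic_graph_def)
  qed
  then show "F \<in> k_subtrees (U, E) k"
    using F tree_connected[OF F(1) ne] by (auto simp: k_subtrees_def)
qed

text \<open>Connects the search from a root with the k-subtrees of the specification; a k-subtree
  can be grown from any of its vertices.\<close>

lemma Sol_root:
  assumes "0 < k" "finite E" "\<And>e. e \<in> E ==> card e = 2"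
  shows "Sol E k r {} = {T \<in> k_subtrees (U, E) k. r \<in> \<Union>T}"
proof -
  have "tree r (\<Union>T) T" if "T \<in> k_subtrees (U, E) k" "r \<in> \<Union>T" for T
    using that assms by (intro connected_acyclic_tree) (auto simp: k_subtrees_def intro: finite_subset)
  moreover have "r \<in> \<Union>T" if "tree r V T" "T \<noteq> {}" for V T
    using that
  proof (induction rule: ext.induct)
    case (ext_step V T u v)
    then show ?case by (cases "T = {}") (auto dest: tree_facts(5))
  qed simp
  moreover have "T \<noteq> {}" if "card T = k" for T :: "'a set set" using that assms(1) by auto
  moreover have "k_subtrees (U, E) k = {T. (\<exists>r V. tree r V T) \<and> T \<subseteq> E \<and> card T = k}"
    using assms by (rule k_subtrees_tree)
  ultimately show ?thesis unfolding Sol_def by blast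
qed

section \<open>Doubly linked adjacency lists\<close>

lemma linked_list_cong:
  "linked_list M p a xs ==> (\<And>z. z \<in> set xs ==> M' (z + 1) = M (z + 1) \<and> M' (z + 2) = M (z + 2)) ==>
   linked_list M' p a xs"
  by (induction xs arbitrary: p a) auto

lemma linked_list_split:
  assumes "linked_list M p a (as @ x # bs)"
  shows "M (x + 2) = (if as = [] then p else last as)" "M (x + 1) = (if bs = [] then 0 else hd bs)"
    "as = [] ==> a = x" "as \<noteq> [] ==> M (last as + 1) = x" "bs \<noteq> [] ==> M (hd bs + 2) = x"
proof -
  have "M (x + 2) = (if as = [] then p else last as) \<and> M (x + 1) = (if bs = [] then 0 else hd bs) \<and>
    (as = [] --> a = x) \<and> (as \<noteq> [] --> M (last as + 1) = x) \<and> (bs \<noteq> [] --> M (hd bs + 2) = x)"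
    using assms
  proof (induction as arbitrary: p a)
    case Nil
    then show ?case by (cases bs) auto
  next
    case (Cons z as)
    have "linked_list M z (M (z + 1)) (as @ x # bs)" "a = z" using Cons.prems by simp_all
    from Cons.IH[OF this(1)] \<open>a = z\<close> show ?case by (cases "as = []") simp_all
  qed
  then show "M (x + 2) = (if as = [] then p else last as)" "M (x + 1) = (if bs = [] then 0 else hd bs)"
    "as = [] ==> a = x" "as \<noteq> [] ==> M (last as + 1) = x" "bs \<noteq> [] ==> M (hd bs + 2) = x" by auto
qed

lemma linked_list_remove:
  assumes "linked_list M p a (as @ x # bs)"
    and "\<And>z. z \<in> set as ==> M' (z + 2) = M (z + 2)" and "\<And>z. z \<in> set bs ==> M' (z + 1) = M (z + 1)"
    and "\<And>z. z \<in> set (butlast as) ==> M' (z + 1) = M (z + 1)" and "as \<noteq> [] ==> M' (last as + 1) = M (x + 1)"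
    and "\<And>z. z \<in> set (tl bs) ==> M' (z + 2) = M (z + 2)" and "bs \<noteq> [] ==> M' (hd bs + 2) = M (x + 2)"
  shows "linked_list M' p (if as = [] then M (x + 1) else a) (as @ bs)"
  using assms
proof (induction as arbitrary: p a)
  case Nil
  then show ?case
  proof (cases bs)
    case (Cons b bs')
    then have "linked_list M b (M (b + 1)) bs'" using Nil(1) by simp
    have "linked_list M' b (M (b + 1)) bs'"
      by (rule linked_list_cong[OF \<open>linked_list M b (M (b + 1)) bs'\<close>]) (use Nil.prems(3,6) Cons in simp)
    then show ?thesis using Nil.prems(1,3,7) Cons by simp
  qed simp
next
  case (Cons z as)
  have "linked_list M' z (if as = [] then M (x + 1) else M (z + 1)) (as @ bs)"
    using Cons.prems by (intro Cons.IH) (auto split: if_splits)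
  then show ?case using Cons.prems by (auto split: if_splits)
qed

text \<open>\<open>M (M (x + 3))\<close> is the neighbour stored in the twin of \<open>x\<close>,
  that is, the vertex whose list contains \<open>x\<close>; its head cell is written when
  \<open>x\<close> is the first node. The cells of \<open>x\<close> itself are left alone.\<close>

definition unlink :: "(nat => nat) => nat => nat => nat" where
  "unlink M x = (let p = M (x + 2); q = M (x + 1);
     M1 = (if p \<noteq> 0 then M(p + 1 := q) else M(M (M (x + 3)) := q))
     in if q \<noteq> 0 then M1(q + 2 := p) else M1)"

text \<open>A removed node still remembers its former neighbours in the list, so reinsertion needs
  no other data, provided that removals are undone in reverse order.\<close>

definition relink :: "(nat => nat) => nat => nat => nat" where
  "relink M x = (let p = M (x + 2); q = M (x + 1);
     M1 = (if p \<noteq> 0 then M(p + 1 := x) else M(M (M (x + 3)) := x))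
     in if q \<noteq> 0 then M1(q + 2 := x) else M1)"

text \<open>Neighbour and twin fields are never written, so they are fixed functions
  \<open>nb\<close> and \<open>tw\<close>; only the lists \<open>L\<close> change. An edge is
  addressed by either of its two nodes.\<close>

locale adjacency =
  fixes n m :: nat and nb tw :: "nat => nat"
begin

definition nodes :: "nat set" where
  "nodes = {n + 4 * i |i. i < 2 * m}"

definition wf_lists :: "(nat => nat list) => bool" where
  "wf_lists L \<longleftrightarrow> (\<forall>v<n. distinct (L v) \<and> set (L v) \<subseteq> nodes \<and> inj_on nb (set (L v)) \<and>
     (\<forall>x\<in>set (L v). nb x < n \<and> nb x \<noteq> v \<and> tw x \<in> set (L (nb x)) \<and> nb (tw x) = v))"

definition rep :: "(nat => nat) => (nat => nat list) => bool" where
  "rep M L \<longleftrightarrow> wf_lists L \<and> (\<forall>x\<in>nodes. M x = nb x \<and> M (x + 3) = tw x) \<and>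
     (\<forall>v<n. linked_list M 0 (M v) (L v))"

definition edges :: "(nat => nat list) => nat set set" where
  "edges L = {{v, nb x} |v x. v < n \<and> x \<in> set (L v)}"

definition ed :: "nat => nat set" where
  "ed x = {nb (tw x), nb x}"

definition del :: "(nat => nat list) => nat => nat => nat list" where
  "del L x = (\<lambda>v. filter (\<lambda>z. z \<noteq> x \<and> z \<noteq> tw x) (L v))"

lemma node_bounds: "x \<in> nodes ==> n \<le> x \<and> x + 3 < n + 8 * m"
  by (auto simp: nodes_def)

lemma node_cell_inj:
  assumes "x \<in> nodes" "y \<in> nodes" "x + a = y + b" "a < 4" "b < 4"
  shows "x = y" "a = b"
proof -
  obtain i j where "x = n + 4 * i" "y = n + 4 * j" using assms by (auto simp: nodes_def)
  then show "x = y" "a = b" using assms by presburger+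
qed

lemma node_cell_neq:
  assumes "x \<in> nodes" "y \<in> nodes"
  shows "x + 1 \<noteq> y" "x + 2 \<noteq> y" "x + 3 \<noteq> y" "x + 1 \<noteq> y + 2" "x + 1 \<noteq> y + 3" "x + 2 \<noteq> y + 3"
    "Suc x \<noteq> y" "x + 2 \<noteq> Suc y" "x + 3 \<noteq> Suc y"
  using node_cell_inj[of x y 1 0] node_cell_inj[of x y 2 0] node_cell_inj[of x y 3 0]
    node_cell_inj[of x y 1 2] node_cell_inj[of x y 1 3] node_cell_inj[of x y 2 3]
    node_cell_inj[of x y 2 1] node_cell_inj[of x y 3 1] assms by auto

lemma wf_listsD:
  assumes "wf_lists L" "v < n" "x \<in> set (L v)"
  shows "x \<in> nodes" "nb x < n" "nb x \<noteq> v" "tw x \<in> set (L (nb x))" "nb (tw x) = v" "tw (tw x) = x"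
    "tw x \<noteq> x" "tw x \<in> nodes" "distinct (L v)" "ed x = {v, nb x}" "ed (tw x) = ed x" "0 < x"
proof -
  have *: "\<And>v x. v < n ==> x \<in> set (L v) ==> x \<in> nodes \<and> nb x < n \<and> nb x \<noteq> v \<and> tw x \<in> set (L (nb x)) \<and> nb (tw x) = v"
    using assms(1) by (auto simp: wf_lists_def)
  show 1: "x \<in> nodes" "nb x < n" "nb x \<noteq> v" "tw x \<in> set (L (nb x))" "nb (tw x) = v" using *[OF assms(2,3)] by auto
  have 2: "tw (tw x) \<in> set (L v)" "nb (tw (tw x)) = nb x" using *[OF 1(2,4)] 1(5) by auto
  have "inj_on nb (set (L v))" using assms(1,2) by (auto simp: wf_lists_def)
  then show "tw (tw x) = x" using 2 assms(3) by (auto dest: inj_onD)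
  show "tw x \<noteq> x" using 1 by auto
  show "tw x \<in> nodes" using *[OF 1(2,4)] by auto
  show "distinct (L v)" using assms(1,2) by (auto simp: wf_lists_def)
  show "ed x = {v, nb x}" using 1 by (simp add: ed_def)
  show "ed (tw x) = ed x" using 1 \<open>tw (tw x) = x\<close> by (auto simp: ed_def)
  show "0 < x" using node_bounds[OF 1(1)] assms(2) by simp
qed

lemma wf_lists_inj: "wf_lists L ==> v < n ==> x \<in> set (L v) ==> y \<in> set (L v) ==> nb x = nb y ==> x = y"
  by (auto simp: wf_lists_def dest: inj_onD)

lemma ed_in_edges: "wf_lists L ==> v < n ==> x \<in> set (L v) ==> ed x \<in> edges L"
  using wf_listsD(10) by (auto simp: edges_def)

lemma edgesD:
  assumes "wf_lists L" "{u, w} \<in> edges L"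
  shows "\<exists>x. u < n \<and> w < n \<and> u \<noteq> w \<and> x \<in> set (L u) \<and> nb x = w \<and> ed x = {u, w}"
proof -
  obtain v x where vx: "v < n" "x \<in> set (L v)" "{u, w} = {v, nb x}" using assms(2) by (auto simp: edges_def)
  note D = wf_listsD[OF assms(1) vx(1,2)]
  show ?thesis
  proof (cases "u = v")
    case True
    then show ?thesis using vx D by (intro exI[of _ x]) (auto simp: doubleton_eq_iff)
  next
    case False
    then have "u = nb x" "w = v" using vx(3) by (auto simp: doubleton_eq_iff)
    then show ?thesis using vx D by (intro exI[of _ "tw x"]) auto
  qed
qed

lemma edgesE:
  assumes "wf_lists L" "e \<in> edges L"
  obtains u x where "u < n" "x \<in> set (L u)" "e = ed x"
  using assms wf_listsD(10)[OF assms(1)] by (auto simp: edges_def)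

lemma edges_wf: "wf_lists L ==> e \<in> edges L ==> card e = 2 \<and> e \<subseteq> {..<n}"
proof -
  assume "wf_lists L" "e \<in> edges L"
  then obtain v x where "v < n" "x \<in> set (L v)" "e = {v, nb x}" by (auto simp: edges_def)
  then show ?thesis using wf_listsD(2,3)[OF \<open>wf_lists L\<close>, of v x] by auto
qed

lemma finite_edges: "wf_lists L ==> finite (edges L)"
  by (rule finite_subset[of _ "Pow {..<n}"]) (use edges_wf in auto)

lemma edges_at: "wf_lists L ==> v < n ==> e \<in> edges L ==> v \<in> e ==> \<exists>x\<in>set (L v). e = ed x"
proof -
  assume *: "wf_lists L" "v < n" "e \<in> edges L" "v \<in> e"
  then obtain u x where "u < n" "x \<in> set (L u)" "e = ed x" by (auto elim: edgesE)
  then show ?thesis using * wf_listsD[OF *(1), of u x] by (cases "u = v") auto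
qed

lemma ed_eq:
  assumes "wf_lists L" "u < n" "x \<in> set (L u)" "v < n" "y \<in> set (L v)" "ed x = ed y"
  shows "y = x \<or> y = tw x"
proof -
  have "{u, nb x} = {v, nb y}" using assms wf_listsD(10) by metis
  then consider "u = v" "nb x = nb y" | "u = nb y" "v = nb x" by (auto simp: doubleton_eq_iff)
  then show ?thesis
  proof cases
    case 1
    then show ?thesis using wf_lists_inj assms by auto
  next
    case 2
    have "tw x \<in> set (L v)" "nb (tw x) = u" using wf_listsD[OF assms(1-3)] 2 by auto
    then show ?thesis using wf_lists_inj[OF assms(1,4,5)] 2 by auto
  qed
qed

text \<open>Each edge owns two nodes, here a chosen one and its twin. This converts bounds on edges,
  which come from trees, into bounds on the list nodes that a program scans.\<close>

lemma card_nodes_le: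
  assumes "wf_lists L" "finite F" "\<And>x. x \<in> A ==> (\<exists>v<n. x \<in> set (L v)) \<and> ed x \<in> F"
  shows "finite A" "card A \<le> 2 * card F"
proof -
  define g where "g e = (SOME x. x \<in> A \<and> ed x = e)" for e
  have "A \<subseteq> (\<Union>e\<in>F. {g e, tw (g e)})"
  proof
    fix x assume x: "x \<in> A"
    then have "g (ed x) \<in> A" "ed (g (ed x)) = ed x" unfolding g_def by (metis (mono_tags, lifting) someI)+
    then have "x = g (ed x) \<or> x = tw (g (ed x))" using assms(3) x ed_eq[OF assms(1)] by metis
    then show "x \<in> (\<Union>e\<in>F. {g e, tw (g e)})" using assms(3)[OF x] by auto
  qed
  moreover have "finite (\<Union>e\<in>F. {g e, tw (g e)})" using assms(2) by auto
  moreover have "card (\<Union>e\<in>F. {g e, tw (g e)}) \<le> (\<Sum>e\<in>F. card {g e, tw (g e)})"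
    by (rule card_UN_le[OF assms(2)])
  moreover have "(\<Sum>e\<in>F. card {g e, tw (g e)}) \<le> (\<Sum>e\<in>F. 2)"
    by (intro sum_mono) (auto simp: card_insert_if)
  ultimately show "finite A" "card A \<le> 2 * card F"
    using card_mono[of "\<Union>e\<in>F. {g e, tw (g e)}" A] by (auto intro: finite_subset)
qed

lemma edges_image: "wf_lists L ==> edges L = ed ` (\<Union>v<n. set (L v))"
  using wf_listsD(10)[of L] by (auto simp: edges_def image_iff) fastforce+

lemma wf_del:
  assumes "wf_lists L" "v < n" "x \<in> set (L v)"
  shows "wf_lists (del L x)" "edges (del L x) = edges L - {ed x}"
proof -
  note D = wf_listsD[OF assms]
  have tw: "tw z \<noteq> x \<and> tw z \<noteq> tw x" if "u < n" "z \<in> set (L u)" "z \<noteq> x" "z \<noteq> tw x" for u z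
    using wf_listsD(6)[OF assms(1) that(1,2)] D(6) that by metis
  show "wf_lists (del L x)"
    unfolding wf_lists_def
  proof (intro allI impI conjI ballI)
    fix u assume u: "u < n"
    show "distinct (del L x u)" "set (del L x u) \<subseteq> nodes" "inj_on nb (set (del L x u))"
      using assms(1) u by (auto simp: wf_lists_def del_def inj_on_def)
    fix z assume z: "z \<in> set (del L x u)"
    then have z': "z \<in> set (L u)" "z \<noteq> x" "z \<noteq> tw x" by (auto simp: del_def)
    show "nb z < n" "nb z \<noteq> u" "nb (tw z) = u" using wf_listsD[OF assms(1) u z'(1)] by auto
    show "tw z \<in> set (del L x (nb z))"
      using wf_listsD(4)[OF assms(1) u z'(1)] tw[OF u z'] by (auto simp: del_def)
  qed
  then have e: "edges (del L x) = ed ` (\<Union>u<n. set (del L x u))" by (rule edges_image)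
  have ne: "ed z \<noteq> ed x" if "z \<in> (\<Union>u<n. set (L u))" "z \<notin> {x, tw x}" for z
    using ed_eq[OF assms, of _ z] that by auto
  have "ed ` (A - {x, tw x}) = ed ` A - {ed x}" if "A = (\<Union>u<n. set (L u))" for A
  proof (intro equalityI subsetI)
    fix f assume "f \<in> ed ` (A - {x, tw x})"
    then obtain z where "z \<in> A" "z \<notin> {x, tw x}" "f = ed z" by blast
    then show "f \<in> ed ` A - {ed x}" using ne that by simp
  next
    fix f assume "f \<in> ed ` A - {ed x}"
    then obtain z where "z \<in> A" "ed z \<noteq> ed x" "f = ed z" by blast
    then show "f \<in> ed ` (A - {x, tw x})" using D(11) by (intro image_eqI[of _ _ z]) auto
  qed
  moreover have "(\<Union>u<n. set (del L x u)) = (\<Union>u<n. set (L u)) - {x, tw x}" by (auto simp: del_def)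
  ultimately show "edges (del L x) = edges L - {ed x}"
    unfolding e edges_image[OF assms(1)] by simp
qed

lemma unlink_list:
  assumes "n > v" and nz: "\<forall>z\<in>nodes. 0 < z" and xs: "linked_list M 0 (M v) xs" "distinct xs" "set xs \<subseteq> nodes" "x \<in> set xs"
    and own: "M (M (x + 3)) = v" and twn: "M (x + 3) \<in> nodes"
  shows "linked_list (unlink M x) 0 (unlink M x v) (filter (\<lambda>z. z \<noteq> x) xs)"
    and "\<And>u. u < n ==> u \<noteq> v ==> unlink M x u = M u"
    and "\<And>z. z \<in> nodes ==> unlink M x z = M z \<and> unlink M x (z + 3) = M (z + 3)"
    and "\<And>z. z \<in> nodes ==> z \<notin> set xs ==> unlink M x (z + 1) = M (z + 1) \<and> unlink M x (z + 2) = M (z + 2)"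
    and "unlink M x (x + 1) = M (x + 1)" "unlink M x (x + 2) = M (x + 2)"
    and "relink (unlink M x) x = M"
proof -
  obtain as bs where s: "xs = as @ x # bs" using xs(4) by (meson split_list)
  note sp = linked_list_split[OF xs(1)[unfolded s]]
  have x: "x \<in> nodes" "x \<notin> set as" "x \<notin> set bs" "distinct as" "distinct bs" "set as \<subseteq> nodes" "set bs \<subseteq> nodes"
    "set as \<inter> set bs = {}" using xs s by auto
  have p: "M (x + 2) = 0 \<longleftrightarrow> as = []" "as \<noteq> [] ==> last as \<in> nodes \<and> last as \<in> set as"
    using sp(1) x nz by (auto simp: subset_iff)
  have q: "M (x + 1) = 0 \<longleftrightarrow> bs = []" "bs \<noteq> [] ==> hd bs \<in> nodes \<and> hd bs \<in> set bs"
    using sp(2) x nz by (auto simp: subset_iff)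
  \<comment> \<open>The memory after unlinking in closed form: the link into \<open>x\<close> from
    the left, or the head cell of \<open>v\<close>, and the link into \<open>x\<close> from the
    right are redirected, and nothing else changes.\<close>
  have U: "unlink M x = (\<lambda>c. if bs \<noteq> [] \<and> c = hd bs + 2 then M (x + 2) else
      if as \<noteq> [] \<and> c = last as + 1 then M (x + 1) else if as = [] \<and> c = v then M (x + 1) else M c)"
    using p q sp own by (auto simp: unlink_def Let_def fun_eq_iff)
  have vn: "z + a \<noteq> v" "v \<noteq> z + a" "z \<noteq> v" if "z \<in> nodes" for z a using node_bounds[OF that] assms(1) by auto
  show "unlink M x u = M u" if "u < n" "u \<noteq> v" for u
    using that p(2) q(2) node_bounds[of "hd bs"] node_bounds[of "last as"] by (auto simp: U)
  show node: "unlink M x z = M z \<and> unlink M x (z + 3) = M (z + 3)" if "z \<in> nodes" for z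
    using that p(2) q(2) vn[OF that] node_cell_neq[of "hd bs" z] node_cell_neq[of "last as" z] by (auto simp: U)
  have z12: "z \<in> nodes ==> z' \<in> nodes ==> z + 1 \<noteq> z' + 2 \<and> z + 2 \<noteq> z' + 1" for z z'
    using node_cell_inj[of z z' 1 2] node_cell_inj[of z z' 2 1] by auto
  have keep: "unlink M x (z + 1) = M (z + 1) \<and> unlink M x (z + 2) = M (z + 2)"
    if z: "z \<in> nodes" "z \<notin> set as" "z \<notin> set bs" for z
  proof -
    have "bs \<noteq> [] --> z + 1 \<noteq> hd bs + 2 \<and> z + 2 \<noteq> hd bs + 2" using z q(2) z12[of z "hd bs"] by auto
    moreover have "as \<noteq> [] --> z + 1 \<noteq> last as + 1 \<and> z + 2 \<noteq> last as + 1" using z p(2) z12[of z "last as"] by auto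
    ultimately show ?thesis using vn[OF z(1)] unfolding U by presburger
  qed
  show "unlink M x (z + 1) = M (z + 1) \<and> unlink M x (z + 2) = M (z + 2)" if "z \<in> nodes" "z \<notin> set xs" for z
    using keep[of z] that s by simp
  show 1: "unlink M x (x + 1) = M (x + 1)" "unlink M x (x + 2) = M (x + 2)"
    using keep[of x] x by simp_all
  have f: "filter (\<lambda>z. z \<noteq> x) xs = as @ bs"
    using x(2,3) unfolding s by (auto simp: filter_empty_conv intro!: arg_cong2[of _ _ _ _ append] filter_True)
  have bl: "z \<in> set as \<and> z \<noteq> last as" if "z \<in> set (butlast as)" for z
    using that x(4) by (cases as rule: rev_cases) auto
  have tl: "z \<in> set bs \<and> z \<noteq> hd bs" if "z \<in> set (tl bs)" for z
    using that x(5) by (cases bs) auto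
  have "linked_list (unlink M x) 0 (if as = [] then M (x + 1) else M v) (as @ bs)"
  proof (rule linked_list_remove[OF xs(1)[unfolded s]])
    fix z assume z: "z \<in> set as"
    then have "z \<in> nodes" "z \<notin> set bs" using x by auto
    then show "unlink M x (z + 2) = M (z + 2)"
      using p(2) q(2) z z12[of "last as" z] vn(1,2)[of z 2] by (auto simp: U)
  next
    fix z assume z: "z \<in> set bs"
    then have "z \<in> nodes" "z \<notin> set as" using x by auto
    then show "unlink M x (z + 1) = M (z + 1)"
      using p(2) q(2) z z12[of z "hd bs"] vn(1,2)[of z 1] by (auto simp: U)
  next
    fix z assume z: "z \<in> set (butlast as)"
    then have "z \<in> nodes" "z \<noteq> last as" using x bl by auto
    then show "unlink M x (z + 1) = M (z + 1)"
      using p(2) q(2) z z12[of z "hd bs"] vn(1,2)[of z 1] by (auto simp: U)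
  next
    fix z assume z: "z \<in> set (tl bs)"
    then have "z \<in> nodes" "z \<noteq> hd bs" using x tl by auto
    then show "unlink M x (z + 2) = M (z + 2)"
      using p(2) q(2) z z12[of "last as" z] vn(1,2)[of z 2] by (auto simp: U)
  next
    assume "as \<noteq> []"
    then show "unlink M x (last as + 1) = M (x + 1)" using p(2) q(2) z12[of "last as" "hd bs"] by (auto simp: U)
  next
    assume "bs \<noteq> []"
    then show "unlink M x (hd bs + 2) = M (x + 2)" by (auto simp: U)
  qed
  moreover have "unlink M x v = (if as = [] then M (x + 1) else M v)"
    using p(2) q(2) vn(1,2)[of "hd bs" 2] vn(1,2)[of "last as" 1] by (auto simp: U)
  ultimately show "linked_list (unlink M x) 0 (unlink M x v) (filter (\<lambda>z. z \<noteq> x) xs)" using f by simp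
  have tw: "unlink M x (unlink M x (x + 3)) = v"
    using node[OF x(1)] node[OF twn] own by simp
  show "relink (unlink M x) x = M"
  proof
    fix c
    have "relink (unlink M x) x = (let M1 = (if as \<noteq> [] then (unlink M x)(last as + 1 := x) else (unlink M x)(v := x))
        in if bs \<noteq> [] then M1(hd bs + 2 := x) else M1)"
      unfolding relink_def 1 tw using p(1) q(1) sp(1,2) by (cases "as = []"; cases "bs = []") (simp_all add: Let_def)
    moreover have "unlink M x c = M c"
      if "bs \<noteq> [] --> c \<noteq> hd bs + 2" "as \<noteq> [] --> c \<noteq> last as + 1" "as = [] --> c \<noteq> v"
      using that by (auto simp: U)
    ultimately show "relink (unlink M x) x c = M c"
      using sp(3-5) by (cases "as = []"; cases "bs = []") (simp_all add: Let_def)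
  qed
qed

definition delete :: "(nat => nat) => nat => nat => nat" where
  "delete M x = unlink (unlink M x) (tw x)"

definition restore :: "(nat => nat) => nat => nat => nat" where
  "restore M x = relink (relink M (tw x)) x"

text \<open>After an unlinking \<open>x\<close> is in no list, so \<open>rep\<close> cannot serve as
  precondition for relinking; this is the local part that survives. That the list neighbours differ
  from \<open>x\<close> ensures that writing into them does not change the fields of
  \<open>x\<close> that are read afterwards.\<close>

definition cell_ok :: "(nat => nat) => nat => bool" where
  "cell_ok M x \<longleftrightarrow> x \<in> nodes \<and> (M (x + 1) \<noteq> 0 --> M (x + 1) \<in> nodes \<and> M (x + 1) \<noteq> x) \<and>
     (M (x + 2) \<noteq> 0 --> M (x + 2) \<in> nodes \<and> M (x + 2) \<noteq> x) \<and> M (x + 3) \<in> nodes \<and> M (M (x + 3)) < n"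

lemma cell_okI:
  assumes "linked_list M 0 (M v) xs" "distinct xs" "set xs \<subseteq> nodes" "x \<in> set xs" "M (x + 3) \<in> nodes" "M (M (x + 3)) < n"
  shows "cell_ok M x"
proof -
  obtain as bs where s: "xs = as @ x # bs" using assms(4) by (meson split_list)
  then have "as \<noteq> [] ==> last as \<in> nodes \<and> last as \<noteq> x" "bs \<noteq> [] ==> hd bs \<in> nodes \<and> hd bs \<noteq> x"
    using assms(2,3) by (auto simp: subset_iff dest: last_in_set hd_in_set)
  then show ?thesis using linked_list_split(1,2)[OF assms(1)[unfolded s]] assms(3-6) by (auto simp: cell_ok_def)
qed

text \<open>The two nodes of an edge lie in the lists of different vertices, so the two unlinkings
  do not interfere. The field \<open>x + 1\<close> survives deletion; a loop over the list may
  therefore delete the current node and still move on.\<close>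

lemma rep_delete:
  assumes R: "rep M L" and v: "v < n" "x \<in> set (L v)"
  shows "rep (delete M x) (del L x)" "restore (delete M x) x = M"
    "delete M x (x + 1) = M (x + 1)"
    "\<And>y. y \<in> nodes ==> unlink M x y = nb y \<and> unlink M x (y + 3) = tw y"
    "cell_ok M x" "cell_ok (unlink M x) (tw x)" "cell_ok (delete M x) (tw x)"
    "cell_ok (relink (delete M x) (tw x)) x" "delete M x (x + 3) = tw x"
proof -
  have wf: "wf_lists L" and stat: "\<And>y. y \<in> nodes ==> M y = nb y \<and> M (y + 3) = tw y"
    and ll: "\<And>u. u < n ==> linked_list M 0 (M u) (L u)" using R by (auto simp: rep_def)
  note D = wf_listsD[OF wf v]
  have nz: "\<forall>z\<in>nodes. 0 < z" using node_bounds v by fastforce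
  have nL: "set (L u) \<subseteq> nodes" "distinct (L u)" if "u < n" for u using wf that by (auto simp: wf_lists_def)
  have disj: "z \<notin> set (L u')" if "u < n" "u' < n" "u \<noteq> u'" "z \<in> set (L u)" for u u' z
    using wf_listsD(5)[OF wf] that by metis
  let ?w = "nb x" let ?y = "tw x" let ?M1 = "unlink M x" let ?M2 = "unlink ?M1 ?y"
  have own1: "M (M (x + 3)) = v" "M (x + 3) \<in> nodes" using stat D by auto
  note A = unlink_list[OF v(1) nz ll[OF v(1)] nL(2)[OF v(1)] nL(1)[OF v(1)] v(2) own1]
  show s1: "unlink M x y = nb y \<and> unlink M x (y + 3) = tw y" if "y \<in> nodes" for y using A(3)[OF that] stat[OF that] by simp
  have ll1: "linked_list ?M1 0 (?M1 u) (L u)" if "u < n" "u \<noteq> v" for u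
  proof -
    have "unlink M x (z + 1) = M (z + 1) \<and> unlink M x (z + 2) = M (z + 2)" if z: "z \<in> set (L u)" for z
      using A(4)[of z] disj[OF \<open>u < n\<close> v(1) \<open>u \<noteq> v\<close> z] nL(1)[OF \<open>u < n\<close>] z by blast
    then show ?thesis using A(2)[OF that] linked_list_cong[OF ll[OF that(1)], of ?M1] by simp
  qed
  have own2: "?M1 (?M1 (?y + 3)) = ?w" "?M1 (?y + 3) \<in> nodes" using s1 D by auto
  note B = unlink_list[OF D(2) nz ll1[OF D(2,3)] nL(2)[OF D(2)] nL(1)[OF D(2)] D(4) own2]
  have s2: "?M2 y = nb y \<and> ?M2 (y + 3) = tw y" if "y \<in> nodes" for y using B(3)[OF that] s1[OF that] by simp
  have "linked_list ?M2 0 (?M2 u) (del L x u)" if u: "u < n" for u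
  proof -
    consider "u = v" | "u = ?w" | "u \<noteq> v" "u \<noteq> ?w" by blast
    then show ?thesis
    proof cases
      case 1
      have "del L x v = filter (\<lambda>z. z \<noteq> x) (L v)"
        using disj[OF D(2) v(1) D(3) D(4)] by (auto simp: del_def intro!: filter_cong)
      moreover have "linked_list ?M2 0 (?M1 v) (filter (\<lambda>z. z \<noteq> x) (L v))"
        by (rule linked_list_cong[OF A(1)]) (use B(4) nL(1)[OF v(1)] disj[OF v(1) D(2) D(3)[symmetric]] in auto)
      moreover have "?M2 v = ?M1 v" using B(2) v(1) D(3) by auto
      ultimately show ?thesis using 1 by simp
    next
      case 2
      have "del L x ?w = filter (\<lambda>z. z \<noteq> ?y) (L ?w)"
        using disj[OF v(1) D(2) D(3)[symmetric] v(2)] by (auto simp: del_def intro!: filter_cong)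
      then show ?thesis using 2 B(1) by simp
    next
      case 3
      then have "x \<notin> set (L u)" "?y \<notin> set (L u)" using disj v D u by metis+
      then have "del L x u = L u" by (auto simp: del_def filter_id_conv)
      moreover have "linked_list ?M2 0 (?M1 u) (L u)"
        by (rule linked_list_cong[OF ll1[OF u 3(1)]]) (use B(4) nL(1)[OF u] disj[OF u D(2) 3(2)] in auto)
      ultimately show ?thesis using B(2) u 3 by simp
    qed
  qed
  then show "rep (delete M x) (del L x)" using wf_del[OF wf v] s2 by (auto simp: rep_def delete_def)
  show "restore (delete M x) x = M" using A(7) B(7) by (simp add: restore_def delete_def)
  show "delete M x (x + 1) = M (x + 1)" using A(5) B(4)[OF D(1) disj[OF v(1) D(2) D(3)[symmetric] v(2)]] by (simp add: delete_def)
  show c1: "cell_ok M x"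
    by (rule cell_okI[OF ll[OF v(1)] nL(2)[OF v(1)] nL(1)[OF v(1)] v(2)]) (use own1 v in auto)
  show c2: "cell_ok ?M1 ?y"
    by (rule cell_okI[OF ll1[OF D(2,3)] nL(2)[OF D(2)] nL(1)[OF D(2)] D(4)]) (use own2 D in auto)
  show "cell_ok (delete M x) ?y" using c2 B(5,6) s1 s2 D(1,6,8) unfolding cell_ok_def delete_def by simp
  show "cell_ok (relink (delete M x) (tw x)) x"
    using c1 A(5,6) s1 stat D(1,8) B(7) unfolding cell_ok_def delete_def by simp
  show "delete M x (x + 3) = tw x" using s2[OF D(1)] by (simp add: delete_def)
qed

end

section \<open>The program\<close>

text \<open>\<open>vS\<close> is the size of the current tree, which occupies the front of
  \<open>aQ\<close>; \<open>vH\<close> and \<open>vT\<close> are head and tail of a queue;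
  \<open>vF\<close> and \<open>vG\<close> report whether and where a search stopped.
  \<open>vP\<close> is the height of the undo stack, \<open>vMode\<close> is \<open>1\<close> when
  descending and \<open>0\<close> when backtracking, and \<open>vGo\<close> keeps the search loop
  running. \<open>vA\<close>, \<open>vHd\<close>, \<open>vOh\<close>, \<open>vOt\<close> serve the
  search for components, \<open>vB\<close> and \<open>vR\<close> the choice of roots.\<close>

abbreviation (input) "vN \<equiv> 0 :: nat"
abbreviation (input) "vK \<equiv> 2 :: nat"
abbreviation (input) "vS \<equiv> 3 :: nat"
abbreviation (input) "vH \<equiv> 4 :: nat"
abbreviation (input) "vT \<equiv> 5 :: nat"
abbreviation (input) "vF \<equiv> 6 :: nat"
abbreviation (input) "vG \<equiv> 7 :: nat"
abbreviation (input) "vX \<equiv> 8 :: nat"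
abbreviation (input) "vY \<equiv> 9 :: nat"
abbreviation (input) "vU \<equiv> 10 :: nat"
abbreviation (input) "vW \<equiv> 11 :: nat"
abbreviation (input) "vL \<equiv> 12 :: nat"
abbreviation (input) "vI \<equiv> 13 :: nat"
abbreviation (input) "vP \<equiv> 16 :: nat"
abbreviation (input) "vMode \<equiv> 17 :: nat"
abbreviation (input) "vGo \<equiv> 18 :: nat"
abbreviation (input) "vA \<equiv> 19 :: nat"
abbreviation (input) "vOt \<equiv> 20 :: nat"
abbreviation (input) "vOh \<equiv> 21 :: nat"
abbreviation (input) "vHd \<equiv> 22 :: nat"
abbreviation (input) "vB \<equiv> 23 :: nat"
abbreviation (input) "vR \<equiv> 24 :: nat"
abbreviation (input) "vV \<equiv> 25 :: nat"
abbreviation (input) "vZ \<equiv> 26 :: nat"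

text \<open>\<open>aPar\<close> holds for each vertex the list node through which it was found, not
  the parent vertex; \<open>aPath\<close> holds the path backwards. \<open>aTx\<close> and
  \<open>aTs\<close> form the undo stack: an edge node, and either \<open>0\<close> for a deleted
  edge or the tree size before an inclusion whose exclusion is still to come.\<close>

abbreviation (input) "aG \<equiv> 0 :: nat"
abbreviation (input) "aQ \<equiv> 2 :: nat"
abbreviation (input) "aPar \<equiv> 3 :: nat"
abbreviation (input) "aVis \<equiv> 4 :: nat"
abbreviation (input) "aQ2 \<equiv> 5 :: nat"
abbreviation (input) "aPath \<equiv> 6 :: nat"
abbreviation (input) "aTx \<equiv> 7 :: nat"
abbreviation (input) "aTs \<equiv> 8 :: nat"
abbreviation (input) "aSeen \<equiv> 9 :: nat"
abbreviation (input) "aOrd \<equiv> 10 :: nat"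

abbreviation (input) "inc r \<equiv> Assign r (Plus (Var r) (Lit 1))"
abbreviation (input) "dec r \<equiv> Assign r (Minus (Var r) (Lit 1))"
text \<open>Subtraction is truncated, so this is the minimum; it is nonzero exactly when both
  operands are, and serves as conjunction in loop tests. Likewise \<open>neqE\<close> is the
  distance of two numbers, nonzero when they differ.\<close>

abbreviation (input) "minE a b \<equiv> Minus a (Minus a b)"
abbreviation (input) "neqE a b \<equiv> Plus (Minus a b) (Minus b a)"
abbreviation (input) "nextE r \<equiv> Arr aG (Plus (Var r) (Lit 1))"
abbreviation (input) "prevE r \<equiv> Arr aG (Plus (Var r) (Lit 2))"
abbreviation (input) "twinE r \<equiv> Arr aG (Plus (Var r) (Lit 3))"

section \<open>Programs for deleting and restoring edges and for the first search\<close>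

definition unlink_com :: "nat => com" where
  "unlink_com r =
     Cond (prevE r) (Write aG (Plus (prevE r) (Lit 1)) (nextE r)) (Write aG (Arr aG (twinE r)) (nextE r)) ;;
     Cond (nextE r) (Write aG (Plus (nextE r) (Lit 2)) (prevE r)) Skip"

definition relink_com :: "nat => com" where
  "relink_com r =
     Cond (prevE r) (Write aG (Plus (prevE r) (Lit 1)) (Var r)) (Write aG (Arr aG (twinE r)) (Var r)) ;;
     Cond (nextE r) (Write aG (Plus (nextE r) (Lit 2)) (Var r)) Skip"

definition delete_com :: "nat => com" where
  "delete_com r = unlink_com r ;; Assign vZ (twinE r) ;; unlink_com vZ"

definition restore_com :: "nat => com" where
  "restore_com r = Assign vZ (twinE r) ;; relink_com vZ ;; relink_com r"

text \<open>Marks are \<open>0\<close> for unseen, \<open>1\<close> in the current tree,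
  \<open>2\<close> found by the search. If \<open>w\<close> is marked, the edge closes a cycle
  unless it joins two tree vertices or leads back along the parent edge of \<open>u\<close>.
  \<open>vG\<close> receives a found vertex whose parent edge has become dispensable. Setting
  \<open>vX\<close> to \<open>0\<close> and \<open>vH\<close> to \<open>vT\<close> ends both loops
  at once.\<close>

definition bfs_visit :: com where
  "bfs_visit =
     Assign vW (Arr aG (Var vX)) ;;
     Cond (Arr aVis (Var vW))
       (Cond (Minus (Arr aVis (Var vU)) (Lit 1))
          (Cond (neqE (twinE vX) (Arr aPar (Var vU))) (Assign vF (Lit 1) ;; Assign vG (Var vU)) Skip)
          (Cond (Minus (Arr aVis (Var vW)) (Lit 1)) (Assign vF (Lit 1) ;; Assign vG (Var vW)) Skip))
       (Write aVis (Var vW) (Lit 2) ;; Write aPar (Var vW) (Var vX) ;; Write aQ (Var vT) (Var vW) ;;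
        inc vT ;;
        Cond (Minus (Var vT) (Plus (Var vK) (Lit 1))) (Assign vF (Lit 1) ;; Assign vG (Var vW)) Skip) ;;
     Cond (Var vF) (Assign vX (Lit 0) ;; Assign vH (Var vT)) (Assign vX (nextE vX))"

definition bfs_com :: com where
  "bfs_com =
     Assign vH (Lit 0) ;; Assign vT (Var vS) ;; Assign vF (Lit 0) ;;
     While (Minus (Var vT) (Var vH))
       (Assign vU (Arr aQ (Var vH)) ;; Assign vX (Arr aG (Var vU)) ;; inc vH ;;
        While (Var vX) bfs_visit)"

text \<open>The input fills \<open>n + 8 * m\<close> cells, so an array of \<open>Z\<close> cells
  holds it, and also every queue and the undo stack. The factor \<open>200\<close> leaves room for
  the addresses of \<open>16\<close> arrays, which need \<open>128\<close>, and for intermediate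
  sums.\<close>

locale machine = adjacency n m nb tw for n m nb tw +
  fixes W Z k :: nat
  assumes Z: "Z = 8 * (n + m + 1)" and W: "200 * (n + m + k + 2) \<le> W"
begin

abbreviation "WP \<equiv> wp W Z"

lemma node_less:
  assumes "x \<in> nodes"
  shows "x < Z" "x + 1 < Z" "x + 2 < Z" "x + 3 < Z" "Suc x < Z" "Suc (Suc x) < Z"
  using node_bounds[OF assms] Z by auto

lemma Z_less: "x < Z ==> x + 20 < W"
  using W Z by auto

lemma wp_unlink:
  assumes "cell_ok M x" "arr s aG = M" "var s r = x"
  shows "WP (unlink_com r) (\<lambda>s'. arr s' = (arr s)(aG := unlink M x) \<and> ticks s' \<le> ticks s + 4) s"
proof -
  have c: "x \<in> nodes" "M (x + 3) \<in> nodes" "M (M (x + 3)) < n"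
    "M (x + 1) \<noteq> 0 ==> M (x + 1) \<in> nodes \<and> M (x + 1) \<noteq> x"
    "M (x + 2) \<noteq> 0 ==> M (x + 2) \<in> nodes \<and> M (x + 2) \<noteq> x" using assms(1) by (auto simp: cell_ok_def)
  note nl = node_less[OF c(1)] Z_less[OF node_less(1)[OF c(1)]] node_less(1)[OF c(2)]
  have "M (x + 1) < Z" "M (x + 2) < Z" "M (M (x + 3)) < Z" using c(3-5) node_less Z by fastforce+
  then have b: "M (x + 1) < Z" "M (x + 2) < Z" "M (M (x + 3)) < Z" "M (x + 1) + 20 < W" "M (x + 2) + 20 < W"
    using Z_less by auto
  define M1 where "M1 = (if M (x + 2) \<noteq> 0 then M(M (x + 2) + 1 := M (x + 1)) else M(M (M (x + 3)) := M (x + 1)))"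
  have "x + 1 \<noteq> M (M (x + 3))" "x + 2 \<noteq> M (M (x + 3))" using node_bounds[OF c(1)] c(3) by auto
  then have M1: "M1 (x + 1) = M (x + 1)" "M1 (x + 2) = M (x + 2)"
    using c(5) node_cell_neq[of "M (x + 2)" x] c(1) by (auto simp: M1_def)
  have U: "unlink M x = (if M1 (x + 1) \<noteq> 0 then M1(M1 (x + 1) + 2 := M1 (x + 2)) else M1)"
    unfolding M1 by (simp add: unlink_def M1_def Let_def)
  have q: "M (x + 1) \<noteq> 0 ==> M (x + 1) + 2 < Z" "M (x + 2) \<noteq> 0 ==> M (x + 2) + 1 < Z"
    using c(4,5) node_less by auto
  have 1: "WP (Cond (prevE r) (Write aG (Plus (prevE r) (Lit 1)) (nextE r)) (Write aG (Arr aG (twinE r)) (nextE r)))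
      (\<lambda>s'. arr s' = (arr s)(aG := M1) \<and> ticks s' = ticks s + 2 \<and> var s' r = x) s"
    using assms(2,3) nl b q by (simp add: M1_def)
  have 2: "WP (Cond (nextE r) (Write aG (Plus (nextE r) (Lit 2)) (prevE r)) Skip)
      (\<lambda>s'. arr s' = (arr s)(aG := unlink M x) \<and> ticks s' \<le> ticks s + 4) s'"
    if "arr s' = (arr s)(aG := M1) \<and> ticks s' = ticks s + 2 \<and> var s' r = x" for s'
    using that nl b q M1 by (simp add: U)
  show ?thesis unfolding unlink_com_def wp_Seq by (rule wp_mono[OF 1]) (rule 2)
qed

lemma wp_relink:
  assumes "cell_ok M x" "arr s aG = M" "var s r = x"
  shows "WP (relink_com r) (\<lambda>s'. arr s' = (arr s)(aG := relink M x) \<and> ticks s' \<le> ticks s + 4) s"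
proof -
  have c: "x \<in> nodes" "M (x + 3) \<in> nodes" "M (M (x + 3)) < n"
    "M (x + 1) \<noteq> 0 ==> M (x + 1) \<in> nodes \<and> M (x + 1) \<noteq> x"
    "M (x + 2) \<noteq> 0 ==> M (x + 2) \<in> nodes \<and> M (x + 2) \<noteq> x" using assms(1) by (auto simp: cell_ok_def)
  note nl = node_less[OF c(1)] Z_less[OF node_less(1)[OF c(1)]] node_less(1)[OF c(2)]
  have "M (x + 1) < Z" "M (x + 2) < Z" "M (M (x + 3)) < Z" using c(3-5) node_less Z by fastforce+
  then have b: "M (x + 1) < Z" "M (x + 2) < Z" "M (M (x + 3)) < Z" "M (x + 1) + 20 < W" "M (x + 2) + 20 < W"
    using Z_less by auto
  define M1 where "M1 = (if M (x + 2) \<noteq> 0 then M(M (x + 2) + 1 := x) else M(M (M (x + 3)) := x))"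
  have "x + 1 \<noteq> M (M (x + 3))" "x + 2 \<noteq> M (M (x + 3))" using node_bounds[OF c(1)] c(3) by auto
  then have M1: "M1 (x + 1) = M (x + 1)" "M1 (x + 2) = M (x + 2)"
    using c(5) node_cell_neq[of "M (x + 2)" x] c(1) by (auto simp: M1_def)
  have U: "relink M x = (if M1 (x + 1) \<noteq> 0 then M1(M1 (x + 1) + 2 := x) else M1)"
    unfolding M1 by (simp add: relink_def M1_def Let_def)
  have q: "M (x + 1) \<noteq> 0 ==> M (x + 1) + 2 < Z" "M (x + 2) \<noteq> 0 ==> M (x + 2) + 1 < Z"
    using c(4,5) node_less by auto
  have 1: "WP (Cond (prevE r) (Write aG (Plus (prevE r) (Lit 1)) (Var r)) (Write aG (Arr aG (twinE r)) (Var r)))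
      (\<lambda>s'. arr s' = (arr s)(aG := M1) \<and> ticks s' = ticks s + 2 \<and> var s' r = x) s"
    using assms(2,3) nl b q by (simp add: M1_def)
  have 2: "WP (Cond (nextE r) (Write aG (Plus (nextE r) (Lit 2)) (Var r)) Skip)
      (\<lambda>s'. arr s' = (arr s)(aG := relink M x) \<and> ticks s' \<le> ticks s + 4) s'"
    if "arr s' = (arr s)(aG := M1) \<and> ticks s' = ticks s + 2 \<and> var s' r = x" for s'
    using that nl b q M1 by (simp add: U)
  show ?thesis unfolding relink_com_def wp_Seq by (rule wp_mono[OF 1]) (rule 2)
qed

lemma wp_delete:
  assumes "rep (arr s aG) L" "v < n" "var s r = x" "x \<in> set (L v)" "r \<noteq> vZ"
  shows "WP (delete_com r) (\<lambda>s'. arr s' = (arr s)(aG := delete (arr s aG) x) \<and> ticks s' \<le> ticks s + 9) s"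
proof -
  note R = rep_delete[OF assms(1,2,4)]
  have x: "x \<in> nodes" using R(5) by (simp add: cell_ok_def)
  show ?thesis
    unfolding delete_com_def wp_Seq
  proof (rule wp_frame[OF wp_unlink[OF R(5) refl assms(3)]])
    fix s' :: store assume s': "arr s' = (arr s)(aG := unlink (arr s aG) x) \<and> ticks s' \<le> ticks s + 4"
      "\<And>r'. r' \<notin> mods (unlink_com r) ==> var s' r' = var s r'"
    have r: "var s' r = x" using s'(2) assms(3) by (simp add: unlink_com_def)
    let ?s = "s'\<lparr>var := (var s')(vZ := tw x), ticks := Suc (ticks s')\<rparr>"
    have "WP (unlink_com vZ) (\<lambda>s''. arr s'' = (arr s)(aG := delete (arr s aG) x) \<and> ticks s'' \<le> ticks s + 9) ?s"
      by (rule wp_mono[OF wp_unlink[OF R(6)]]) (use s' in \<open>auto simp: delete_def\<close>)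
    then show "WP (Assign vZ (twinE r)) (WP (unlink_com vZ) (\<lambda>s'. arr s' = (arr s)(aG := delete (arr s aG) x) \<and> ticks s' \<le> ticks s + 9)) s'"
      using s' r R(4)[OF x] node_less[OF x] Z_less[OF node_less(1)[OF x]] by simp
  qed
qed

lemma wp_restore:
  assumes "rep M L" "v < n" "var s r = x" "x \<in> set (L v)" "r \<noteq> vZ" "arr s aG = delete M x"
  shows "WP (restore_com r) (\<lambda>s'. arr s' = (arr s)(aG := M) \<and> ticks s' \<le> ticks s + 9) s"
proof -
  note R = rep_delete[OF assms(1,2,4)]
  have x: "x \<in> nodes" using R(5) by (simp add: cell_ok_def)
  let ?s = "s\<lparr>var := (var s)(vZ := tw x), ticks := Suc (ticks s)\<rparr>"
  have "WP (relink_com vZ) (WP (relink_com r) (\<lambda>s'. arr s' = (arr s)(aG := M) \<and> ticks s' \<le> ticks s + 9)) ?s"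
  proof (rule wp_frame[OF wp_relink[OF R(7)]])
    fix s' :: store assume s': "arr s' = (arr ?s)(aG := relink (delete M x) (tw x)) \<and> ticks s' \<le> ticks ?s + 4"
      "\<And>r'. r' \<notin> mods (relink_com vZ) ==> var s' r' = var ?s r'"
    have r: "var s' r = x" using s'(2)[of r] assms(3,5) by (simp add: relink_com_def)
    show "WP (relink_com r) (\<lambda>s'. arr s' = (arr s)(aG := M) \<and> ticks s' \<le> ticks s + 9) s'"
      by (rule wp_mono[OF wp_relink[OF R(8) _ r]]) (use s' R(2) in \<open>auto simp: restore_def\<close>)
  qed (use assms in auto)
  then show ?thesis
    unfolding restore_com_def
    using assms(3,6) R(9) node_less[OF x] Z_less[OF node_less(1)[OF x]] by simp
qed

section \<open>Trees stored in the queue\<close>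

text \<open>The parent of \<open>q i\<close> is given by a node in the list of an earlier
  \<open>q j\<close>; this node yields the edge, its direction and, through its twin, the parent
  vertex. Prefixes of the queue are again trees, so lowering a counter undoes inclusions.\<close>

definition qtree :: "(nat => nat list) => (nat => nat) => (nat => nat) => nat => bool" where
  "qtree L q par l \<longleftrightarrow> 0 < l \<and> inj_on q {..<l} \<and> (\<forall>i<l. q i < n) \<and>
     (\<forall>i. 0 < i --> i < l --> (\<exists>j<i. par (q i) \<in> set (L (q j)) \<and> nb (par (q i)) = q i))"

definition tedges :: "(nat => nat) => (nat => nat) => nat => nat set set" where
  "tedges q par l = (\<lambda>i. ed (par (q i))) ` {0<..<l}"

lemma qtreeD:
  assumes "wf_lists L" "qtree L q par l" "0 < i" "i < l"
  shows "\<exists>j<i. par (q i) \<in> set (L (q j)) \<and> nb (par (q i)) = q i \<and> ed (par (q i)) = {q j, q i} \<and> q j < n \<and> q j \<noteq> q i"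
proof -
  obtain j where j: "j < i" "par (q i) \<in> set (L (q j))" "nb (par (q i)) = q i"
    using assms by (auto simp: qtree_def)
  moreover have "q j < n" using assms j by (auto simp: qtree_def)
  ultimately show ?thesis using wf_listsD(3,10)[OF assms(1)] by metis
qed

lemma qtree_cong:
  assumes "qtree L q par l" "\<And>i. i < l ==> q' i = q i" "\<And>i. 0 < i ==> i < l ==> par' (q i) = par (q i)"
  shows "qtree L q' par' l" "tedges q' par' l = tedges q par l" "q' ` {..<l} = q ` {..<l}"
proof -
  show "qtree L q' par' l"
    unfolding qtree_def
  proof (intro conjI allI impI)
    show "inj_on q' {..<l}" using assms(1,2) by (auto simp: qtree_def inj_on_def)
    fix i assume "0 < i" "i < l"
    then obtain j where "j < i" "par (q i) \<in> set (L (q j))" "nb (par (q i)) = q i"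
      using assms(1) by (auto simp: qtree_def)
    then show "\<exists>j<i. par' (q' i) \<in> set (L (q' j)) \<and> nb (par' (q' i)) = q' i"
      using assms(2,3) \<open>0 < i\<close> \<open>i < l\<close> by (intro exI[of _ j]) auto
  qed (use assms in \<open>auto simp: qtree_def\<close>)
  show "tedges q' par' l = tedges q par l" unfolding tedges_def using assms(2,3) by (intro image_cong) auto
  show "q' ` {..<l} = q ` {..<l}" using assms(2) by (intro image_cong) auto
qed

lemma qtree_le: "qtree L q par l ==> 0 < l' ==> l' \<le> l ==> qtree L q par l'"
  by (auto simp: qtree_def inj_on_def)

lemma qtree_tree:
  assumes "wf_lists L" "qtree L q par l"
  shows "tree (q 0) (q ` {..<l}) (tedges q par l)" "tedges q par l \<subseteq> edges L" "card (q ` {..<l}) = l"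
    "card (tedges q par l) = l - 1" "finite (tedges q par l)"
proof -
  have "tree (q 0) (q ` {..<l}) (tedges q par l)" if "qtree L q par l" for l
    using that
  proof (induction l)
    case 0
    then show ?case by (simp add: qtree_def)
  next
    case (Suc l)
    show ?case
    proof (cases "l = 0")
      case True
      moreover have "{0<..<Suc 0} = {}" by auto
      ultimately show ?thesis by (auto simp: tedges_def lessThan_Suc intro: ext_refl)
    next
      case False
      have t: "tree (q 0) (q ` {..<l}) (tedges q par l)"
        using Suc.IH qtree_le[OF Suc.prems, of l] False by simp
      obtain j where j: "j < l" "ed (par (q l)) = {q j, q l}"
        using qtreeD[OF assms(1) Suc.prems, of l] False by auto
      have "inj_on q {..<Suc l}" using Suc.prems by (simp add: qtree_def)
      then have new: "q l \<notin> q ` {..<l}" by (simp add: lessThan_Suc inj_on_insert)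
      have "{0<..<Suc l} = insert l {0<..<l}" using False by auto
      then have "tedges q par (Suc l) = insert {q j, q l} (tedges q par l)" using j by (simp add: tedges_def)
      moreover have "q ` {..<Suc l} = insert (q l) (q ` {..<l})" by (auto simp: lessThan_Suc)
      ultimately show ?thesis using ext_step[OF t _ new, of "q j"] j by simp
    qed
  qed
  then show t: "tree (q 0) (q ` {..<l}) (tedges q par l)" using assms(2) .
  show "tedges q par l \<subseteq> edges L"
  proof
    fix e assume "e \<in> tedges q par l"
    then obtain i where "0 < i" "i < l" "e = ed (par (q i))" by (auto simp: tedges_def)
    then show "e \<in> edges L" using qtreeD[OF assms, of i] ed_in_edges[OF assms(1)] by auto
  qed
  show c: "card (q ` {..<l}) = l" using assms(2) by (simp add: qtree_def card_image)
  show "card (tedges q par l) = l - 1" "finite (tedges q par l)" using tree_facts[OF t] c by auto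
qed

text \<open>A tree edge is the parent edge of its endpoint that was queued later.\<close>

lemma tedges_max:
  assumes "wf_lists L" "qtree L q par l" "e \<in> tedges q par l" "q a \<in> e" "q b \<in> e" "a < b" "b < l"
  shows "e = ed (par (q b))"
proof -
  obtain i where i: "0 < i" "i < l" "e = ed (par (q i))" using assms(3) by (auto simp: tedges_def)
  obtain j where j: "j < i" "e = {q j, q i}" using qtreeD[OF assms(1,2) i(1,2)] i by auto
  have inj: "\<And>a b. a < l ==> b < l ==> q a = q b ==> a = b" using assms(2) by (auto simp: qtree_def inj_on_def)
  have "q a = q j \<or> q a = q i" "q b = q j \<or> q b = q i" using assms(4,5) j by auto
  moreover have "a < l" "j < l" using assms i j by auto
  ultimately have "a = j \<or> a = i" "b = j \<or> b = i" using inj assms(7) i(2) by blast+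
  then have "b = i" using assms(6) j(1) by linarith
  then show ?thesis using i by simp
qed

lemma tedges_neq:
  assumes "wf_lists L" "qtree L q par l" "0 < a" "a < l" "0 < b" "b < l" "a \<noteq> b"
  shows "ed (par (q a)) \<noteq> ed (par (q b))"
proof
  assume eq: "ed (par (q a)) = ed (par (q b))"
  obtain i j where ij: "i < a" "ed (par (q a)) = {q i, q a}" "j < b" "ed (par (q b)) = {q j, q b}"
    using qtreeD[OF assms(1-4)] qtreeD[OF assms(1,2,5,6)] by metis
  have inj: "\<And>a b. a < l ==> b < l ==> q a = q b ==> a = b" using assms(2) by (auto simp: qtree_def inj_on_def)
  have "q a = q j" "q i = q b" using eq ij inj[OF assms(4,6)] assms(7) by (auto simp: doubleton_eq_iff)
  then have "a = j" "i = b" using inj[of a j] inj[of i b] ij assms by auto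
  then show False using ij by simp
qed

lemma qtree_extend:
  assumes "wf_lists L" "qtree L q par l" "w \<notin> q ` {..<l}" "j < l" "x \<in> set (L (q j))" "nb x = w"
  shows "qtree L (q(l := w)) (par(w := x)) (Suc l)"
    "tedges (q(l := w)) (par(w := x)) (Suc l) = insert (ed x) (tedges q par l)"
    "(q(l := w)) ` {..<l} = q ` {..<l}" "(q(l := w)) ` {..<Suc l} = insert w (q ` {..<l})"
proof -
  have l: "0 < l" "q j < n" using assms by (auto simp: qtree_def)
  have w: "w < n" using wf_listsD(2)[OF assms(1) l(2) assms(5)] assms(6) by simp
  have p: "(par(w := x)) (q i) = par (q i)" if "i < l" for i using assms(3) that by auto
  note c = qtree_cong[OF assms(2), of "q(l := w)" "par(w := x)"]
  have c: "qtree L (q(l := w)) (par(w := x)) l" "tedges (q(l := w)) (par(w := x)) l = tedges q par l"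
    "(q(l := w)) ` {..<l} = q ` {..<l}"
    using c p by auto
  show "(q(l := w)) ` {..<l} = q ` {..<l}" by fact
  show "(q(l := w)) ` {..<Suc l} = insert w (q ` {..<l})"
    unfolding lessThan_Suc image_insert c(3) by simp
  show "qtree L (q(l := w)) (par(w := x)) (Suc l)"
    unfolding qtree_def
  proof (intro conjI allI impI)
    show "inj_on (q(l := w)) {..<Suc l}" using c(1,3) assms(3) by (auto simp: qtree_def lessThan_Suc inj_on_insert)
    fix i assume i: "0 < i" "i < Suc l"
    show "\<exists>j<i. (par(w := x)) ((q(l := w)) i) \<in> set (L ((q(l := w)) j)) \<and> nb ((par(w := x)) ((q(l := w)) i)) = (q(l := w)) i"
    proof (cases "i = l")
      case True
      then show ?thesis using assms by (intro exI[of _ j]) auto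
    next
      case False
      then show ?thesis using c(1) i by (auto simp: qtree_def)
    qed
  qed (use c(1) w in \<open>auto simp: qtree_def less_Suc_eq\<close>)
  have "{0<..<Suc l} = insert l {0<..<l}" using l by auto
  then have "tedges (q(l := w)) (par(w := x)) (Suc l) = insert (ed x) (tedges (q(l := w)) (par(w := x)) l)"
    unfolding tedges_def by (simp only: image_insert fun_upd_same)
  then show "tedges (q(l := w)) (par(w := x)) (Suc l) = insert (ed x) (tedges q par l)"
    unfolding c(2) .
qed

text \<open>Whatever is reached across \<open>e\<close> is one of its endpoints, and both are
  reachable anyway.\<close>

lemma reach_non_bridge:
  assumes "{a, b} = e" "a \<in> reach (E - {e}) A" "b \<in> reach (E - {e}) A"
  shows "reach (E - {e}) A = reach E A"
proof
  show "reach E A \<subseteq> reach (E - {e}) A"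
  proof (rule reach_least)
    fix u v assume *: "u \<in> reach (E - {e}) A" "{u, v} \<in> E"
    show "v \<in> reach (E - {e}) A"
    proof (cases "{u, v} = e")
      case True
      then show ?thesis using assms by (auto simp: doubleton_eq_iff)
    qed (use * in \<open>auto intro: reach_step\<close>)
  qed (auto intro: reach_base)
qed (rule reach_mono, auto)

lemma finite_reach: "wf_lists L ==> finite A ==> E \<subseteq> edges L ==> finite (reach E A)"
  by (rule finite_subset[OF reach_subset_Union]) (auto intro: finite_subset[of _ "{..<n}"] dest: edges_wf)

text \<open>The absence of further edges inside the tree keeps the first search at
  \<open>O(k)\<close> steps. Enough reachable vertices means that a solution exists, so no branch of
  the search is empty.\<close>

definition good :: "(nat => nat list) => (nat => nat) => (nat => nat) => nat => bool" where
  "good L q par sz \<longleftrightarrow> qtree L q par sz \<and> sz \<le> Suc k \<and>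
     (\<forall>e\<in>edges L. e \<subseteq> q ` {..<sz} --> e \<in> tedges q par sz) \<and>
     Suc k \<le> card (reach (edges L) (q ` {..<sz}))"

text \<open>Three values let one array tell the current tree from the temporary part of a search;
  \<open>t = sz\<close> describes the state after cleaning up.\<close>

definition marks :: "(nat => nat) => nat => nat => (nat => nat) => bool" where
  "marks q sz t vis \<longleftrightarrow>
     (\<forall>v<n. vis v = (if v \<in> q ` {..<sz} then 1 else if v \<in> q ` {..<t} then 2 else 0))"

lemma linked_list_next:
  assumes "rep M L" "v < n" "L v = as @ x # bs"
  shows "M (x + 1) = (case bs of [] => 0 | y # _ => y)"
  using assms linked_list_split(2)[of M 0 "M v" as x bs] by (cases bs) (auto simp: rep_def)

lemma linked_list_first:
  assumes "rep M L" "v < n"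
  shows "M v = (case L v of [] => 0 | y # _ => y)"
  using assms by (cases "L v") (auto simp: rep_def dest!: spec[of _ v])

section \<open>The search from the current tree\<close>

text \<open>The vertex \<open>q h\<close> is being scanned, so the only found vertices that depend
  on it are its children, and these have no children yet. The chord \<open>x\<close> leads to a
  vertex that is not one of these children, since its node is new; that vertex reaches the tree
  without \<open>q h\<close>, and through it so does \<open>q h\<close> after the loss of its parent
  edge.\<close>

lemma chord_outside:
  assumes wf: "wf_lists L" and qt: "qtree L q par t" and h: "0 < sz" "sz \<le> h" "h < t"
    and parent: "\<And>i. sz \<le> i ==> i < t ==> \<exists>j\<le>h. j < i \<and> par (q i) \<in> set (L (q j)) \<and> (j = h --> par (q i) \<in> A)"
    and x: "x \<in> set (L (q h))" "x \<notin> A" "nb x \<in> q ` {..<t}" "tw x \<noteq> par (q h)"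
  shows "reach (edges L - {ed (par (q h))}) (q ` {..<sz}) = reach (edges L) (q ` {..<sz})"
proof -
  let ?p = "ed (par (q h))" let ?R = "reach (edges L - {?p}) (q ` {..<sz})"
  have qn: "\<And>i. i < t ==> q i < n" using qt by (auto simp: qtree_def)
  have inj: "\<And>a b. a < t ==> b < t ==> q a = q b ==> a = b" using qt by (auto simp: qtree_def inj_on_def)
  note X = wf_listsD[OF wf qn[OF h(3)] x(1)]
  have own: "a = b" if "a < t" "b < t" "z \<in> set (L (q a))" "z \<in> set (L (q b))" for a b z
    using inj[OF that(1,2)] wf_listsD(5)[OF wf qn[OF that(1)] that(3)] wf_listsD(5)[OF wf qn[OF that(2)] that(4)] by simp
  \<comment> \<open>Every found vertex other than \<open>q h\<close> and its children reaches the
    tree along parent edges that avoid \<open>q h\<close>.\<close>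
  have r: "q i \<in> ?R" if "i < t" "i \<noteq> h" "i < sz \<or> par (q i) \<notin> set (L (q h))" for i
    using that
  proof (induction i rule: less_induct)
    case (less i)
    show ?case
    proof (cases "i < sz")
      case False
      obtain j where j: "j \<le> h" "j < i" "par (q i) \<in> set (L (q j))" using parent[of i] False less.prems by auto
      have jh: "j < h" using j less.prems False by (metis le_neq_implies_less)
      have "j < sz \<or> par (q j) \<notin> set (L (q h))"
      proof (rule disjCI)
        assume pj: "\<not> par (q j) \<notin> set (L (q h))"
        show "j < sz"
        proof (rule ccontr)
          assume "\<not> j < sz"
          then obtain j' where "j' < j" "par (q j) \<in> set (L (q j'))" using parent[of j] jh h by auto
          then show False using own[of j' h "par (q j)"] pj jh h by auto
        qed
      qed
      then have "q j \<in> ?R" using less.IH[of j] j less.prems jh by auto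
      moreover have "ed (par (q i)) = {q j, q i}"
      proof -
        have "nb (par (q i)) = q i" using qtreeD[OF wf qt, of i] less.prems False h by auto
        then show ?thesis using wf_listsD(10)[OF wf qn j(3)] j less.prems by simp
      qed
      moreover have "ed (par (q i)) \<noteq> ?p" using tedges_neq[OF wf qt, of i h] less.prems h False by auto
      moreover have "ed (par (q i)) \<in> edges L" using ed_in_edges[OF wf qn j(3)] j less.prems by simp
      ultimately have "{q j, q i} \<in> edges L - {?p}" "q j \<in> ?R" by simp_all
      then show ?thesis by (blast intro: reach_step)
    qed (auto intro: reach_base)
  qed
  obtain b where b: "b < t" "nb x = q b" using x(3) by auto
  have "b \<noteq> h" using b X by auto
  have qb: "q b \<in> ?R"
  proof (rule r[OF b(1) \<open>b \<noteq> h\<close>], rule disjCI)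
    assume pb: "\<not> par (q b) \<notin> set (L (q h))"
    show "b < sz"
    proof (rule ccontr)
      assume "\<not> b < sz"
      then obtain j where j: "j \<le> h" "j < b" "par (q b) \<in> set (L (q j))" "j = h --> par (q b) \<in> A" using parent[of b] b by auto
      then have "par (q b) \<in> A" using own[of j h "par (q b)"] pb h b by auto
      moreover have "nb (par (q b)) = q b" using qtreeD[OF wf qt, of b] j b by auto
      ultimately show False using wf_lists_inj[OF wf qn[OF h(3)] _ x(1), of "par (q b)"] pb b x(2) by auto
    qed
  qed
  obtain j where j: "j < h" "par (q h) \<in> set (L (q j))" "?p = {q j, q h}" using qtreeD[OF wf qt, of h] h by auto
  have qj: "q j \<in> ?R"
  proof (rule r)
    show "j < sz \<or> par (q j) \<notin> set (L (q h))"
    proof (rule disjCI)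
      assume pj: "\<not> par (q j) \<notin> set (L (q h))"
      show "j < sz"
      proof (rule ccontr)
        assume "\<not> j < sz"
        then obtain j' where "j' < j" "par (q j) \<in> set (L (q j'))" using parent[of j] j h by auto
        then show False using own[of j' h "par (q j)"] pj j h by auto
      qed
    qed
  qed (use j h in auto)
  have "ed x \<noteq> ?p"
  proof
    assume "ed x = ?p"
    moreover have "q j < n" using qn[of j] j(1) h(3) by linarith
    ultimately have "par (q h) = x \<or> par (q h) = tw x" using ed_eq[OF wf qn[OF h(3)] x(1) _ j(2)] by blast
    then have "x \<in> set (L (q j))" using x(4) j(2) by metis
    then have "j = h" using own[of j h x] j(1) h(3) x(1) by linarith
    then show False using j(1) by simp
  qed
  moreover have "ed x \<in> edges L" "ed x = {q b, q h}" using ed_in_edges[OF wf qn[OF h(3)] x(1)] X b by auto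
  ultimately have "{q b, q h} \<in> edges L - {?p}" by simp
  then have "q h \<in> ?R" using qb by (blast intro: reach_step)
  then show ?thesis by (rule reach_non_bridge[OF j(3)[symmetric] qj])
qed

text \<open>Both the parent edge of \<open>q b\<close> and \<open>x\<close> start in the current
  tree, because found vertices hang on some \<open>q j\<close> with \<open>j\<close> at most
  \<open>h\<close>, and \<open>h < sz\<close>. Either edge can replace the other.\<close>

lemma chord_inside:
  assumes wf: "wf_lists L" and qt: "qtree L q par t" and h: "h < sz" "sz \<le> b" "b < t"
    and j: "j \<le> h" "par (q b) \<in> set (L (q j))" "j = h --> par (q b) \<in> A"
    and x: "x \<in> set (L (q h))" "x \<notin> A" "nb x = q b"
  shows "reach (edges L - {ed (par (q b))}) (q ` {..<sz}) = reach (edges L) (q ` {..<sz})"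
proof -
  let ?p = "ed (par (q b))" let ?R = "reach (edges L - {?p}) (q ` {..<sz})"
  have qn: "\<And>i. i < t ==> q i < n" using qt by (auto simp: qtree_def)
  have inj: "\<And>a b. a < t ==> b < t ==> q a = q b ==> a = b" using qt by (auto simp: qtree_def inj_on_def)
  have X: "ed x = {q h, q b}" "ed x \<in> edges L" "tw x \<in> set (L (q b))"
    using wf_listsD[OF wf qn x(1)] ed_in_edges[OF wf qn x(1)] x(3) h by auto
  have P: "?p = {q j, q b}"
    using wf_listsD(10)[OF wf qn j(2)] qtreeD[OF wf qt, of b] j h by auto
  have "ed x \<noteq> ?p"
  proof
    assume e: "ed x = ?p"
    then have "q j = q h" using X P by (auto simp: doubleton_eq_iff)
    then have "j = h" using inj[of j h] j h by auto
    moreover have "nb (par (q b)) = q b" using qtreeD[OF wf qt, of b] h by auto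
    ultimately have "par (q b) = x" using wf_lists_inj[OF wf, of "q h" "par (q b)" x] qn[of h] j(2) x(1,3) h by simp
    then show False using x(2) j(3) \<open>j = h\<close> by simp
  qed
  then have "{q h, q b} \<in> edges L - {?p}" using X by simp
  moreover have "q h \<in> ?R" "q j \<in> ?R" using h j by (auto intro!: reach_base)
  ultimately have "q b \<in> ?R" by (blast intro: reach_step)
  then show ?thesis by (rule reach_non_bridge[OF P[symmetric] \<open>q j \<in> ?R\<close>])
qed

text \<open>The vertex queued last is a leaf of the search tree; without its parent edge the other
  \<open>k + 1\<close> vertices are still reachable.\<close>

lemma overfull:
  assumes wf: "wf_lists L" and qt: "qtree L q par (Suc (Suc k))" and sz: "0 < sz" "sz \<le> Suc k"
  shows "Suc k \<le> card (reach (edges L - {ed (par (q (Suc k)))}) (q ` {..<sz}))"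
proof -
  let ?p = "ed (par (q (Suc k)))" let ?R = "reach (edges L - {?p}) (q ` {..<sz})"
  have "q i \<in> ?R" if "i < Suc k" for i
    using that
  proof (induction i rule: less_induct)
    case (less i)
    show ?case
    proof (cases "i < sz")
      case False
      then have i: "0 < i" "i < Suc (Suc k)" using sz less.prems by auto
      obtain j where j: "j < i" "par (q i) \<in> set (L (q j))" "ed (par (q i)) = {q j, q i}" "q j < n"
        using qtreeD[OF wf qt i] by auto
      have "ed (par (q i)) \<noteq> ?p" using tedges_neq[OF wf qt i, of "Suc k"] less.prems by auto
      then have "{q j, q i} \<in> edges L - {?p}" using ed_in_edges[OF wf j(4,2)] j(3) by simp
      moreover have "q j \<in> ?R" using less j by auto
      ultimately show ?thesis by (blast intro: reach_step)
    qed (auto intro: reach_base)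
  qed
  then have "q ` {..<Suc k} \<subseteq> ?R" by auto
  then have "card (q ` {..<Suc k}) \<le> card ?R" by (rule card_mono[rotated]) (rule finite_reach[OF wf], auto)
  then show ?thesis using qtree_tree(3)[OF wf qtree_le[OF qt, of "Suc k"]] by simp
qed

lemma qtree_bound:
  assumes "wf_lists L" "qtree L q par l"
  shows "l \<le> n"
proof -
  have "q ` {..<l} \<subseteq> {..<n}" using assms(2) by (auto simp: qtree_def)
  then show ?thesis using card_mono[of "{..<n}" "q ` {..<l}"] qtree_tree(3)[OF assms] by simp
qed

text \<open>\<open>h\<close> is the position being scanned and \<open>A\<close> the part of its list
  already done. Every node scanned so far belongs to a tree edge, which bounds the scanned nodes by
  twice the number of edges of the search tree.\<close>

definition bfs_inv where
  "bfs_inv L sz q0 par0 h A s \<longleftrightarrow> (let q = arr s aQ; par = arr s aPar; t = var s vT in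
     rep (arr s aG) L \<and> qtree L q par t \<and> sz \<le> t \<and> t \<le> Suc k \<and> marks q sz t (arr s aVis) \<and>
     (\<forall>i<sz. q i = q0 i \<and> par (q0 i) = par0 (q0 i)) \<and>
     (\<forall>i. sz \<le> i --> i < t --> (\<exists>j\<le>h. j < i \<and> par (q i) \<in> set (L (q j)) \<and> (j = h --> par (q i) \<in> A))) \<and>
     (\<forall>i<h. \<forall>x\<in>set (L (q i)). ed x \<in> tedges q par t) \<and> (\<forall>x\<in>A. ed x \<in> tedges q par t) \<and>
     var s vK = k)"

text \<open>The parent edge of \<open>q d\<close> can be deleted while \<open>k + 1\<close> vertices
  stay reachable, so the path to \<open>q d\<close> contains an edge to branch on. The facts about
  \<open>h\<close> and \<open>j\<close> record how far the scan got; from them the inner vertices of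
  the path turn out to have no other edges backwards.\<close>

definition bfs_found where
  "bfs_found L sz q0 par0 s \<longleftrightarrow> (let q = arr s aQ; par = arr s aPar; t = var s vT in
     rep (arr s aG) L \<and> qtree L q par t \<and> sz \<le> t \<and> t \<le> Suc (Suc k) \<and> marks q sz t (arr s aVis) \<and>
     (\<forall>i<sz. q i = q0 i \<and> par (q0 i) = par0 (q0 i)) \<and> var s vK = k \<and>
     (\<exists>h d. sz \<le> d \<and> d < t \<and> h < t \<and> var s vG = q d \<and> (\<exists>j<d. j \<le> h \<and> par (q d) \<in> set (L (q j))) \<and>
       (\<forall>i<h. \<forall>x\<in>set (L (q i)). ed x \<in> tedges q par t) \<and>
       Suc k \<le> card (reach (edges L - {ed (par (q d))}) (q0 ` {..<sz}))))"

lemma bfs_foundI: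
  assumes "arr s aQ = q" "arr s aPar = par" "var s vT = t" "var s vK = k" "var s vG = q d"
    and "rep (arr s aG) L" "marks q sz t (arr s aVis)" "qtree L q par t" "sz \<le> t" "t \<le> Suc (Suc k)"
    and "\<And>i. i < sz ==> q i = q0 i \<and> par (q0 i) = par0 (q0 i)"
    and "sz \<le> d" "d < t" "h < t" "j < d" "j \<le> h" "par (q d) \<in> set (L (q j))"
    and "\<And>i x. i < h ==> x \<in> set (L (q i)) ==> ed x \<in> tedges q par t"
    and "Suc k \<le> card (reach (edges L - {ed (par (q d))}) (q0 ` {..<sz}))"
  shows "bfs_found L sz q0 par0 s"
  using assms unfolding bfs_found_def Let_def by blast

lemma bfs_inv_Suc:
  assumes "bfs_inv L sz q0 par0 h (set (L (arr s aQ h))) s"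
  shows "bfs_inv L sz q0 par0 (Suc h) {} s"
proof -
  have "\<exists>j\<le>Suc h. j < i \<and> arr s aPar (arr s aQ i) \<in> set (L (arr s aQ j)) \<and> (j = Suc h --> arr s aPar (arr s aQ i) \<in> {})"
    if "sz \<le> i" "i < var s vT" for i
  proof -
    obtain j where "j \<le> h" "j < i" "arr s aPar (arr s aQ i) \<in> set (L (arr s aQ j))"
      using assms \<open>sz \<le> i\<close> \<open>i < var s vT\<close> by (auto simp: bfs_inv_def Let_def)
    then show ?thesis by (intro exI[of _ j]) auto
  qed
  moreover have "\<forall>i<Suc h. \<forall>x\<in>set (L (arr s aQ i)). ed x \<in> tedges (arr s aQ) (arr s aPar) (var s vT)"
    using assms by (auto simp: bfs_inv_def Let_def less_Suc_eq)
  ultimately show ?thesis using assms unfolding bfs_inv_def Let_def by blast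
qed

lemma wp_bfs_visit:
  assumes I: "bfs_inv L sz q0 par0 h (set xs1) s" and g: "good L q0 par0 sz" "sz \<le> k" and h: "h < var s vT"
    and u: "var s vU = arr s aQ h" and x: "var s vX = x" and L: "L (arr s aQ h) = xs1 @ x # xs2" and F: "var s vF = 0"
  shows "WP bfs_visit (\<lambda>s'. ticks s' \<le> ticks s + 13 \<and>
    ((var s' vF = 0 \<and> bfs_inv L sz q0 par0 h (set (xs1 @ [x])) s' \<and> var s' vX = (case xs2 of [] => 0 | y # _ => y) \<and>
       (\<forall>i\<le>h. arr s' aQ i = arr s aQ i) \<and> h < var s' vT \<and> var s' vH = var s vH) \<or>
     (var s' vF = 1 \<and> bfs_found L sz q0 par0 s' \<and> var s' vX = 0 \<and> var s' vH = var s' vT))) s"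
proof -
  define q par t u M vis where d: "q = arr s aQ" "par = arr s aPar" "t = var s vT" "u = q h" "M = arr s aG" "vis = arr s aVis"
  have rp: "rep M L" and qt: "qtree L q par t" and t: "sz \<le> t" "t \<le> Suc k" and mk: "marks q sz t vis"
    and fr: "\<And>i. i < sz ==> q i = q0 i \<and> par (q0 i) = par0 (q0 i)"
    and parent: "\<And>i. sz \<le> i ==> i < t ==> \<exists>j\<le>h. j < i \<and> par (q i) \<in> set (L (q j)) \<and> (j = h --> par (q i) \<in> set xs1)"
    and sc: "\<And>i x. i < h ==> x \<in> set (L (q i)) ==> ed x \<in> tedges q par t" "\<And>x. x \<in> set xs1 ==> ed x \<in> tedges q par t"
    and K: "var s vK = k"
    using I by (auto simp: bfs_inv_def d Let_def)
  have h': "h < t" "q h < n" "u < n" using h qt by (auto simp: d qtree_def)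
  have wf: "wf_lists L" using rp by (simp add: rep_def)
  have Lu: "L u = xs1 @ x # xs2" "x \<in> set (L u)" using L by (auto simp: d)
  note X = wf_listsD[OF wf h'(3) Lu(2)]
  have xA: "x \<notin> set xs1" using X(9) Lu by auto
  have M: "M x = nb x" "M (x + 3) = tw x" using rp X(1) by (auto simp: rep_def)
  have nxt: "M (x + 1) = (case xs2 of [] => 0 | y # _ => y)" using linked_list_next[OF rp h'(3) Lu(1)] .
  have sz0: "0 < sz" using g by (simp add: good_def qtree_def)
  have gq: "q0 ` {..<sz} = q ` {..<sz}" using fr by (intro image_cong) auto
  have g': "\<forall>e\<in>edges L. e \<subseteq> q ` {..<sz} --> e \<in> tedges q0 par0 sz" "Suc k \<le> card (reach (edges L) (q ` {..<sz}))"
    using g gq by (auto simp: good_def)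
  have te: "tedges q0 par0 sz \<subseteq> tedges q par t"
    unfolding tedges_def using fr t by (intro image_subsetI) (metis greaterThanLessThan_iff imageI order_less_le_trans)
  have bd: "x < Z" "x + 3 < Z" "x + 1 < Z" "x + 20 < W" "nb x < Z" "u < Z" "t < Z" "t + 20 < W" "k + 20 < W" "2 < W" "1 < W" "0 < W"
    using node_less[OF X(1)] Z_less[of x] X(2) h'(3) t W Z qtree_bound[OF wf qt] by auto
  have tb: "tw x - par u + (par u - tw x) < W" if hs: "sz \<le> h"
  proof -
    obtain j where "j < h" "par u \<in> set (L (q j))" "q j < n" using qtreeD[OF wf qt, of h] hs sz0 h' by (auto simp: d)
    then have "par u \<in> nodes" using wf_listsD(1)[OF wf] by blast
    then show ?thesis using Z_less[of "tw x"] Z_less[of "par u"] node_less(1)[OF X(8)] node_less(1)[of "par u"] by linarith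
  qed
  have "inj_on q {..<t}" using qt by (simp add: qtree_def)
  then have "q h \<in> q ` {..<sz} \<longleftrightarrow> h < sz" using inj_on_image_mem_iff[of q "{..<t}" h "{..<sz}"] h'(1) t(1) by auto
  then have vu: "vis u = (if h < sz then 1 else 2)" using mk h' by (simp add: marks_def d(4))
  have vw: "vis (nb x) = (if nb x \<in> q ` {..<sz} then 1 else if nb x \<in> q ` {..<t} then 2 else 0)" using mk X(2) by (auto simp: marks_def)
  show ?thesis
  proof (cases "nb x \<in> q ` {..<t}")
    case False
    have nsz: "nb x \<notin> q ` {..<sz}" using False t by auto
    note Ex = qtree_extend[OF wf qt False h'(1) Lu(2)[unfolded d(4)] refl]
    let ?q = "q(t := nb x)" let ?par = "par(nb x := x)" let ?vis = "vis(nb x := 2)"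
    have mk': "marks ?q sz (Suc t) ?vis"
      unfolding marks_def Ex(4) using mk nsz t by (auto simp: marks_def)
    have fr': "\<And>i. i < sz ==> ?q i = q0 i \<and> ?par (q0 i) = par0 (q0 i)"
    proof -
      fix i assume i: "i < sz"
      then have "q0 i \<noteq> nb x" using nsz fr[OF i] by (metis imageI lessThan_iff)
      then show "?q i = q0 i \<and> ?par (q0 i) = par0 (q0 i)" using fr[OF i] i t by auto
    qed
    have sc': "\<And>i x'. i < h ==> x' \<in> set (L (?q i)) ==> ed x' \<in> tedges ?q ?par (Suc t)"
      "\<And>x'. x' \<in> set (xs1 @ [x]) ==> ed x' \<in> tedges ?q ?par (Suc t)"
      unfolding Ex(2) using sc h' by auto
    have parent': "\<exists>j\<le>h. j < i \<and> ?par (?q i) \<in> set (L (?q j)) \<and> (j = h --> ?par (?q i) \<in> set (xs1 @ [x]))" if ii: "sz \<le> i" "i < Suc t" for i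
    proof (cases "i = t")
      case True
      then show ?thesis using h' Lu by (intro exI[of _ h]) (auto simp: d)
    next
      case i: False
      then obtain j where "j \<le> h" "j < i" "par (q i) \<in> set (L (q j))" "j = h --> par (q i) \<in> set xs1" using parent[of i] ii i by auto
      moreover have "q i \<noteq> nb x" using False ii i by (metis imageI lessThan_iff less_SucE)
      ultimately show ?thesis using i ii by (intro exI[of _ j]) auto
    qed
    show ?thesis
    proof (cases "t = Suc k")
      case True
      \<comment> \<open>The new vertex is number \<open>k + 2\<close>, and its parent edge is the
        one that \<open>overfull\<close> spares.\<close>
      have "Suc k \<le> card (reach (edges L - {ed (?par (?q (Suc k)))}) (?q ` {..<sz}))"
        using overfull[OF wf, of ?q ?par sz] Ex(1) True sz0 g(2) by simp
      moreover have "?q ` {..<sz} = q0 ` {..<sz}" using fr' by (intro image_cong) auto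
      ultimately have rc: "Suc k \<le> card (reach (edges L - {ed x}) (q0 ` {..<sz}))" using True by simp
      have "bfs_found L sz q0 par0 s'" if "arr s' = (arr s)(aVis := ?vis, aPar := ?par, aQ := ?q)"
        "var s' vT = Suc t" "var s' vK = k" "var s' vG = nb x" for s' :: store
        by (rule bfs_foundI[of s' ?q ?par "Suc t" t L sz q0 par0 h h])
          (use that rp Ex(1) mk' fr' sc'(1) rc True t h' Lu g(2) in \<open>auto simp: d\<close>)
      then show ?thesis
        unfolding bfs_visit_def using u x M bd vw False nsz K True F
        by (simp add: d[symmetric] fun_upd_twist)
    next
      case nk: False
      have "bfs_inv L sz q0 par0 h (set (xs1 @ [x])) s'" if "arr s' = (arr s)(aVis := ?vis, aPar := ?par, aQ := ?q)"
        "var s' vT = Suc t" "var s' vK = k" for s' :: store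
        unfolding bfs_inv_def Let_def that
        using rp Ex(1) mk' fr' sc' parent' nk t
        by (auto simp: d)
      then show ?thesis
        unfolding bfs_visit_def using u x M bd vw False nsz K nk t F nxt h'
        by (simp add: d[symmetric] fun_upd_twist)
    qed
  next
    case True
    have keep: "bfs_inv L sz q0 par0 h (set (xs1 @ [x])) s'" if "ed x \<in> tedges q par t" "arr s' = arr s"
        "var s' vT = t" "var s' vK = k" for s' :: store
      unfolding bfs_inv_def Let_def that(2-)
      using I that(1) by (fastforce simp: bfs_inv_def Let_def d)
    show ?thesis
    proof (cases "h < sz")
      case hs: True
      show ?thesis
      proof (cases "nb x \<in> q ` {..<sz}")
        case ws: True
        \<comment> \<open>Inside the current tree \<open>good\<close> admits tree edges only, so
          this edge closes no cycle.\<close>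
        have "ed x \<subseteq> q ` {..<sz}" using ws hs X(10) by (auto simp: d)
        then have "ed x \<in> tedges q par t" using g'(1) te ed_in_edges[OF wf h'(3) Lu(2)] by blast
        then show ?thesis
          unfolding bfs_visit_def using keep u x M bd vw vu True hs ws K F nxt h'
          by (simp add: d[symmetric])
      next
        case ws: False
        obtain b where b: "b < t" "nb x = q b" "sz \<le> b" using True ws by (auto simp: not_less[symmetric])
        obtain j where j: "j \<le> h" "j < b" "par (q b) \<in> set (L (q j))" "j = h --> par (q b) \<in> set xs1"
          using parent[OF b(3,1)] by auto
        have rc: "reach (edges L - {ed (par (q b))}) (q ` {..<sz}) = reach (edges L) (q ` {..<sz})"
          using chord_inside[OF wf qt hs b(3,1) j(1,3,4) Lu(2)[unfolded d(4)] xA b(2)] .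
        have "Suc k \<le> card (reach (edges L - {ed (par (q b))}) (q0 ` {..<sz}))" using rc g'(2) unfolding gq by simp
        then have "bfs_found L sz q0 par0 s'" if "arr s' = arr s" "var s' vT = t" "var s' vK = k" "var s' vG = nb x" for s' :: store
          using bfs_foundI[of s' q par t b L sz q0 par0 h j] that rp qt t mk fr sc(1) j b h'(1)
          by (simp add: d(1,2,3,5,6)[symmetric])
        then show ?thesis
          unfolding bfs_visit_def using u x M bd vw vu True hs ws K F
          by (simp add: d[symmetric])
      qed
    next
      case hs: False
      show ?thesis
      proof (cases "tw x = par u")
        case eq: True
        have "ed x = ed (par (q h))" using X(11) eq by (simp add: d)
        then have "ed x \<in> tedges q par t" using hs sz0 h' by (auto simp: tedges_def)
        then show ?thesis
          unfolding bfs_visit_def using keep u x M bd vw vu True hs eq K F nxt h' tb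
          by (simp add: d[symmetric])
      next
        case neq: False
        have rc: "reach (edges L - {ed (par (q h))}) (q ` {..<sz}) = reach (edges L) (q ` {..<sz})"
          using chord_outside[OF wf qt sz0 _ h'(1) parent Lu(2)[unfolded d(4)] xA True] neq hs by (simp add: d)
        obtain j where j: "j < h" "par (q h) \<in> set (L (q j))" using qtreeD[OF wf qt, of h] hs sz0 h' by auto
        have "Suc k \<le> card (reach (edges L - {ed (par (q h))}) (q0 ` {..<sz}))" using rc g'(2) unfolding gq by simp
        then have "bfs_found L sz q0 par0 s'" if "arr s' = arr s" "var s' vT = t" "var s' vK = k" "var s' vG = u" for s' :: store
          using bfs_foundI[of s' q par t h L sz q0 par0 h j] that rp qt t mk fr sc(1) j h'(1) hs d(4)
          by (simp add: d(1,2,3,5,6)[symmetric])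
        moreover have "tw x - par u + (par u - tw x) \<noteq> 0" using neq by auto
        ultimately show ?thesis
          unfolding bfs_visit_def using u x M bd vw vu True hs K F tb
          by (simp add: d[symmetric])
      qed
    qed
  qed
qed

text \<open>A scan stopped in the middle of a long list was still short, because the part done
  consists of nodes of tree edges.\<close>

lemma prefix_length:
  assumes wf: "wf_lists L" and qt: "qtree L q par t" "t \<le> Suc (Suc k)" and v: "v < n" "L v = xs1 @ xs2"
    and sc: "\<And>x. x \<in> set xs1 ==> ed x \<in> tedges q par t"
  shows "length xs1 \<le> 2 * Suc k"
proof -
  have "distinct (L v)" using wf v(1) by (auto simp: wf_lists_def)
  then have "length xs1 = card (set xs1)" using v(2) distinct_card[of xs1] by simp
  also have "\<dots> \<le> 2 * card (tedges q par t)"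
    by (rule card_nodes_le[OF wf]) (use qtree_tree(5)[OF wf qt(1)] sc v in auto)
  also have "\<dots> \<le> 2 * Suc k" using qtree_tree(4)[OF wf qt(1)] qt(2) by simp
  finally show ?thesis .
qed

text \<open>A completed list is paid by its length, which the caller sums up; a scan that stops
  early must be paid at once and is bounded by \<open>prefix_length\<close>.\<close>

lemma wp_bfs_inner:
  assumes I: "bfs_inv L sz q0 par0 h {} s" and g: "good L q0 par0 sz" "sz \<le> k" and h: "h < var s vT"
    and u: "var s vU = arr s aQ h" and x: "var s vX = arr s aG (arr s aQ h)" and F: "var s vF = 0"
  shows "WP (While (Var vX) bfs_visit) (\<lambda>s'.
     (var s' vF = 0 \<and> bfs_inv L sz q0 par0 h (set (L (arr s aQ h))) s' \<and>
       (\<forall>i\<le>h. arr s' aQ i = arr s aQ i) \<and> h < var s' vT \<and> var s' vH = var s vH \<and>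
       ticks s' \<le> ticks s + 14 * length (L (arr s aQ h)) + 1) \<or>
     (var s' vF = 1 \<and> bfs_found L sz q0 par0 s' \<and> var s' vH = var s' vT \<and> ticks s' \<le> ticks s + 28 * Suc k + 15)) s"
proof -
  define v where "v = arr s aQ h"
  define xs where "xs = L v"
  have wf: "wf_lists L" "v < n" using I h by (auto simp: bfs_inv_def rep_def Let_def qtree_def v_def)
  have nz: "0 < y" if "y \<in> set xs" for y using wf_listsD(12)[OF wf] that by (simp add: xs_def)
  let ?I = "\<lambda>l s'. (\<exists>xs1 xs2. l = length xs2 \<and> xs = xs1 @ xs2 \<and> var s' vF = 0 \<and>
      bfs_inv L sz q0 par0 h (set xs1) s' \<and> var s' vX = (case xs2 of [] => 0 | y # _ => y) \<and> var s' vU = v \<and>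
      (\<forall>i\<le>h. arr s' aQ i = arr s aQ i) \<and> h < var s' vT \<and> var s' vH = var s vH \<and> ticks s' \<le> ticks s + 14 * length xs1) \<or>
     (l = 0 \<and> var s' vF = 1 \<and> bfs_found L sz q0 par0 s' \<and> var s' vX = 0 \<and> var s' vH = var s' vT \<and> ticks s' \<le> ticks s + 28 * Suc k + 14)"
  show ?thesis
  proof (rule wp_While[where I = ?I and f = id])
    have "var s vX = (case xs of [] => 0 | y # _ => y)"
      using linked_list_first[of "arr s aG" L v] wf I x by (simp add: bfs_inv_def Let_def v_def xs_def)
    then show "?I (length xs) s" using I h u F by (intro disjI1 exI[of _ "[]"] exI[of _ xs]) (auto simp: v_def)
  next
    fix l and s' :: store assume inv: "?I l s'" and e: "ev (Var vX) s' = 0"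
    from inv show "(var (tick s') vF = 0 \<and> bfs_inv L sz q0 par0 h (set (L (arr s aQ h))) (tick s') \<and>
       (\<forall>i\<le>h. arr (tick s') aQ i = arr s aQ i) \<and> h < var (tick s') vT \<and> var (tick s') vH = var s vH \<and>
       ticks (tick s') \<le> ticks s + 14 * length (L (arr s aQ h)) + 1) \<or>
     (var (tick s') vF = 1 \<and> bfs_found L sz q0 par0 (tick s') \<and> var (tick s') vH = var (tick s') vT \<and> ticks (tick s') \<le> ticks s + 28 * Suc k + 15)"
    proof (elim disjE exE conjE)
      fix xs1 xs2 assume *: "xs = xs1 @ xs2" "var s' vX = (case xs2 of [] => 0 | y # _ => y)"
      then have "xs2 = []" using e nz by (cases xs2) auto
      moreover assume "bfs_inv L sz q0 par0 h (set xs1) s'" "ticks s' \<le> ticks s + 14 * length xs1" "var s' vF = 0"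
        "\<forall>i\<le>h. arr s' aQ i = arr s aQ i" "h < var s' vT" "var s' vH = var s vH"
      ultimately show ?thesis using * by (auto simp: xs_def v_def bfs_inv_def)
    qed (auto simp: bfs_found_def)
  next
    fix l and s' :: store assume inv: "?I l s'" and e: "ev (Var vX) s' \<noteq> 0"
    then obtain xs1 xs2 where *: "l = length xs2" "xs = xs1 @ xs2" "var s' vF = 0"
      "bfs_inv L sz q0 par0 h (set xs1) s'" "var s' vX = (case xs2 of [] => 0 | y # _ => y)" "var s' vU = v"
      "\<forall>i\<le>h. arr s' aQ i = arr s aQ i" "h < var s' vT" "var s' vH = var s vH" "ticks s' \<le> ticks s + 14 * length xs1" by auto
    obtain y ys where xs2: "xs2 = y # ys" using e *(5) by (cases xs2) auto
    have v: "arr s' aQ h = v" using *(7) by (simp add: v_def)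
    have len: "length xs1 \<le> 2 * Suc k"
      by (rule prefix_length[OF wf(1), of "arr s' aQ" "arr s' aPar" "var s' vT" v xs1 xs2])
        (use *(4) wf *(2) in \<open>auto simp: bfs_inv_def Let_def xs_def\<close>)
    have I': "bfs_inv L sz q0 par0 h (set xs1) (tick s')" using *(4) by (simp add: bfs_inv_def)
    show "WP bfs_visit (\<lambda>s'. \<exists>l'. ?I l' s' \<and> id l' < id l) (tick s')"
    proof (rule wp_frame[OF wp_bfs_visit[OF I' g, of y ys]])
      fix s'' :: store
      assume a: "ticks s'' \<le> ticks (tick s') + 13 \<and>
    ((var s'' vF = 0 \<and> bfs_inv L sz q0 par0 h (set (xs1 @ [y])) s'' \<and> var s'' vX = (case ys of [] => 0 | y # _ => y) \<and>
       (\<forall>i\<le>h. arr s'' aQ i = arr (tick s') aQ i) \<and> h < var s'' vT \<and> var s'' vH = var (tick s') vH) \<or>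
     (var s'' vF = 1 \<and> bfs_found L sz q0 par0 s'' \<and> var s'' vX = 0 \<and> var s'' vH = var s'' vT))"
        and fr: "\<And>r. r \<notin> mods bfs_visit ==> var s'' r = var (tick s') r"
      have U: "var s'' vU = v" using fr[of vU] *(6) by (simp add: bfs_visit_def)
      from a show "\<exists>l'. ?I l' s'' \<and> id l' < id l"
      proof (elim conjE disjE)
        assume "var s'' vF = 0" "bfs_inv L sz q0 par0 h (set (xs1 @ [y])) s''" "var s'' vX = (case ys of [] => 0 | y # _ => y)"
          "\<forall>i\<le>h. arr s'' aQ i = arr (tick s') aQ i" "h < var s'' vT" "var s'' vH = var (tick s') vH" "ticks s'' \<le> ticks (tick s') + 13"
        then have "?I (length ys) s''"
          using * xs2 U by (intro disjI1 exI[of _ "xs1 @ [y]"] exI[of _ ys]) auto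
        then show ?thesis using * xs2 by (intro exI[of _ "length ys"]) auto
      next
        assume "var s'' vF = 1" "bfs_found L sz q0 par0 s''" "var s'' vX = 0" "var s'' vH = var s'' vT" "ticks s'' \<le> ticks (tick s') + 13"
        then have "?I 0 s''" using len * by auto
        then show ?thesis using * xs2 by (intro exI[of _ 0]) auto
      qed
    qed (use * xs2 v in \<open>auto simp: xs_def\<close>)
  qed auto
qed

lemma card_scanned:
  assumes wf: "wf_lists L" and q: "inj_on q {..h}" "\<And>i. i \<le> h ==> q i < n"
  shows "card (\<Union>i<Suc h. set (L (q i))) = card (\<Union>i<h. set (L (q i))) + length (L (q h))"
proof -
  have "(\<Union>i<h. set (L (q i))) \<inter> set (L (q h)) = {}"
  proof (rule ccontr)
    assume "\<not> ?thesis"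
    then obtain x i where x: "i < h" "x \<in> set (L (q i))" "x \<in> set (L (q h))" by auto
    have "q i < n" "q h < n" using q(2) x by auto
    then have "q i = q h" using wf_listsD(5)[OF wf _ x(2)] wf_listsD(5)[OF wf _ x(3)] by simp
    then show False using q(1) x by (auto simp: inj_on_def)
  qed
  moreover have "distinct (L (q h))" using wf q(2) by (auto simp: wf_lists_def)
  moreover have "(\<Union>i<Suc h. set (L (q i))) = (\<Union>i<h. set (L (q i))) \<union> set (L (q h))" by (auto simp: less_Suc_eq)
  ultimately show ?thesis by (simp add: card_Un_disjoint distinct_card)
qed

text \<open>The loops cost a constant per dequeued vertex and per scanned node. There are at most
  \<open>k + 1\<close> of the former, and the nodes of completed lists belong to at most
  \<open>k\<close> tree edges; the one interrupted list is accounted for separately.\<close>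

lemma wp_bfs:
  assumes R: "rep (arr s aG) L" and g: "good L (arr s aQ) (arr s aPar) sz" "sz \<le> k"
    and mk: "marks (arr s aQ) sz sz (arr s aVis)" and v: "var s vS = sz" "var s vK = k"
  shows "WP bfs_com (\<lambda>s'. ticks s' \<le> ticks s + 70 * Suc k \<and>
     ((var s' vF = 0 \<and> bfs_inv L sz (arr s aQ) (arr s aPar) (var s' vT) {} s') \<or>
      (var s' vF = 1 \<and> bfs_found L sz (arr s aQ) (arr s aPar) s'))) s"
proof -
  let ?q0 = "arr s aQ" let ?par0 = "arr s aPar"
  have wf: "wf_lists L" using R by (simp add: rep_def)
  let ?N = "\<lambda>h s'. card (\<Union>i<h. set (L (arr s' aQ i)))"
  let ?I = "\<lambda>l s'. (\<exists>h. l = Suc (Suc k) - h \<and> h \<le> var s' vT \<and> var s' vH = h \<and> var s' vF = 0 \<and>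
      bfs_inv L sz ?q0 ?par0 h {} s' \<and> ticks s' \<le> ticks s + 3 + 6 * h + 14 * ?N h s') \<or>
     (l = 0 \<and> var s' vF = 1 \<and> bfs_found L sz ?q0 ?par0 s' \<and> var s' vH = var s' vT \<and> ticks s' \<le> ticks s + 68 * Suc k)"
  have Nb: "?N h s' \<le> 2 * k" if "bfs_inv L sz ?q0 ?par0 h {} s'" "h \<le> var s' vT" for h s'
  proof -
    have *: "qtree L (arr s' aQ) (arr s' aPar) (var s' vT)" "var s' vT \<le> Suc k"
      "\<forall>i<h. \<forall>x\<in>set (L (arr s' aQ i)). ed x \<in> tedges (arr s' aQ) (arr s' aPar) (var s' vT)"
      using that by (auto simp: bfs_inv_def Let_def)
    have "?N h s' \<le> 2 * card (tedges (arr s' aQ) (arr s' aPar) (var s' vT))"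
    proof (rule card_nodes_le(2)[OF wf qtree_tree(5)[OF wf *(1)]])
      fix x assume "x \<in> (\<Union>i<h. set (L (arr s' aQ i)))"
      then obtain i where i: "i < h" "x \<in> set (L (arr s' aQ i))" by auto
      moreover have "arr s' aQ i < n" using *(1) i(1) that(2) by (auto simp: qtree_def)
      ultimately show "(\<exists>v<n. x \<in> set (L v)) \<and> ed x \<in> tedges (arr s' aQ) (arr s' aPar) (var s' vT)"
        using *(3) by blast
    qed
    then show ?thesis using qtree_tree(4)[OF wf *(1)] *(2) by simp
  qed
  have tb: "var s' vT \<le> n" if "bfs_inv L sz ?q0 ?par0 h {} s'" for h s'
    using that qtree_bound[OF wf] by (auto simp: bfs_inv_def Let_def)
  have loop: "WP (While (Minus (Var vT) (Var vH))
       (Assign vU (Arr aQ (Var vH)) ;; Assign vX (Arr aG (Var vU)) ;; inc vH ;; While (Var vX) bfs_visit))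
     (\<lambda>s'. ticks s' \<le> ticks s + 70 * Suc k \<and>
     ((var s' vF = 0 \<and> bfs_inv L sz ?q0 ?par0 (var s' vT) {} s') \<or>
      (var s' vF = 1 \<and> bfs_found L sz ?q0 ?par0 s'))) s1"
    if s1: "arr s1 = arr s" "var s1 vT = sz" "var s1 vH = 0" "var s1 vF = 0" "var s1 vK = k" "ticks s1 = ticks s + 3" for s1
  proof (rule wp_While[where I = ?I and f = id])
    show "?I (Suc (Suc k)) s1"
      using R g mk s1 by (auto simp: bfs_inv_def good_def)
  next
    fix l and s' :: store assume inv: "?I l s'" and e: "ev (Minus (Var vT) (Var vH)) s' = 0"
    from inv show "ticks (tick s') \<le> ticks s + 70 * Suc k \<and>
     ((var (tick s') vF = 0 \<and> bfs_inv L sz ?q0 ?par0 (var (tick s') vT) {} (tick s')) \<or>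
      (var (tick s') vF = 1 \<and> bfs_found L sz ?q0 ?par0 (tick s')))"
    proof (elim disjE exE conjE)
      fix h assume *: "h \<le> var s' vT" "var s' vH = h" "var s' vF = 0" "bfs_inv L sz ?q0 ?par0 h {} s'"
        "ticks s' \<le> ticks s + 3 + 6 * h + 14 * ?N h s'"
      then have "h = var s' vT" using e by simp
      moreover have "var s' vT \<le> Suc k" using *(4) by (simp add: bfs_inv_def Let_def)
      ultimately show ?thesis using * Nb[OF *(4,1)] by (auto simp: bfs_inv_def)
    qed (auto simp: bfs_found_def)
  next
    fix l and s' :: store assume inv: "?I l s'" and e: "ev (Minus (Var vT) (Var vH)) s' \<noteq> 0"
    then obtain h where *: "l = Suc (Suc k) - h" "h < var s' vT" "var s' vH = h" "var s' vF = 0"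
      "bfs_inv L sz ?q0 ?par0 h {} s'" "ticks s' \<le> ticks s + 3 + 6 * h + 14 * ?N h s'" by auto
    let ?v = "arr s' aQ h"
    have b: "var s' vT \<le> Suc k" "?v < n" "h < n" using *(2,5) tb[OF *(5)] by (auto simp: bfs_inv_def Let_def qtree_def)
    let ?s = "s'\<lparr>var := (var s')(vU := ?v, vX := arr s' aG ?v, vH := Suc h), ticks := Suc (Suc (Suc (Suc (ticks s'))))\<rparr>"
    have I': "bfs_inv L sz ?q0 ?par0 h {} ?s" using *(5) by (simp add: bfs_inv_def)
    define Q where "Q = (\<lambda>s' :: store. \<exists>l'. ?I l' s' \<and> id l' < id l)"
    have "WP (While (Var vX) bfs_visit) Q ?s"
      unfolding Q_def
    proof (rule wp_mono[OF wp_bfs_inner[OF I' g]])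
      fix s'' :: store
      assume "(var s'' vF = 0 \<and> bfs_inv L sz ?q0 ?par0 h (set (L (arr ?s aQ h))) s'' \<and>
       (\<forall>i\<le>h. arr s'' aQ i = arr ?s aQ i) \<and> h < var s'' vT \<and> var s'' vH = var ?s vH \<and>
       ticks s'' \<le> ticks ?s + 14 * length (L (arr ?s aQ h)) + 1) \<or>
     (var s'' vF = 1 \<and> bfs_found L sz ?q0 ?par0 s'' \<and> var s'' vH = var s'' vT \<and> ticks s'' \<le> ticks ?s + 28 * Suc k + 15)"
      then show "\<exists>l'. ?I l' s'' \<and> id l' < id l"
      proof (elim disjE conjE)
        assume a: "var s'' vF = 0" "bfs_inv L sz ?q0 ?par0 h (set (L (arr ?s aQ h))) s''"
          "\<forall>i\<le>h. arr s'' aQ i = arr ?s aQ i" "h < var s'' vT" "var s'' vH = var ?s vH"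
          "ticks s'' \<le> ticks ?s + 14 * length (L (arr ?s aQ h)) + 1"
        have qe: "\<And>i. i \<le> h ==> arr s'' aQ i = arr s' aQ i" using a(3) by simp
        have "bfs_inv L sz ?q0 ?par0 (Suc h) {} s''"
          using a(2) qe[of h] by (intro bfs_inv_Suc) simp
        moreover have "?N (Suc h) s'' = ?N h s' + length (L (arr s' aQ h))"
        proof -
          have "?N (Suc h) s'' = ?N (Suc h) s'" using qe by (intro arg_cong[where f = card] SUP_cong) auto
          then show ?thesis using card_scanned[OF wf, of "arr s' aQ" h] *(2,5) by (auto simp: bfs_inv_def Let_def qtree_def inj_on_def)
        qed
        ultimately have "?I (Suc (Suc k) - Suc h) s''" using a * by auto
        then show ?thesis using *(1,2) b by (intro exI[of _ "Suc (Suc k) - Suc h"]) auto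
      next
        assume a: "var s'' vF = 1" "bfs_found L sz ?q0 ?par0 s''" "var s'' vH = var s'' vT" "ticks s'' \<le> ticks ?s + 28 * Suc k + 15"
        have "?I 0 s''" using a * b Nb[OF *(5)] by auto
        then show ?thesis using *(1,2) b by (intro exI[of _ 0]) auto
      qed
    qed (use * in auto)
    moreover have "h < Z" "?v < Z" "Suc h < W" using b W Z by auto
    ultimately show "WP (Assign vU (Arr aQ (Var vH)) ;; Assign vX (Arr aG (Var vU)) ;; inc vH ;; While (Var vX) bfs_visit)
       (\<lambda>s'. \<exists>l'. ?I l' s' \<and> id l' < id l) (tick s')"
      unfolding Q_def[symmetric] using *(3) W by (simp add: fun_upd_twist)
  qed (use W in auto)
  show ?thesis unfolding bfs_com_def wp_Seq wp_Assign by (intro conjI loop) (use v W in auto)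
qed

end

section \<open>Programs for the path and for testing its edges\<close>

definition path_com :: com where
  "path_com = Assign vL (Lit 0) ;;
     While (Minus (Arr aVis (Var vG)) (Lit 1))
       (Write aPath (Var vL) (Var vG) ;; inc vL ;;
        Assign vG (Arr aG (Arr aG (Plus (Arr aPar (Var vG)) (Lit 3)))))"

definition clear_com :: com where
  "clear_com = Assign vH (Var vS) ;;
     While (Minus (Var vT) (Var vH)) (Write aVis (Arr aQ (Var vH)) (Lit 0) ;; inc vH)"

text \<open>This search looks for vertices only: it ignores chords, skips the single node
  \<open>vX\<close> and gives up as soon as \<open>k + 1\<close> vertices are known.\<close>

definition explore_visit :: com where
  "explore_visit = Assign vW (Arr aG (Var vY)) ;;
     Cond (neqE (Var vY) (Var vX))
       (Cond (Arr aVis (Var vW)) Skip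
          (Write aVis (Var vW) (Lit 2) ;; Write aQ2 (Var vT) (Var vW) ;; inc vT)) Skip ;;
     Cond (Minus (Plus (Var vK) (Lit 1)) (Var vT)) (Assign vY (nextE vY)) (Assign vY (Lit 0))"

definition explore_com :: com where
  "explore_com =
     While (minE (Minus (Var vT) (Var vH)) (Minus (Plus (Var vK) (Lit 1)) (Var vT)))
       (Assign vU (Arr aQ2 (Var vH)) ;; Assign vY (Arr aG (Var vU)) ;;
        While (Var vY) explore_visit ;; inc vH)"

text \<open>When the exploration dries up before \<open>k + 1\<close> vertices, the candidate edge
  is forced and its endpoint joins both the tree and the queue \<open>aQ2\<close>. \<open>vH\<close>
  is kept, so the next exploration continues where this one ended, and all tests along the path
  together scan each list at most once.\<close>

definition force_com :: com where
  "force_com =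
     While (minE (Var vI) (Minus (Plus (Var vK) (Lit 1)) (Var vT)))
       (Assign vV (Arr aPath (Var vI)) ;; Assign vX (Arr aPar (Var vV)) ;;
        explore_com ;;
        Cond (Minus (Plus (Var vK) (Lit 1)) (Var vT))
          (Write aVis (Var vV) (Lit 1) ;; Write aQ (Var vS) (Var vV) ;; inc vS ;;
           Write aQ2 (Var vT) (Var vV) ;; inc vT ;; dec vI) Skip)"

definition copy_com :: com where
  "copy_com = Assign vT (Lit 0) ;;
     While (Minus (Var vS) (Var vT)) (Write aQ2 (Var vT) (Arr aQ (Var vT)) ;; inc vT) ;;
     Assign vH (Lit 0) ;; Assign vI (Minus (Var vL) (Lit 1))"

text \<open>The queue also contains tree vertices, whose mark \<open>1\<close> must stay, so only
  marks above \<open>1\<close> are erased.\<close>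

definition clear2_com :: com where
  "clear2_com = Assign vH (Lit 0) ;;
     While (Minus (Var vT) (Var vH))
       (Cond (Minus (Arr aVis (Arr aQ2 (Var vH))) (Lit 1)) (Write aVis (Arr aQ2 (Var vH)) (Lit 0)) Skip ;; inc vH)"

context machine
begin

section \<open>The path to the target\<close>

text \<open>For each path vertex before the last, the parent edge is its only edge back to the tree
  and the earlier path; hence a forced edge can be added without pruning. The last edge is known to
  be dispensable, so at the latest it becomes the branching edge.\<close>

definition path_ok where
  "path_ok L q par sz vs \<longleftrightarrow> vs \<noteq> [] \<and> distinct vs \<and> set vs \<subseteq> {..<n} - q ` {..<sz} \<and>
     (\<exists>j<sz. par (hd vs) \<in> set (L (q j))) \<and> (\<forall>i. Suc i < length vs --> par (vs ! Suc i) \<in> set (L (vs ! i))) \<and>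
     (\<forall>v\<in>set vs. nb (par v) = v) \<and>
     (\<forall>i. Suc i < length vs --> (\<forall>e\<in>edges L. vs ! i \<in> e --> e \<subseteq> q ` {..<sz} \<union> set (take (Suc i) vs) --> e = ed (par (vs ! i)))) \<and>
     Suc k \<le> card (reach (edges L - {ed (par (last vs))}) (q ` {..<sz})) \<and> sz + length vs \<le> Suc (Suc k)"

text \<open>The inner path vertices sit at positions up to \<open>h\<close>, and all lists before
  \<open>h\<close> were scanned without finding a chord. An edge from such a vertex to an earlier
  one was therefore seen from its earlier end and is a tree edge, hence the parent edge of its later
  end.\<close>

lemma path_okI:
  assumes wf: "wf_lists L" and qt: "qtree L q par t" and t: "0 < sz" "t \<le> Suc (Suc k)" and e: "e < sz"
    and ds: "ds \<noteq> []" "\<And>i. i < length ds ==> sz \<le> ds ! i \<and> ds ! i < t \<and> (e # ds) ! i < ds ! i \<and>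
      par (q (ds ! i)) \<in> set (L (q ((e # ds) ! i)))"
    and h: "\<And>i. Suc i < length ds ==> ds ! i \<le> h" "\<And>i x. i < h ==> x \<in> set (L (q i)) ==> ed x \<in> tedges q par t"
    and r: "Suc k \<le> card (reach (edges L - {ed (par (q (last ds)))}) (q ` {..<sz}))"
  shows "path_ok L q par sz (map q ds)"
proof -
  have mono: "ds ! i < ds ! j" if "i < j" "j < length ds" for i j
    using that
  proof (induction j)
    case (Suc j)
    then show ?case using ds(2)[of "Suc j"] by (cases "i = j") auto
  qed simp
  have dist: "distinct ds" using mono by (metis distinct_conv_nth linorder_neq_iff)
  have rng: "set ds \<subseteq> {sz..<t}" using ds(2) by (force simp: in_set_conv_nth)
  have inj: "inj_on q {..<t}" using qt by (simp add: qtree_def)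
  have mem: "q a \<in> q ` {..<sz} \<longleftrightarrow> a < sz" if "a \<in> set ds" for a
    using inj_on_image_mem_iff[OF inj, of a "{..<sz}"] rng that e by force
  have len: "sz + length ds \<le> Suc (Suc k)"
    using card_mono[OF _ rng] distinct_card[OF dist] t rng ds(1) by (cases ds) auto
  have internal: "f = ed (par (map q ds ! i))" if i: "Suc i < length (map q ds)" and f: "f \<in> edges L" "map q ds ! i \<in> f"
    "f \<subseteq> q ` {..<sz} \<union> set (take (Suc i) (map q ds))" for i f
  proof -
    let ?d = "ds ! i"
    have d: "?d \<le> h" "sz \<le> ?d" "?d < t" using h(1)[of i] ds(2)[of i] i by auto
    have qd: "q ?d < n" using qt d by (simp add: qtree_def)
    obtain y where y: "y \<in> set (L (q ?d))" "f = ed y" using edges_at[OF wf qd f(1)] f(2) i by auto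
    note Y = wf_listsD[OF wf qd y(1)]
    have "nb y \<in> f" "nb y \<noteq> q ?d" using Y y by auto
    then have "nb y \<in> q ` {..<sz} \<union> q ` set (take i ds)"
      using f(3) i by (auto simp: take_map take_Suc_conv_app_nth)
    moreover have "q ` set (take i ds) \<subseteq> q ` {..<?d}"
    proof (rule image_mono, rule subsetI)
      fix z assume "z \<in> set (take i ds)"
      then obtain i' where "i' < i" "z = ds ! i'" by (auto simp: in_set_conv_nth)
      then show "z \<in> {..<?d}" using mono[of i' i] i by simp
    qed
    ultimately have "nb y \<in> q ` {..<?d}" using image_mono[of "{..<sz}" "{..<?d}" q] d(2) by auto
    then obtain a where a: "a < ?d" "nb y = q a" by auto
    \<comment> \<open>Since \<open>a < h\<close>, the list of \<open>q a\<close> was scanned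
      completely, and the twin of \<open>y\<close> stands in it.\<close>
    have "ed (tw y) \<in> tedges q par t" using h(2)[of a "tw y"] a d Y by auto
    then have "f \<in> tedges q par t" using Y y by simp
    then show ?thesis
      using tedges_max[OF wf qt, of f a ?d] a d f(2) \<open>nb y \<in> f\<close> i by simp
  qed
  show ?thesis
    unfolding path_ok_def
  proof (intro conjI allI impI ballI)
    show "map q ds \<noteq> []" using ds by simp
    have "inj_on q (set ds)" by (rule inj_on_subset[OF inj]) (use rng in auto)
    then show "distinct (map q ds)" using dist by (simp add: distinct_map)
    show "set (map q ds) \<subseteq> {..<n} - q ` {..<sz}"
    proof
      fix v assume "v \<in> set (map q ds)"
      then obtain a where a: "a \<in> set ds" "v = q a" by auto
      then have "sz \<le> a" "a < t" using rng by auto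
      then show "v \<in> {..<n} - q ` {..<sz}" using mem[OF a(1)] a(2) qt by (simp add: qtree_def)
    qed
    show "\<exists>j<sz. par (hd (map q ds)) \<in> set (L (q j))" using ds(2)[of 0] ds(1) e by (intro exI[of _ e]) (auto simp: hd_conv_nth)
    show "par (map q ds ! Suc i) \<in> set (L (map q ds ! i))" if "Suc i < length (map q ds)" for i
      using ds(2)[of "Suc i"] that by auto
    show "nb (par v) = v" if v: "v \<in> set (map q ds)" for v
    proof -
      obtain d where "d \<in> set ds" "v = q d" using v by auto
      then show ?thesis using qtreeD[OF wf qt, of d] rng t by force
    qed
    show "Suc k \<le> card (reach (edges L - {ed (par (last (map q ds)))}) (q ` {..<sz}))" using r ds(1) by (simp add: last_map)
    show "sz + length (map q ds) \<le> Suc (Suc k)" using len by simp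
  qed (use internal in blast)
qed

lemma wp_path:
  assumes F: "bfs_found L sz q0 par0 s" and sz: "0 < sz"
  shows "WP path_com (\<lambda>s'. \<exists>vs. path_ok L q0 (arr s aPar) sz vs \<and> var s' vL = length vs \<and>
     (\<forall>i<length vs. arr s' aPath i = rev vs ! i) \<and> ticks s' \<le> ticks s + 10 * Suc (Suc k)) s"
proof -
  define q par t where d: "q = arr s aQ" "par = arr s aPar" "t = var s vT"
  obtain h dd j0 where rp: "rep (arr s aG) L" and qt: "qtree L q par t" and t: "sz \<le> t" "t \<le> Suc (Suc k)"
    and mk: "marks q sz t (arr s aVis)" and fr: "\<And>i. i < sz ==> q i = q0 i"
    and dd: "sz \<le> dd" "dd < t" "h < t" "var s vG = q dd" and j0: "j0 < dd" "j0 \<le> h" "par (q dd) \<in> set (L (q j0))"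
    and sc: "\<And>i x. i < h ==> x \<in> set (L (q i)) ==> ed x \<in> tedges q par t"
    and r: "Suc k \<le> card (reach (edges L - {ed (par (q dd))}) (q0 ` {..<sz}))"
    using F unfolding bfs_found_def Let_def d by blast
  have wf: "wf_lists L" using rp by (simp add: rep_def)
  have qn: "\<And>i. i < t ==> q i < n" using qt by (auto simp: qtree_def)
  have inj: "\<And>a b. a < t ==> b < t ==> q a = q b ==> a = b" using qt by (auto simp: qtree_def inj_on_def)
  have tn: "t \<le> n" using qtree_bound[OF wf qt] .
  have im: "q ` {..<sz} = q0 ` {..<sz}" using fr by (intro image_cong) auto
  have vis: "arr s aVis (q a) = (if a < sz then 1 else 2)" if "a < t" for a
  proof -
    have "q a \<in> q ` {..<sz} \<longleftrightarrow> a < sz"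
      using inj_on_image_mem_iff[of q "{..<t}" a "{..<sz}"] qt that t by (auto simp: qtree_def)
    then show ?thesis using mk that qn[OF that] by (auto simp: marks_def)
  qed
  let ?ok = "\<lambda>e ds. e < t \<and> (ds = [] --> e = dd) \<and> (ds \<noteq> [] --> last ds = dd) \<and>
    (\<forall>i<length ds. sz \<le> ds ! i \<and> ds ! i < t \<and> (e # ds) ! i < ds ! i \<and> par (q (ds ! i)) \<in> set (L (q ((e # ds) ! i))))"
  let ?I = "\<lambda>l s'. \<exists>ds. ?ok l ds \<and> var s' vG = q l \<and> var s' vL = length ds \<and> (\<forall>i<length ds. arr s' aPath i = q (rev ds ! i)) \<and>
    arr s' aG = arr s aG \<and> arr s' aVis = arr s aVis \<and> arr s' aPar = par \<and> ticks s' \<le> ticks s + 1 + 4 * length ds"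
  have len: "length ds + sz \<le> t" if ok: "?ok e ds" for e ds
  proof -
    have "sz + i \<le> ds ! i" if "i < length ds" for i
      using that
    proof (induction i)
      case (Suc i)
      then have "ds ! i < ds ! Suc i" using ok by force
      then show ?case using Suc by simp
    qed (use ok in auto)
    then have "0 < length ds ==> sz + (length ds - 1) < t" using ok by (metis One_nat_def diff_Suc_less le_less_trans)
    then show ?thesis using t by (cases "length ds") auto
  qed
  have "WP (While (Minus (Arr aVis (Var vG)) (Lit 1))
       (Write aPath (Var vL) (Var vG) ;; inc vL ;;
        Assign vG (Arr aG (Arr aG (Plus (Arr aPar (Var vG)) (Lit 3))))))
     (\<lambda>s'. \<exists>vs. path_ok L q0 par sz vs \<and> var s' vL = length vs \<and>
     (\<forall>i<length vs. arr s' aPath i = rev vs ! i) \<and> ticks s' \<le> ticks s + 10 * Suc (Suc k))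
     (s\<lparr>var := (var s)(vL := 0), ticks := Suc (ticks s)\<rparr>)" (is "WP _ ?Q ?s")
  proof (rule wp_While[where I = ?I and f = id])
    show "?I dd ?s" using dd by (intro exI[of _ "[]"]) (auto simp: d)
  next
    fix e and s' :: store assume "?I e s'"
    then have "var s' vG = q e" "e < t" by blast+
    then show "safe W Z (Minus (Arr aVis (Var vG)) (Lit 1)) s'" using qn[of e] Z W by simp
  next
    fix e and s' :: store assume inv: "?I e s'" and ev: "ev (Minus (Arr aVis (Var vG)) (Lit 1)) s' = 0"
    then obtain ds where ok: "?ok e ds" and s': "var s' vG = q e" "var s' vL = length ds" "\<forall>i<length ds. arr s' aPath i = q (rev ds ! i)"
      "arr s' aVis = arr s aVis" "ticks s' \<le> ticks s + 1 + 4 * length ds" by blast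
    have e: "e < sz" using ev s' vis[of e] ok by (auto split: if_splits)
    have ne: "ds \<noteq> []" using ok e dd by auto
    have "path_ok L q par sz (map q ds)"
    proof (rule path_okI[OF wf qt sz t(2) e ne, where h = h])
      \<comment> \<open>Positions increase along the path, and the vertex before the target is the
        \<open>q j0\<close> from which the target was found, with \<open>j0\<close> at most
        \<open>h\<close>.\<close>
      show "ds ! i \<le> h" if i: "Suc i < length ds" for i
      proof -
        let ?l = "length ds - 1"
        have l: "ds ! ?l = dd" "?l < length ds" using ok ne by (auto simp: last_conv_nth)
        have "par (q dd) \<in> set (L (q ((e # ds) ! ?l)))" "(e # ds) ! ?l < dd" using ok l by metis+
        then have "(e # ds) ! ?l = j0"
          using inj[of "(e # ds) ! ?l" j0] wf_listsD(5)[OF wf qn j0(3)] wf_listsD(5)[OF wf qn, of "(e # ds) ! ?l"] j0 dd by auto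
        then have last: "ds ! (length ds - 2) \<le> h" using j0 i by (auto simp: nth_Cons' numeral_2_eq_2)
        have "ds ! a \<le> ds ! b" if "a \<le> b" "b < length ds" for a b
          using that
        proof (induction b)
          case (Suc b)
          have "(e # ds) ! Suc b < ds ! Suc b" using ok Suc.prems by blast
          then show ?case using Suc by (cases "a = Suc b") auto
        qed simp
        from order_trans[OF this[of i "length ds - 2"] last] show ?thesis using i by simp
      qed
    qed (use ok sc r ne im in auto)
    then have "path_ok L q0 par sz (map q ds)" using fr unfolding path_ok_def im by auto
    then show "?Q (tick s')"
      using s' len[OF ok] t by (intro exI[of _ "map q ds"]) (auto simp: rev_map)
  next
    fix e and s' :: store assume inv: "?I e s'" and ev: "ev (Minus (Arr aVis (Var vG)) (Lit 1)) s' \<noteq> 0"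
    then obtain ds where ok: "?ok e ds" and s': "var s' vG = q e" "var s' vL = length ds" "\<forall>i<length ds. arr s' aPath i = q (rev ds ! i)"
      "arr s' aG = arr s aG" "arr s' aVis = arr s aVis" "arr s' aPar = par" "ticks s' \<le> ticks s + 1 + 4 * length ds" by blast
    have e: "sz \<le> e" "e < t" using ev s' vis[of e] ok by (auto split: if_splits)
    obtain j where j: "j < e" "par (q e) \<in> set (L (q j))" using qtreeD[OF wf qt, of e] e sz by auto
    note P = wf_listsD[OF wf qn j(2)]
    \<comment> \<open>The twin of the parent node stores the parent vertex as its neighbour.\<close>
    have own: "arr s aG (arr s aG (par (q e) + 3)) = q j" using P rp j e by (auto simp: rep_def)
    have b: "q e < Z" "length ds < Z" "Suc (length ds) < W" "par (q e) + 3 < Z" "par (q e) + 3 < W" "arr s aG (par (q e) + 3) < Z"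
      using qn[OF e(2)] len[OF ok] t tn Z W node_less[of "par (q e)"] Z_less[of "par (q e)"] node_less[of "tw (par (q e))"] P rp j e
      by (auto simp: rep_def)
    have "?ok j (e # ds)"
      using ok e j by (auto simp: nth_Cons split: nat.splits)
    moreover have "\<forall>i<length (e # ds). ((arr s' aPath)(length ds := q e)) i = q (rev (e # ds) ! i)"
      using s' by (auto simp: nth_append less_Suc_eq)
    ultimately have I': "?I j s''" if "var s'' vG = q j" "var s'' vL = Suc (length ds)" "arr s'' = (arr s')(aPath := (arr s' aPath)(length ds := q e))"
      "ticks s'' = ticks s' + 4" for s'' :: store
      using that s' by (intro exI[of _ "e # ds"]) simp
    define Q where "Q = (\<lambda>s' :: store. \<exists>a'. ?I a' s' \<and> id a' < id e)"
    have "Q (s'\<lparr>arr := (arr s')(aPath := (arr s' aPath)(length ds := q e)),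
       var := (var s')(vL := Suc (length ds), vG := q j), ticks := Suc (Suc (Suc (Suc (ticks s'))))\<rparr>)"
      unfolding Q_def by (rule exI[of _ j], rule conjI, rule I') (use j s' in auto)
    then show "WP (Write aPath (Var vL) (Var vG) ;; inc vL ;; Assign vG (Arr aG (Arr aG (Plus (Arr aPar (Var vG)) (Lit 3)))))
      (\<lambda>s'. \<exists>a'. ?I a' s' \<and> id a' < id e) (tick s')"
      unfolding Q_def[symmetric] using s' b own W by simp
  qed
  then show ?thesis unfolding path_com_def using W by (simp add: d)
qed

lemma wp_clear:
  assumes mk: "marks q sz t (arr s aVis)" and q: "arr s aQ = q" "\<And>i. i < t ==> q i < n" "inj_on q {..<t}"
    and v: "var s vS = sz" "var s vT = t" "sz \<le> t" "t \<le> n"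
  shows "WP clear_com (\<lambda>s'. marks q sz sz (arr s' aVis) \<and> ticks s' \<le> ticks s + 5 * Suc t) s"
proof -
  let ?I = "\<lambda>l s'. \<exists>h. l = t - h \<and> sz \<le> h \<and> h \<le> t \<and> var s' vH = h \<and> var s' vT = t \<and> arr s' aQ = q \<and>
    (\<forall>v<n. arr s' aVis v = (if v \<in> q ` {..<sz} then 1 else if v \<in> q ` {h..<t} then 2 else 0)) \<and>
    ticks s' \<le> ticks s + 1 + 3 * h"
  let ?s = "s\<lparr>var := (var s)(vH := sz), ticks := Suc (ticks s)\<rparr>"
  have "WP (While (Minus (Var vT) (Var vH)) (Write aVis (Arr aQ (Var vH)) (Lit 0) ;; inc vH))
    (\<lambda>s'. marks q sz sz (arr s' aVis) \<and> ticks s' \<le> ticks s + 5 * Suc t) ?s"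
  proof (rule wp_While[where I = ?I and f = id])
    have "(if x \<in> q ` {..<sz} then 1 else if x \<in> q ` {..<t} then 2 else 0) = (if x \<in> q ` {..<sz} then 1 else if x \<in> q ` {sz..<t} then 2 else (0::nat))" for x
      using v(3) by (auto simp: image_iff) (metis atLeastLessThan_iff lessThan_iff linorder_not_le)
    then show "?I (t - sz) ?s" using mk q v by (intro exI[of _ sz]) (auto simp: marks_def)
  next
    fix l and s' :: store assume "?I l s'" and ev: "ev (Minus (Var vT) (Var vH)) s' \<noteq> 0"
    then obtain h where h: "l = t - h" "sz \<le> h" "h < t" "var s' vH = h" "var s' vT = t" "arr s' aQ = q"
      "\<And>v. v < n ==> arr s' aVis v = (if v \<in> q ` {..<sz} then 1 else if v \<in> q ` {h..<t} then 2 else 0)"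
      "ticks s' \<le> ticks s + 1 + 3 * h" by auto
    have b: "h < Z" "q h < Z" "Suc h < W" using h q(2)[OF h(3)] v Z W by auto
    have nm: "q h \<notin> q ` {..<sz}" "q h \<notin> q ` {Suc h..<t}"
    proof -
      have "q h \<notin> q ` A" if "A \<subseteq> {..<t}" "h \<notin> A" for A
        using inj_on_image_mem_iff[OF q(3), of h A] that h(3) by simp
      moreover have "{..<sz} \<subseteq> {..<t}" "{Suc h..<t} \<subseteq> {..<t}" "h \<notin> {..<sz}" "h \<notin> {Suc h..<t}" using h(2,3) by auto
      ultimately show "q h \<notin> q ` {..<sz}" "q h \<notin> q ` {Suc h..<t}" by blast+
    qed
    have im: "q ` {h..<t} = insert (q h) (q ` {Suc h..<t})" using h(3) by (auto simp: atLeastLessThan_def) (metis atLeast_iff imageI IntI lessThan_iff le_antisym not_less_eq_eq)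
    have "\<forall>v<n. ((arr s' aVis)(q h := 0)) v = (if v \<in> q ` {..<sz} then 1 else if v \<in> q ` {Suc h..<t} then 2 else 0)"
      using h(7) nm unfolding im by auto
    then have "?I (t - Suc h) (s'\<lparr>arr := (arr s')(aVis := (arr s' aVis)(q h := 0)), var := (var s')(vH := Suc h), ticks := Suc (Suc (Suc (ticks s')))\<rparr>)"
      using h by (intro exI[of _ "Suc h"]) auto
    then show "WP (Write aVis (Arr aQ (Var vH)) (Lit 0) ;; inc vH) (\<lambda>s'. \<exists>a'. ?I a' s' \<and> id a' < id l) (tick s')"
      using h b W by simp
  qed (use v W in \<open>auto simp: marks_def\<close>)
  then show ?thesis unfolding clear_com_def using v by simp
qed

section \<open>Exploring without the candidate edge\<close>

lemma vertex_less: "v < n ==> v < Z"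
  unfolding Z by simp

definition inner_edges where
  "inner_edges L U = {e \<in> edges L. e \<subseteq> U}"

definition scanned where
  "scanned L q h A = (\<Union>i<h. set (L (q i))) \<union> A"

text \<open>\<open>x\<close> is the node of the edge that must not be used.\<close>

definition ex_inv where
  "ex_inv L x VS h A s \<longleftrightarrow> (let q = arr s aQ2; t = var s vT; U = q ` {..<t} in
     rep (arr s aG) L \<and> inj_on q {..<t} \<and> (\<forall>i<t. q i < n) \<and> VS \<subseteq> U \<and> t \<le> Suc k \<and>
     (\<forall>v<n. arr s aVis v = (if v \<in> VS then 1 else if v \<in> U then 2 else 0)) \<and>
     U \<subseteq> reach (inner_edges L U - {ed x}) VS \<and>
     (\<forall>y\<in>scanned L q h A. y = x \<or> nb y \<in> U) \<and> var s vK = k)"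

lemma ex_invI:
  assumes "arr s aQ2 = q" "var s vT = t" "q ` {..<t} = U" "arr s aG = M" "arr s aVis = vis" "rep M L" "inj_on q {..<t}" "\<forall>i<t. q i < n"
    "VS \<subseteq> U" "t \<le> Suc k" "\<forall>v<n. vis v = (if v \<in> VS then 1 else if v \<in> U then 2 else 0)"
    "U \<subseteq> reach (inner_edges L U - {ed x}) VS" "\<forall>y\<in>scanned L q h A. y = x \<or> nb y \<in> U" "var s vK = k"
  shows "ex_inv L x VS h A s"
  using assms unfolding ex_inv_def Let_def by blast

lemma inner_edges_mono: "U \<subseteq> U' ==> inner_edges L U \<subseteq> inner_edges L U'"
  by (auto simp: inner_edges_def)

lemma ex_inv_card: "ex_inv L x VS h A s ==> card (arr s aQ2 ` {..<var s vT}) = var s vT \<and> var s vT \<le> n"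
proof -
  assume "ex_inv L x VS h A s"
  then have *: "inj_on (arr s aQ2) {..<var s vT}" "\<forall>i<var s vT. arr s aQ2 i < n" by (auto simp: ex_inv_def Let_def)
  then have "card (arr s aQ2 ` {..<var s vT}) = var s vT" by (simp add: card_image)
  moreover have "arr s aQ2 ` {..<var s vT} \<subseteq> {..<n}" using * by auto
  ultimately show ?thesis using card_mono[of "{..<n}" "arr s aQ2 ` {..<var s vT}"] by simp
qed

text \<open>A scanned node other than \<open>x\<close> joins two explored vertices, so two nodes per
  inner edge suffice, and \<open>1\<close> accounts for \<open>x\<close>. The cost of an exploration
  is thus measured by \<open>inner_edges\<close>, whose number need not be
  \<open>O(k)\<close>.\<close>

lemma scanned_card:
  assumes wf: "wf_lists L" and I: "ex_inv L x VS h A s" and h: "h \<le> var s vT" and A: "A \<subseteq> set (L (arr s aQ2 h))" "A = {} \<or> h < var s vT"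
  shows "finite (scanned L (arr s aQ2) h A)"
    "card (scanned L (arr s aQ2) h A) \<le> 2 * card (inner_edges L (arr s aQ2 ` {..<var s vT})) + 1"
proof -
  let ?q = "arr s aQ2" let ?C = "scanned L ?q h A" let ?U = "?q ` {..<var s vT}"
  have C: "\<exists>i<var s vT. y \<in> set (L (?q i))" if yC: "y \<in> ?C" for y
  proof -
    consider i where "i < h" "y \<in> set (L (?q i))" | "y \<in> A" using yC by (auto simp: scanned_def)
    then show ?thesis using h A by cases (use order_less_le_trans in blast, blast)
  qed
  have qn: "\<And>i. i < var s vT ==> ?q i < n" using I by (auto simp: ex_inv_def Let_def)
  have fin: "finite (inner_edges L ?U)" using finite_edges[OF wf] by (simp add: inner_edges_def)
  have *: "(\<exists>v<n. y \<in> set (L v)) \<and> ed y \<in> inner_edges L ?U" if y: "y \<in> ?C - {x}" for y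
  proof -
    obtain i where i: "i < var s vT" "y \<in> set (L (?q i))" using C y by blast
    have "nb y \<in> ?U" using I y by (auto simp: ex_inv_def Let_def)
    then show ?thesis
      using wf_listsD(10)[OF wf qn[OF i(1)] i(2)] ed_in_edges[OF wf qn[OF i(1)] i(2)] i qn by (auto simp: inner_edges_def)
  qed
  note c = card_nodes_le[OF wf fin, of "?C - {x}", OF *]
  then show "finite ?C" by simp
  have "card ?C \<le> card (insert x (?C - {x}))" by (rule card_mono) (use c in auto)
  also have "\<dots> \<le> card (?C - {x}) + 1"
  proof -
    have "card (insert x D) \<le> card D + 1" if "finite D" for D using that by (simp add: card_insert_if)
    then show ?thesis using c(1) by blast
  qed
  finally show "card ?C \<le> 2 * card (inner_edges L ?U) + 1" using c(2) by simp
qed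

lemma wp_explore_visit:
  assumes I: "ex_inv L x VS h (set xs1) s" and px: "pv \<in> VS" "pv < n" "x \<in> set (L pv)" and h: "h < var s vT" "var s vT \<le> k"
    and y: "var s vY = y" "var s vX = x" "x < Z" and L: "L (arr s aQ2 h) = xs1 @ y # xs2"
  shows "WP explore_visit (\<lambda>s'. ticks s' \<le> ticks s + 8 \<and> ex_inv L x VS h (set (xs1 @ [y])) s' \<and>
    var s vT \<le> var s' vT \<and> (\<forall>i<var s vT. arr s' aQ2 i = arr s aQ2 i) \<and>
    (var s' vY = (if var s' vT = Suc k then 0 else case xs2 of [] => 0 | y # _ => y))) s"
proof -
  define q t M vis where d: "q = arr s aQ2" "t = var s vT" "M = arr s aG" "vis = arr s aVis"
  let ?U = "q ` {..<t}"
  have rp: "rep M L" and inj: "inj_on q {..<t}" and qn: "\<And>i. i < t ==> q i < n" and VS: "VS \<subseteq> ?U" and t: "t \<le> Suc k"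
    and vis: "\<And>v. v < n ==> vis v = (if v \<in> VS then 1 else if v \<in> ?U then 2 else 0)"
    and con: "?U \<subseteq> reach (inner_edges L ?U - {ed x}) VS"
    and sc: "\<And>y. y \<in> scanned L q h (set xs1) ==> y = x \<or> nb y \<in> ?U" and K: "var s vK = k"
    using I unfolding ex_inv_def Let_def d by blast+
  have wf: "wf_lists L" using rp by (simp add: rep_def)
  have h': "h < t" "q h < n" "t \<le> k" using h qn by (auto simp: d)
  have Ly: "L (q h) = xs1 @ y # xs2" "y \<in> set (L (q h))" using L by (auto simp: d)
  note Y = wf_listsD[OF wf h'(2) Ly(2)]
  have M: "M y = nb y" using rp Y(1) by (auto simp: rep_def)
  have nxt: "M (y + 1) = (case xs2 of [] => 0 | y # _ => y)" using linked_list_next[OF rp h'(2) Ly(1)] .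
  have tn: "t \<le> n" using ex_inv_card[OF I] by (simp add: d)
  have "y < Z" using node_less[OF Y(1)] by simp
  then have bd: "y < Z" "Suc y < Z" "Suc y < W" "nb y < Z" "t < Z" "Suc t < W" "Suc k < W" "2 < W" "0 < W" "1 < W" "y - x + (x - y) < W"
    using node_less[OF Y(1)] Z_less[of y] Z_less[of x] y(3) Y(2) tn W Z by auto
  have same: "ex_inv L x VS h (set (xs1 @ [y])) s'" if "y = x \<or> nb y \<in> ?U" "arr s' = arr s" "var s' vT = t" "var s' vK = k" for s' :: store
    unfolding ex_inv_def Let_def that(2-4) using that(1) rp inj qn VS t vis con sc
    by (auto simp: d scanned_def)
  show ?thesis
  proof (cases "y = x \<or> nb y \<in> ?U")
    case True
    have "vis (nb y) \<noteq> 0" if "y \<noteq> x" using vis[OF Y(2)] True that by auto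
    then show ?thesis
      unfolding explore_visit_def using y M bd h' K nxt True same
      by (cases "y = x") (simp_all add: d[symmetric])
  next
    case False
    let ?q = "q(t := nb y)" let ?vis = "vis(nb y := 2)" let ?U' = "insert (nb y) ?U"
    have im: "?q ` {..<t} = ?U" "?q ` {..<Suc t} = ?U'"
    proof -
      show 1: "?q ` {..<t} = ?U" by (intro image_cong) auto
      show "?q ` {..<Suc t} = ?U'" unfolding lessThan_Suc image_insert 1 by simp
    qed
    have inj': "inj_on ?q {..<Suc t}"
      using inj False unfolding lessThan_Suc inj_on_insert by (auto simp: inj_on_def)
    have vis': "\<forall>v<n. ?vis v = (if v \<in> VS then 1 else if v \<in> ?U' then 2 else 0)" using vis False VS by auto
    have "ed y = {q h, nb y}" "ed y \<in> edges L" using Y ed_in_edges[OF wf h'(2) Ly(2)] by auto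
    \<comment> \<open>Otherwise \<open>y\<close> would be the twin of \<open>x\<close> and lead back
      to \<open>pv\<close>, which is explored already.\<close>
    moreover have "ed y \<noteq> ed x"
    proof
      assume "ed y = ed x"
      then have "x = tw y" using ed_eq[OF wf h'(2) Ly(2) px(2,3)] False by auto
      then have "nb y = pv" using wf_listsD(5)[OF wf px(2,3)] Y(6) by simp
      then show False using False px(1) VS by auto
    qed
    ultimately have e: "{q h, nb y} \<in> inner_edges L ?U' - {ed x}" using h' by (auto simp: inner_edges_def)
    have mono: "reach (inner_edges L ?U - {ed x}) VS \<subseteq> reach (inner_edges L ?U' - {ed x}) VS"
      by (rule reach_mono) (use inner_edges_mono[of ?U ?U' L] in auto)
    have con': "?U' \<subseteq> reach (inner_edges L ?U' - {ed x}) VS"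
    proof -
      have "q h \<in> reach (inner_edges L ?U' - {ed x}) VS" using con mono h' by auto
      then show ?thesis using con mono e by (blast intro: reach_step)
    qed
    have "ex_inv L x VS h (set (xs1 @ [y])) s'" if "arr s' = (arr s)(aVis := ?vis, aQ2 := ?q)" "var s' vT = Suc t" "var s' vK = k" for s' :: store
    proof -
      have "scanned L ?q h (set (xs1 @ [y])) = insert y (scanned L q h (set xs1))"
        using h' by (auto simp: scanned_def)
      then have "\<forall>z\<in>scanned L ?q h (set (xs1 @ [y])). z = x \<or> nb z \<in> ?U'" using sc by auto
      moreover have "\<forall>i<Suc t. ?q i < n" using qn Y(2) by (auto simp: less_Suc_eq)
      moreover have "arr s' aQ2 = ?q" "arr s' aVis = ?vis" "arr s' aG = M" using that by (simp_all add: d)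
      moreover have "VS \<subseteq> ?U'" "Suc t \<le> Suc k" using VS h'(3) by auto
      ultimately show ?thesis using ex_invI[of s' ?q "Suc t" ?U' M ?vis] that(2,3) im(2) rp inj' vis' con' by blast
    qed
    moreover have "vis (nb y) = 0" using vis[OF Y(2)] False VS by auto
    moreover have "\<forall>i<t. ?q i = q i" by simp
    ultimately show ?thesis
      unfolding explore_visit_def using y M bd h' K nxt False
      by (cases "t = k") (simp_all add: d[symmetric] fun_upd_twist)
  qed
qed

lemma wp_explore_inner:
  assumes I: "ex_inv L x VS h {} s" and px: "pv \<in> VS" "pv < n" "x \<in> set (L pv)" and h: "h < var s vT" "var s vT \<le> k"
    and y: "var s vY = arr s aG (arr s aQ2 h)" "var s vX = x" "x < Z"
  shows "WP (While (Var vY) explore_visit) (\<lambda>s'. \<exists>xs1 xs2. L (arr s aQ2 h) = xs1 @ xs2 \<and> ex_inv L x VS h (set xs1) s' \<and>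
    (xs2 = [] \<or> var s' vT = Suc k) \<and> var s vT \<le> var s' vT \<and> (\<forall>i<var s vT. arr s' aQ2 i = arr s aQ2 i) \<and>
    ticks s' \<le> ticks s + 9 * length xs1 + 1) s"
proof -
  define v where "v = arr s aQ2 h"
  have wf: "wf_lists L" "v < n" "rep (arr s aG) L" using I h by (auto simp: ex_inv_def rep_def Let_def v_def)
  have nz: "0 < y" if "y \<in> set (L v)" for y using wf_listsD(12)[OF wf(1,2) that] .
  let ?I = "\<lambda>l s'. \<exists>xs1 xs2. l = length xs2 \<and> L v = xs1 @ xs2 \<and> ex_inv L x VS h (set xs1) s' \<and>
    var s' vY = (if var s' vT = Suc k then 0 else case xs2 of [] => 0 | y # _ => y) \<and> var s' vX = x \<and>
    var s vT \<le> var s' vT \<and> (\<forall>i<var s vT. arr s' aQ2 i = arr s aQ2 i) \<and> ticks s' \<le> ticks s + 9 * length xs1"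
  show ?thesis
    unfolding v_def[symmetric]
  proof (rule wp_While[where I = ?I and f = id])
    have "var s vY = (case L v of [] => 0 | y # _ => y)"
      using linked_list_first[OF wf(3,2)] y(1) by (simp add: v_def)
    then show "?I (length (L v)) s" using I h y by (intro exI[of _ "[]"] exI[of _ "L v"]) auto
  next
    fix l and s' :: store assume inv: "?I l s'" and e: "ev (Var vY) s' = 0"
    then obtain xs1 xs2 where *: "L v = xs1 @ xs2" "ex_inv L x VS h (set xs1) s'"
      "var s' vY = (if var s' vT = Suc k then 0 else case xs2 of [] => 0 | y # _ => y)"
      "var s vT \<le> var s' vT" "\<forall>i<var s vT. arr s' aQ2 i = arr s aQ2 i" "ticks s' \<le> ticks s + 9 * length xs1" by blast
    have "xs2 = [] \<or> var s' vT = Suc k" using e *(1,3) nz[of "hd xs2"] by (cases xs2; cases "var s' vT = Suc k") auto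
    moreover have "ex_inv L x VS h (set xs1) (tick s')" using *(2) by (simp add: ex_inv_def)
    ultimately show "\<exists>xs1 xs2. L v = xs1 @ xs2 \<and> ex_inv L x VS h (set xs1) (tick s') \<and>
    (xs2 = [] \<or> var (tick s') vT = Suc k) \<and> var s vT \<le> var (tick s') vT \<and> (\<forall>i<var s vT. arr (tick s') aQ2 i = arr s aQ2 i) \<and>
    ticks (tick s') \<le> ticks s + 9 * length xs1 + 1"
      using * by (intro exI[of _ xs1] exI[of _ xs2]) simp
  next
    fix l and s' :: store assume inv: "?I l s'" and e: "ev (Var vY) s' \<noteq> 0"
    then obtain xs1 xs2 where *: "l = length xs2" "L v = xs1 @ xs2" "ex_inv L x VS h (set xs1) s'"
      "var s' vY = (if var s' vT = Suc k then 0 else case xs2 of [] => 0 | y # _ => y)" "var s' vX = x"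
      "var s vT \<le> var s' vT" "\<forall>i<var s vT. arr s' aQ2 i = arr s aQ2 i" "ticks s' \<le> ticks s + 9 * length xs1" by blast
    have tk: "var s' vT \<le> k" using e *(3,4) by (auto simp: ex_inv_def Let_def split: if_splits)
    obtain y ys where xs2: "xs2 = y # ys" using e *(4) tk by (cases xs2) auto
    have v: "arr s' aQ2 h = v" using *(7) h by (simp add: v_def)
    have I': "ex_inv L x VS h (set xs1) (tick s')" using *(3) by (simp add: ex_inv_def)
    show "WP explore_visit (\<lambda>s'. \<exists>l'. ?I l' s' \<and> id l' < id l) (tick s')"
    proof (rule wp_frame[OF wp_explore_visit[OF I' px, of y ys]])
      fix s'' :: store
      assume a: "ticks s'' \<le> ticks (tick s') + 8 \<and> ex_inv L x VS h (set (xs1 @ [y])) s'' \<and>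
    var (tick s') vT \<le> var s'' vT \<and> (\<forall>i<var (tick s') vT. arr s'' aQ2 i = arr (tick s') aQ2 i) \<and>
    (var s'' vY = (if var s'' vT = Suc k then 0 else case ys of [] => 0 | y # _ => y))"
        and fr: "\<And>r. r \<notin> mods explore_visit ==> var s'' r = var (tick s') r"
      have X: "var s'' vX = x" using fr[of vX] *(5) by (simp add: explore_visit_def)
      have "?I (length ys) s''"
        using a * xs2 X by (intro exI[of _ "xs1 @ [y]"] exI[of _ ys]) auto
      then show "\<exists>l'. ?I l' s'' \<and> id l' < id l" using * xs2 by (intro exI[of _ "length ys"]) auto
    qed (use * xs2 v tk y h in auto)
  qed auto
qed

text \<open>The cost is the growth of \<open>5\<close> per finished vertex plus \<open>9\<close> per
  scanned node. In this form the costs of successive explorations telescope to the final values of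
  both counters.\<close>

lemma wp_explore:
  assumes I: "ex_inv L x VS h {} s" and px: "pv \<in> VS" "pv < n" "x \<in> set (L pv)" and h: "h \<le> var s vT" "var s vH = h"
    and y: "var s vX = x" "x < Z"
  shows "WP explore_com (\<lambda>s'. \<exists>h' A. ex_inv L x VS h' A s' \<and> h' \<le> var s' vT \<and> A \<subseteq> set (L (arr s' aQ2 h')) \<and> (A = {} \<or> h' < var s' vT) \<and>
    (var s' vT = Suc k \<or> var s' vH = h' \<and> A = {} \<and> h' = var s' vT) \<and>
    ticks s' + 5 * h + 9 * card (scanned L (arr s aQ2) h {}) \<le> ticks s + 5 * h' + 9 * card (scanned L (arr s' aQ2) h' A) + 10) s"
proof -
  have wf: "wf_lists L" using I by (simp add: ex_inv_def rep_def Let_def)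
  let ?N = "\<lambda>s' h A. card (scanned L (arr s' aQ2) h A)"
  let ?R = "\<lambda>s' h' A B. ex_inv L x VS h' A s' \<and> h' \<le> var s' vT \<and> A \<subseteq> set (L (arr s' aQ2 h')) \<and> (A = {} \<or> h' < var s' vT) \<and>
    ticks s' + 5 * h + 9 * ?N s h {} \<le> ticks s + 5 * h' + 9 * ?N s' h' A + B"
  let ?I = "\<lambda>l s'. (\<exists>h'. l = Suc (Suc k) - h' \<and> ?R s' h' {} 0 \<and> var s' vH = h' \<and> var s' vX = x) \<or>
    (l = 0 \<and> (\<exists>h' A. ?R s' h' A 9 \<and> var s' vT = Suc k))"
  have tick: "?R (tick s') h' A (Suc B)" if "?R s' h' A B" for s' h' A B using that by (simp add: ex_inv_def)
  show ?thesis
    unfolding explore_com_def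
  proof (rule wp_While[where I = ?I and f = id])
    show "?I (Suc (Suc k) - h) s" using I h y by auto
  next
    fix l and s' :: store assume inv: "?I l s'" and e: "ev (minE (Minus (Var vT) (Var vH)) (Minus (Plus (Var vK) (Lit 1)) (Var vT))) s' = 0"
    have K: "var s' vK = k" "var s' vT \<le> Suc k" using inv by (auto simp: ex_inv_def Let_def)
    show "\<exists>h' A. ex_inv L x VS h' A (tick s') \<and> h' \<le> var (tick s') vT \<and> A \<subseteq> set (L (arr (tick s') aQ2 h')) \<and> (A = {} \<or> h' < var (tick s') vT) \<and>
    (var (tick s') vT = Suc k \<or> var (tick s') vH = h' \<and> A = {} \<and> h' = var (tick s') vT) \<and>
    ticks (tick s') + 5 * h + 9 * ?N s h {} \<le> ticks s + 5 * h' + 9 * ?N (tick s') h' A + 10"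
    proof -
      from inv consider h' where "?R s' h' {} 0" "var s' vH = h'" | h' A where "?R s' h' A 9" "var s' vT = Suc k" by blast
      then show ?thesis
      proof cases
      case (1 h')
      then show ?thesis
        using e K by (intro exI[of _ h'] exI[of _ "{}"]) (auto simp add: ex_inv_def)
      next
      case (2 h' A)
      then show ?thesis
        by (intro exI[of _ h'] exI[of _ A]) (simp add: ex_inv_def)
      qed
    qed
  next
    fix l and s' :: store assume inv: "?I l s'" and e: "ev (minE (Minus (Var vT) (Var vH)) (Minus (Plus (Var vK) (Lit 1)) (Var vT))) s' \<noteq> 0"
    have K: "var s' vK = k" "var s' vT \<le> k" "var s' vH < var s' vT" using inv e by (auto simp: ex_inv_def Let_def)
    then obtain h' where *: "l = Suc (Suc k) - h'" "ex_inv L x VS h' {} s'" "var s' vH = h'" "var s' vX = x"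
      "ticks s' + 5 * h + 9 * ?N s h {} \<le> ticks s + 5 * h' + 9 * ?N s' h' {}" using inv by auto
    have h': "h' < var s' vT" using K *(3) by simp
    have qh: "arr s' aQ2 h' < n" "inj_on (arr s' aQ2) {..<var s' vT}" "\<And>i. i < var s' vT ==> arr s' aQ2 i < n"
      using *(2) h' by (auto simp: ex_inv_def Let_def)
    let ?s = "s'\<lparr>var := (var s')(vU := arr s' aQ2 h', vY := arr s' aG (arr s' aQ2 h')), ticks := Suc (Suc (Suc (ticks s')))\<rparr>"
    have I': "ex_inv L x VS h' {} ?s" using *(2) by (simp add: ex_inv_def)
    define Q where "Q = (\<lambda>s' :: store. \<exists>l'. ?I l' s' \<and> id l' < id l)"
    have "WP (While (Var vY) explore_visit) (WP (inc vH) Q) ?s"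
    proof (rule wp_frame[OF wp_explore_inner[OF I' px]])
      fix s'' :: store
      assume "\<exists>xs1 xs2. L (arr ?s aQ2 h') = xs1 @ xs2 \<and> ex_inv L x VS h' (set xs1) s'' \<and>
        (xs2 = [] \<or> var s'' vT = Suc k) \<and> var ?s vT \<le> var s'' vT \<and> (\<forall>i<var ?s vT. arr s'' aQ2 i = arr ?s aQ2 i) \<and>
        ticks s'' \<le> ticks ?s + 9 * length xs1 + 1"
        and fr: "\<And>r. r \<notin> mods (While (Var vY) explore_visit) ==> var s'' r = var ?s r"
      then obtain xs1 xs2 where a0: "L (arr ?s aQ2 h') = xs1 @ xs2" "ex_inv L x VS h' (set xs1) s''"
        "xs2 = [] \<or> var s'' vT = Suc k" "var ?s vT \<le> var s'' vT" "\<forall>i<var ?s vT. arr s'' aQ2 i = arr ?s aQ2 i"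
        "ticks s'' \<le> ticks ?s + 9 * length xs1 + 1" by blast
      then have a: "L (arr s' aQ2 h') = xs1 @ xs2" "ex_inv L x VS h' (set xs1) s''"
        "xs2 = [] \<or> var s'' vT = Suc k" "var s' vT \<le> var s'' vT" "\<And>i. i < var s' vT ==> arr s'' aQ2 i = arr s' aQ2 i"
        "ticks s'' \<le> ticks s' + 9 * length xs1 + 4" by simp_all
      have X: "var s'' vX = x" "var s'' vH = h'" using fr[of vX] fr[of vH] *(3,4) by (auto simp: explore_visit_def)
      have sceq: "scanned L (arr s'' aQ2) h' B = scanned L (arr s' aQ2) h' B" for B
        using a(5) h' unfolding scanned_def by (intro arg_cong2[where f = "(\<union>)"] SUP_cong) auto
      have dis: "scanned L (arr s' aQ2) h' {} \<inter> set xs1 = {}"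
      proof (rule ccontr)
        assume "\<not> ?thesis"
        then obtain i z where z: "i < h'" "z \<in> set (L (arr s' aQ2 i))" "z \<in> set (L (arr s' aQ2 h'))" using a(1) by (auto simp: scanned_def)
        then have "arr s' aQ2 i = arr s' aQ2 h'" using wf_listsD(5)[OF wf qh(3) z(2)] wf_listsD(5)[OF wf qh(3) z(3)] h' by simp
        then show False using qh(2) z(1) h' by (auto simp: inj_on_def)
      qed
      have "distinct xs1" using wf qh(1) a(1) by (auto simp: wf_lists_def dest!: spec[of _ "arr s' aQ2 h'"])
      then have N: "?N s'' h' (set xs1) = ?N s' h' {} + length xs1"
        using card_Un_disjoint[OF scanned_card(1)[OF wf *(2) less_imp_le[OF h']] _ dis] sceq distinct_card[of xs1]
        by (simp add: scanned_def)
      define s3 where "s3 = s''\<lparr>var := (var s'')(vH := Suc h'), ticks := Suc (ticks s'')\<rparr>"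
      have s3: "ex_inv L x VS h' (set xs1) s3" "var s3 vH = Suc h'" "var s3 vX = x" "var s3 vT = var s'' vT" "arr s3 = arr s''" "ticks s3 = ticks s'' + 1"
        using a(2) X by (simp_all add: s3_def ex_inv_def)
      have "\<exists>l'. ?I l' s3 \<and> id l' < id l"
      proof (cases "xs2 = []")
        case True
        have sc: "scanned L (arr s'' aQ2) (Suc h') {} = scanned L (arr s'' aQ2) h' (set xs1)"
          using a(1) True a(5)[OF h'] by (auto simp: scanned_def less_Suc_eq)
        have "ex_inv L x VS (Suc h') {} s3" using s3(1) sc unfolding ex_inv_def Let_def s3(5) by simp
        then have "?I (Suc (Suc k) - Suc h') s3"
          using s3 sc N a * h' by auto
        then show ?thesis using *(1) h' K by (intro exI[of _ "Suc (Suc k) - Suc h'"]) auto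
      next
        case False
        then have "var s3 vT = Suc k" using a(3) s3 by simp
        moreover have "set xs1 \<subseteq> set (L (arr s3 aQ2 h'))" using a(1) a(5)[OF h'] s3 by simp
        ultimately have "?R s3 h' (set xs1) 9" using s3 N a * h' by simp
        then have "\<exists>h' A. ?R s3 h' A 9 \<and> var s3 vT = Suc k" using \<open>var s3 vT = Suc k\<close> by blast
        then have "?I 0 s3" by blast
        then show ?thesis using *(1) h' K by (intro exI[of _ 0]) auto
      qed
      then have "Q s3" unfolding Q_def .
      moreover have "Suc h' < W" using h' K W by simp
      ultimately show "WP (inc vH) Q s''" using X W unfolding s3_def by simp
    qed (use * h' K y in auto)
    moreover have "h' < Z" using h' ex_inv_card[OF *(2)] Z by simp
    moreover have "arr s' aQ2 h' < Z" using vertex_less[OF qh(1)] .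
    ultimately show "WP (Assign vU (Arr aQ2 (Var vH)) ;; Assign vY (Arr aG (Var vU)) ;; While (Var vY) explore_visit ;; inc vH)
        (\<lambda>s'. \<exists>l'. ?I l' s' \<and> id l' < id l) (tick s')"
      unfolding Q_def[symmetric] using *(3) by simp
  qed (use W in \<open>auto simp: ex_inv_def Let_def\<close>)
qed

section \<open>Charging the explored edges to solutions\<close>

lemma star_card: "finite A ==> card ((\<lambda>w. {v, w}) ` A) \<le> card A"
  by (rule card_image_le)

lemma goodD:
  assumes wf: "wf_lists L" and g: "good L q par sz"
  shows "tree (q 0) (q ` {..<sz}) (tedges q par sz)" "tedges q par sz \<subseteq> edges L" "card (q ` {..<sz}) = sz"
    "card (tedges q par sz) = sz - 1" "0 < sz" "finite (reach (edges L) (q ` {..<sz}))" "Suc k \<le> card (reach (edges L) (q ` {..<sz}))"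
    "\<And>e. e \<in> edges L ==> e \<subseteq> q ` {..<sz} ==> e \<in> tedges q par sz"
proof -
  have qt: "qtree L q par sz" using g by (simp add: good_def)
  show "tree (q 0) (q ` {..<sz}) (tedges q par sz)" "tedges q par sz \<subseteq> edges L" "card (q ` {..<sz}) = sz"
    "card (tedges q par sz) = sz - 1" using qtree_tree[OF wf qt] by auto
  show "0 < sz" using qt by (simp add: qtree_def)
  show "finite (reach (edges L) (q ` {..<sz}))" by (rule finite_reach[OF wf]) auto
  show "Suc k \<le> card (reach (edges L) (q ` {..<sz}))"
    "\<And>e. e \<in> edges L ==> e \<subseteq> q ` {..<sz} ==> e \<in> tedges q par sz" using g by (auto simp: good_def)
qed

lemma include_tree:
  assumes wf: "wf_lists L" and g: "good L q par sz" and x: "j < sz" "x \<in> set (L (q j))" "nb x \<notin> q ` {..<sz}"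
  shows "tree (q 0) (insert (nb x) (q ` {..<sz})) (insert (ed x) (tedges q par sz))"
    "insert (ed x) (tedges q par sz) \<subseteq> edges L" "card (insert (ed x) (tedges q par sz)) = sz"
    "card (insert (nb x) (q ` {..<sz})) = Suc sz"
proof -
  note G = goodD[OF wf g]
  have qj: "q j < n" using g x by (auto simp: good_def qtree_def)
  have e: "ed x = {q j, nb x}" "ed x \<in> edges L" using wf_listsD(10)[OF wf qj x(2)] ed_in_edges[OF wf qj x(2)] by auto
  show t: "tree (q 0) (insert (nb x) (q ` {..<sz})) (insert (ed x) (tedges q par sz))"
    unfolding e(1) by (rule ext_step[OF G(1)]) (use x in auto)
  show "insert (ed x) (tedges q par sz) \<subseteq> edges L" using G e by auto
  show "card (insert (nb x) (q ` {..<sz})) = Suc sz" using G(3) x by simp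
  then show "card (insert (ed x) (tedges q par sz)) = sz" using tree_facts(3)[OF t] by simp
qed

text \<open>Take a solution \<open>T0\<close> through the branching edge that covers the new vertex
  \<open>?v\<close> and all of \<open>U\<close> except possibly one vertex \<open>z\<close>. An
  inner edge lies in \<open>T0\<close>, touches \<open>?v\<close> or \<open>z\<close>, or can be
  exchanged into \<open>T0\<close>. The former number \<open>O(k)\<close>, and the last are counted
  by \<open>Sol_count\<close>.\<close>

lemma inner_count:
  assumes wf: "wf_lists L" and g: "good L q par sz" and x: "j < sz" "x \<in> set (L (q j))" "nb x \<notin> q ` {..<sz}" and sz: "sz \<le> k"
    and U: "finite U" "card U \<le> Suc k" "q ` {..<sz} \<subseteq> U" "U \<subseteq> reach (inner_edges L U) (q ` {..<sz})"
  shows "card (inner_edges L U) \<le> 4 * Suc k + card (Sol (edges L) k (q 0) (insert (ed x) (tedges q par sz)))"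
proof -
  note G = goodD[OF wf g] and T = include_tree[OF wf g x]
  let ?V = "q ` {..<sz}" let ?v = "nb x" let ?V' = "insert ?v ?V" let ?S' = "insert (ed x) (tedges q par sz)"
  let ?W = "insert ?v U" let ?E = "edges L"
  have fE: "finite ?E" using finite_edges[OF wf] .
  have VW: "?V' \<subseteq> ?W" using U by auto
  have cW: "card ?W \<le> Suc (Suc k)" "finite ?W" using U by (auto simp: card_insert_if)
  have rW: "reach (inner_edges L ?W) ?V' = ?W"
  proof
    have "U \<subseteq> reach (inner_edges L ?W) ?V'"
      using U(4) reach_mono[OF inner_edges_mono[of U ?W L], of ?V ?V'] by auto
    then show "?W \<subseteq> reach (inner_edges L ?W) ?V'" by (auto intro: reach_base)
    show "reach (inner_edges L ?W) ?V' \<subseteq> ?W" by (rule reach_least[OF VW]) (auto simp: inner_edges_def)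
  qed
  have "Suc sz \<le> card ?W" using card_mono[OF cW(2) VW] T(4) by simp
  \<comment> \<open>\<open>?W\<close> may have \<open>k + 2\<close> vertices, one too many for a
    solution; the minimum then leaves out a single vertex, the later \<open>z\<close>.\<close>
  then obtain V1 T1 where V1: "ext ?V' ?S' V1 T1" "card V1 = min (card ?W) (Suc k)" "T1 \<subseteq> ?S' \<union> inner_edges L ?W" "V1 \<subseteq> ?W"
    using ext_exists[of ?V' "min (card ?W) (Suc k)" "inner_edges L ?W" ?S'] rW cW(2) T(4) sz by auto
  have t1: "tree (q 0) V1 T1" using ext_trans[OF V1(1) T(1)] .
  have T1E: "T1 \<subseteq> ?E" using V1(3) T(2) by (auto simp: inner_edges_def)
  have mono1: "?V' \<subseteq> V1" "?S' \<subseteq> T1" using ext_mono[OF V1(1)] by auto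
  have fr: "finite (reach ?E V1)" by (rule finite_reach[OF wf]) (use tree_facts(1)[OF t1] in auto)
  have "Suc k \<le> card (reach ?E V1)"
    using card_mono[OF fr reach_mono[of ?E ?E ?V V1]] mono1 G(7) by (meson dual_order.trans insert_subset order_refl)
  then obtain V0 T0 where T0: "tree (q 0) V0 T0" "ext V1 T1 V0 T0" "T1 \<subseteq> T0" "T0 \<subseteq> ?E" "card T0 = k"
    using Sol_exists[OF t1 T1E _ _ fr] V1(2) by (metis min.cobounded2)
  have V10: "V1 \<subseteq> V0" using ext_mono[OF T0(2)] by simp
  define F where "F = {f \<in> inner_edges L U. f \<notin> T0 \<and> \<not> f \<subseteq> ?V' \<and> f \<subseteq> V0}"
  have cF: "card F \<le> card (Sol ?E k (q 0) ?S')"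
  proof (cases "sz < k")
    case True
    show ?thesis
      by (rule Sol_count[OF T(1) T0(1) _ T0(5) _ T0(4) fE])
        (use mono1 T0 T True edges_wf[OF wf] in \<open>auto simp: F_def inner_edges_def\<close>)
  next
    case False
    \<comment> \<open>Here the tree with the branching edge already has \<open>k + 1\<close>
      vertices and is all of \<open>V0\<close>, so no edge is left for an exchange.\<close>
    then have "card ?V' = card V0" using T(4) tree_facts(3)[OF T0(1)] T0(5) sz by simp
    then have "?V' = V0" using card_subset_eq[OF tree_facts(1)[OF T0(1)]] mono1 V10 by (meson order_trans)
    then have "F = {}" by (auto simp: F_def)
    then show ?thesis by simp
  qed
  have "card (?W - V1) \<le> 1"
    using card_Diff_subset[OF finite_subset[OF V1(4) cW(2)] V1(4)] V1(2) cW(1) by linarith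
  then obtain z where z: "?W - V1 \<subseteq> {z}"
    using cW(2) by (metis card_le_Suc0_iff_eq finite_Diff One_nat_def insertCI subsetI empty_iff insert_iff)
  have sub: "inner_edges L U \<subseteq> F \<union> T0 \<union> (\<lambda>w. {?v, w}) ` ?V' \<union> (\<lambda>w. {z, w}) ` U"
  proof
    fix f assume f: "f \<in> inner_edges L U"
    then have fe: "f \<in> ?E" "f \<subseteq> U" "card f = 2" using edges_wf[OF wf] by (auto simp: inner_edges_def)
    obtain a b where ab: "f = {a, b}" "a \<noteq> b" using fe(3) card_2_iff by metis
    consider "\<not> f \<subseteq> V0" | "f \<subseteq> ?V'" | "f \<subseteq> V0" "\<not> f \<subseteq> ?V'" by blast
    then show "f \<in> F \<union> T0 \<union> (\<lambda>w. {?v, w}) ` ?V' \<union> (\<lambda>w. {z, w}) ` U"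
    proof cases
      case 1
      then have "a = z \<or> b = z" using ab fe(2) z V10 by auto
      then show ?thesis using ab fe(2) by (auto simp: insert_commute)
    next
      case 2
      show ?thesis
      proof (cases "?v \<in> f")
        case True
        then show ?thesis using ab 2 by (auto simp: insert_commute)
      next
        case False
        then have "f \<in> tedges q par sz" using G(8)[OF fe(1)] 2 by auto
        then show ?thesis using mono1 T0(3) by auto
      qed
    next
      case 3
      then show ?thesis using f by (auto simp: F_def)
    qed
  qed
  have fin: "finite F" "finite T0" using finite_subset[of F ?E] fE tree_facts(2)[OF T0(1)] by (auto simp: F_def inner_edges_def)
  have "card (inner_edges L U) \<le> card (F \<union> T0 \<union> (\<lambda>w. {?v, w}) ` ?V' \<union> (\<lambda>w. {z, w}) ` U)"
    by (rule card_mono[OF _ sub]) (use fin U in auto)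
  also have "\<dots> \<le> card F + card T0 + card ((\<lambda>w. {?v, w}) ` ?V') + card ((\<lambda>w. {z, w}) ` U)"
    by (intro order_trans[OF card_Un_le] add_mono order_refl)
  also have "\<dots> \<le> card F + k + Suc sz + Suc k"
    using star_card[of ?V' ?v] star_card[of U z] T(4) U T0(5) by simp
  finally show ?thesis using cF sz by simp
qed

text \<open>Bounds the pruning at the new vertex \<open>nb x\<close>. Its edges lead back to the
  tree, or lie in a solution \<open>T0\<close> through the branching edge, or meet the enlarged tree
  in one endpoint only and are exchanged into \<open>T0\<close>.\<close>

lemma degree_count:
  assumes wf: "wf_lists L" and g: "good L q par sz" and x: "j < sz" "x \<in> set (L (q j))" "nb x \<notin> q ` {..<sz}" and sz: "sz < k"
  shows "length (L (nb x)) \<le> 2 * Suc k + card (Sol (edges L) k (q 0) (insert (ed x) (tedges q par sz)))"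
proof -
  note G = goodD[OF wf g] and T = include_tree[OF wf g x]
  let ?V = "q ` {..<sz}" let ?v = "nb x" let ?V' = "insert ?v ?V" let ?S' = "insert (ed x) (tedges q par sz)"
  let ?E = "edges L"
  have fE: "finite ?E" using finite_edges[OF wf] .
  have qj: "q j < n" using g x by (auto simp: good_def qtree_def)
  have v: "?v < n" using wf_listsD(2)[OF wf qj x(2)] .
  have fr: "finite (reach ?E ?V')" by (rule finite_reach[OF wf]) auto
  have "Suc k \<le> card (reach ?E ?V')"
    using card_mono[OF fr reach_mono[of ?E ?E ?V ?V']] G(7) by (meson dual_order.trans subset_insertI order_refl)
  then obtain V0 T0 where T0: "tree (q 0) V0 T0" "?S' \<subseteq> T0" "T0 \<subseteq> ?E" "card T0 = k"
    using Sol_exists[OF T(1,2) _ _ fr, of k] T(4) sz by auto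
  define F where "F = {f \<in> ?E. f \<notin> T0 \<and> \<not> f \<subseteq> ?V' \<and> ?v \<in> f}"
  have cF: "card F \<le> card (Sol ?E k (q 0) ?S')"
    by (rule Sol_count[OF T(1) T0(1,2,4) _ T0(3) fE])
      (use T(3) sz edges_wf[OF wf] in \<open>auto simp: F_def\<close>)
  have inj: "inj_on ed (set (L ?v))"
  proof (rule inj_onI)
    fix y z assume yz: "y \<in> set (L ?v)" "z \<in> set (L ?v)" "ed y = ed z"
    then have "nb y = nb z" using wf_listsD(3,10)[OF wf v yz(1)] wf_listsD(3,10)[OF wf v yz(2)] by (auto simp: doubleton_eq_iff)
    then show "y = z" using wf_lists_inj[OF wf v yz(1,2)] by simp
  qed
  have sub: "ed ` set (L ?v) \<subseteq> F \<union> T0 \<union> (\<lambda>w. {?v, w}) ` ?V'"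
  proof
    fix f assume "f \<in> ed ` set (L ?v)"
    then obtain y where y: "y \<in> set (L ?v)" "f = ed y" by auto
    have f: "f = {?v, nb y}" "f \<in> ?E" using wf_listsD(10)[OF wf v y(1)] ed_in_edges[OF wf v y(1)] y(2) by auto
    show "f \<in> F \<union> T0 \<union> (\<lambda>w. {?v, w}) ` ?V'"
      using f by (cases "nb y \<in> ?V'"; cases "f \<in> T0") (auto simp: F_def)
  qed
  have fin: "finite F" "finite T0" using finite_subset[of F ?E] fE tree_facts(2)[OF T0(1)] by (auto simp: F_def)
  have "length (L ?v) = card (set (L ?v))" using wf v by (auto simp: wf_lists_def distinct_card)
  also have "\<dots> = card (ed ` set (L ?v))" using inj by (simp add: card_image)
  also have "\<dots> \<le> card (F \<union> T0 \<union> (\<lambda>w. {?v, w}) ` ?V')" by (rule card_mono[OF _ sub]) (use fin in auto)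
  also have "\<dots> \<le> card F + card T0 + card ((\<lambda>w. {?v, w}) ` ?V')"
    by (intro order_trans[OF card_Un_le] add_mono order_refl)
  also have "\<dots> \<le> card F + k + Suc sz" using star_card[of ?V' ?v] T(4) T0(4) by simp
  finally show ?thesis using cF sz by simp
qed

end

definition phase2_com :: com where
  "phase2_com = copy_com ;; force_com ;; clear2_com"

context machine
begin

section \<open>Forced edges\<close>

text \<open>\<open>f\<close> path edges have been forced. Unless \<open>k + 1\<close> vertices are
  known, the exploration stands at a boundary between two lists, from which it can be resumed. The
  last conjunct says that forced edges lose no solution.\<close>

definition force_inv where
  "force_inv L q par sz vs f h A s \<longleftrightarrow>
     f < length vs \<and> var s vS = sz + f \<and> var s vI = length vs - 1 - f \<and>
     (\<forall>i<sz. arr s aQ i = q i) \<and> (\<forall>i<f. arr s aQ (sz + i) = vs ! i) \<and> arr s aPar = par \<and>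
     (\<forall>i<length vs. arr s aPath i = rev vs ! i) \<and> good L (arr s aQ) par (sz + f) \<and>
     ex_inv L (par (vs ! f)) (arr s aQ ` {..<sz + f}) h A s \<and> h \<le> var s vT \<and>
     A \<subseteq> set (L (arr s aQ2 h)) \<and> (A = {} \<or> h < var s vT) \<and> (var s vT = Suc k \<or> var s vH = h \<and> A = {}) \<and>
     Sol (edges L) k (q 0) (tedges (arr s aQ) par (sz + f)) = Sol (edges L) k (q 0) (tedges q par sz)"

lemma force_image:
  assumes "\<forall>i<sz. q' i = q i" "\<forall>i<f. q' (sz + i) = vs ! i" "f \<le> length vs"
  shows "q' ` {..<sz + f} = q ` {..<sz} \<union> set (take f vs)"
proof -
  have "{..<sz + f} = {..<sz} \<union> (+) sz ` {..<f}"
  proof -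
    have "(+) sz ` {..<f} = {sz..<sz + f}" by (simp add: lessThan_atLeast0 add.commute)
    then show ?thesis by auto
  qed
  then have "q' ` {..<sz + f} = q' ` {..<sz} \<union> (\<lambda>i. q' (sz + i)) ` {..<f}" by (simp add: image_Un image_image)
  also have "q' ` {..<sz} = q ` {..<sz}" using assms(1) by (intro image_cong) auto
  also have "(\<lambda>i. q' (sz + i)) ` {..<f} = (!) vs ` {..<f}" using assms(2) by (intro image_cong) auto
  also have "(!) vs ` {..<f} = set (take f vs)" using assms(3) by (simp add: nth_image lessThan_atLeast0)
  finally show ?thesis .
qed

lemma force_facts:
  assumes P: "path_ok L q par sz vs" and F: "force_inv L q par sz vs f h A s"
  shows "vs ! f \<notin> arr s aQ ` {..<sz + f}" "vs ! f < n" "nb (par (vs ! f)) = vs ! f"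
    "\<exists>j<sz + f. par (vs ! f) \<in> set (L (arr s aQ j))" "arr s aPath (var s vI) = vs ! f" "sz + f \<le> Suc k" "f \<le> Suc k"
proof -
  have f: "f < length vs" "\<forall>i<sz. arr s aQ i = q i" "\<forall>i<f. arr s aQ (sz + i) = vs ! i" using F by (auto simp: force_inv_def)
  have im: "arr s aQ ` {..<sz + f} = q ` {..<sz} \<union> set (take f vs)" using force_image[OF f(2,3) less_imp_le[OF f(1)]] .
  have dis: "distinct vs" "set vs \<subseteq> {..<n} - q ` {..<sz}" using P by (auto simp: path_ok_def)
  have "vs ! f \<notin> set (take f vs)" using dis(1) f(1) by (metis id_take_nth_drop distinct_append not_distinct_conv_prefix)
  moreover have "vs ! f \<in> set vs" using f by simp
  ultimately show "vs ! f \<notin> arr s aQ ` {..<sz + f}" using im dis(2) by blast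
  show "vs ! f < n" using dis(2) f(1) nth_mem by blast
  show "nb (par (vs ! f)) = vs ! f" using P f by (auto simp: path_ok_def)
  show "\<exists>j<sz + f. par (vs ! f) \<in> set (L (arr s aQ j))"
  proof (cases f)
    case 0
    then show ?thesis using P f by (auto simp: path_ok_def hd_conv_nth)
  next
    case (Suc f')
    then have "par (vs ! f) \<in> set (L (vs ! f'))" using P f(1) by (auto simp: path_ok_def)
    then show ?thesis using f(3) Suc by (intro exI[of _ "sz + f'"]) auto
  qed
  show "arr s aPath (var s vI) = vs ! f" using F f(1) by (auto simp: force_inv_def rev_nth)
  have "sz + length vs \<le> Suc (Suc k)" using P by (simp add: path_ok_def)
  then show "sz + f \<le> Suc k" "f \<le> Suc k" using f(1) by auto
qed

lemma wp_force:
  assumes P: "path_ok L q par sz vs" and F0: "force_inv L q par sz vs 0 0 {} s"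
  shows "WP force_com (\<lambda>s'. \<exists>f h A. force_inv L q par sz vs f h A s' \<and> (var s' vT = Suc k \<or> Suc f = length vs) \<and>
     ticks s' \<le> ticks s + 25 * f + 26 + 5 * h + 9 * card (scanned L (arr s' aQ2) h A)) s"
proof -
  let ?N = "\<lambda>s h A. card (scanned L (arr s aQ2) h A)"
  let ?I = "\<lambda>l s'. \<exists>f h A. l = (if var s' vT = Suc k then 0 else length vs - f) \<and> force_inv L q par sz vs f h A s' \<and>
     ticks s' \<le> ticks s + 25 * f + (if var s' vT = Suc k then 25 else 0) + 5 * h + 9 * ?N s' h A"
  have wf: "wf_lists L" using F0 by (simp add: force_inv_def ex_inv_def rep_def Let_def)
  have kW: "Suc k < W" using W by simp
  show ?thesis
    unfolding force_com_def
  proof (rule wp_While[where I = ?I and f = id])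
    show "?I (if var s vT = Suc k then 0 else length vs) s"
      using F0 by (intro exI[of _ 0] exI[of _ "{}"]) auto
  next
    fix l and s' :: store assume inv: "?I l s'" and e: "ev (minE (Var vI) (Minus (Plus (Var vK) (Lit 1)) (Var vT))) s' = 0"
    then obtain f h A where *: "force_inv L q par sz vs f h A s'"
      "ticks s' \<le> ticks s + 25 * f + (if var s' vT = Suc k then 25 else 0) + 5 * h + 9 * ?N s' h A" by blast
    have "force_inv L q par sz vs f h A (tick s')" using *(1) by (simp add: force_inv_def ex_inv_def)
    moreover have "var s' vT = Suc k \<or> Suc f = length vs"
    proof -
      have "var s' vK = k" "var s' vT \<le> Suc k" "var s' vI = length vs - 1 - f" "f < length vs"
        using *(1) by (auto simp: force_inv_def ex_inv_def Let_def)
      then show ?thesis using e by auto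
    qed
    ultimately show "\<exists>f h A. force_inv L q par sz vs f h A (tick s') \<and> (var (tick s') vT = Suc k \<or> Suc f = length vs) \<and>
     ticks (tick s') \<le> ticks s + 25 * f + 26 + 5 * h + 9 * ?N (tick s') h A"
      using *(2) by (intro exI[of _ f] exI[of _ h] exI[of _ A]) (auto split: if_splits)
  next
    fix l and s' :: store assume "?I l s'"
    then have "var s' vK = k" by (auto simp: force_inv_def ex_inv_def Let_def)
    then show "safe W Z (minE (Var vI) (Minus (Plus (Var vK) (Lit 1)) (Var vT))) s'" using W by simp
  next
    fix l and s' :: store assume inv: "?I l s'" and e: "ev (minE (Var vI) (Minus (Plus (Var vK) (Lit 1)) (Var vT))) s' \<noteq> 0"
    then obtain f h A where *: "l = (if var s' vT = Suc k then 0 else length vs - f)" "force_inv L q par sz vs f h A s'"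
      "ticks s' \<le> ticks s + 25 * f + (if var s' vT = Suc k then 25 else 0) + 5 * h + 9 * ?N s' h A" by blast
    have K: "var s' vK = k" "var s' vT \<le> k" "0 < var s' vI" "Suc f < length vs"
      using *(2) e by (auto simp: force_inv_def ex_inv_def Let_def)
    have A: "A = {}" "var s' vH = h" using *(2) K by (auto simp: force_inv_def)
    note FF = force_facts[OF P *(2)]
    define v x VS where d: "v = vs ! f" "x = par v" "VS = arr s' aQ ` {..<sz + f}"
    obtain j where j: "j < sz + f" "x \<in> set (L (arr s' aQ j))" using FF(4) by (auto simp: d)
    have g: "good L (arr s' aQ) par (sz + f)" using *(2) by (simp add: force_inv_def)
    have qj: "arr s' aQ j < n" using g j by (auto simp: good_def qtree_def)
    note X = wf_listsD[OF wf qj j(2)]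
    have xZ: "x < Z" using node_less(1)[OF X(1)] .
    have vI: "var s' vI < n"
    proof -
      have "length vs \<le> n" using P card_mono[of "{..<n}" "set vs"] distinct_card[of vs] by (auto simp: path_ok_def)
      then show ?thesis using *(2) K(4) by (auto simp: force_inv_def)
    qed
    let ?s = "s'\<lparr>var := (var s')(vV := v, vX := x), ticks := Suc (Suc (Suc (ticks s')))\<rparr>"
    have exv: "ex_inv L x VS h {} ?s" using *(2) A by (simp add: force_inv_def ex_inv_def d)
    define Q where "Q = (\<lambda>s' :: store. \<exists>l'. ?I l' s' \<and> id l' < id l)"
    have hT: "h \<le> var s' vT" using *(2) by (simp add: force_inv_def)
    have "WP explore_com (WP (Cond (Minus (Plus (Var vK) (Lit 1)) (Var vT))
          (Write aVis (Var vV) (Lit 1) ;; Write aQ (Var vS) (Var vV) ;; inc vS ;;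
           Write aQ2 (Var vT) (Var vV) ;; inc vT ;; dec vI) Skip) Q) ?s"
    proof (rule wp_frame[OF wp_explore[OF exv _ qj j(2)]])
      show "arr s' aQ j \<in> VS" using j by (auto simp: d)
      show "h \<le> var ?s vT" "var ?s vH = h" "var ?s vX = x" "x < Z" using hT A xZ by simp_all
      fix s2 :: store
      assume "\<exists>h' A. ex_inv L x VS h' A s2 \<and> h' \<le> var s2 vT \<and> A \<subseteq> set (L (arr s2 aQ2 h')) \<and> (A = {} \<or> h' < var s2 vT) \<and>
          (var s2 vT = Suc k \<or> var s2 vH = h' \<and> A = {} \<and> h' = var s2 vT) \<and>
          ticks s2 + 5 * h + 9 * card (scanned L (arr ?s aQ2) h {}) \<le> ticks ?s + 5 * h' + 9 * card (scanned L (arr s2 aQ2) h' A) + 10"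
        and fr: "\<And>r. r \<notin> mods explore_com ==> var s2 r = var ?s r" "\<And>a. a \<notin> amods explore_com ==> arr s2 a = arr ?s a"
      then obtain h' B where s2: "ex_inv L x VS h' B s2" "h' \<le> var s2 vT" "B \<subseteq> set (L (arr s2 aQ2 h'))" "B = {} \<or> h' < var s2 vT"
          "var s2 vT = Suc k \<or> var s2 vH = h' \<and> B = {} \<and> h' = var s2 vT"
          "ticks s2 + 5 * h + 9 * card (scanned L (arr ?s aQ2) h {}) \<le> ticks ?s + 5 * h' + 9 * ?N s2 h' B + 10" by blast
      have tk: "ticks s2 \<le> ticks s + 25 * f + 13 + 5 * h' + 9 * ?N s2 h' B" using s2(6) *(3) A K by simp
      have v2: "var s2 vS = sz + f" "var s2 vI = length vs - 1 - f" "var s2 vV = v" "var s2 vK = k"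
        "arr s2 aQ = arr s' aQ" "arr s2 aPar = par" "arr s2 aPath = arr s' aPath"
        using fr(1)[of vS] fr(1)[of vI] fr(1)[of vV] fr(1)[of vK] fr(2)[of aQ] fr(2)[of aPar] fr(2)[of aPath] *(2) K(1)
        by (auto simp: explore_com_def explore_visit_def force_inv_def)
      have base: "f < length vs" "\<forall>i<sz. arr s' aQ i = q i" "\<forall>i<f. arr s' aQ (sz + i) = vs ! i"
        "\<forall>i<length vs. arr s' aPath i = rev vs ! i"
        "Sol (edges L) k (q 0) (tedges (arr s' aQ) par (sz + f)) = Sol (edges L) k (q 0) (tedges q par sz)"
        using *(2) by (auto simp: force_inv_def)
      show "WP (Cond (Minus (Plus (Var vK) (Lit 1)) (Var vT))
          (Write aVis (Var vV) (Lit 1) ;; Write aQ (Var vS) (Var vV) ;; inc vS ;;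
           Write aQ2 (Var vT) (Var vV) ;; inc vT ;; dec vI) Skip) Q s2"
      proof (cases "var s2 vT = Suc k")
        case True
        have "ex_inv L (par (vs ! f)) (arr s' aQ ` {..<sz + f}) h' B (tick s2)" using s2(1) by (simp add: ex_inv_def d)
        then have "force_inv L q par sz vs f h' B (tick s2)"
          unfolding force_inv_def using v2 base s2(2-4) g True by simp
        then have "?I 0 (tick s2)" using True tk by (intro exI[of _ f] exI[of _ h'] exI[of _ B]) simp
        then have "Q (tick s2)" unfolding Q_def using *(1) K by (intro exI[of _ 0]) simp
        then show ?thesis using True v2 kW W by simp
      next
        case False
        define t U where tU: "t = var s2 vT" "U = arr s2 aQ2 ` {..<t}"
        have h': "h' = t" "B = {}" "var s2 vH = t" using s2(5) False by (auto simp: tU)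
        have I2: "rep (arr s2 aG) L" "inj_on (arr s2 aQ2) {..<t}" "\<forall>i<t. arr s2 aQ2 i < n" "VS \<subseteq> U" "t \<le> k"
          "\<forall>v<n. arr s2 aVis v = (if v \<in> VS then 1 else if v \<in> U then 2 else 0)"
          "U \<subseteq> reach (inner_edges L U - {ed x}) VS" "\<forall>y\<in>scanned L (arr s2 aQ2) t {}. y = x \<or> nb y \<in> U"
          using s2(1) False unfolding ex_inv_def Let_def h' tU by auto
        have cU: "card U = t" "finite U" "t \<le> n" using ex_inv_card[OF s2(1)] by (auto simp: tU)
        note G = goodD[OF wf g]
        have xe: "ed x = {arr s' aQ j, v}" "ed x \<in> edges L" using X(10) FF(3) ed_in_edges[OF wf qj j(2)] by (auto simp: d)
        \<comment> \<open>The exploration ran dry: all lists of \<open>U\<close> are scanned, so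
          \<open>U\<close> is exactly what is reachable without the candidate edge.\<close>
        have rU: "reach (edges L - {ed x}) VS = U"
        proof
          show "reach (edges L - {ed x}) VS \<subseteq> U"
          proof (rule reach_least[OF I2(4)])
            fix u w assume uw: "u \<in> U" "{u, w} \<in> edges L - {ed x}"
            then obtain i where i: "i < t" "u = arr s2 aQ2 i" by (auto simp: tU)
            obtain y where y: "y \<in> set (L u)" "nb y = w" "ed y = {u, w}" using edgesD[OF wf, of u w] uw by auto
            then have "y \<in> scanned L (arr s2 aQ2) t {}" using i by (auto simp: scanned_def)
            then show "w \<in> U" using I2(8) y uw by auto
          qed
          have "reach (inner_edges L U - {ed x}) VS \<subseteq> reach (edges L - {ed x}) VS"
            by (rule reach_mono) (auto simp: inner_edges_def)
          then show "U \<subseteq> reach (edges L - {ed x}) VS" using I2(7) by blast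
        qed
        \<comment> \<open>With both endpoints in \<open>U\<close> the candidate edge would make no
          difference to reachability, and the at most \<open>k\<close> vertices of \<open>U\<close>
          would contradict \<open>good\<close>.\<close>
        have vU: "v \<notin> U"
        proof
          assume "v \<in> U"
          moreover have "arr s' aQ j \<in> U" using j I2(4) by (auto simp: d)
          ultimately have "reach (edges L - {ed x}) VS = reach (edges L) VS"
            using reach_non_bridge[OF xe(1)[symmetric]] rU by blast
          then have "card (reach (edges L) VS) \<le> k" using rU cU I2(5) by simp
          then show False using G(7) by (simp add: d)
        qed
        have vVS: "v \<notin> VS" using vU I2(4) by auto
        have S1: "Sol (edges L) k (q 0) (tedges (arr s' aQ) par (sz + f)) =
            Sol (edges L) k (q 0) (insert (ed x) (tedges (arr s' aQ) par (sz + f)))"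
        proof (rule Sol_forced)
          have "sz \<noteq> 0" using F0 by (auto simp: force_inv_def good_def qtree_def)
          then show "tree (q 0) VS (tedges (arr s' aQ) par (sz + f))" using G(1) base(2) by (simp add: d)
          show "tedges (arr s' aQ) par (sz + f) \<subseteq> edges L - {ed x}"
          proof -
            have "ed x \<notin> tedges (arr s' aQ) par (sz + f)"
              using tree_facts(6)[OF G(1), of "ed x"] xe vVS by (auto simp: d)
            then show ?thesis using G(2) by auto
          qed
          show "card (reach (edges L - {ed x}) VS) \<le> k" "finite (reach (edges L - {ed x}) VS)" using rU cU I2(5) by auto
        qed
        let ?q = "(arr s' aQ)(sz + f := v)"
        have qt: "qtree L (arr s' aQ) par (sz + f)" using g by (simp add: good_def)
        have nbx: "nb x = v" using FF(3) by (simp add: d)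
        have "par(v := x) = par" by (simp add: d)
        then have Ex: "qtree L ?q par (sz + Suc f)" "tedges ?q par (sz + Suc f) = insert (ed x) (tedges (arr s' aQ) par (sz + f))"
          "?q ` {..<sz + Suc f} = insert v VS"
          using qtree_extend[OF wf qt _ j nbx] vVS by (auto simp: d)
        have szf: "sz + f \<le> k" using card_mono[OF cU(2) I2(4)] G(3) cU(1) I2(5) by (simp add: d)
        have g': "good L ?q par (sz + Suc f)"
          unfolding good_def
        proof (intro conjI ballI impI)
          show "qtree L ?q par (sz + Suc f)" "sz + Suc f \<le> Suc k" using Ex szf by auto
          show "e \<in> tedges ?q par (sz + Suc f)" if ee: "e \<in> edges L" "e \<subseteq> ?q ` {..<sz + Suc f}" for e
          proof (cases "v \<in> e")
            case True
            have "VS = q ` {..<sz} \<union> set (take f vs)" using force_image[OF base(2,3) less_imp_le[OF base(1)]] by (simp add: d)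
            moreover have "set (take (Suc f) vs) = insert v (set (take f vs))" using base(1) by (simp add: take_Suc_conv_app_nth d)
            ultimately have "e \<subseteq> q ` {..<sz} \<union> set (take (Suc f) vs)" using ee(2) Ex(3) by auto
            then have "e = ed x" using P K(4) ee(1) True unfolding path_ok_def d by blast
            then show ?thesis using Ex(2) by simp
          next
            case False
            then show ?thesis using G(8)[OF ee(1)] ee(2) Ex by (auto simp: d)
          qed
          have "reach (edges L) VS \<subseteq> reach (edges L) (insert v VS)" by (rule reach_mono) auto
          moreover have "finite (reach (edges L) (insert v VS))" by (rule finite_reach[OF wf]) (auto simp: d)
          ultimately show "Suc k \<le> card (reach (edges L) (?q ` {..<sz + Suc f}))"
            using G(7) card_mono unfolding Ex(3) d(3)[symmetric] by (meson order_trans)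
        qed
        let ?q2 = "(arr s2 aQ2)(t := v)" let ?vis = "(arr s2 aVis)(v := 1)" let ?U = "insert v U"
        have im2: "?q2 ` {..<Suc t} = ?U" by (auto simp: tU lessThan_Suc)
        have inj2: "inj_on ?q2 {..<Suc t}"
          using I2(2) vU unfolding lessThan_Suc inj_on_insert by (auto simp: inj_on_def tU)
        have vn: "v < n" using FF(2) by (simp add: d)
        have sc2: "scanned L ?q2 t {} = scanned L (arr s2 aQ2) t {}" by (auto simp: scanned_def)
        let ?x' = "par (vs ! Suc f)"
        have x': "v \<in> ed ?x'"
        proof -
          have "?x' \<in> set (L v)" using P K(4) by (auto simp: path_ok_def d)
          then show ?thesis using wf_listsD(10)[OF wf vn] by simp
        qed
        \<comment> \<open>What was explored without the old candidate did not use the new one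
          either, because that edge has the endpoint \<open>v\<close>, which was outside
          \<open>U\<close>. So the exploration remains valid for the next test.\<close>
        have con2: "?U \<subseteq> reach (inner_edges L ?U - {ed ?x'}) (insert v VS)"
        proof -
          have "inner_edges L U - {ed x} \<subseteq> inner_edges L ?U - {ed ?x'}" using x' vU by (auto simp: inner_edges_def)
          then have "reach (inner_edges L U - {ed x}) VS \<subseteq> reach (inner_edges L ?U - {ed ?x'}) (insert v VS)"
            by (rule reach_mono) auto
          then show ?thesis using I2(7) by (auto intro: reach_base)
        qed
        define s3 where "s3 = s2\<lparr>arr := (arr s2)(aVis := ?vis, aQ := ?q, aQ2 := ?q2),
          var := (var s2)(vS := Suc (sz + f), vT := Suc t, vI := length vs - Suc (Suc f)), ticks := Suc (Suc (Suc (Suc (Suc (Suc (Suc (ticks s2)))))))\<rparr>"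
        have "ex_inv L ?x' (insert v VS) t {} s3"
        proof (rule ex_invI[of s3 ?q2 "Suc t" ?U "arr s2 aG" ?vis])
          show "\<forall>i<Suc t. ?q2 i < n" using I2(3) vn by (auto simp: less_Suc_eq)
          show "\<forall>u<n. ?vis u = (if u \<in> insert v VS then 1 else if u \<in> ?U then 2 else 0)" using I2(6) by auto
          \<comment> \<open>The old candidate loses its exceptional role, since its far end
            \<open>v\<close> now belongs to the explored set.\<close>
          show "\<forall>y\<in>scanned L ?q2 t {}. y = ?x' \<or> nb y \<in> ?U" unfolding sc2 using I2(8) nbx by auto
        qed (use I2 im2 inj2 con2 v2 in \<open>auto simp: s3_def\<close>)
        then have ex3: "ex_inv L ?x' (?q ` {..<sz + Suc f}) t {} s3" unfolding Ex(3) .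
        have s3: "var s3 vS = sz + Suc f" "var s3 vI = length vs - 1 - Suc f" "var s3 vT = Suc t" "var s3 vH = t"
          "arr s3 aQ = ?q" "arr s3 aPar = par" "arr s3 aPath = arr s' aPath" using v2 h' by (simp_all add: s3_def)
        have q3: "\<forall>i<sz. ?q i = q i" "\<forall>i<Suc f. ?q (sz + i) = vs ! i" using base by (auto simp: less_Suc_eq d)
        have S3: "Sol (edges L) k (q 0) (tedges ?q par (sz + Suc f)) = Sol (edges L) k (q 0) (tedges q par sz)"
          unfolding Ex(2) using S1 base(5) by simp
        have "force_inv L q par sz vs (Suc f) t {} s3"
          unfolding force_inv_def s3 using K(4) q3 base(4) g' ex3 S3 by (intro conjI; (assumption | simp))
        moreover have "ticks s3 \<le> ticks s + 25 * Suc f + (if var s3 vT = Suc k then 25 else 0) + 5 * t + 9 * ?N s3 t {}"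
          using tk h' sc2 by (simp add: s3_def)
        ultimately have "?I (if var s3 vT = Suc k then 0 else length vs - Suc f) s3" by blast
        moreover have "(if var s3 vT = Suc k then 0 else length vs - Suc f) < l" using *(1) K by auto
        ultimately have "Q s3" unfolding Q_def id_def by blast
        moreover have "sz + f < n" using qtree_bound[OF wf Ex(1)] by simp
        moreover have "sz + f < Z" "t < Z" "v < Z" "Suc (sz + f) < W" "Suc t < W"
          using calculation(2) I2(5) cU(3) vn W Z by auto
        ultimately show ?thesis
          using v2 h' False I2(5) kW W unfolding s3_def tU(1)[symmetric]
          by (simp add: fun_upd_twist tU(1)[symmetric])
      qed
    qed
    moreover have "arr s' aPath (var s' vI) = v" "var s' vI < Z" "arr s' aPar v = x" "v < Z"
      using FF(5,2) vertex_less vI *(2) by (auto simp: d force_inv_def)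
    ultimately show "WP (Assign vV (Arr aPath (Var vI)) ;; Assign vX (Arr aPar (Var vV)) ;; explore_com ;;
        Cond (Minus (Plus (Var vK) (Lit 1)) (Var vT))
          (Write aVis (Var vV) (Lit 1) ;; Write aQ (Var vS) (Var vV) ;; inc vS ;;
           Write aQ2 (Var vT) (Var vV) ;; inc vT ;; dec vI) Skip)
        (\<lambda>s'. \<exists>l'. ?I l' s' \<and> id l' < id l) (tick s')"
      unfolding Q_def[symmetric] by simp
  qed
qed

lemma wp_copy:
  assumes "var s vS = sz" "sz \<le> n"
  shows "WP copy_com (\<lambda>s'. var s' vT = sz \<and> (\<forall>i<sz. arr s' aQ2 i = arr s aQ i) \<and> var s' vH = 0 \<and> var s' vI = var s vL - 1 \<and>
    ticks s' \<le> ticks s + 4 * sz + 5) s"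
proof -
  let ?I = "\<lambda>l s'. l = sz - var s' vT \<and> var s' vT \<le> sz \<and> var s' vS = sz \<and> arr s' aQ = arr s aQ \<and> var s' vL = var s vL \<and>
    (\<forall>i<var s' vT. arr s' aQ2 i = arr s aQ i) \<and> ticks s' \<le> ticks s + 1 + 3 * var s' vT"
  let ?s = "s\<lparr>var := (var s)(vT := 0), ticks := Suc (ticks s)\<rparr>"
  define Q where "Q = (\<lambda>s' :: store. var s' vT = sz \<and> (\<forall>i<sz. arr s' aQ2 i = arr s aQ i) \<and> var s' vH = 0 \<and> var s' vI = var s vL - 1 \<and>
    ticks s' \<le> ticks s + 4 * sz + 5)"
  have "WP (While (Minus (Var vS) (Var vT)) (Write aQ2 (Var vT) (Arr aQ (Var vT)) ;; inc vT))
     (WP (Assign vH (Lit 0) ;; Assign vI (Minus (Var vL) (Lit 1))) Q) ?s"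
  proof (rule wp_While[where I = ?I and f = id])
    show "?I sz ?s" using assms by simp
  next
    fix l and s' :: store assume "?I l s'" "ev (Minus (Var vS) (Var vT)) s' = 0"
    then show "WP (Assign vH (Lit 0) ;; Assign vI (Minus (Var vL) (Lit 1))) Q (tick s')"
      using W by (simp add: Q_def)
  next
    fix l and s' :: store assume I: "?I l s'" "ev (Minus (Var vS) (Var vT)) s' \<noteq> 0"
    then have b: "var s' vT < sz" "var s' vT < Z" "Suc (var s' vT) < W" using assms W vertex_less[of "var s' vT"] by auto
    show "WP (Write aQ2 (Var vT) (Arr aQ (Var vT)) ;; inc vT) (\<lambda>s'. \<exists>a'. ?I a' s' \<and> id a' < id l) (tick s')"
      using I b W by (auto simp: less_Suc_eq)
  qed (use W in auto)
  then show ?thesis unfolding copy_com_def Q_def[symmetric] using W by simp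
qed

lemma wp_clear2:
  assumes I: "ex_inv L x VS h A s"
  shows "WP clear2_com (\<lambda>s'. (\<forall>v<n. arr s' aVis v = (if v \<in> VS then 1 else 0)) \<and> ticks s' \<le> ticks s + 5 * Suc (var s vT)) s"
proof -
  define q t where d: "q = arr s aQ2" "t = var s vT"
  have inj: "inj_on q {..<t}" and qn: "\<And>i. i < t ==> q i < n" and vis: "\<forall>v<n. arr s aVis v = (if v \<in> VS then 1 else if v \<in> q ` {..<t} then 2 else 0)"
    using I unfolding ex_inv_def Let_def d by blast+
  have tn: "t \<le> n" using ex_inv_card[OF I] by (simp add: d)
  let ?I = "\<lambda>l s'. \<exists>h. l = t - h \<and> h \<le> t \<and> var s' vH = h \<and> var s' vT = t \<and> arr s' aQ2 = q \<and>
    (\<forall>v<n. arr s' aVis v = (if v \<in> VS then 1 else if v \<in> q ` {h..<t} then 2 else 0)) \<and> ticks s' \<le> ticks s + 1 + 4 * h"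
  let ?s = "s\<lparr>var := (var s)(vH := 0), ticks := Suc (ticks s)\<rparr>"
  have "WP (While (Minus (Var vT) (Var vH))
       (Cond (Minus (Arr aVis (Arr aQ2 (Var vH))) (Lit 1)) (Write aVis (Arr aQ2 (Var vH)) (Lit 0)) Skip ;; inc vH))
    (\<lambda>s'. (\<forall>v<n. arr s' aVis v = (if v \<in> VS then 1 else 0)) \<and> ticks s' \<le> ticks s + 5 * Suc t) ?s"
  proof (rule wp_While[where I = ?I and f = id])
    show "?I t ?s" using vis by (intro exI[of _ 0]) (auto simp: d lessThan_atLeast0)
  next
    fix l and s' :: store assume "?I l s'" and ev: "ev (Minus (Var vT) (Var vH)) s' \<noteq> 0"
    then obtain h where h: "l = t - h" "h < t" "var s' vH = h" "var s' vT = t" "arr s' aQ2 = q"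
      "\<And>v. v < n ==> arr s' aVis v = (if v \<in> VS then 1 else if v \<in> q ` {h..<t} then 2 else 0)"
      "ticks s' \<le> ticks s + 1 + 4 * h" by auto
    have b: "h < Z" "q h < Z" "Suc h < W" "q h < n" using h qn[OF h(2)] tn vertex_less W by auto
    have nm: "q h \<notin> q ` {Suc h..<t}"
    proof
      assume "q h \<in> q ` {Suc h..<t}"
      then obtain i where "i \<in> {Suc h..<t}" "q h = q i" by blast
      then show False using inj_onD[OF inj, of h i] h(2) by auto
    qed
    have "{h..<t} = insert h {Suc h..<t}" using h(2) by auto
    then have im: "q ` {h..<t} = insert (q h) (q ` {Suc h..<t})" by simp
    let ?vis = "if arr s' aVis (q h) - 1 \<noteq> 0 then (arr s' aVis)(q h := 0) else arr s' aVis"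
    have vis': "\<forall>v<n. ?vis v = (if v \<in> VS then 1 else if v \<in> q ` {Suc h..<t} then 2 else 0)"
      using h(6) nm b(4) unfolding im by auto
    define Q where "Q = (\<lambda>s' :: store. \<exists>a'. ?I a' s' \<and> id a' < id l)"
    have next_inv: "Q s''" if "arr s'' aQ2 = q" "arr s'' aVis = ?vis" "var s'' vH = Suc h" "var s'' vT = t"
      "ticks s'' \<le> ticks s' + 4" for s'' :: store
      unfolding Q_def using that h(1,2,7) vis' by (intro exI[of _ "t - Suc h"] conjI exI[of _ "Suc h"]) auto
    have "WP (Cond (Minus (Arr aVis (Arr aQ2 (Var vH))) (Lit 1)) (Write aVis (Arr aQ2 (Var vH)) (Lit 0)) Skip ;; inc vH) Q (tick s')"
      using h(3,4,5) b W next_inv by simp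
    then show "WP (Cond (Minus (Arr aVis (Arr aQ2 (Var vH))) (Lit 1)) (Write aVis (Arr aQ2 (Var vH)) (Lit 0)) Skip ;; inc vH)
      (\<lambda>s'. \<exists>a'. ?I a' s' \<and> id a' < id l) (tick s')" unfolding Q_def .
  qed (use W in auto)
  then show ?thesis unfolding clear2_com_def d(2) using W by simp
qed

section \<open>The branching edge and the price of finding it\<close>

definition decided where
  "decided L q par sz sz' v s \<longleftrightarrow> sz \<le> sz' \<and> (\<forall>i<sz. arr s aQ i = q i) \<and> good L (arr s aQ) par sz' \<and>
     marks (arr s aQ) sz' sz' (arr s aVis) \<and> var s vS = sz' \<and> arr s aPath (var s vI) = v \<and> var s vI < n \<and> v < n \<and>
     v \<notin> arr s aQ ` {..<sz'} \<and> (\<exists>j<sz'. par v \<in> set (L (arr s aQ j))) \<and> nb (par v) = v \<and>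
     Sol (edges L) k (q 0) (tedges (arr s aQ) par sz') = Sol (edges L) k (q 0) (tedges q par sz) \<and>
     Suc k \<le> card (reach (edges L - {ed (par v)}) (arr s aQ ` {..<sz'}))"

text \<open>The solutions that contain the parent edge of \<open>v\<close>, which are the ones
  charged by a branching. A complete tree does not branch, and the value \<open>0\<close> makes the
  \<open>O(k)\<close> bound stand alone.\<close>

definition inc_count where
  "inc_count L q par sz v = (if sz \<le> k then card (Sol (edges L) k (q 0) (insert (ed (par v)) (tedges q par sz))) else 0)"

text \<open>The factor \<open>18\<close> is \<open>9\<close> ticks per scanned node times two nodes
  per inner edge. Forced edges alone may complete the tree, so \<open>sz'\<close> can be
  \<open>k + 1\<close>.\<close>

lemma wp_phase2:
  assumes R: "rep (arr s aG) L" and g: "good L (arr s aQ) (arr s aPar) sz"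
    and mk: "marks (arr s aQ) sz sz (arr s aVis)" and v: "var s vS = sz" "var s vK = k" "var s vL = length vs"
    and P: "path_ok L (arr s aQ) (arr s aPar) sz vs" "\<forall>i<length vs. arr s aPath i = rev vs ! i"
  shows "WP phase2_com (\<lambda>s'. \<exists>sz' v. decided L (arr s aQ) (arr s aPar) sz sz' v s' \<and>
     ticks s' \<le> ticks s + 200 * Suc k + 18 * inc_count L (arr s' aQ) (arr s aPar) sz' v) s"
proof -
  define q par where qp: "q = arr s aQ" "par = arr s aPar"
  have wf: "wf_lists L" using R by (simp add: rep_def)
  note G = goodD[OF wf g[folded qp]]
  have szn: "sz \<le> n" "sz \<le> Suc k" using g qtree_bound[OF wf] by (auto simp: good_def)
  have vs: "vs \<noteq> []" "sz + length vs \<le> Suc (Suc k)" "length vs \<le> n"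
    using P card_mono[of "{..<n}" "set vs"] distinct_card[of vs] by (auto simp: path_ok_def)
  show ?thesis
    unfolding phase2_com_def wp_Seq
  proof (rule wp_frame[OF wp_copy[OF v(1) szn(1)]])
    fix s1 :: store
    assume s1: "var s1 vT = sz \<and> (\<forall>i<sz. arr s1 aQ2 i = arr s aQ i) \<and> var s1 vH = 0 \<and> var s1 vI = var s vL - 1 \<and>
      ticks s1 \<le> ticks s + 4 * sz + 5" and fr: "\<And>r. r \<notin> mods copy_com ==> var s1 r = var s r" "\<And>a. a \<notin> amods copy_com ==> arr s1 a = arr s a"
    have e1: "arr s1 aQ = q" "arr s1 aPar = par" "arr s1 aG = arr s aG" "arr s1 aVis = arr s aVis" "arr s1 aPath = arr s aPath"
      "var s1 vS = sz" "var s1 vK = k"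
      using fr(2)[of aQ] fr(2)[of aPar] fr(2)[of aG] fr(2)[of aVis] fr(2)[of aPath] fr(1)[of vS] fr(1)[of vK] v
      by (simp_all add: copy_com_def qp)
    have im: "arr s1 aQ2 ` {..<sz} = q ` {..<sz}" using s1 by (intro image_cong) (auto simp: qp)
    have ex: "ex_inv L (par (vs ! 0)) (q ` {..<sz}) 0 {} s1"
    proof (rule ex_invI[of s1 "arr s1 aQ2" sz "q ` {..<sz}" "arr s aG" "arr s aVis"])
      show "inj_on (arr s1 aQ2) {..<sz}" "\<forall>i<sz. arr s1 aQ2 i < n"
        using g s1 by (auto simp: good_def qtree_def inj_on_def)
      show "\<forall>v<n. arr s aVis v = (if v \<in> q ` {..<sz} then 1 else if v \<in> q ` {..<sz} then 2 else 0)" using mk by (simp add: marks_def qp)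
    qed (use s1 e1 im R szn in \<open>auto simp: scanned_def intro: reach_base\<close>)
    have F: "force_inv L q par sz vs 0 0 {} s1"
      unfolding force_inv_def using vs s1 e1 v g P ex by (simp add: qp)
    have P': "path_ok L q par sz vs" using P by (simp add: qp)
    show "WP force_com (WP clear2_com (\<lambda>s'. \<exists>sz' v. decided L (arr s aQ) (arr s aPar) sz sz' v s' \<and>
     ticks s' \<le> ticks s + 200 * Suc k + 18 * inc_count L (arr s' aQ) (arr s aPar) sz' v)) s1"
    proof (rule wp_mono[OF wp_force[OF P' F]])
      fix s2 :: store
      assume "\<exists>f h A. force_inv L q par sz vs f h A s2 \<and> (var s2 vT = Suc k \<or> Suc f = length vs) \<and>
       ticks s2 \<le> ticks s1 + 25 * f + 26 + 5 * h + 9 * card (scanned L (arr s2 aQ2) h A)"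
      then obtain f h A where s2: "force_inv L q par sz vs f h A s2" "var s2 vT = Suc k \<or> Suc f = length vs"
       "ticks s2 \<le> ticks s1 + 25 * f + 26 + 5 * h + 9 * card (scanned L (arr s2 aQ2) h A)" by blast
      note FF = force_facts[OF P' s2(1)]
      define v where "v = vs ! f"
      define U where "U = arr s2 aQ2 ` {..<var s2 vT}"
      let ?VS = "arr s2 aQ ` {..<sz + f}"
      have F2: "var s2 vS = sz + f" "\<forall>i<sz. arr s2 aQ i = q i" "good L (arr s2 aQ) par (sz + f)" "ex_inv L (par v) ?VS h A s2"
        "h \<le> var s2 vT" "A \<subseteq> set (L (arr s2 aQ2 h))" "A = {} \<or> h < var s2 vT" "var s2 vI = length vs - 1 - f" "f < length vs"
        "Sol (edges L) k (q 0) (tedges (arr s2 aQ) par (sz + f)) = Sol (edges L) k (q 0) (tedges q par sz)"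
        using s2(1) by (auto simp: force_inv_def v_def)
      have X2: "?VS \<subseteq> U" "U \<subseteq> reach (inner_edges L U - {ed (par v)}) ?VS" "var s2 vT \<le> Suc k"
        using F2(4) unfolding ex_inv_def Let_def U_def by blast+
      have cU: "card U = var s2 vT" "finite U" using ex_inv_card[OF F2(4)] by (auto simp: U_def)
      have conU: "U \<subseteq> reach (inner_edges L U) ?VS" using X2(2) reach_mono[of "inner_edges L U - {ed (par v)}" "inner_edges L U" ?VS ?VS] by auto
      note G2 = goodD[OF wf F2(3)]
      \<comment> \<open>Either the exploration found \<open>k + 1\<close> vertices without the edge,
        or all earlier path edges were forced and this is the last one, for which
        \<open>path_ok\<close> gives the claim.\<close>
      have excl: "Suc k \<le> card (reach (edges L - {ed (par v)}) ?VS)"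
      proof -
        have fin: "finite (reach (edges L - {ed (par v)}) ?VS)" by (rule finite_reach[OF wf]) auto
        show ?thesis
        proof (cases "var s2 vT = Suc k")
          case True
          have "inner_edges L U - {ed (par v)} \<subseteq> edges L - {ed (par v)}" by (auto simp: inner_edges_def)
          then have "reach (inner_edges L U - {ed (par v)}) ?VS \<subseteq> reach (edges L - {ed (par v)}) ?VS"
            by (rule reach_mono) simp
          then have "U \<subseteq> reach (edges L - {ed (par v)}) ?VS" using X2(2) by (rule order_trans[rotated])
          from card_mono[OF fin this] show ?thesis using cU(1) True by simp
        next
          case False
          then have "f = length vs - 1" using s2(2) by linarith
          then have "v = last vs" using vs(1) by (simp add: v_def last_conv_nth)
          then have "Suc k \<le> card (reach (edges L - {ed (par v)}) (q ` {..<sz}))" using P' by (simp add: path_ok_def)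
          moreover have "reach (edges L - {ed (par v)}) (q ` {..<sz}) \<subseteq> reach (edges L - {ed (par v)}) ?VS"
          proof (rule reach_mono)
            show "q ` {..<sz} \<subseteq> ?VS"
            proof
              fix u assume "u \<in> q ` {..<sz}"
              then obtain i where "i < sz" "u = arr s2 aQ i" using F2(2) by auto
              then show "u \<in> ?VS" by auto
            qed
          qed simp
          ultimately show ?thesis using card_mono[OF fin] by (meson order_trans)
        qed
      qed
      have innerU: "card (inner_edges L U) \<le> 4 * Suc k + inc_count L (arr s2 aQ) par (sz + f) v"
      proof (cases "sz + f \<le> k")
        case True
        obtain j where j: "j < sz + f" "par v \<in> set (L (arr s2 aQ j))" using FF(4) by (auto simp: v_def)
        have "arr s2 aQ 0 = q 0" using F2(2) G(5) by simp
        moreover have "nb (par v) \<notin> ?VS" using FF(1,3) by (simp add: v_def)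
        ultimately show ?thesis
          using inner_count[OF wf F2(3) j _ True cU(2) _ X2(1) conU] cU(1) X2(3) True by (simp add: inc_count_def)
      next
        case False
        \<comment> \<open>A complete tree fills \<open>U\<close>, and by \<open>good\<close> the
          inner edges are then tree edges.\<close>
        then have "sz + f = Suc k" using FF(6) by simp
        then have "?VS = U" using card_subset_eq[OF cU(2) X2(1)] G2(3) cU(1) X2(3) card_mono[OF cU(2) X2(1)] by simp
        then have "inner_edges L U \<subseteq> tedges (arr s2 aQ) par (sz + f)" using G2(8) by (auto simp: inner_edges_def)
        then have "card (inner_edges L U) \<le> card (tedges (arr s2 aQ) par (sz + f))"
          using card_mono tree_facts(2)[OF G2(1)] by blast
        then show ?thesis using G2(4) \<open>sz + f = Suc k\<close> by simp
      qed
      have tk: "ticks s2 \<le> ticks s + 180 * Suc k + 10 + 18 * inc_count L (arr s2 aQ) par (sz + f) v"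
      proof -
        have "ticks s1 \<le> ticks s + 4 * sz + 5" using s1 by blast
        then show ?thesis
          using s2(3) scanned_card(2)[OF wf F2(4-7)] innerU FF(7) F2(5) X2(3) szn(2) unfolding U_def by simp
      qed
      show "WP clear2_com (\<lambda>s'. \<exists>sz' v. decided L (arr s aQ) (arr s aPar) sz sz' v s' \<and>
        ticks s' \<le> ticks s + 200 * Suc k + 18 * inc_count L (arr s' aQ) (arr s aPar) sz' v) s2"
      proof (rule wp_frame[OF wp_clear2[OF F2(4)]])
        fix s3 :: store
        assume s3: "(\<forall>v<n. arr s3 aVis v = (if v \<in> ?VS then 1 else 0)) \<and> ticks s3 \<le> ticks s2 + 5 * Suc (var s2 vT)"
          and fr: "\<And>r. r \<notin> mods clear2_com ==> var s3 r = var s2 r" "\<And>a. a \<notin> amods clear2_com ==> arr s3 a = arr s2 a"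
        have e3: "arr s3 aQ = arr s2 aQ" "arr s3 aPath = arr s2 aPath" "var s3 vS = sz + f" "var s3 vI = var s2 vI"
          using fr(2)[of aQ] fr(2)[of aPath] fr(1)[of vS] fr(1)[of vI] F2(1) by (simp_all add: clear2_com_def)
        have mk3: "marks (arr s3 aQ) (sz + f) (sz + f) (arr s3 aVis)" using s3 unfolding marks_def e3 by simp
        have "decided L q par sz (sz + f) v s3"
          unfolding decided_def e3(1-3) using F2 FF excl mk3[unfolded e3(1)] vs(3) e3(4) by (auto simp: v_def)
        moreover have "ticks s3 \<le> ticks s + 200 * Suc k + 18 * inc_count L (arr s3 aQ) par (sz + f) v"
          using conjunct2[OF s3] tk X2(3) unfolding e3 by simp
        ultimately show "\<exists>sz' v. decided L (arr s aQ) (arr s aPar) sz sz' v s3 \<and>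
          ticks s3 \<le> ticks s + 200 * Suc k + 18 * inc_count L (arr s3 aQ) (arr s aPar) sz' v" unfolding qp by blast
      qed
    qed
  qed
qed

end

section \<open>Programs for output, pruning and branching\<close>

definition output_com :: com where
  "output_com = Emit (Var vK) ;; Assign vI (Lit 1) ;;
     While (Minus (Plus (Var vK) (Lit 1)) (Var vI))
       (Assign vX (Arr aPar (Arr aQ (Var vI))) ;; Emit (Arr aG (Var vX)) ;;
        Emit (Arr aG (twinE vX)) ;; inc vI) ;;
     Assign vMode (Lit 0)"

text \<open>A deleted node stays readable, so \<open>nextE vY\<close> still leads to the rest of the
  list. The node whose twin is \<open>vX\<close> belongs to the edge just included and is
  kept.\<close>

definition prune_visit :: com where
  "prune_visit = Assign vW (Arr aG (Var vY)) ;;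
     Cond (Arr aVis (Var vW))
       (Cond (neqE (twinE vY) (Var vX))
          (delete_com vY ;; Write aTx (Var vP) (Var vY) ;; Write aTs (Var vP) (Lit 0) ;; inc vP) Skip) Skip ;;
     Assign vY (nextE vY)"

definition prune_com :: com where
  "prune_com = Assign vY (Arr aG (Var vV)) ;; While (Var vY) prune_visit"

text \<open>The stack entry remembers the tree size before the inclusion. A complete tree is not
  pruned, because nothing is searched from it.\<close>

definition branch_com :: com where
  "branch_com = Assign vV (Arr aPath (Var vI)) ;; Assign vX (Arr aPar (Var vV)) ;;
     Write aTx (Var vP) (Var vX) ;; Write aTs (Var vP) (Var vS) ;; inc vP ;;
     Write aVis (Var vV) (Lit 1) ;; Write aQ (Var vS) (Var vV) ;; inc vS ;;
     Cond (Minus (Plus (Var vK) (Lit 1)) (Var vS)) prune_com Skip"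

text \<open>One node of the search tree, up to the creation of its include child. An output at any
  of the three places means that exactly one solution is left: the tree is complete on entry, or the
  search exhausted a component of \<open>k + 1\<close> vertices, or forced edges completed the
  tree.\<close>

definition macro_com :: com where
  "macro_com =
     Cond (Minus (Plus (Var vK) (Lit 1)) (Var vS))
       (bfs_com ;;
        Cond (Var vF)
          (path_com ;; clear_com ;; phase2_com ;;
           Cond (Minus (Plus (Var vK) (Lit 1)) (Var vS)) branch_com output_com)
          (output_com ;; clear_com))
       output_com"

lemmas macro_com_defs =
  macro_com_def bfs_com_def bfs_visit_def path_com_def clear_com_def phase2_com_def copy_com_def
  force_com_def explore_com_def explore_visit_def clear2_com_def branch_com_def
  prune_com_def prune_visit_def delete_com_def unlink_com_def output_com_def

context machine
begin

definition lists_tree where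
  "lists_tree ws T \<longleftrightarrow> (\<exists>es. ws = encode_edges es \<and> distinct (listed_edges es) \<and> set (listed_edges es) = T)"

lemma wp_output:
  assumes R: "rep (arr s aG) L" and qt: "qtree L (arr s aQ) (arr s aPar) (Suc k)" and v: "var s vK = k"
  shows "WP output_com (\<lambda>s'. (\<exists>ws. emitted s' = emitted s @ ws \<and> lists_tree ws (tedges (arr s aQ) (arr s aPar) (Suc k))) \<and>
     var s' vMode = 0 \<and> ticks s' \<le> ticks s + 10 * Suc k) s"
proof -
  define q par where d: "q = arr s aQ" "par = arr s aPar"
  have wf: "wf_lists L" and st: "\<And>x. x \<in> nodes ==> arr s aG x = nb x \<and> arr s aG (x + 3) = tw x" using R by (auto simp: rep_def)
  have kn: "Suc k \<le> n" using qtree_bound[OF wf qt] .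
  define es where "es l = map (\<lambda>i. (nb (par (q i)), nb (tw (par (q i))))) [1..<l]" for l
  define flat where "flat l = concat (map (\<lambda>(u, v). [u, v]) (es l))" for l
  let ?I = "\<lambda>l s'. \<exists>i. l = Suc k - i \<and> 0 < i \<and> i \<le> Suc k \<and> var s' vI = i \<and> var s' vK = k \<and> arr s' = arr s \<and>
    emitted s' = emitted s @ k # flat i \<and> ticks s' \<le> ticks s + 5 * i"
  define Q where "Q = (\<lambda>s' :: store. (\<exists>ws. emitted s' = emitted s @ ws \<and> lists_tree ws (tedges q par (Suc k))) \<and>
     var s' vMode = 0 \<and> ticks s' \<le> ticks s + 10 * Suc k)"
  have le: "listed_edges (es l) = map (\<lambda>i. ed (par (q i))) [1..<l]" for l
    by (simp add: listed_edges_def es_def ed_def insert_commute)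
  let ?s = "s\<lparr>emitted := emitted s @ [k], var := (var s)(vI := 1), ticks := Suc (Suc (ticks s))\<rparr>"
  have "WP (While (Minus (Plus (Var vK) (Lit 1)) (Var vI))
       (Assign vX (Arr aPar (Arr aQ (Var vI))) ;; Emit (Arr aG (Var vX)) ;; Emit (Arr aG (twinE vX)) ;; inc vI))
     (WP (Assign vMode (Lit 0)) Q) ?s"
  proof (rule wp_While[where I = ?I and f = id])
    show "?I k ?s" using v by (intro exI[of _ 1]) (simp add: flat_def es_def)
  next
    fix l and s' :: store assume "?I l s'" then show "safe W Z (Minus (Plus (Var vK) (Lit 1)) (Var vI)) s'" using W by auto
  next
    fix l and s' :: store assume I: "?I l s'" "ev (Minus (Plus (Var vK) (Lit 1)) (Var vI)) s' = 0"
    then have *: "emitted s' = emitted s @ k # flat (Suc k)" "ticks s' \<le> ticks s + 5 * Suc k" by (auto simp: le_Suc_eq)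
    have "encode_edges (es (Suc k)) = k # flat (Suc k)" by (simp add: encode_edges_def flat_def) (simp add: es_def)
    moreover have "distinct (listed_edges (es (Suc k)))"
    proof -
      have "inj_on (\<lambda>i. ed (par (q i))) (set [1..<Suc k])"
      proof (rule inj_onI, rule ccontr)
        fix a b assume "a \<in> set [1..<Suc k]" "b \<in> set [1..<Suc k]" "ed (par (q a)) = ed (par (q b))" "a \<noteq> b"
        then show False using tedges_neq[OF wf qt[folded d], of a b] by auto
      qed
      then show ?thesis unfolding le by (simp add: distinct_map del: upt_Suc)
    qed
    moreover have "set (listed_edges (es (Suc k))) = tedges q par (Suc k)" unfolding le by (auto simp: tedges_def)
    ultimately have "lists_tree (k # flat (Suc k)) (tedges q par (Suc k))" unfolding lists_tree_def by metis
    then have "\<exists>ws. emitted s @ k # flat (Suc k) = emitted s @ ws \<and> lists_tree ws (tedges q par (Suc k))" by blast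
    then show "WP (Assign vMode (Lit 0)) Q (tick s')" using * W by (simp add: Q_def)
  next
    fix l and s' :: store assume I: "?I l s'" "ev (Minus (Plus (Var vK) (Lit 1)) (Var vI)) s' \<noteq> 0"
    then obtain i where i: "l = Suc k - i" "0 < i" "i < Suc k" "var s' vI = i" "var s' vK = k" "arr s' = arr s"
      "emitted s' = emitted s @ k # flat i" "ticks s' \<le> ticks s + 5 * i" by auto
    obtain j where j: "j < i" "par (q i) \<in> set (L (q j))" "q j < n" using qtreeD[OF wf qt[folded d] i(2,3)] by blast
    note X = wf_listsD[OF wf j(3,2)]
    have qi: "q i < n" using qt i by (auto simp: qtree_def d)
    have b: "i < Z" "q i < Z" "par (q i) < Z" "par (q i) + 3 < Z" "par (q i) + 3 < W" "tw (par (q i)) < Z" "Suc i < W"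
      using vertex_less[of i] vertex_less[OF qi] node_less[OF X(1)] node_less[OF X(8)] Z_less[of "par (q i)"] i kn W by auto
    have G: "arr s aG (par (q i)) = nb (par (q i))" "arr s aG (par (q i) + 3) = tw (par (q i))" "arr s aG (tw (par (q i))) = nb (tw (par (q i)))"
      using st[OF X(1)] st[OF X(8)] by auto
    have fl: "flat (Suc i) = flat i @ [nb (par (q i)), nb (tw (par (q i)))]" using i(2) by (simp add: flat_def es_def)
    define Q' where "Q' = (\<lambda>s' :: store. \<exists>l'. ?I l' s' \<and> id l' < id l)"
    have "Q' s''" if "var s'' vI = Suc i" "var s'' vK = k" "arr s'' = arr s" "emitted s'' = emitted s @ k # flat (Suc i)" "ticks s'' = ticks s' + 5" for s'' :: store
      unfolding Q'_def using that i by (intro exI[of _ "Suc k - Suc i"] conjI exI[of _ "Suc i"]) auto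
    then have "WP (Assign vX (Arr aPar (Arr aQ (Var vI))) ;; Emit (Arr aG (Var vX)) ;; Emit (Arr aG (twinE vX)) ;; inc vI) Q' (tick s')"
      using i b G fl W by (simp add: d[symmetric])
    then show "WP (Assign vX (Arr aPar (Arr aQ (Var vI))) ;; Emit (Arr aG (Var vX)) ;; Emit (Arr aG (twinE vX)) ;; inc vI)
        (\<lambda>s'. \<exists>l'. ?I l' s' \<and> id l' < id l) (tick s')" unfolding Q'_def .
  qed
  then show ?thesis unfolding output_com_def d[symmetric] Q_def[symmetric] using v W by simp
qed

section \<open>Including an edge\<close>

text \<open>All intermediate states are representable, which is what undoing the deletions one by
  one in reverse order requires.\<close>

definition del_seq where
  "del_seq M L v ds \<longleftrightarrow> (\<forall>i<length ds. rep (foldl delete M (take i ds)) (foldl del L (take i ds)) \<and>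
     ds ! i \<in> set (foldl del L (take i ds) v))"

lemma del_seq_snoc:
  assumes "del_seq M L v ds" "rep (foldl delete M ds) (foldl del L ds)" "y \<in> set (foldl del L ds v)"
  shows "del_seq M L v (ds @ [y])"
  using assms unfolding del_seq_def by (auto simp: less_Suc_eq nth_append)

lemma foldl_del_filter: "foldl del L ds u = filter (\<lambda>z. \<forall>y\<in>set ds. z \<noteq> y \<and> z \<noteq> tw y) (L u)"
  by (induction ds arbitrary: L) (auto simp: del_def intro!: filter_cong)

lemma del_seq_edges:
  assumes "rep M L" "v < n" "del_seq M L v ds"
  shows "rep (foldl delete M ds) (foldl del L ds) \<and> edges (foldl del L ds) = edges L - ed ` set ds \<and> card (edges L) = card (edges (foldl del L ds)) + length ds"
  using assms(3)
proof (induction ds rule: rev_induct)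
  case Nil
  then show ?case using assms(1) by simp
next
  case (snoc y ds)
  have ds: "del_seq M L v ds" using snoc.prems by (auto simp: del_seq_def nth_append split: if_splits)
  note IH = snoc.IH[OF ds]
  have y: "y \<in> set (foldl del L ds v)" using snoc.prems by (auto simp: del_seq_def dest!: spec[of _ "length ds"])
  have r: "rep (foldl delete M ds) (foldl del L ds)" "wf_lists (foldl del L ds)" using IH by (auto simp: rep_def)
  have e: "edges (del (foldl del L ds) y) = edges (foldl del L ds) - {ed y}" using wf_del(2)[OF r(2) assms(2) y] .
  have "ed y \<in> edges (foldl del L ds)" using ed_in_edges[OF r(2) assms(2) y] .
  then have "card (edges (foldl del L ds)) = Suc (card (edges (foldl del L ds) - {ed y}))"
    using card_Suc_Diff1[OF finite_edges[OF r(2)]] by simp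
  then show ?case using IH e rep_delete(1)[OF r(1) assms(2) y] by auto
qed

lemma wp_prune:
  assumes R: "rep (arr s aG) L" and v: "var s vV = v" "v < n" "var s vX = x" "x < Z"
    and vis: "\<forall>u<n. arr s aVis u = (if u \<in> V then 1 else 0)" and P: "var s vP + length (L v) < n + m + 1"
  shows "WP prune_com (\<lambda>s'. \<exists>ds. del_seq (arr s aG) L v ds \<and> set ds = {y \<in> set (L v). nb y \<in> V \<and> tw y \<noteq> x} \<and> length ds \<le> length (L v) \<and>
     arr s' aG = foldl delete (arr s aG) ds \<and> var s' vP = var s vP + length ds \<and>
     (\<forall>i<length ds. arr s' aTx (var s vP + i) = ds ! i \<and> arr s' aTs (var s vP + i) = 0) \<and>
     (\<forall>i<var s vP. arr s' aTx i = arr s aTx i \<and> arr s' aTs i = arr s aTs i) \<and>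
     ticks s' \<le> ticks s + 18 * length (L v) + 3) s"
proof -
  define M p where d: "M = arr s aG" "p = var s vP"
  have wf: "wf_lists L" using R by (simp add: rep_def)
  let ?del = "\<lambda>y. nb y \<in> V \<and> tw y \<noteq> x"
  let ?I = "\<lambda>l s'. \<exists>xs1 xs2. l = length xs2 \<and> L v = xs1 @ xs2 \<and> (let ds = filter ?del xs1 in
     del_seq M L v ds \<and> rep (foldl delete M ds) (foldl del L ds) \<and> foldl del L ds v = filter (\<lambda>y. \<not> ?del y) xs1 @ xs2 \<and>
     arr s' aG = foldl delete M ds \<and> var s' vP = p + length ds \<and>
     (\<forall>i<length ds. arr s' aTx (p + i) = ds ! i \<and> arr s' aTs (p + i) = 0) \<and>
     (\<forall>i<p. arr s' aTx i = arr s aTx i \<and> arr s' aTs i = arr s aTs i) \<and> arr s' aVis = arr s aVis \<and> var s' vX = x \<and>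
     var s' vY = (case xs2 of [] => 0 | y # _ => y) \<and> ticks s' \<le> ticks s + 1 + 18 * length xs1)"
  let ?Q = "\<lambda>s'. \<exists>ds. del_seq M L v ds \<and> set ds = {y \<in> set (L v). nb y \<in> V \<and> tw y \<noteq> x} \<and> length ds \<le> length (L v) \<and>
     arr s' aG = foldl delete M ds \<and> var s' vP = p + length ds \<and>
     (\<forall>i<length ds. arr s' aTx (p + i) = ds ! i \<and> arr s' aTs (p + i) = 0) \<and>
     (\<forall>i<p. arr s' aTx i = arr s aTx i \<and> arr s' aTs i = arr s aTs i) \<and>
     ticks s' \<le> ticks s + 18 * length (L v) + 3"
  let ?s = "s\<lparr>var := (var s)(vY := M v), ticks := Suc (ticks s)\<rparr>"
  have "WP (While (Var vY) prune_visit) ?Q ?s"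
  proof (rule wp_While[where I = ?I and f = id])
    have "M v = (case L v of [] => 0 | y # _ => y)" using linked_list_first[OF R v(2)] by (simp add: d)
    then show "?I (length (L v)) ?s" using R v by (intro exI[of _ "[]"] exI[of _ "L v"]) (simp add: d del_seq_def)
  next
    fix l and s' :: store assume "?I l s'" and e: "ev (Var vY) s' = 0"
    then obtain xs1 xs2 where x: "L v = xs1 @ xs2" "var s' vY = (case xs2 of [] => 0 | y # _ => y)"
      and i: "let ds = filter ?del xs1 in
       del_seq M L v ds \<and> arr s' aG = foldl delete M ds \<and> var s' vP = p + length ds \<and>
       (\<forall>i<length ds. arr s' aTx (p + i) = ds ! i \<and> arr s' aTs (p + i) = 0) \<and>
       (\<forall>i<p. arr s' aTx i = arr s aTx i \<and> arr s' aTs i = arr s aTs i) \<and> ticks s' \<le> ticks s + 1 + 18 * length xs1"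
      unfolding Let_def by blast
    have "xs2 = []"
    proof (cases xs2)
      case (Cons y ys)
      then show ?thesis using wf_listsD(12)[OF wf v(2), of y] x e by simp
    qed simp
    then show "?Q (tick s')" using x i by (intro exI[of _ "filter ?del xs1"]) (auto simp: Let_def)
  next
    fix l and s' :: store assume "?I l s'" and e: "ev (Var vY) s' \<noteq> 0"
    then obtain xs1 xs2 where x: "l = length xs2" "L v = xs1 @ xs2" "var s' vY = (case xs2 of [] => 0 | y # _ => y)"
      and i: "let ds = filter ?del xs1 in
       del_seq M L v ds \<and> rep (foldl delete M ds) (foldl del L ds) \<and> foldl del L ds v = filter (\<lambda>y. \<not> ?del y) xs1 @ xs2 \<and>
       arr s' aG = foldl delete M ds \<and> var s' vP = p + length ds \<and>
       (\<forall>i<length ds. arr s' aTx (p + i) = ds ! i \<and> arr s' aTs (p + i) = 0) \<and>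
       (\<forall>i<p. arr s' aTx i = arr s aTx i \<and> arr s' aTs i = arr s aTs i) \<and> arr s' aVis = arr s aVis \<and> var s' vX = x \<and>
       ticks s' \<le> ticks s + 1 + 18 * length xs1"
      unfolding Let_def by blast
    obtain y ys where xs2: "xs2 = y # ys" using e x(3) by (cases xs2) auto
    define ds M' L' where dd: "ds = filter ?del xs1" "M' = foldl delete M ds" "L' = foldl del L ds"
    have i': "del_seq M L v ds" "rep M' L'" "L' v = filter (\<lambda>y. \<not> ?del y) xs1 @ y # ys" "arr s' aG = M'" "var s' vP = p + length ds"
       "\<forall>i<length ds. arr s' aTx (p + i) = ds ! i \<and> arr s' aTs (p + i) = 0"
       "\<forall>i<p. arr s' aTx i = arr s aTx i \<and> arr s' aTs i = arr s aTs i" "arr s' aVis = arr s aVis" "var s' vX = x"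
       "ticks s' \<le> ticks s + 1 + 18 * length xs1"
      using i xs2 unfolding Let_def dd by blast+
    have wf': "wf_lists L'" using i'(2) by (simp add: rep_def)
    have y: "y \<in> set (L' v)" "y \<in> set (L v)" using i'(3) x xs2 by auto
    note Y = wf_listsD[OF wf' v(2) y(1)]
    have st: "M' y = nb y" "M' (y + 3) = tw y" using i'(2) Y(1) by (auto simp: rep_def)
    have nxt: "M' (y + 1) = (case ys of [] => 0 | z # _ => z)" using linked_list_next[OF i'(2) v(2) i'(3)] .
    have vw: "arr s aVis (nb y) = (if nb y \<in> V then 1 else 0)" using vis Y(2) by simp
    have len: "length ds < length (L v)" using x xs2 le_imp_less_Suc[OF trans_le_add1[OF length_filter_le[of ?del xs1], of "length ys"]] by (simp add: dd)
    have b: "y < Z" "Suc y < Z" "y + 3 < Z" "y + 3 < W" "nb y < Z" "p + length ds < Z" "Suc (p + length ds) < W" "tw y - x + (x - tw y) < W"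
      using node_less[OF Y(1)] Z_less[of y] vertex_less[OF Y(2)] P len W Z Z_less[of "tw y"] Z_less[of x] node_less(1)[OF Y(8)] v(4) unfolding d by auto
    define Q where "Q = (\<lambda>s' :: store. \<exists>l'. ?I l' s' \<and> id l' < id l)"
    have Y1: "var s' vY = y" using x(3) xs2 by simp
    have "WP prune_visit Q (tick s')"
    proof (cases "?del y")
      case False
      have "Q s''" if "arr s'' = arr s'" "var s'' vP = var s' vP" "var s'' vX = x" "var s'' vY = (case ys of [] => 0 | z # _ => z)" "ticks s'' \<le> ticks s' + 18" for s'' :: store
      proof -
        have f: "filter ?del (xs1 @ [y]) = ds" "filter (\<lambda>y. \<not> ?del y) (xs1 @ [y]) = filter (\<lambda>y. \<not> ?del y) xs1 @ [y]" using False by (auto simp: dd)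
        have "?I (length ys) s''"
          by (rule exI[of _ "xs1 @ [y]"], rule exI[of _ ys], unfold Let_def f dd(2,3)[symmetric])
            (use that i' x xs2 in simp)
        then show ?thesis unfolding Q_def using x xs2 by (intro exI[of _ "length ys"]) simp
      qed
      then show ?thesis unfolding prune_visit_def using i' Y1 st nxt vw b False W by (cases "nb y \<in> V") (auto)
    next
      case True
      have dy: "rep (delete M' y) (del L' y)" "delete M' y (y + 1) = M' (y + 1)" using rep_delete(1,3)[OF i'(2) v(2) y(1)] by auto
      have f: "filter ?del (xs1 @ [y]) = ds @ [y]" "filter (\<lambda>y. \<not> ?del y) (xs1 @ [y]) = filter (\<lambda>y. \<not> ?del y) xs1" using True by (auto simp: dd)
      have fd: "foldl delete M (ds @ [y]) = delete M' y" "foldl del L (ds @ [y]) = del L' y" by (simp_all add: dd)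
      \<comment> \<open>The deletion takes the current node out of the list of \<open>v\<close>; its
        twin stands in another list, so the part still to be scanned is unchanged.\<close>
      have dl: "del L' y v = filter (\<lambda>y. \<not> ?del y) xs1 @ ys"
      proof -
        have "tw y \<notin> set (L' v)" using wf_listsD(5)[OF wf' v(2), of "tw y"] Y by auto
        moreover have "distinct (L' v)" using Y(9) .
        ultimately have "\<forall>z\<in>set (filter (\<lambda>y. \<not> ?del y) xs1 @ ys). z \<noteq> y \<and> z \<noteq> tw y" "y \<noteq> tw y" using Y(7) unfolding i'(3) by auto
        then have "filter (\<lambda>z. z \<noteq> y \<and> z \<noteq> tw y) (filter (\<lambda>y. \<not> ?del y) xs1 @ ys) = filter (\<lambda>y. \<not> ?del y) xs1 @ ys" by (intro filter_True)
        then show ?thesis unfolding del_def i'(3) by simp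
      qed
      have seq: "del_seq M L v (ds @ [y])" using del_seq_snoc[OF i'(1)] i'(2) y(1) by (simp add: dd)
      define s1 where "s1 = s'\<lparr>var := (var s')(vW := nb y), ticks := Suc (Suc (Suc (Suc (ticks s'))))\<rparr>"
      have s1: "arr s1 = arr s'" "var s1 vY = y" "var s1 vP = p + length ds" "var s1 vX = x" "ticks s1 = ticks s' + 4" using Y1 i' by (simp_all add: s1_def)
      have QI: "Q s''" if "arr s'' aG = delete M' y" "arr s'' aVis = arr s aVis" "arr s'' aTx = (arr s' aTx)(p + length ds := y)" "arr s'' aTs = (arr s' aTs)(p + length ds := 0)"
        "var s'' vP = Suc (p + length ds)" "var s'' vX = x" "var s'' vY = (case ys of [] => 0 | z # _ => z)" "ticks s'' \<le> ticks s' + 18" for s'' :: store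
      proof -
        have "?I (length ys) s''"
          by (rule exI[of _ "xs1 @ [y]"], rule exI[of _ ys], unfold Let_def f fd)
            (use that i' x xs2 seq dy(1) dl in \<open>auto simp: nth_append less_Suc_eq\<close>)
        then show ?thesis unfolding Q_def using x xs2 by (intro exI[of _ "length ys"]) simp
      qed
      have "WP (delete_com vY) (WP (Write aTx (Var vP) (Var vY) ;; Write aTs (Var vP) (Lit 0) ;; inc vP) (WP (Assign vY (nextE vY)) Q)) s1"
      proof (rule wp_frame[OF wp_delete[of s1 L' v vY y]])
        fix s2 :: store assume s2: "arr s2 = (arr s1)(aG := delete (arr s1 aG) y) \<and> ticks s2 \<le> ticks s1 + 9"
          and fr: "\<And>r. r \<notin> mods (delete_com vY) ==> var s2 r = var s1 r"
        have v2: "var s2 vP = p + length ds" "var s2 vX = x" "var s2 vY = y"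
          using fr[of vP] fr[of vX] fr[of vY] s1 by (simp_all add: delete_com_def unlink_com_def)
        have a2: "arr s2 = (arr s')(aG := delete M' y)" "ticks s2 \<le> ticks s' + 13" using s2 s1 i'(4) by auto
        show "WP (Write aTx (Var vP) (Var vY) ;; Write aTs (Var vP) (Lit 0) ;; inc vP) (WP (Assign vY (nextE vY)) Q) s2"
          using v2 a2 b W dy(2) nxt i'(8) by (auto intro!: QI)
      qed (use s1 i' v(2) y(1) in auto)
      moreover have "tw y - x + (x - tw y) \<noteq> 0" using True by auto
      ultimately show ?thesis unfolding prune_visit_def using i' Y1 st vw b True W by (auto simp: s1_def)
    qed
    then show "WP prune_visit (\<lambda>s'. \<exists>l'. ?I l' s' \<and> id l' < id l) (tick s')" unfolding Q_def .
  qed (use W in auto)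
  then show ?thesis unfolding prune_com_def d[symmetric] using v vertex_less[OF v(2)] by (simp add: d)
qed

text \<open>A tree with \<open>k + 1\<close> vertices is not pruned after the inclusion of its last
  edge, so only incomplete trees are required to be \<open>good\<close>.\<close>

definition est where
  "est L sz s \<longleftrightarrow> rep (arr s aG) L \<and> marks (arr s aQ) sz sz (arr s aVis) \<and> var s vS = sz \<and> var s vK = k \<and>
     qtree L (arr s aQ) (arr s aPar) sz \<and> sz \<le> Suc k \<and> (sz \<le> k --> good L (arr s aQ) (arr s aPar) sz)"

text \<open>What the rest of the search relies on: the stack below its entry height and the first
  \<open>sz\<close> vertices with their parents. Everything above may be overwritten.\<close>

definition keeps where
  "keeps sz s s' \<longleftrightarrow> var s' vP = var s vP \<and> var s' vK = k \<and>
     (\<forall>i<var s vP. arr s' aTx i = arr s aTx i \<and> arr s' aTs i = arr s aTs i) \<and>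
     (\<forall>i<sz. arr s' aQ i = arr s aQ i \<and> arr s' aPar (arr s aQ i) = arr s aPar (arr s aQ i))"

text \<open>The tree may have grown beyond \<open>sz\<close>. The marks still describe a prefix of
  the queue, so they can be erased while the counter is lowered.\<close>

definition tidy where
  "tidy sz s \<longleftrightarrow> (\<exists>sz'\<ge>sz. sz' \<le> n \<and> sz' \<le> Suc k \<and> var s vS = sz' \<and> marks (arr s aQ) sz' sz' (arr s aVis) \<and>
     inj_on (arr s aQ) {..<sz'} \<and> (\<forall>i<sz'. arr s aQ i < n))"

definition leaf where
  "leaf L sz s s' \<longleftrightarrow> var s' vMode = 0 \<and> arr s' aG = arr s aG \<and> keeps sz s s' \<and> tidy sz s' \<and>
     (\<exists>ws T. emitted s' = emitted s @ ws \<and> lists_tree ws T \<and>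
        Sol (edges L) k (arr s aQ 0) (tedges (arr s aQ) (arr s aPar) sz) = {T}) \<and>
     ticks s' \<le> ticks s + 400 * Suc k"

text \<open>\<open>sz1\<close> is the size after the forced edges, \<open>v\<close> the vertex added
  by the branching edge, and \<open>ds\<close> lists the nodes deleted by pruning. On the stack the
  entry for the inclusion lies below those for \<open>ds\<close>.\<close>

definition branched where
  "branched L sz s sz1 v ds s' \<longleftrightarrow> (let q = arr s' aQ; par = arr s' aPar; x = par v; p = var s vP in
     var s' vMode = 1 \<and> sz \<le> sz1 \<and> sz1 \<le> k \<and> good L q par sz1 \<and> q sz1 = v \<and> v < n \<and> v \<notin> q ` {..<sz1} \<and>
     (\<exists>j<sz1. x \<in> set (L (q j))) \<and> nb x = v \<and>
     (\<forall>i<sz. q i = arr s aQ i \<and> par (q i) = arr s aPar (q i)) \<and>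
     Sol (edges L) k (q 0) (tedges q par sz1) = Sol (edges L) k (q 0) (tedges (arr s aQ) (arr s aPar) sz) \<and>
     Suc k \<le> card (reach (edges L - {ed x}) (q ` {..<sz1})) \<and>
     del_seq (arr s aG) L v ds \<and> arr s' aG = foldl delete (arr s aG) ds \<and>
     set ds \<subseteq> {y \<in> set (L v). nb y \<in> q ` {..<Suc sz1} \<and> tw y \<noteq> x} \<and>
     (Suc sz1 \<le> k --> {y \<in> set (L v). nb y \<in> q ` {..<Suc sz1} \<and> tw y \<noteq> x} \<subseteq> set ds) \<and>
     marks q (Suc sz1) (Suc sz1) (arr s' aVis) \<and> var s' vS = Suc sz1 \<and> var s' vK = k \<and>
     var s' vP = Suc p + length ds \<and> arr s' aTx p = x \<and> arr s' aTs p = sz1 \<and>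
     (\<forall>i<length ds. arr s' aTx (Suc p + i) = ds ! i \<and> arr s' aTs (Suc p + i) = 0) \<and>
     (\<forall>i<p. arr s' aTx i = arr s aTx i \<and> arr s' aTs i = arr s aTs i) \<and> emitted s' = emitted s \<and>
     length ds \<le> 2 * Suc k + inc_count L q par sz1 v \<and>
     ticks s' \<le> ticks s + 400 * Suc k + 36 * inc_count L q par sz1 v)"

lemma list_length_edges:
  assumes "wf_lists L" "v < n"
  shows "length (L v) \<le> card (edges L)"
proof -
  have inj: "inj_on ed (set (L v))"
  proof (rule inj_onI)
    fix y z assume yz: "y \<in> set (L v)" "z \<in> set (L v)" "ed y = ed z"
    then have "nb y = nb z" using wf_listsD(3,10)[OF assms yz(1)] wf_listsD(3,10)[OF assms yz(2)] by (auto simp: doubleton_eq_iff)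
    then show "y = z" using wf_lists_inj[OF assms yz(1,2)] by simp
  qed
  have "length (L v) = card (set (L v))" using assms by (auto simp: wf_lists_def distinct_card)
  also have "\<dots> = card (ed ` set (L v))" using inj by (simp add: card_image)
  also have "\<dots> \<le> card (edges L)" using finite_edges[OF assms(1)] ed_in_edges[OF assms] by (intro card_mono) auto
  finally show ?thesis .
qed

lemma Sol_full:
  assumes "wf_lists L" "qtree L q par (Suc k)"
  shows "Sol (edges L) k (q 0) (tedges q par (Suc k)) = {tedges q par (Suc k)}"
proof -
  note T = qtree_tree[OF assms]
  have "T = tedges q par (Suc k)" if "T \<in> Sol (edges L) k (q 0) (tedges q par (Suc k))" for T
  proof -
    have "tedges q par (Suc k) \<subseteq> T" "card T = k" "finite T"
      using that tree_facts(2) by (auto simp: Sol_def)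
    then show ?thesis using T(4) card_subset_eq[of T "tedges q par (Suc k)"] by simp
  qed
  moreover have "tedges q par (Suc k) \<in> Sol (edges L) k (q 0) (tedges q par (Suc k))"
    unfolding Sol_def using T by auto
  ultimately show ?thesis by blast
qed

text \<open>A search that stops for no reason has scanned a whole component, whose edges are exactly
  those of the search tree. The component has at least \<open>k + 1\<close> vertices by
  \<open>good\<close> and at most that many by the limit of the search.\<close>

lemma Sol_exhausted:
  assumes wf: "wf_lists L" and g: "good L q0 par0 sz" and I: "bfs_inv L sz q0 par0 (var s vT) {} s"
  shows "var s vT = Suc k" "Sol (edges L) k (q0 0) (tedges q0 par0 sz) = {tedges (arr s aQ) (arr s aPar) (Suc k)}"
proof -
  define q par t where d: "q = arr s aQ" "par = arr s aPar" "t = var s vT"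
  have I': "qtree L q par t" "sz \<le> t" "t \<le> Suc k" "\<And>i. i < sz ==> q i = q0 i \<and> par (q0 i) = par0 (q0 i)"
    "\<And>i x. i < t ==> x \<in> set (L (q i)) ==> ed x \<in> tedges q par t"
    using I unfolding bfs_inv_def Let_def d by blast+
  note T = qtree_tree[OF wf I'(1)] and G = goodD[OF wf g]
  have cl: "e \<in> tedges q par t" if e: "e \<in> edges L" "e \<inter> q ` {..<t} \<noteq> {}" for e
  proof -
    obtain i where i: "i < t" "q i \<in> e" using e(2) by auto
    then have "q i < n" using I'(1) by (auto simp: qtree_def)
    then obtain y where "y \<in> set (L (q i))" "e = ed y" using edges_at[OF wf _ e(1) i(2)] by blast
    then show ?thesis using I'(5) i by blast
  qed
  have qq: "q0 ` {..<sz} = q ` {..<sz}" using I'(4) by (intro image_cong) auto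
  have "reach (edges L) (q ` {..<sz}) \<subseteq> q ` {..<t}"
  proof (rule reach_least)
    show "q ` {..<sz} \<subseteq> q ` {..<t}" using I'(2) by auto
    fix u w assume "u \<in> q ` {..<t}" "{u, w} \<in> edges L"
    then have "{u, w} \<in> tedges q par t" using cl by auto
    then show "w \<in> q ` {..<t}" using tree_facts(6)[OF T(1)] by auto
  qed
  then have "card (reach (edges L) (q ` {..<sz})) \<le> t" using T(3) card_mono by (metis finite_imageI finite_lessThan)
  then show t: "var s vT = Suc k" using G(7) qq I'(3) d by simp
  have q0: "q 0 = q0 0" using I'(4)[of 0] G(5) by simp
  have "tedges q0 par0 sz \<subseteq> tedges q par t"
  proof
    fix e assume "e \<in> tedges q0 par0 sz"
    then obtain i where i: "0 < i" "i < sz" "e = ed (par0 (q0 i))" by (auto simp: tedges_def)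
    then have "e = ed (par (q i))" using I'(4)[of i] by simp
    then show "e \<in> tedges q par t" using i I'(2) by (auto simp: tedges_def)
  qed
  moreover have "card (tedges q par t) = k" using T(4) t d by simp
  ultimately have "Sol (edges L) k (q 0) (tedges q0 par0 sz) = {tedges q par t}"
    using Sol_unique[OF T(1) _ T(2) _ cl] by blast
  then show "Sol (edges L) k (q0 0) (tedges q0 par0 sz) = {tedges (arr s aQ) (arr s aPar) (Suc k)}"
    using q0 t by (simp add: d)
qed

lemma marks_include:
  assumes "marks q sz sz vis" "v \<notin> q ` {..<sz}"
  shows "marks (q(sz := v)) (Suc sz) (Suc sz) (vis(v := 1))"
proof -
  have "(q(sz := v)) ` {..<sz} = q ` {..<sz}" by (intro image_cong) auto
  then have "(q(sz := v)) ` {..<Suc sz} = insert v (q ` {..<sz})" unfolding lessThan_Suc image_insert by simp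
  then show ?thesis using assms unfolding marks_def by auto
qed

lemma good_cong:
  assumes "good L q par sz" "\<And>i. i < sz ==> q' i = q i" "\<And>i. 0 < i ==> i < sz ==> par' (q i) = par (q i)"
  shows "good L q' par' sz" "tedges q' par' sz = tedges q par sz" "q' ` {..<sz} = q ` {..<sz}"
  using assms qtree_cong[of L q par sz q' par'] unfolding good_def by auto

definition br_post where
  "br_post L sz1 v ds M q par tx ts p t s' \<longleftrightarrow> (let q' = q(sz1 := v); x = par v; C = {y \<in> set (L v). nb y \<in> q' ` {..<Suc sz1} \<and> tw y \<noteq> x} in
     arr s' aPar = par \<and> arr s' aQ = q' \<and> var s' vMode = 1 \<and>
     del_seq M L v ds \<and> arr s' aG = foldl delete M ds \<and> set ds \<subseteq> C \<and> (Suc sz1 \<le> k --> C \<subseteq> set ds) \<and>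
     marks q' (Suc sz1) (Suc sz1) (arr s' aVis) \<and> var s' vS = Suc sz1 \<and> var s' vK = k \<and>
     var s' vP = Suc p + length ds \<and> arr s' aTx p = x \<and> arr s' aTs p = sz1 \<and>
     (\<forall>i<length ds. arr s' aTx (Suc p + i) = ds ! i \<and> arr s' aTs (Suc p + i) = 0) \<and>
     (\<forall>i<p. arr s' aTx i = tx i \<and> arr s' aTs i = ts i) \<and>
     length ds \<le> (if Suc sz1 \<le> k then length (L v) else 0) \<and>
     ticks s' \<le> t + 13 + 18 * (if Suc sz1 \<le> k then length (L v) else 0))"

text \<open>The hypothesis on \<open>vP\<close> bounds the stack: each entry belongs to a deleted
  edge or to an included one, so height plus remaining edges is at most \<open>m\<close> plus the
  tree size. Hence the stack fits into an array.\<close>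

lemma wp_branch:
  assumes R: "rep (arr s aG) L" and D: "decided L q0 (arr s aPar) sz sz1 v s" and sz1: "sz1 \<le> k"
    and v: "var s vK = k" "var s vMode = 1" and P: "var s vP + card (edges L) \<le> m + sz"
  shows "WP branch_com (\<lambda>s'. \<exists>ds. br_post L sz1 v ds (arr s aG) (arr s aQ) (arr s aPar) (arr s aTx) (arr s aTs) (var s vP) (ticks s) s') s"
proof -
  define q par x p where d: "q = arr s aQ" "par = arr s aPar" "x = par v" "p = var s vP"
  have wf: "wf_lists L" using R by (simp add: rep_def)
  have D': "sz \<le> sz1" "good L q par sz1" "marks q sz1 sz1 (arr s aVis)" "var s vS = sz1" "arr s aPath (var s vI) = v"
    "var s vI < n" "v < n" "v \<notin> q ` {..<sz1}" "nb x = v"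
    using D by (auto simp: decided_def d)
  obtain j where j: "j < sz1" "x \<in> set (L (q j))" using D by (auto simp: decided_def d)
  have qj: "q j < n" using D'(2) j by (auto simp: good_def qtree_def)
  note X = wf_listsD[OF wf qj j(2)]
  let ?q = "q(sz1 := v)"
  have "card (insert v (q ` {..<sz1})) \<le> card {..<n}"
    using D'(2,7) by (intro card_mono) (auto simp: good_def qtree_def)
  then have sn: "sz1 < n" using D'(8) goodD(3)[OF wf D'(2)] by simp
  have b: "p < Z" "Suc p < W" "sz1 < Z" "Suc sz1 < W" "v < Z" "var s vI < Z" "x < Z" "Suc k < W"
    using P D'(1) sn W Z vertex_less[OF D'(7)] vertex_less[OF D'(6)] node_less(1)[OF X(1)] by (auto simp: d)
  have mk: "marks ?q (Suc sz1) (Suc sz1) ((arr s aVis)(v := 1))" using marks_include[OF D'(3,8)] .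
  define s1 where "s1 = s\<lparr>arr := (arr s)(aTx := (arr s aTx)(p := x), aTs := (arr s aTs)(p := sz1), aVis := (arr s aVis)(v := 1), aQ := ?q),
     var := (var s)(vV := v, vX := x, vP := Suc p, vS := Suc sz1),
     ticks := Suc (Suc (Suc (Suc (Suc (Suc (Suc (Suc (ticks s))))))))\<rparr>"
  define Q where "Q = (\<lambda>s' :: store. \<exists>ds. br_post L sz1 v ds (arr s aG) q par (arr s aTx) (arr s aTs) p (ticks s) s')"
  have s1: "arr s1 aG = arr s aG" "arr s1 aQ = ?q" "arr s1 aPar = par" "var s1 vV = v" "var s1 vX = x" "var s1 vP = Suc p" "var s1 vS = Suc sz1"
    "var s1 vK = k" "var s1 vMode = 1" "arr s1 aVis = (arr s aVis)(v := 1)" "arr s1 aTx = (arr s aTx)(p := x)" "arr s1 aTs = (arr s aTs)(p := sz1)"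
    "ticks s1 = ticks s + 8"
    using v by (simp_all add: s1_def d)
  define C where "C = Cond (Minus (Plus (Var vK) (Lit 1)) (Var vS)) prune_com Skip"
  have rest: "WP C Q s1"
  proof (cases "Suc sz1 \<le> k")
    case False
    have "Q (tick s1)"
      unfolding Q_def br_post_def Let_def using False s1 mk by (intro exI[of _ "[]"]) (simp add: d(3)[symmetric] del_seq_def)
    then show ?thesis unfolding C_def using False sz1 s1(7,8) b by simp
  next
    case True
    let ?V = "?q ` {..<Suc sz1}"
    have "WP prune_com Q (tick s1)"
    proof (rule wp_frame[OF wp_prune[of "tick s1" L v x ?V]])
      show "rep (arr (tick s1) aG) L" "var (tick s1) vV = v" "v < n" "var (tick s1) vX = x" "x < Z" using R s1 D' b by simp_all
      show "\<forall>u<n. arr (tick s1) aVis u = (if u \<in> ?V then 1 else 0)" using mk s1 by (simp add: marks_def)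
      show "var (tick s1) vP + length (L v) < n + m + 1"
        using s1(6) list_length_edges[OF wf D'(7)] P D'(1) sn by (simp add: d)
      fix s2 :: store
      assume "\<exists>ds. del_seq (arr (tick s1) aG) L v ds \<and> set ds = {y \<in> set (L v). nb y \<in> ?V \<and> tw y \<noteq> x} \<and> length ds \<le> length (L v) \<and>
         arr s2 aG = foldl delete (arr (tick s1) aG) ds \<and> var s2 vP = var (tick s1) vP + length ds \<and>
         (\<forall>i<length ds. arr s2 aTx (var (tick s1) vP + i) = ds ! i \<and> arr s2 aTs (var (tick s1) vP + i) = 0) \<and>
         (\<forall>i<var (tick s1) vP. arr s2 aTx i = arr (tick s1) aTx i \<and> arr s2 aTs i = arr (tick s1) aTs i) \<and>
         ticks s2 \<le> ticks (tick s1) + 18 * length (L v) + 3"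
        and fr: "\<And>r. r \<notin> mods prune_com ==> var s2 r = var (tick s1) r" "\<And>a. a \<notin> amods prune_com ==> arr s2 a = arr (tick s1) a"
      then obtain ds where ds: "del_seq (arr s aG) L v ds" "set ds = {y \<in> set (L v). nb y \<in> ?V \<and> tw y \<noteq> x}" "length ds \<le> length (L v)"
         "arr s2 aG = foldl delete (arr s aG) ds" "var s2 vP = Suc p + length ds"
         "\<forall>i<length ds. arr s2 aTx (Suc p + i) = ds ! i \<and> arr s2 aTs (Suc p + i) = 0"
         "\<forall>i<Suc p. arr s2 aTx i = ((arr s aTx)(p := x)) i \<and> arr s2 aTs i = ((arr s aTs)(p := sz1)) i"
         "ticks s2 \<le> ticks s + 18 * length (L v) + 13" using s1 by auto
      have f2: "arr s2 aQ = ?q" "arr s2 aPar = par" "arr s2 aVis = (arr s aVis)(v := 1)" "var s2 vS = Suc sz1" "var s2 vK = k" "var s2 vMode = 1"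
        using fr(2)[of aQ] fr(2)[of aPar] fr(2)[of aVis] fr(1)[of vS] fr(1)[of vK] fr(1)[of vMode] s1
        by (simp_all add: prune_com_def prune_visit_def delete_com_def unlink_com_def)
      have "br_post L sz1 v ds (arr s aG) q par (arr s aTx) (arr s aTs) p (ticks s) s2"
        unfolding br_post_def Let_def f2 d(3)[symmetric] using ds(1-6,8) mk True
        by (intro conjI) (use ds(7) in \<open>simp_all add: less_Suc_eq\<close>)
      then show "Q s2" unfolding Q_def by blast
    qed
    then show ?thesis unfolding C_def using True s1(7,8) b by simp
  qed
  show ?thesis
    unfolding branch_com_def d(1,2,4)[symmetric] Q_def[symmetric] C_def[symmetric] using rest D' v b W
    unfolding s1_def by (simp add: d[symmetric] fun_upd_twist)
qed

text \<open>The factor \<open>36\<close> consists of \<open>18\<close> for the exploration and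
  \<open>18\<close> for the pruning, which costs \<open>18\<close> ticks per node of the list of the
  new vertex; \<open>degree_count\<close> bounds that list.\<close>

lemma wp_macro:
  assumes E: "est L sz s" and v: "var s vMode = 1" and P: "var s vP + card (edges L) \<le> m + sz"
  shows "WP macro_com (\<lambda>s'. leaf L sz s s' \<or> (\<exists>sz1 v ds. branched L sz s sz1 v ds s')) s"
proof -
  have R: "rep (arr s aG) L" and mk: "marks (arr s aQ) sz sz (arr s aVis)" and S: "var s vS = sz" and K: "var s vK = k"
    and qt: "qtree L (arr s aQ) (arr s aPar) sz" and sz: "sz \<le> Suc k" and g0: "sz \<le> k ==> good L (arr s aQ) (arr s aPar) sz"
    using E by (auto simp: est_def)
  have wf: "wf_lists L" using R by (simp add: rep_def)
  have kW: "Suc k < W" using W by simp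
  define Q where "Q = (\<lambda>s' :: store. leaf L sz s s' \<or> (\<exists>sz1 v ds. branched L sz s sz1 v ds s'))"
  have tidyI: "tidy sz s'" if "qtree L (arr s' aQ) (arr s' aPar) z" "sz \<le> z" "z \<le> Suc k" "var s' vS = z" "marks (arr s' aQ) z z (arr s' aVis)" for z s'
    using that qtree_bound[OF wf that(1)] unfolding tidy_def qtree_def by (intro exI[of _ z]) simp
  show ?thesis
  proof (cases "sz \<le> k")
    case False
    then have sk: "sz = Suc k" using sz by simp
    have "WP output_com Q (tick s)"
    proof (rule wp_frame[OF wp_output[of "tick s" L]])
      show "rep (arr (tick s) aG) L" "qtree L (arr (tick s) aQ) (arr (tick s) aPar) (Suc k)" "var (tick s) vK = k" using R qt K sk by simp_all
      fix s' :: store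
      assume a: "(\<exists>ws. emitted s' = emitted (tick s) @ ws \<and> lists_tree ws (tedges (arr (tick s) aQ) (arr (tick s) aPar) (Suc k))) \<and>
        var s' vMode = 0 \<and> ticks s' \<le> ticks (tick s) + 10 * Suc k"
        and fr: "\<And>r. r \<notin> mods output_com ==> var s' r = var (tick s) r" "\<And>a. a \<notin> amods output_com ==> arr s' a = arr (tick s) a"
      have ar: "arr s' = arr s" using fr(2) by (auto simp: output_com_def)
      have vr: "var s' vP = var s vP" "var s' vK = k" "var s' vS = sz" using fr(1)[of vP] fr(1)[of vK] fr(1)[of vS] K S by (simp_all add: output_com_def)
      have "keeps sz s s'" using vr by (simp add: keeps_def ar)
      moreover have "tidy sz s'" using tidyI[of s' sz] qt mk vr sz by (simp add: ar)
      ultimately have "leaf L sz s s'"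
        unfolding leaf_def using a ar Sol_full[OF wf qt[unfolded sk]] sk by auto
      then show "Q s'" by (simp add: Q_def)
    qed
    then show ?thesis unfolding macro_com_def Q_def[symmetric] using sk S K kW by simp
  next
    case True
    note g = g0[OF True]
    note G = goodD[OF wf g]
    let ?q0 = "arr s aQ" let ?par0 = "arr s aPar"
    define C where "C = Cond (Minus (Plus (Var vK) (Lit 1)) (Var vS)) branch_com output_com"
    have "WP bfs_com (WP (Cond (Var vF) (path_com ;; clear_com ;; phase2_com ;; C) (output_com ;; clear_com)) Q) (tick s)"
    proof (rule wp_frame[OF wp_bfs[of "tick s" L sz]])
      show "rep (arr (tick s) aG) L" "good L (arr (tick s) aQ) (arr (tick s) aPar) sz" "sz \<le> k" "marks (arr (tick s) aQ) sz sz (arr (tick s) aVis)"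
        "var (tick s) vS = sz" "var (tick s) vK = k" using R g True mk S K by simp_all
      fix s1 :: store
      assume a: "ticks s1 \<le> ticks (tick s) + 70 * Suc k \<and>
         ((var s1 vF = 0 \<and> bfs_inv L sz (arr (tick s) aQ) (arr (tick s) aPar) (var s1 vT) {} s1) \<or>
          (var s1 vF = 1 \<and> bfs_found L sz (arr (tick s) aQ) (arr (tick s) aPar) s1))"
        and fr: "\<And>r. r \<notin> mods bfs_com ==> var s1 r = var (tick s) r" "\<And>a. a \<notin> amods bfs_com ==> arr s1 a = arr (tick s) a"
        and em: "silent bfs_com ==> emitted s1 = emitted (tick s)"
      have v1: "var s1 vP = var s vP" "var s1 vK = k" "var s1 vS = sz" "var s1 vMode = 1"
        using fr(1)[of vP] fr(1)[of vK] fr(1)[of vS] fr(1)[of vMode] K S v by (simp_all add: bfs_com_def bfs_visit_def)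
      have a1: "arr s1 aG = arr s aG" "arr s1 aTx = arr s aTx" "arr s1 aTs = arr s aTs"
        using fr(2)[of aG] fr(2)[of aTx] fr(2)[of aTs] by (simp_all add: bfs_com_def bfs_visit_def)
      have e1: "emitted s1 = emitted s" using em by (simp add: bfs_com_def bfs_visit_def)
      have tk1: "ticks s1 \<le> ticks s + 70 * Suc k + 1" using a by simp
      from a consider "var s1 vF = 0" "bfs_inv L sz ?q0 ?par0 (var s1 vT) {} s1" | "var s1 vF = 1" "bfs_found L sz ?q0 ?par0 s1" by auto
      then show "WP (Cond (Var vF) (path_com ;; clear_com ;; phase2_com ;; C) (output_com ;; clear_com)) Q s1"
      proof cases
        case 1
        note X = Sol_exhausted[OF wf g 1(2)]
        have I: "qtree L (arr s1 aQ) (arr s1 aPar) (Suc k)" "marks (arr s1 aQ) sz (Suc k) (arr s1 aVis)"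
          "\<forall>i<sz. arr s1 aQ i = ?q0 i \<and> arr s1 aPar (?q0 i) = ?par0 (?q0 i)"
          using 1(2) X(1) by (auto simp: bfs_inv_def Let_def)
        have "WP output_com (WP clear_com Q) (tick s1)"
        proof (rule wp_frame[OF wp_output[of "tick s1" L]])
          show "rep (arr (tick s1) aG) L" "qtree L (arr (tick s1) aQ) (arr (tick s1) aPar) (Suc k)" "var (tick s1) vK = k" using R a1 I v1 by simp_all
          fix s2 :: store
          assume b: "(\<exists>ws. emitted s2 = emitted (tick s1) @ ws \<and> lists_tree ws (tedges (arr (tick s1) aQ) (arr (tick s1) aPar) (Suc k))) \<and>
            var s2 vMode = 0 \<and> ticks s2 \<le> ticks (tick s1) + 10 * Suc k"
            and fr: "\<And>r. r \<notin> mods output_com ==> var s2 r = var (tick s1) r" "\<And>a. a \<notin> amods output_com ==> arr s2 a = arr (tick s1) a"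
          have ar: "arr s2 = arr s1" using fr(2) by (auto simp: output_com_def)
          have v2: "var s2 vP = var s vP" "var s2 vK = k" "var s2 vS = sz" "var s2 vT = Suc k"
            using fr(1)[of vP] fr(1)[of vK] fr(1)[of vS] fr(1)[of vT] v1 X(1) by (simp_all add: output_com_def)
          show "WP clear_com Q s2"
          proof (rule wp_frame[OF wp_clear[of "arr s1 aQ" sz "Suc k" s2]])
            show "marks (arr s1 aQ) sz (Suc k) (arr s2 aVis)" "arr s2 aQ = arr s1 aQ" "\<And>i. i < Suc k ==> arr s1 aQ i < n"
              "inj_on (arr s1 aQ) {..<Suc k}" "var s2 vS = sz" "var s2 vT = Suc k" "sz \<le> Suc k" "Suc k \<le> n"
              using I v2 ar sz qtree_bound[OF wf I(1)] by (auto simp: qtree_def)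
            fix s3 :: store
            assume c: "marks (arr s1 aQ) sz sz (arr s3 aVis) \<and> ticks s3 \<le> ticks s2 + 5 * Suc (Suc k)"
              and fr: "\<And>r. r \<notin> mods clear_com ==> var s3 r = var s2 r" "\<And>a. a \<notin> amods clear_com ==> arr s3 a = arr s2 a"
              and em: "silent clear_com ==> emitted s3 = emitted s2"
            have a3: "arr s3 aQ = arr s1 aQ" "arr s3 aPar = arr s1 aPar" "arr s3 aG = arr s aG" "arr s3 aTx = arr s aTx" "arr s3 aTs = arr s aTs"
              using fr(2)[of aQ] fr(2)[of aPar] fr(2)[of aG] fr(2)[of aTx] fr(2)[of aTs] ar a1 by (simp_all add: clear_com_def)
            have v3: "var s3 vP = var s vP" "var s3 vK = k" "var s3 vS = sz" "var s3 vMode = 0"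
              using fr(1)[of vP] fr(1)[of vK] fr(1)[of vS] fr(1)[of vMode] v2 b by (simp_all add: clear_com_def)
            have "keeps sz s s3" unfolding keeps_def using v3 a3 I(3) by simp
            moreover have "tidy sz s3"
              using tidyI[of s3 sz] qtree_le[OF I(1) G(5) sz] v3 a3 c sz by simp
            moreover have "\<exists>ws. emitted s3 = emitted s @ ws \<and> lists_tree ws (tedges (arr s1 aQ) (arr s1 aPar) (Suc k))"
              using b e1 em by (simp add: clear_com_def)
            moreover have "ticks s3 \<le> ticks s + 400 * Suc k" using c b tk1 by simp
            ultimately have "leaf L sz s s3" unfolding leaf_def using v3 a3 X(2) by blast
            then show "Q s3" by (simp add: Q_def)
          qed
        qed
        then show ?thesis using 1(1) by simp
      next
        case 2
        have F: "qtree L (arr s1 aQ) (arr s1 aPar) (var s1 vT)" "sz \<le> var s1 vT" "var s1 vT \<le> Suc (Suc k)"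
          "marks (arr s1 aQ) sz (var s1 vT) (arr s1 aVis)" "\<forall>i<sz. arr s1 aQ i = ?q0 i \<and> arr s1 aPar (?q0 i) = ?par0 (?q0 i)"
          using 2(2) unfolding bfs_found_def Let_def by blast+
        have F': "bfs_found L sz ?q0 ?par0 (tick s1)" using 2(2) by (simp add: bfs_found_def)
        have "WP path_com (WP (clear_com ;; phase2_com ;; C) Q) (tick s1)"
        proof (rule wp_frame[OF wp_path[OF F' G(5)]])
          fix s2 :: store
          assume "\<exists>vs. path_ok L ?q0 (arr (tick s1) aPar) sz vs \<and> var s2 vL = length vs \<and>
            (\<forall>i<length vs. arr s2 aPath i = rev vs ! i) \<and> ticks s2 \<le> ticks (tick s1) + 10 * Suc (Suc k)"
            and fr: "\<And>r. r \<notin> mods path_com ==> var s2 r = var (tick s1) r" "\<And>a. a \<notin> amods path_com ==> arr s2 a = arr (tick s1) a"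
            and em: "silent path_com ==> emitted s2 = emitted (tick s1)"
          then obtain vs where vs: "path_ok L ?q0 (arr s1 aPar) sz vs" "var s2 vL = length vs" "\<forall>i<length vs. arr s2 aPath i = rev vs ! i"
            "ticks s2 \<le> ticks s1 + 1 + 10 * Suc (Suc k)" by auto
          have a2: "arr s2 aQ = arr s1 aQ" "arr s2 aPar = arr s1 aPar" "arr s2 aG = arr s aG" "arr s2 aTx = arr s aTx" "arr s2 aTs = arr s aTs" "arr s2 aVis = arr s1 aVis"
            using fr(2)[of aQ] fr(2)[of aPar] fr(2)[of aG] fr(2)[of aTx] fr(2)[of aTs] fr(2)[of aVis] a1 by (simp_all add: path_com_def)
          have v2: "var s2 vP = var s vP" "var s2 vK = k" "var s2 vS = sz" "var s2 vMode = 1" "var s2 vT = var s1 vT"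
            using fr(1)[of vP] fr(1)[of vK] fr(1)[of vS] fr(1)[of vMode] fr(1)[of vT] v1 by (simp_all add: path_com_def)
          have e2: "emitted s2 = emitted s" using em e1 by (simp add: path_com_def)
          have "WP clear_com (WP (phase2_com ;; C) Q) s2"
          proof (rule wp_frame[OF wp_clear[of "arr s1 aQ" sz "var s1 vT" s2]])
            show "marks (arr s1 aQ) sz (var s1 vT) (arr s2 aVis)" "arr s2 aQ = arr s1 aQ" "\<And>i. i < var s1 vT ==> arr s1 aQ i < n"
              "inj_on (arr s1 aQ) {..<var s1 vT}" "var s2 vS = sz" "var s2 vT = var s1 vT" "sz \<le> var s1 vT" "var s1 vT \<le> n"
              using F v2 a2 qtree_bound[OF wf F(1)] by (auto simp: qtree_def)
            fix s3 :: store
            assume c: "marks (arr s1 aQ) sz sz (arr s3 aVis) \<and> ticks s3 \<le> ticks s2 + 5 * Suc (var s1 vT)"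
              and fr: "\<And>r. r \<notin> mods clear_com ==> var s3 r = var s2 r" "\<And>a. a \<notin> amods clear_com ==> arr s3 a = arr s2 a"
              and em: "silent clear_com ==> emitted s3 = emitted s2"
            have a3: "arr s3 aQ = arr s1 aQ" "arr s3 aPar = arr s1 aPar" "arr s3 aG = arr s aG" "arr s3 aTx = arr s aTx" "arr s3 aTs = arr s aTs" "arr s3 aPath = arr s2 aPath"
              using fr(2)[of aQ] fr(2)[of aPar] fr(2)[of aG] fr(2)[of aTx] fr(2)[of aTs] fr(2)[of aPath] a2 by (simp_all add: clear_com_def)
            have v3: "var s3 vP = var s vP" "var s3 vK = k" "var s3 vS = sz" "var s3 vMode = 1" "var s3 vL = length vs"
              using fr(1)[of vP] fr(1)[of vK] fr(1)[of vS] fr(1)[of vMode] fr(1)[of vL] v2 vs(2) by (simp_all add: clear_com_def)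
            have e3: "emitted s3 = emitted s" using em e2 by (simp add: clear_com_def)
            have tk3: "ticks s3 \<le> ticks s + 110 * Suc k + 17" using c vs(4) tk1 F(3) by simp
            have gc: "good L (arr s3 aQ) (arr s3 aPar) sz" "tedges (arr s3 aQ) (arr s3 aPar) sz = tedges ?q0 ?par0 sz" "arr s3 aQ ` {..<sz} = ?q0 ` {..<sz}"
              using good_cong[OF g, of "arr s3 aQ" "arr s3 aPar"] F(5) a3 by auto
            have q00: "arr s3 aQ 0 = ?q0 0" using F(5) G(5) a3 by simp
            have po: "path_ok L (arr s3 aQ) (arr s3 aPar) sz vs"
            proof -
              have "(\<exists>j<sz. arr s1 aPar (hd vs) \<in> set (L (arr s1 aQ j))) = (\<exists>j<sz. arr s1 aPar (hd vs) \<in> set (L (?q0 j)))" using F(5) by auto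
              then show ?thesis using vs(1) unfolding path_ok_def gc(3) unfolding a3 by simp
            qed
            have "WP phase2_com (WP C Q) s3"
            proof (rule wp_frame[OF wp_phase2[of s3 L sz vs]])
              show "rep (arr s3 aG) L" "good L (arr s3 aQ) (arr s3 aPar) sz" "marks (arr s3 aQ) sz sz (arr s3 aVis)" "var s3 vS = sz" "var s3 vK = k"
                "var s3 vL = length vs" "path_ok L (arr s3 aQ) (arr s3 aPar) sz vs" "\<forall>i<length vs. arr s3 aPath i = rev vs ! i"
                using R a3 gc c v3 po vs(3) by simp_all
              fix s4 :: store
              assume "\<exists>sz' v. decided L (arr s3 aQ) (arr s3 aPar) sz sz' v s4 \<and>
                 ticks s4 \<le> ticks s3 + 200 * Suc k + 18 * inc_count L (arr s4 aQ) (arr s3 aPar) sz' v"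
                and fr: "\<And>r. r \<notin> mods phase2_com ==> var s4 r = var s3 r" "\<And>a. a \<notin> amods phase2_com ==> arr s4 a = arr s3 a"
                and em: "silent phase2_com ==> emitted s4 = emitted s3"
              then obtain sz1 v where D: "decided L (arr s3 aQ) (arr s3 aPar) sz sz1 v s4"
                "ticks s4 \<le> ticks s3 + 200 * Suc k + 18 * inc_count L (arr s4 aQ) (arr s3 aPar) sz1 v" by blast
              have a4: "arr s4 aPar = arr s3 aPar" "arr s4 aG = arr s aG" "arr s4 aTx = arr s aTx" "arr s4 aTs = arr s aTs"
                using fr(2)[of aPar] fr(2)[of aG] fr(2)[of aTx] fr(2)[of aTs] a3
                by (simp_all add: phase2_com_def copy_com_def force_com_def explore_com_def explore_visit_def clear2_com_def)
              have v4: "var s4 vP = var s vP" "var s4 vK = k" "var s4 vMode = 1"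
                using fr(1)[of vP] fr(1)[of vK] fr(1)[of vMode] v3
                by (simp_all add: phase2_com_def copy_com_def force_com_def explore_com_def explore_visit_def clear2_com_def)
              have e4: "emitted s4 = emitted s" using em e3
                by (simp add: phase2_com_def copy_com_def force_com_def explore_com_def explore_visit_def clear2_com_def)
              have D': "sz \<le> sz1" "\<forall>i<sz. arr s4 aQ i = arr s3 aQ i" "good L (arr s4 aQ) (arr s4 aPar) sz1" "marks (arr s4 aQ) sz1 sz1 (arr s4 aVis)" "var s4 vS = sz1"
                "v < n" "v \<notin> arr s4 aQ ` {..<sz1}" "\<exists>j<sz1. arr s4 aPar v \<in> set (L (arr s4 aQ j))" "nb (arr s4 aPar v) = v"
                "Sol (edges L) k (?q0 0) (tedges (arr s4 aQ) (arr s4 aPar) sz1) = Sol (edges L) k (?q0 0) (tedges ?q0 ?par0 sz)"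
                "Suc k \<le> card (reach (edges L - {ed (arr s4 aPar v)}) (arr s4 aQ ` {..<sz1}))"
                using D(1) gc(2) q00 unfolding decided_def a4(1) by auto
              have q40: "arr s4 aQ 0 = ?q0 0" using D'(2) q00 G(5) by simp
              have pre: "\<forall>i<sz. arr s4 aQ i = ?q0 i \<and> arr s4 aPar (?q0 i) = ?par0 (?q0 i)" using D'(2) F(5) a3 a4 by simp
              have tk4: "ticks s4 \<le> ticks s + 310 * Suc k + 17 + 18 * inc_count L (arr s4 aQ) (arr s4 aPar) sz1 v" using D(2) tk3 a4 by simp
              have sz1: "sz1 \<le> Suc k" using D'(3) by (simp add: good_def)
              show "WP C Q s4"
              proof (cases "sz1 \<le> k")
                case s1k: False
                then have sk: "sz1 = Suc k" using sz1 by simp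
                have qt4: "qtree L (arr s4 aQ) (arr s4 aPar) (Suc k)" using D'(3) sk by (simp add: good_def)
                have "WP output_com Q (tick s4)"
                proof (rule wp_frame[OF wp_output[of "tick s4" L]])
                  show "rep (arr (tick s4) aG) L" "qtree L (arr (tick s4) aQ) (arr (tick s4) aPar) (Suc k)" "var (tick s4) vK = k" using R qt4 v4 a4 by simp_all
                  fix s' :: store
                  assume a: "(\<exists>ws. emitted s' = emitted (tick s4) @ ws \<and> lists_tree ws (tedges (arr (tick s4) aQ) (arr (tick s4) aPar) (Suc k))) \<and>
                    var s' vMode = 0 \<and> ticks s' \<le> ticks (tick s4) + 10 * Suc k"
                    and fr: "\<And>r. r \<notin> mods output_com ==> var s' r = var (tick s4) r" "\<And>a. a \<notin> amods output_com ==> arr s' a = arr (tick s4) a"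
                  have ar: "arr s' = arr s4" using fr(2) by (auto simp: output_com_def)
                  have vr: "var s' vP = var s vP" "var s' vK = k" "var s' vS = sz1" using fr(1)[of vP] fr(1)[of vK] fr(1)[of vS] v4 D'(5) by (simp_all add: output_com_def)
                  have "keeps sz s s'" unfolding keeps_def ar using vr pre a4 by simp
                  moreover have "tidy sz s'" using tidyI[of s' sz1] qt4 D'(1,4) vr sk by (simp add: ar)
                  moreover have "Sol (edges L) k (?q0 0) (tedges ?q0 ?par0 sz) = {tedges (arr s4 aQ) (arr s4 aPar) (Suc k)}"
                    using Sol_full[OF wf qt4] D'(10) sk q40 by simp
                  moreover have "\<exists>ws. emitted s' = emitted s @ ws \<and> lists_tree ws (tedges (arr s4 aQ) (arr s4 aPar) (Suc k))" using a e4 by simp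
                  moreover have "ticks s' \<le> ticks s + 400 * Suc k" using a tk4 s1k by (simp add: inc_count_def)
                  moreover have "var s' vMode = 0" "arr s' aG = arr s aG" using a a4(2) by (simp_all add: ar)
                  ultimately have "leaf L sz s s'" unfolding leaf_def by blast
                  then show "Q s'" by (simp add: Q_def)
                qed
                then show ?thesis unfolding C_def using sk D'(5) v4 kW by simp
              next
                case s1k: True
                have "WP branch_com Q (tick s4)"
                proof (rule wp_frame[OF wp_branch[of "tick s4" L "arr s3 aQ" sz sz1 v]])
                  show "rep (arr (tick s4) aG) L" "decided L (arr s3 aQ) (arr (tick s4) aPar) sz sz1 v (tick s4)" "sz1 \<le> k"
                    "var (tick s4) vK = k" "var (tick s4) vMode = 1" "var (tick s4) vP + card (edges L) \<le> m + sz"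
                    using R a4 v4 D(1) s1k P by (simp_all add: decided_def)
                  fix s' :: store
                  assume "\<exists>ds. br_post L sz1 v ds (arr (tick s4) aG) (arr (tick s4) aQ) (arr (tick s4) aPar) (arr (tick s4) aTx) (arr (tick s4) aTs)
                      (var (tick s4) vP) (ticks (tick s4)) s'"
                    and em: "silent branch_com ==> emitted s' = emitted (tick s4)"
                  then obtain ds where "br_post L sz1 v ds (arr s aG) (arr s4 aQ) (arr s4 aPar) (arr s aTx) (arr s aTs) (var s vP) (Suc (ticks s4)) s'"
                    using a4 v4(1) by auto
                  note b = this[unfolded br_post_def Let_def]
                  define q' par' where qp: "q' = (arr s4 aQ)(sz1 := v)" "par' = arr s4 aPar"
                  have gq: "good L q' par' sz1" "tedges q' par' sz1 = tedges (arr s4 aQ) par' sz1" "q' ` {..<sz1} = arr s4 aQ ` {..<sz1}"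
                    using good_cong[OF D'(3), of q' par'] by (auto simp: qp)
                  have "0 < sz1" using G(5) D'(1) by simp
                  then have q'0: "q' 0 = ?q0 0" using q40 by (simp add: qp)
                  have ic: "inc_count L (arr s4 aQ) par' sz1 v = inc_count L q' par' sz1 v" unfolding inc_count_def gq(2) q'0 q40 ..
                  have deg: "(if Suc sz1 \<le> k then length (L v) else 0) \<le> 2 * Suc k + inc_count L q' par' sz1 v"
                  proof (cases "Suc sz1 \<le> k")
                    case True
                    obtain j where j: "j < sz1" "par' v \<in> set (L (arr s4 aQ j))" using D'(8) by (auto simp: qp)
                    have "length (L (nb (par' v))) \<le> 2 * Suc k + card (Sol (edges L) k (arr s4 aQ 0) (insert (ed (par' v)) (tedges (arr s4 aQ) par' sz1)))"
                      using degree_count[OF wf D'(3)[folded qp(2)] j] D'(7,9) True by (simp add: qp(2))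
                    then show ?thesis using True D'(9) q'0 q40 gq(2) by (simp add: inc_count_def qp(2))
                  qed simp
                  have e': "emitted s' = emitted s" using em e4 by (simp add: branch_com_def prune_com_def prune_visit_def delete_com_def unlink_com_def)
                  have s': "arr s' aQ = q'" "arr s' aPar = par'" using b by (auto simp: qp)
                  have pre': "\<forall>i<sz. q' i = ?q0 i \<and> par' (q' i) = ?par0 (q' i)" using pre D'(1) by (simp add: qp)
                  have "branched L sz s sz1 v ds s'"
                    unfolding branched_def s' Let_def
                  proof (intro conjI)
                    show "q' sz1 = v" by (simp add: qp)
                    show "\<exists>j<sz1. par' v \<in> set (L (q' j))" using D'(8) by (auto simp: qp)
                    show "v \<notin> q' ` {..<sz1}" using D'(7) gq(3) by simp
                    show "nb (par' v) = v" using D'(9) by (simp add: qp)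
                    show "Sol (edges L) k (q' 0) (tedges q' par' sz1) = Sol (edges L) k (q' 0) (tedges ?q0 ?par0 sz)"
                      using D'(10) gq(2) q'0 by (simp add: qp(2))
                    show "Suc k \<le> card (reach (edges L - {ed (par' v)}) (q' ` {..<sz1}))" using D'(11) gq(3) by (simp add: qp(2))
                    show "length ds \<le> 2 * Suc k + inc_count L q' par' sz1 v" using b deg by linarith
                    show "ticks s' \<le> ticks s + 400 * Suc k + 36 * inc_count L q' par' sz1 v"
                    proof -
                      have "ticks s' \<le> Suc (ticks s4) + 13 + 18 * (if Suc sz1 \<le> k then length (L v) else 0)" using b by blast
                      then show ?thesis using deg tk4 unfolding qp(2)[symmetric] ic by simp
                    qed
                  qed (use b D'(1,6) s1k gq pre' e' in \<open>auto simp: qp\<close>)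
                  then have "Q s'" unfolding Q_def by blast
                  then show "Q s'" .
                qed
                then show ?thesis unfolding C_def using s1k D'(5) v4 kW by simp
              qed
            qed
            then show "WP (phase2_com ;; C) Q s3" by simp
          qed
          then show "WP (clear_com ;; phase2_com ;; C) Q s2" by simp
        qed
        then show ?thesis using 2(1) by simp
      qed
    qed
    then show ?thesis unfolding macro_com_def Q_def[symmetric] C_def[symmetric] using True S K kW by simp
  qed
qed

end

definition truncate_com :: com where
  "truncate_com = While (Minus (Var vS) (Arr aTs (Var vP)))
     (dec vS ;; Write aVis (Arr aQ (Var vS)) (Lit 0))"

text \<open>Tree sizes are positive, so \<open>0\<close> can mark entries of plain deletions, which
  are restored. An entry with a size means that the include branch is done: the tree is truncated,
  the same entry becomes one for the deletion of its edge, and the exclude branch starts. With an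
  empty stack the search ends.\<close>

definition back_com :: com where
  "back_com =
     Cond (Var vP)
       (dec vP ;; Assign vX (Arr aTx (Var vP)) ;;
        Cond (Arr aTs (Var vP))
          (truncate_com ;; Write aTs (Var vP) (Lit 0) ;; inc vP ;; delete_com vX ;; Assign vMode (Lit 1))
          (restore_com vX))
       (Assign vGo (Lit 0))"

definition enum_com :: com where
  "enum_com = While (Var vGo) (Cond (Var vMode) macro_com back_com)"

lemmas enum_com_defs =
  enum_com_def back_com_def truncate_com_def restore_com_def relink_com_def macro_com_defs

context machine
begin

section \<open>Backtracking\<close>

lemma enum_step:
  assumes "var s vGo = 1" "WP (if var s vMode = 0 then back_com else macro_com) (WP enum_com Q) (tick (tick s))"
  shows "WP enum_com Q s"
  unfolding enum_com_def
proof (rule wp_While_unfold)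
  show "WP (Cond (Var vMode) macro_com back_com) (WP (While (Var vGo) (Cond (Var vMode) macro_com back_com)) Q) (tick s)"
    using assms by (simp add: enum_com_def split: if_splits)
qed (use assms in auto)

text \<open>The search is one flat loop, so its phases are stated in continuation style: what is
  provable for the loop started after the phase holds for the loop started before it.\<close>

lemma back_restore:
  assumes s: "var s vGo = 1" "var s vMode = 0" "var s vP = Suc p" "arr s aTx p = x" "arr s aTs p = 0" "p < n + m + 1"
    and M: "rep M L" "v < n" "x \<in> set (L v)" "arr s aG = delete M x"
    and next_state: "\<And>s'. arr s' = (arr s)(aG := M) ==> var s' vP = p ==>
      (\<And>r. r \<notin> {vP, vX, vZ} ==> var s' r = var s r) ==> emitted s' = emitted s ==> ticks s' \<le> ticks s + 15 ==> WP enum_com Q s'"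
  shows "WP enum_com Q s"
proof (rule enum_step[OF s(1)])
  have b: "p < Z" "1 < W" using s(6) Z W by auto
  define C where "C = restore_com vX"
  let ?s = "s\<lparr>var := (var s)(vP := p, vX := x), ticks := Suc (Suc (Suc (Suc (Suc (Suc (ticks s))))))\<rparr>"
  have "WP C (WP enum_com Q) ?s"
    unfolding C_def
  proof (rule wp_frame[OF wp_restore[OF M(1,2) _ M(3)]])
    show "var ?s vX = x" "vX \<noteq> vZ" "arr ?s aG = delete M x" using M by simp_all
    fix s' :: store assume a: "arr s' = (arr ?s)(aG := M) \<and> ticks s' \<le> ticks ?s + 9" and fr: "\<And>r. r \<notin> mods (restore_com vX) ==> var s' r = var ?s r"
      and em: "silent (restore_com vX) ==> emitted s' = emitted ?s"
    show "WP enum_com Q s'"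
    proof (rule next_state)
      show "var s' vP = p" using fr[of vP] by (simp add: restore_com_def relink_com_def)
      show "var s' r = var s r" if "r \<notin> {vP, vX, vZ}" for r using fr[of r] that by (simp add: restore_com_def relink_com_def)
      show "emitted s' = emitted s" using em by (simp add: restore_com_def relink_com_def)
    qed (use a in auto)
  qed
  then show "WP (if var s vMode = 0 then back_com else macro_com) (WP enum_com Q) (tick (tick s))"
    unfolding back_com_def C_def[symmetric] using s b W by simp
qed

lemma back_restores:
  assumes M: "rep M L" "v < n" "del_seq M L v ds"
    and s: "var s vGo = 1" "var s vMode = 0" "var s vP = p + length ds" "p + length ds \<le> n + m + 1"
      "\<forall>i<length ds. arr s aTx (p + i) = ds ! i \<and> arr s aTs (p + i) = 0" "arr s aG = foldl delete M ds"
    and next_state: "\<And>s'. arr s' = (arr s)(aG := M) ==> var s' vP = p ==>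
      (\<And>r. r \<notin> {vP, vX, vZ} ==> var s' r = var s r) ==> emitted s' = emitted s ==> ticks s' \<le> ticks s + 15 * length ds ==> WP enum_com Q s'"
  shows "WP enum_com Q s"
  using M(3) s next_state
proof (induction ds arbitrary: s rule: rev_induct)
  case Nil
  show ?case by (rule Nil.prems(8)) (use Nil.prems in \<open>auto simp: fun_upd_idem\<close>)
next
  case (snoc y ds)
  have ds: "del_seq M L v ds" using snoc.prems(1) by (auto simp: del_seq_def nth_append split: if_splits)
  have y: "y \<in> set (foldl del L ds v)" using snoc.prems(1) by (auto simp: del_seq_def dest!: spec[of _ "length ds"])
  have rp: "rep (foldl delete M ds) (foldl del L ds)" using del_seq_edges[OF M(1,2) ds] by blast
  have last: "arr s aTx (p + length ds) = y" "arr s aTs (p + length ds) = 0" using snoc.prems(6) by (auto dest!: spec[of _ "length ds"])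
  show ?case
  proof (rule back_restore[OF snoc.prems(2,3) _ last _ rp M(2) y])
    show "var s vP = Suc (p + length ds)" "p + length ds < n + m + 1" "arr s aG = delete (foldl delete M ds) y" using snoc.prems by auto
    fix s' :: store
    assume s': "arr s' = (arr s)(aG := foldl delete M ds)" "var s' vP = p + length ds" "\<And>r. r \<notin> {vP, vX, vZ} ==> var s' r = var s r"
      "emitted s' = emitted s" "ticks s' \<le> ticks s + 15"
    show "WP enum_com Q s'"
    proof (rule snoc.IH[OF ds])
      show "var s' vGo = 1" "var s' vMode = 0" using s'(3)[of vGo] s'(3)[of vMode] snoc.prems by auto
      show "\<forall>i<length ds. arr s' aTx (p + i) = ds ! i \<and> arr s' aTs (p + i) = 0"
      proof (intro allI impI)
        fix i assume "i < length ds"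
        then show "arr s' aTx (p + i) = ds ! i \<and> arr s' aTs (p + i) = 0"
          using snoc.prems(6) s'(1) by (auto simp: nth_append dest!: spec[of _ i])
      qed
      fix s2 :: store
      assume s2: "arr s2 = (arr s')(aG := M)" "var s2 vP = p" "\<And>r. r \<notin> {vP, vX, vZ} ==> var s2 r = var s' r" "emitted s2 = emitted s'" "ticks s2 \<le> ticks s' + 15 * length ds"
      show "WP enum_com Q s2" by (rule snoc.prems(8)) (use s' s2 in auto)
    qed (use s' snoc.prems in auto)
  qed
qed

lemma wp_truncate:
  assumes t: "tidy sz s" "arr s aTs (var s vP) = sz" "var s vP < Z"
  shows "WP truncate_com (\<lambda>s'. var s' vS = sz \<and> marks (arr s aQ) sz sz (arr s' aVis) \<and> ticks s' \<le> ticks s + 3 * n + 1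
     \<and> ticks s' \<le> ticks s + 3 * var s vS + 1) s"
proof -
  obtain sz' where sz': "sz \<le> sz'" "sz' \<le> n" "var s vS = sz'" "marks (arr s aQ) sz' sz' (arr s aVis)"
     "inj_on (arr s aQ) {..<sz'}" "\<forall>i<sz'. arr s aQ i < n" using t(1) by (auto simp: tidy_def)
  define q where "q = arr s aQ"
  let ?I = "\<lambda>l s'. sz + l \<le> sz' \<and> var s' vS = sz + l \<and> var s' vP = var s vP \<and> arr s' aTs = arr s aTs \<and> arr s' aQ = q \<and> marks q (sz + l) (sz + l) (arr s' aVis) \<and>
    ticks s' + 3 * l \<le> ticks s + 3 * (sz' - sz)"
  show ?thesis
    unfolding truncate_com_def q_def[symmetric]
  proof (rule wp_While[where I = ?I and f = id])
    show "?I (sz' - sz) s" using sz' by (simp add: q_def)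
  next
    fix l and s' :: store assume I: "?I l s'" and e: "ev (Minus (Var vS) (Arr aTs (Var vP))) s' = 0"
    then show "var (tick s') vS = sz \<and> marks q sz sz (arr (tick s') aVis) \<and> ticks (tick s') \<le> ticks s + 3 * n + 1 \<and> ticks (tick s') \<le> ticks s + 3 * var s vS + 1"
      using t(2) sz' by auto
  next
    fix l and s' :: store assume I: "?I l s'" and e: "ev (Minus (Var vS) (Arr aTs (Var vP))) s' \<noteq> 0"
    have l: "0 < l" using e I t(2) by simp
    then obtain l' where l': "l = Suc l'" by (cases l) auto
    have qn: "q (sz + l') < n" "sz + l' < n" using sz' I l' by (auto simp: q_def)
    have nm: "q (sz + l') \<notin> q ` {..<sz + l'}"
    proof
      assume "q (sz + l') \<in> q ` {..<sz + l'}"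
      then obtain i where "i < sz + l'" "q (sz + l') = q i" by blast
      then show False using inj_onD[OF sz'(5), of "sz + l'" i] I l' by (auto simp: q_def)
    qed
    have "{..<sz + l} = insert (sz + l') {..<sz + l'}" using l' by auto
    then have "marks q (sz + l') (sz + l') ((arr s' aVis)(q (sz + l') := 0))"
      using I nm unfolding marks_def by auto
    then show "WP (dec vS ;; Write aVis (Arr aQ (Var vS)) (Lit 0)) (\<lambda>s'. \<exists>a'. ?I a' s' \<and> id a' < id l) (tick s')"
      using I l' vertex_less[OF qn(1)] vertex_less[OF qn(2)] W by (auto intro!: exI[of _ l'])
  qed (use t(3) in auto)
qed

lemma back_exclude:
  assumes s: "var s vGo = 1" "var s vMode = 0" "var s vP = Suc p" "arr s aTx p = x" "arr s aTs p = sz" "0 < sz" "p < n + m + 1" "tidy sz s"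
    and M: "rep (arr s aG) L" "v < n" "x \<in> set (L v)"
    and next_state: "\<And>s'. arr s' aG = delete (arr s aG) x ==> arr s' aQ = arr s aQ ==> arr s' aPar = arr s aPar ==>
      arr s' aTx = arr s aTx ==> arr s' aTs = (arr s aTs)(p := 0) ==> marks (arr s aQ) sz sz (arr s' aVis) ==>
      var s' vP = Suc p ==> var s' vS = sz ==> var s' vMode = 1 ==> var s' vGo = 1 ==> var s' vK = var s vK ==>
      emitted s' = emitted s ==> ticks s' \<le> ticks s + 30 * Suc k ==> WP enum_com Q s'"
  shows "WP enum_com Q s"
proof (rule enum_step[OF s(1)])
  have b: "p < Z" "Suc p < W" "1 < W" using s(7) Z W by auto
  have vS: "var s vS \<le> Suc k" using s(8) by (auto simp: tidy_def)
  let ?R = "WP (Write aTs (Var vP) (Lit 0) ;; inc vP ;; delete_com vX ;; Assign vMode (Lit 1)) (WP enum_com Q)"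
  let ?s = "s\<lparr>var := (var s)(vP := p, vX := x), ticks := Suc (Suc (Suc (Suc (Suc (Suc (ticks s))))))\<rparr>"
  have "WP truncate_com ?R ?s"
  proof (rule wp_frame[OF wp_truncate[of sz ?s]])
    show "tidy sz ?s" "arr ?s aTs (var ?s vP) = sz" "var ?s vP < Z" using s b by (simp_all add: tidy_def)
    fix s1 :: store
    assume a: "var s1 vS = sz \<and> marks (arr ?s aQ) sz sz (arr s1 aVis) \<and> ticks s1 \<le> ticks ?s + 3 * n + 1 \<and> ticks s1 \<le> ticks ?s + 3 * var ?s vS + 1"
      and fr: "\<And>r. r \<notin> mods truncate_com ==> var s1 r = var ?s r" "\<And>a. a \<notin> amods truncate_com ==> arr s1 a = arr ?s a"
      and em: "silent truncate_com ==> emitted s1 = emitted ?s"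
    have v1: "var s1 vP = p" "var s1 vX = x" "var s1 vGo = 1" "var s1 vK = var s vK"
      using fr(1)[of vP] fr(1)[of vX] fr(1)[of vGo] fr(1)[of vK] s by (simp_all add: truncate_com_def)
    have a1: "arr s1 aG = arr s aG" "arr s1 aQ = arr s aQ" "arr s1 aPar = arr s aPar" "arr s1 aTx = arr s aTx" "arr s1 aTs = arr s aTs"
      using fr(2)[of aG] fr(2)[of aQ] fr(2)[of aPar] fr(2)[of aTx] fr(2)[of aTs] by (simp_all add: truncate_com_def)
    have e1: "emitted s1 = emitted s" using em by (simp add: truncate_com_def)
    define s2 where "s2 = s1\<lparr>arr := (arr s1)(aTs := (arr s1 aTs)(p := 0)), var := (var s1)(vP := Suc p), ticks := Suc (Suc (ticks s1))\<rparr>"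
    have s2: "arr s2 aG = arr s aG" "var s2 vX = x" "arr s2 aQ = arr s aQ" "arr s2 aPar = arr s aPar" "arr s2 aTx = arr s aTx" "arr s2 aTs = (arr s aTs)(p := 0)"
      "arr s2 aVis = arr s1 aVis" "var s2 vP = Suc p" "var s2 vGo = 1" "var s2 vK = var s vK" "var s2 vS = sz" "emitted s2 = emitted s" "ticks s2 = ticks s1 + 2"
      using v1 a1 e1 a by (simp_all add: s2_def)
    have "WP (delete_com vX) (WP (Assign vMode (Lit 1)) (WP enum_com Q)) s2"
    proof (rule wp_frame[OF wp_delete[of s2 L v vX x]])
      show "rep (arr s2 aG) L" "v < n" "var s2 vX = x" "x \<in> set (L v)" "vX \<noteq> vZ" using M s2 by simp_all
      fix s3 :: store
      assume c: "arr s3 = (arr s2)(aG := delete (arr s2 aG) x) \<and> ticks s3 \<le> ticks s2 + 9"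
        and fr: "\<And>r. r \<notin> mods (delete_com vX) ==> var s3 r = var s2 r" and em: "silent (delete_com vX) ==> emitted s3 = emitted s2"
      let ?s4 = "s3\<lparr>var := (var s3)(vMode := 1), ticks := Suc (ticks s3)\<rparr>"
      have v3: "var s3 vP = Suc p" "var s3 vGo = 1" "var s3 vK = var s vK" "var s3 vS = sz"
        using fr[of vP] fr[of vGo] fr[of vK] fr[of vS] s2 by (simp_all add: delete_com_def unlink_com_def)
      have e3: "emitted s3 = emitted s" using em s2 by (simp add: delete_com_def unlink_com_def)
      have "WP enum_com Q ?s4"
        by (rule next_state) (use c s2 v3 e3 a vS in auto)
      then show "WP (Assign vMode (Lit 1)) (WP enum_com Q) s3" using b by simp
    qed
    then show "?R s1" using v1 b W unfolding s2_def by simp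
  qed
  then show "WP (if var s vMode = 0 then back_com else macro_com) (WP enum_com Q) (tick (tick s))"
    unfolding back_com_def using s b W by simp
qed

text \<open>The two children leave \<open>600 * K\<close> for their parent, since
  \<open>(2 * Ni - 1) + (2 * Ne - 1)\<close> is one below \<open>2 * (Ni + Ne) - 1\<close>, and the
  include child, having one edge more, releases \<open>60 * Ni\<close>. This covers the branching:
  \<open>51\<close> is \<open>36\<close> for the node itself plus \<open>15\<close> for restoring
  each deleted edge.\<close>

lemma bound_arith:
  fixes K Ni Ne a c :: nat
  assumes "0 < K" "0 < Ni" "0 < Ne" "Suc a \<le> c"
  shows "480 * K + 51 * Ni + 17 + (600 * K * (2 * Ni - 1) + 60 * a * Ni) + (600 * K * (2 * Ne - 1) + 60 * Suc a * Ne)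
    \<le> 600 * K * (2 * (Ni + Ne) - 1) + 60 * c * (Ni + Ne)"
proof -
  obtain i e where ie: "Ni = Suc i" "Ne = Suc e" using assms by (metis gr0_implies_Suc)
  have "Suc a * (Ni + Ne) \<le> c * (Ni + Ne)" using assms(4) by (rule mult_le_mono1)
  then have c: "60 * (Suc a * (Ni + Ne)) \<le> 60 * c * (Ni + Ne)" by simp
  have "480 * K + 51 * Ni + 17 + (600 * K * (2 * Ni - 1) + 60 * a * Ni) + (600 * K * (2 * Ne - 1) + 60 * Suc a * Ne)
    \<le> 600 * K * (2 * (Ni + Ne) - 1) + 60 * (Suc a * (Ni + Ne))"
    using assms(1) unfolding ie by (simp add: algebra_simps)
  then show ?thesis using c by linarith
qed

lemma foldl_del_qtree:
  assumes qt: "qtree L q par l" and "\<And>i y. 0 < i ==> i < l ==> y \<in> set ds ==> par (q i) \<noteq> y \<and> par (q i) \<noteq> tw y"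
  shows "qtree (foldl del L ds) q par l"
  unfolding qtree_def
proof (intro conjI allI impI)
  fix i assume i: "0 < i" "i < l"
  then obtain j where "j < i" "par (q i) \<in> set (L (q j))" "nb (par (q i)) = q i" using qt by (auto simp: qtree_def)
  then show "\<exists>j<i. par (q i) \<in> set (foldl del L ds (q j)) \<and> nb (par (q i)) = q i"
    unfolding foldl_del_filter using assms(2)[OF i] by (intro exI[of _ j]) auto
qed (use qt in \<open>auto simp: qtree_def\<close>)

text \<open>The far end of the excluded edge lies outside the tree, so neither of its nodes is a
  parent node of the tree.\<close>

lemma exclude_good:
  assumes wf: "wf_lists L" and g: "good L q par sz" and x: "j < sz" "x \<in> set (L (q j))" "nb x \<notin> q ` {..<sz}"
    and ex: "Suc k \<le> card (reach (edges L - {ed x}) (q ` {..<sz}))"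
  shows "good (del L x) q par sz" "edges (del L x) = edges L - {ed x}"
proof -
  have qt: "qtree L q par sz" using g by (simp add: good_def)
  have qn: "\<And>i. i < sz ==> q i < n" using qt by (auto simp: qtree_def)
  show e: "edges (del L x) = edges L - {ed x}" using wf_del(2)[OF wf qn[OF x(1)] x(2)] .
  have "par (q i) \<noteq> x \<and> par (q i) \<noteq> tw x" if i: "0 < i" "i < sz" for i
  proof -
    obtain j' where j': "j' < i" "par (q i) \<in> set (L (q j'))" "nb (par (q i)) = q i" using qtreeD[OF wf qt i] by blast
    have "par (q i) \<noteq> x" using j'(3) x(3) i by auto
    moreover have "par (q i) \<noteq> tw x"
    proof
      assume "par (q i) = tw x"
      then have "q j' = nb x" using wf_listsD(5)[OF wf qn j'(2)] wf_listsD(6)[OF wf qn[OF x(1)] x(2)] j' i by simp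
      then show False using x(3) j'(1) i by (metis imageI lessThan_iff less_trans)
    qed
    ultimately show ?thesis by simp
  qed
  then have "qtree (del L x) q par sz" using foldl_del_qtree[OF qt, of "[x]"] by simp
  then show "good (del L x) q par sz" using g ex unfolding good_def e by auto
qed

text \<open>Pruning deletes only non-tree edges inside the enlarged tree, so no parent node, no
  completion and no reachable vertex is lost. In an incomplete tree, what remains of the edges from
  \<open>v\<close> into the tree is the parent edge alone.\<close>

lemma include_state:
  assumes wf: "wf_lists L" and R: "rep M L" and g: "good L q par sz" and sz: "sz \<le> k"
    and x: "j < sz" "par v \<in> set (L (q j))" "nb (par v) = v" "v \<notin> q ` {..<sz}" "q sz = v" "v < n"
    and ds: "del_seq M L v ds" "set ds \<subseteq> {y \<in> set (L v). nb y \<in> q ` {..<Suc sz} \<and> tw y \<noteq> par v}"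
      "Suc sz \<le> k ==> {y \<in> set (L v). nb y \<in> q ` {..<Suc sz} \<and> tw y \<noteq> par v} \<subseteq> set ds"
  shows "rep (foldl delete M ds) (foldl del L ds)" "qtree (foldl del L ds) q par (Suc sz)"
    "Suc sz \<le> k ==> good (foldl del L ds) q par (Suc sz)"
    "Sol (edges (foldl del L ds)) k (q 0) (tedges q par (Suc sz)) = Sol (edges L) k (q 0) (insert (ed (par v)) (tedges q par sz))"
    "card (edges L) = card (edges (foldl del L ds)) + length ds"
proof -
  let ?x = "par v" let ?L = "foldl del L ds" let ?V = "q ` {..<Suc sz}"
  have qt: "qtree L q par sz" using g by (simp add: good_def)
  note G = goodD[OF wf g]
  have qn: "\<And>i. i < sz ==> q i < n" using qt by (auto simp: qtree_def)
  note E = del_seq_edges[OF R x(6) ds(1)]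
  show "rep (foldl delete M ds) ?L" "card (edges L) = card (edges ?L) + length ds" using E by blast+
  have eL: "edges ?L = edges L - ed ` set ds" using E by blast
  have wf': "wf_lists ?L" using E by (simp add: rep_def)
  have "q(sz := v) = q" "par(v := ?x) = par" using x(5) by auto
  then have X: "qtree L q par (Suc sz)" "tedges q par (Suc sz) = insert (ed ?x) (tedges q par sz)" "?V = insert v (q ` {..<sz})"
    using qtree_extend[OF wf qt x(4,1,2,3)] by simp_all
  have nodel: "par (q i) \<noteq> y \<and> par (q i) \<noteq> tw y" if i: "0 < i" "i < Suc sz" and y: "y \<in> set ds" for i y
  proof -
    have y': "y \<in> set (L v)" "nb y \<in> ?V" "tw y \<noteq> ?x" using ds(2) y by auto
    note Y = wf_listsD[OF wf x(6) y'(1)]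
    obtain j' where j': "j' < i" "par (q i) \<in> set (L (q j'))" "nb (par (q i)) = q i" using qtreeD[OF wf X(1) i] by blast
    have "j' < sz" using j' i by simp
    then have "q j' \<noteq> v" using x(4) by auto
    then have "par (q i) \<noteq> y" using wf_listsD(5)[OF wf qn[OF \<open>j' < sz\<close>] j'(2)] Y(5) by auto
    moreover have "par (q i) \<noteq> tw y"
    proof
      assume a: "par (q i) = tw y"
      then have "q i = v" using j'(3) Y(5) by simp
      then show False using a y'(3) by simp
    qed
    ultimately show ?thesis by simp
  qed
  show qt': "qtree ?L q par (Suc sz)" using foldl_del_qtree[OF X(1) nodel] .
  have T: "tree (q 0) ?V (tedges q par (Suc sz))" "tedges q par (Suc sz) \<subseteq> edges L" using qtree_tree[OF wf X(1)] by auto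
  \<comment> \<open>A deleted edge cannot be a tree edge: the tree still stands after the deletions,
    and its edges are among the remaining ones.\<close>
  have D: "e \<subseteq> ?V \<and> e \<notin> tedges q par (Suc sz)" if e: "e \<in> ed ` set ds" for e
  proof -
    obtain y where y: "y \<in> set ds" "e = ed y" using e by blast
    then have "e \<subseteq> ?V" using wf_listsD(10)[OF wf x(6), of y] ds(2) X(3) by auto
    moreover have "e \<notin> edges ?L" using eL e by simp
    ultimately show ?thesis using qtree_tree(2)[OF wf' qt'] by blast
  qed
  show "Sol (edges ?L) k (q 0) (tedges q par (Suc sz)) = Sol (edges L) k (q 0) (insert (ed ?x) (tedges q par sz))"
    using Sol_delete_internal[OF T(1) D, where E = "edges L" and k = k] X(2) eL by simp
  show "good ?L q par (Suc sz)" if s: "Suc sz \<le> k"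
    unfolding good_def
  proof (intro conjI ballI impI)
    show "qtree ?L q par (Suc sz)" "Suc sz \<le> Suc k" using qt' s by auto
    show "e \<in> tedges q par (Suc sz)" if e: "e \<in> edges ?L" "e \<subseteq> ?V" for e
    proof (cases "v \<in> e")
      case True
      have eL': "e \<in> edges L" "e \<notin> ed ` set ds" using e eL by auto
      obtain y where y: "y \<in> set (L v)" "e = ed y" using edges_at[OF wf x(6) eL'(1) True] by blast
      have "nb y \<in> ?V" using wf_listsD(10)[OF wf x(6) y(1)] y(2) e(2) by auto
      \<comment> \<open>Pruning removed every other edge from \<open>v\<close> into the
        tree.\<close>
      then have "tw y = ?x" using ds(3)[OF s] y eL'(2) by auto
      then have "e = ed ?x" using wf_listsD(11)[OF wf x(6) y(1)] y(2) by simp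
      then show ?thesis using X(2) by simp
    next
      case False
      then show ?thesis using e eL G(8)[of e] X by auto
    qed
    have "reach (edges L - ed ` set ds) ?V = reach (edges L) ?V" by (rule reach_delete_internal[OF T D])
    moreover have "reach (edges L) (q ` {..<sz}) \<subseteq> reach (edges L) ?V" by (rule reach_mono) (auto simp: X(3))
    moreover have "finite (reach (edges L) ?V)" by (rule finite_reach[OF wf]) auto
    ultimately show "Suc k \<le> card (reach (edges ?L) ?V)" using G(7) card_mono unfolding eL by (metis order_trans)
  qed
qed

section \<open>Joining outputs and enumerating from one root\<close>

lemma enumerates_single: "lists_tree ws T ==> enumerates ws {T}"
  unfolding lists_tree_def enumerates_def by (elim exE, rule_tac x = "[es]" in exI) simp

lemma enumerates_append:
  assumes "enumerates ws F" "enumerates ws' F'" "F \<inter> F' = {}"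
  shows "enumerates (ws @ ws') (F \<union> F')"
proof -
  obtain a b where "ws = concat (map encode_edges a)" "\<forall>es\<in>set a. distinct (listed_edges es)"
    "distinct (map (\<lambda>es. set (listed_edges es)) a)" "set (map (\<lambda>es. set (listed_edges es)) a) = F"
    "ws' = concat (map encode_edges b)" "\<forall>es\<in>set b. distinct (listed_edges es)"
    "distinct (map (\<lambda>es. set (listed_edges es)) b)" "set (map (\<lambda>es. set (listed_edges es)) b) = F'"
    using assms(1,2) unfolding enumerates_def by metis
  then show ?thesis using assms(3) unfolding enumerates_def by (intro exI[of _ "a @ b"]) auto
qed

text \<open>No search node is barren; this is what bounds their number by \<open>2 * N - 1\<close>
  and makes the induction on the number of solutions possible.\<close>

lemma Sol_est_pos:
  assumes "est L sz s"
  shows "0 < card (Sol (edges L) k (arr s aQ 0) (tedges (arr s aQ) (arr s aPar) sz))"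
proof -
  have wf: "wf_lists L" and qt: "qtree L (arr s aQ) (arr s aPar) sz" and sz: "sz \<le> Suc k" using assms by (auto simp: est_def rep_def)
  have fin: "finite (Sol (edges L) k (arr s aQ 0) (tedges (arr s aQ) (arr s aPar) sz))" using finite_Sol[OF finite_edges[OF wf]] .
  show ?thesis
  proof (cases "sz \<le> k")
    case True
    then have g: "good L (arr s aQ) (arr s aPar) sz" using assms by (simp add: est_def)
    note G = goodD[OF wf g]
    obtain V T where "tree (arr s aQ 0) V T" "tedges (arr s aQ) (arr s aPar) sz \<subseteq> T" "T \<subseteq> edges L" "card T = k"
      using Sol_exists[OF G(1,2) _ G(7,6)] G(3) True by auto
    then have "T \<in> Sol (edges L) k (arr s aQ 0) (tedges (arr s aQ) (arr s aPar) sz)" by (auto simp: Sol_def)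
    then show ?thesis using fin by (auto simp: card_gt_0_iff)
  next
    case False
    then have "sz = Suc k" using sz by simp
    then show ?thesis using Sol_full[OF wf] qt by simp
  qed
qed

text \<open>The first summand pays \<open>O(k)\<close> for each of \<open>2 * N - 1\<close> search
  nodes. The second is the potential for charges to solutions: a solution is charged at most once
  for each vertex that the tree can still gain.\<close>

definition bound where
  "bound sz N = 600 * Suc k * (2 * N - 1) + 60 * (Suc k - sz) * N"

definition enum_post where
  "enum_post L sz s s' \<longleftrightarrow> (let F = Sol (edges L) k (arr s aQ 0) (tedges (arr s aQ) (arr s aPar) sz) in
     var s' vMode = 0 \<and> var s' vGo = 1 \<and> arr s' aG = arr s aG \<and> keeps sz s s' \<and> tidy sz s' \<and>
     (\<exists>ws. emitted s' = emitted s @ ws \<and> enumerates ws F) \<and> ticks s' \<le> ticks s + bound sz (card F))"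

lemma macro_frame: "vGo \<notin> mods macro_com"
  by (simp add: macro_com_defs)

text \<open>Induction on the number of solutions: the include and the exclude child both have some,
  so each has fewer than the parent. As \<open>Q\<close> is arbitrary, the loop passes from a fresh
  search node to a state in which all solutions below it are printed and the graph is
  restored.\<close>

lemma enum_correct:
  assumes "est L sz s" "var s vMode = 1" "var s vGo = 1" "var s vP + card (edges L) \<le> m + sz"
    and "\<And>s'. enum_post L sz s s' ==> WP enum_com Q s'"
  shows "WP enum_com Q s"
  using assms
proof (induction "card (Sol (edges L) k (arr s aQ 0) (tedges (arr s aQ) (arr s aPar) sz))" arbitrary: L sz s rule: less_induct)
  case less
  define q0 par0 M p F where d: "q0 = arr s aQ" "par0 = arr s aPar" "M = arr s aG" "p = var s vP" "F = Sol (edges L) k (q0 0) (tedges q0 par0 sz)"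
  note E = less.prems(1) and cont = less.prems(5)
  have R: "rep M L" and qt: "qtree L q0 par0 sz" using E by (auto simp: est_def d)
  have wf: "wf_lists L" using R by (simp add: rep_def)
  have sz0: "0 < sz" using qt by (simp add: qtree_def)
  let ?s = "tick (tick s)"
  have E0: "est L sz ?s" using E by (simp add: est_def)
  have "WP macro_com (WP enum_com Q) ?s"
  proof (rule wp_frame[OF wp_macro[OF E0]])
    show "var ?s vMode = 1" "var ?s vP + card (edges L) \<le> m + sz" using less.prems by simp_all
    fix s1 :: store
    assume out: "leaf L sz ?s s1 \<or> (\<exists>sz1 v ds. branched L sz ?s sz1 v ds s1)"
      and fr: "\<And>r. r \<notin> mods macro_com ==> var s1 r = var ?s r"
    have go1: "var s1 vGo = 1" using fr[OF macro_frame] less.prems(3) by simp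
    from out show "WP enum_com Q s1"
    proof
      assume l: "leaf L sz ?s s1"
      then obtain ws T where ws: "emitted s1 = emitted s @ ws" "lists_tree ws T" "F = {T}" by (auto simp: leaf_def d)
      have "ticks s1 \<le> ticks s + bound sz (card F)" using l ws(3) by (simp add: leaf_def bound_def)
      then have "enum_post L sz s s1"
        using l go1 ws enumerates_single[OF ws(2)] unfolding enum_post_def Let_def
        by (simp add: leaf_def d keeps_def)
      then show ?thesis by (rule cont)
    next
      assume "\<exists>sz1 v ds. branched L sz ?s sz1 v ds s1"
      then obtain sz1 v ds where "branched L sz ?s sz1 v ds s1" by blast
      define q par x where q: "q = arr s1 aQ" "par = arr s1 aPar" "x = par v"
      have B: "sz \<le> sz1" "sz1 \<le> k" "good L q par sz1" "q sz1 = v" "v < n" "v \<notin> q ` {..<sz1}"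
        "\<exists>j<sz1. x \<in> set (L (q j))" "nb x = v" "\<forall>i<sz. q i = q0 i \<and> par (q i) = par0 (q i)"
        "Sol (edges L) k (q 0) (tedges q par sz1) = Sol (edges L) k (q 0) (tedges q0 par0 sz)"
        "Suc k \<le> card (reach (edges L - {ed x}) (q ` {..<sz1}))"
        "del_seq M L v ds" "arr s1 aG = foldl delete M ds"
        "set ds \<subseteq> {y \<in> set (L v). nb y \<in> q ` {..<Suc sz1} \<and> tw y \<noteq> x}"
        "Suc sz1 \<le> k --> {y \<in> set (L v). nb y \<in> q ` {..<Suc sz1} \<and> tw y \<noteq> x} \<subseteq> set ds"
        "marks q (Suc sz1) (Suc sz1) (arr s1 aVis)" "var s1 vS = Suc sz1" "var s1 vK = k"
        "var s1 vP = Suc p + length ds" "arr s1 aTx p = x" "arr s1 aTs p = sz1"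
        "\<forall>i<length ds. arr s1 aTx (Suc p + i) = ds ! i \<and> arr s1 aTs (Suc p + i) = 0"
        "\<forall>i<p. arr s1 aTx i = arr s aTx i \<and> arr s1 aTs i = arr s aTs i" "emitted s1 = emitted s"
        "length ds \<le> 2 * Suc k + inc_count L q par sz1 v" "ticks s1 \<le> ticks s + 2 + 400 * Suc k + 36 * inc_count L q par sz1 v" "var s1 vMode = 1"
        using \<open>branched L sz ?s sz1 v ds s1\<close> unfolding branched_def Let_def q d by auto
      obtain j where j: "j < sz1" "x \<in> set (L (q j))" using B(7) by blast
      have qj: "q j < n" using B(3) j by (auto simp: good_def qtree_def)
      have q00: "q 0 = q0 0" using B(9) sz0 by simp
      define L1 where "L1 = foldl del L ds"
      have jx: "par v \<in> set (L (q j))" "nb (par v) = v" using j B(8) by (auto simp: q)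
      note IS = include_state[OF wf R B(3,2) j(1) jx B(6,4,5,12) B(14)[unfolded q(3)] B(15)[rule_format, unfolded q(3)], folded L1_def q(3)]
      have nx: "nb x \<notin> q ` {..<sz1}" using B(6,8) by simp
      note EG = exclude_good[OF wf B(3) j nx B(11)]
      define Fi Fe where F: "Fi = Sol (edges L) k (q 0) (insert (ed x) (tedges q par sz1))" "Fe = Sol (edges L - {ed x}) k (q 0) (tedges q par sz1)"
      have xS: "ed x \<notin> tedges q par sz1"
      proof
        assume "ed x \<in> tedges q par sz1"
        then have "ed x \<subseteq> q ` {..<sz1}" using tree_facts(6)[OF goodD(1)[OF wf B(3)]] by blast
        then show False using wf_listsD(10)[OF wf qj j(2)] nx by auto
      qed
      have FF: "F = Fi \<union> Fe" "Fi \<inter> Fe = {}" using Sol_split(1)[OF xS, of "edges L" k "q 0"] Sol_split(2)[of "edges L" k "q 0" "ed x"] B(10) q00 by (auto simp: F d)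
      have finF: "finite Fi" "finite Fe" using finite_Sol[OF finite_edges[OF wf]] finite_Sol[OF finite_subset[OF Diff_subset finite_edges[OF wf]]] by (auto simp: F)
      have cF: "card F = card Fi + card Fe" using FF finF by (simp add: card_Un_disjoint)
      have ic: "inc_count L q par sz1 v = card Fi" using B(2) by (simp add: inc_count_def F q)
      have E1: "est L1 (Suc sz1) s1"
        unfolding est_def using IS(1-3) B(2,13,16-18) by (simp add: q)
      have Fi1: "Sol (edges L1) k (arr s1 aQ 0) (tedges (arr s1 aQ) (arr s1 aPar) (Suc sz1)) = Fi" using IS(4) by (simp add: F q)
      have cFi: "0 < card Fi" using Sol_est_pos[OF E1] Fi1 by simp
      have szn: "Suc sz1 \<le> n"
      proof -
        have "wf_lists L1" using IS(1) by (simp add: rep_def)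
        then show ?thesis using qtree_bound[of L1 q par "Suc sz1"] IS(2) by simp
      qed
      have pb: "p + card (edges L) \<le> m + sz" using less.prems(4) by (simp add: d)
      have edx: "ed x \<in> edges L" using ed_in_edges[OF wf qj j(2)] .
      have cE: "0 < card (edges L)" using edx finite_edges[OF wf] by (auto simp: card_gt_0_iff)
      have pn: "p < n + m" "Suc p + length ds \<le> n + m + 1" using pb cE IS(5) B(1) szn by auto
      have exE: "est (del L x) sz1 s4" if s4: "arr s4 aG = delete M x" "\<forall>i<sz1. arr s4 aQ i = q i \<and> arr s4 aPar (q i) = par (q i)"
        "marks (arr s4 aQ) sz1 sz1 (arr s4 aVis)" "var s4 vS = sz1" "var s4 vK = k" for s4
      proof -
        have "good (del L x) (arr s4 aQ) (arr s4 aPar) sz1" 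
          by (rule good_cong(1)[OF EG(1)]) (use s4(2) in auto)
        moreover have "rep (delete M x) (del L x)" using rep_delete(1)[OF R qj j(2)] .
        ultimately show ?thesis using s4 B(2) by (simp add: est_def good_def)
      qed
      have Fe1: "Sol (edges (del L x)) k (arr s4 aQ 0) (tedges (arr s4 aQ) (arr s4 aPar) sz1) = Fe"
        if "\<forall>i<sz1. arr s4 aQ i = q i \<and> arr s4 aPar (q i) = par (q i)" for s4
      proof -
        have "tedges (arr s4 aQ) (arr s4 aPar) sz1 = tedges q par sz1" 
          by (rule good_cong(2)[OF EG(1)]) (use that in auto)
        then show ?thesis using that j(1) by (simp add: F EG(2))
      qed
      \<comment> \<open>A chain of continuations: include child, undoing of the pruning, exclude
        child, undoing of the exclusion.\<close>
      show ?thesis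
      proof (rule less.hyps[OF _ E1 B(27) go1])
        show "var s1 vP + card (edges L1) \<le> m + Suc sz1" using B(1,19) IS(5) pb by simp
        fix s2 :: store assume "enum_post L1 (Suc sz1) s1 s2"
        then obtain ws1 where P2: "var s2 vMode = 0" "var s2 vGo = 1" "arr s2 aG = foldl delete M ds" "keeps (Suc sz1) s1 s2" "tidy (Suc sz1) s2"
          "emitted s2 = emitted s @ ws1" "enumerates ws1 Fi" "ticks s2 \<le> ticks s1 + bound (Suc sz1) (card Fi)"
          unfolding enum_post_def Let_def Fi1 using B(13,24) by auto
        have K2: "var s2 vP = Suc p + length ds" "var s2 vK = k"
          "\<And>i. i < Suc p + length ds ==> arr s2 aTx i = arr s1 aTx i \<and> arr s2 aTs i = arr s1 aTs i"
          "\<And>i. i < Suc sz1 ==> arr s2 aQ i = q i \<and> arr s2 aPar (q i) = par (q i)"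
          using P2(4) B(19) by (auto simp: keeps_def q)
        show "WP enum_com Q s2"
        proof (rule back_restores[OF R B(5,12) P2(2,1) K2(1) pn(2)])
          show "\<forall>i<length ds. arr s2 aTx (Suc p + i) = ds ! i \<and> arr s2 aTs (Suc p + i) = 0" using B(22) K2(3) by simp
          show "arr s2 aG = foldl delete M ds" by fact
          fix s3 :: store
          assume s3: "arr s3 = (arr s2)(aG := M)" "var s3 vP = Suc p" "\<And>r. r \<notin> {vP, vX, vZ} ==> var s3 r = var s2 r"
            "emitted s3 = emitted s2" "ticks s3 \<le> ticks s2 + 15 * length ds"
          have v3: "var s3 vGo = 1" "var s3 vMode = 0" "var s3 vS = var s2 vS" "var s3 vK = k"
            using s3(3)[of vGo] s3(3)[of vMode] s3(3)[of vS] s3(3)[of vK] P2 K2 by auto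
          have t3: "tidy sz1 s3" using P2(5) v3 unfolding tidy_def s3(1) by (auto dest: Suc_leD)
          have tp: "arr s3 aTx p = x" "arr s3 aTs p = sz1" using K2(3)[of p] B(20,21) s3(1) by simp_all
          show "WP enum_com Q s3"
          proof (rule back_exclude[where L = L and v = "q j", OF v3(1,2) s3(2) tp _ _ t3 _ qj j(2)])
            show "0 < sz1" "p < n + m + 1" "rep (arr s3 aG) L" using sz0 B(1) pn R s3 by auto
            fix s4 :: store
            assume s4: "arr s4 aG = delete (arr s3 aG) x" "arr s4 aQ = arr s3 aQ" "arr s4 aPar = arr s3 aPar"
              "arr s4 aTx = arr s3 aTx" "arr s4 aTs = (arr s3 aTs)(p := 0)" "marks (arr s3 aQ) sz1 sz1 (arr s4 aVis)"
              "var s4 vP = Suc p" "var s4 vS = sz1" "var s4 vMode = 1" "var s4 vGo = 1" "var s4 vK = var s3 vK"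
              "emitted s4 = emitted s3" "ticks s4 \<le> ticks s3 + 30 * Suc k"
            have q4: "\<forall>i<sz1. arr s4 aQ i = q i \<and> arr s4 aPar (q i) = par (q i)" using K2(4) s4(2,3) s3(1) by simp
            have E4: "est (del L x) sz1 s4" by (rule exE[OF _ q4]) (use s4 s3 v3 in auto)
            have cFe: "0 < card Fe" using Sol_est_pos[OF E4] Fe1[OF q4] by simp
            show "WP enum_com Q s4"
            proof (rule less.hyps[OF _ E4 s4(9,10)])
              show "card (Sol (edges (del L x)) k (arr s4 aQ 0) (tedges (arr s4 aQ) (arr s4 aPar) sz1))
                  < card (Sol (edges L) k (arr s aQ 0) (tedges (arr s aQ) (arr s aPar) sz))"
                unfolding Fe1[OF q4] using cF cFi by (simp add: d)
              show "var s4 vP + card (edges (del L x)) \<le> m + sz1"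
                using s4(7) pb B(1) cE edx finite_edges[OF wf] by (simp add: EG(2))
              fix s5 :: store assume "enum_post (del L x) sz1 s4 s5"
              then obtain ws2 where P5: "var s5 vMode = 0" "var s5 vGo = 1" "arr s5 aG = delete M x" "keeps sz1 s4 s5" "tidy sz1 s5"
                "emitted s5 = emitted s @ ws1 @ ws2" "enumerates ws2 Fe" "ticks s5 \<le> ticks s4 + bound sz1 (card Fe)"
                unfolding enum_post_def Let_def Fe1[OF q4] using s4(1,12) s3(1,4) P2(6) by auto
              have K5: "var s5 vP = Suc p" "var s5 vK = k"
                "\<And>i. i < Suc p ==> arr s5 aTx i = arr s4 aTx i \<and> arr s5 aTs i = arr s4 aTs i"
                "\<And>i. i < sz1 ==> arr s5 aQ i = q i \<and> arr s5 aPar (q i) = par (q i)"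
                using P5(4) s4(7) q4 by (auto simp: keeps_def)
              have tp5: "arr s5 aTx p = x" "arr s5 aTs p = 0" using K5(3)[of p] s4(4,5) tp by auto
              have pn': "p < n + m + 1" using pn by simp
              show "WP enum_com Q s5"
              proof (rule back_restore[OF P5(2,1) K5(1) tp5 pn' R qj j(2) P5(3)])
                fix s6 :: store
                assume s6: "arr s6 = (arr s5)(aG := M)" "var s6 vP = p" "\<And>r. r \<notin> {vP, vX, vZ} ==> var s6 r = var s5 r"
                  "emitted s6 = emitted s5" "ticks s6 \<le> ticks s5 + 15"
                have v6: "var s6 vGo = 1" "var s6 vMode = 0" "var s6 vS = var s5 vS" "var s6 vK = k"
                  using s6(3)[of vGo] s6(3)[of vMode] s6(3)[of vS] s6(3)[of vK] P5 K5 by auto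
                have "tidy sz s6" using P5(5) v6 B(1) unfolding tidy_def s6(1) by (auto dest: order_trans)
                moreover have "keeps sz s s6"
                proof -
                  have "arr s6 aTx i = arr s aTx i \<and> arr s6 aTs i = arr s aTs i" if "i < p" for i
                    using that K5(3)[of i] K2(3)[of i] B(23) s4(4,5) s3(1) s6(1) by simp
                  moreover have "arr s6 aQ i = arr s aQ i \<and> arr s6 aPar (arr s aQ i) = arr s aPar (arr s aQ i)" if "i < sz" for i
                    using that K5(4)[of i] B(1,9) s6(1) by (auto simp: d)
                  ultimately show ?thesis unfolding keeps_def using s6(2) v6(4) by (simp add: d)
                qed
                moreover have "\<exists>ws. emitted s6 = emitted s @ ws \<and> enumerates ws F"
                  using s6(4) P5(6) enumerates_append[OF P2(7) P5(7) FF(2)] FF(1) by auto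
                moreover have "ticks s6 \<le> ticks s + bound sz (card F)"
                proof -
                  have a: "Suc k - sz1 = Suc (Suc k - Suc sz1)" "Suc (Suc k - Suc sz1) \<le> Suc k - sz" using B(1,2) by auto
                  \<comment> \<open>Collects \<open>400 + 2 * 15 + 30\<close> units of
                    \<open>Suc k\<close>, which \<open>480\<close> covers, \<open>36 + 15\<close>
                    per solution of the include child, and \<open>2 + 15\<close> single
                    ticks.\<close>
                  have "ticks s6 \<le> ticks s + (480 * Suc k + 51 * card Fi + 17 + bound (Suc sz1) (card Fi) + bound sz1 (card Fe))"
                    using s6(5) P5(8) s4(13) s3(5) P2(8) B(25,26) unfolding ic by simp
                  also have "\<dots> \<le> ticks s + bound sz (card F)"
                    using bound_arith[of "Suc k" "card Fi" "card Fe" "Suc k - Suc sz1" "Suc k - sz"] cFi cFe a(2)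
                    unfolding bound_def cF a(1) by simp
                  finally show ?thesis .
                qed
                ultimately have "enum_post L sz s s6"
                  unfolding enum_post_def Let_def using v6 s6(1) by (simp add: d)
                then show "WP enum_com Q s6" by (rule cont)
              qed
            qed
          qed
        qed
      next
        \<comment> \<open>The include child is smaller because the exclude child is not empty; this
          rests on the \<open>k + 1\<close> vertices reachable without the branching edge.\<close>
        have "0 < card Fe"
        proof -
          note G = goodD[OF wf_del(1)[OF wf qj j(2)] EG(1)]
          obtain V T where "tree (q 0) V T" "tedges q par sz1 \<subseteq> T" "T \<subseteq> edges (del L x)" "card T = k"
            using Sol_exists[OF G(1,2) _ G(7,6)] G(3) B(2) by auto
          then have "T \<in> Fe" unfolding F Sol_def EG(2)[symmetric] by auto
          then show ?thesis using finF by (auto simp: card_gt_0_iff)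
        qed
        then show "card (Sol (edges L1) k (arr s1 aQ 0) (tedges (arr s1 aQ) (arr s1 aPar) (Suc sz1)))
            < card (Sol (edges L) k (arr s aQ 0) (tedges (arr s aQ) (arr s aPar) sz))"
          unfolding Fi1 using cF by (simp add: d)
      qed
    qed
  qed
  then show ?case using less.prems(2) by (intro enum_step[OF less.prems(3)]) simp
qed

end

definition comp_visit :: com where
  "comp_visit = Assign vW (Arr aG (Var vX)) ;;
     Cond (Arr aSeen (Var vW)) Skip
       (Write aSeen (Var vW) (Lit 1) ;; Write aOrd (Var vOt) (Var vW) ;; inc vOt) ;;
     Assign vX (nextE vX)"

text \<open>\<open>aOrd\<close> collects the components one after the other in breadth-first order,
  and the current one starts at \<open>vHd\<close>.\<close>

definition comp_com :: com where
  "comp_com = Assign vHd (Var vOt) ;; Write aSeen (Var vA) (Lit 1) ;; Write aOrd (Var vOt) (Var vA) ;;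
     Assign vOh (Var vOt) ;; inc vOt ;;
     While (Minus (Var vOt) (Var vOh))
       (Assign vU (Arr aOrd (Var vOh)) ;; Assign vX (Arr aG (Var vU)) ;;
        While (Var vX) comp_visit ;; inc vOh)"

text \<open>The removal of a root is permanent, so nothing is pushed on the undo stack.\<close>

definition isolate_com :: com where
  "isolate_com = While (Arr aG (Var vR)) (Assign vX (Arr aG (Var vR)) ;; delete_com vX)"

definition reset_com :: com where
  "reset_com = While (Var vS) (dec vS ;; Write aVis (Arr aQ (Var vS)) (Lit 0))"

context machine
begin

section \<open>Components and roots\<close>

text \<open>\<open>C0\<close> contains the vertices of earlier components. Each vertex after the
  first has an edge to an earlier one of the same component, which is what makes the reverse order
  safe for removing roots.\<close>

definition comp_inv where
  "comp_inv L C0 a hd0 oh A s \<longleftrightarrow> (let ord = arr s aOrd; ot = var s vOt in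
     rep (arr s aG) L \<and> (\<forall>v<n. arr s aSeen v = (if v \<in> ord ` {..<ot} then 1 else 0)) \<and> inj_on ord {..<ot} \<and> (\<forall>i<ot. ord i < n) \<and>
     hd0 < ot \<and> ord ` {..<hd0} = C0 \<and> ord hd0 = a \<and>
     (\<forall>i. hd0 < i --> i < ot --> (\<exists>j. hd0 \<le> j \<and> j < i \<and> {ord j, ord i} \<in> edges L)) \<and>
     (\<forall>i. hd0 \<le> i --> i < oh --> (\<forall>x\<in>set (L (ord i)). nb x \<in> ord ` {..<ot})) \<and> (\<forall>x\<in>A. nb x \<in> ord ` {..<ot}))"

lemma comp_inv_ot: "comp_inv L C0 a hd0 oh A s ==> var s vOt \<le> n"
proof -
  assume "comp_inv L C0 a hd0 oh A s"
  then have *: "inj_on (arr s aOrd) {..<var s vOt}" "\<forall>i<var s vOt. arr s aOrd i < n" by (auto simp: comp_inv_def Let_def)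
  then have "arr s aOrd ` {..<var s vOt} \<subseteq> {..<n}" by auto
  then show ?thesis using card_mono[of "{..<n}" "arr s aOrd ` {..<var s vOt}"] card_image[OF *(1)] by simp
qed

lemma wp_comp_visit:
  assumes I: "comp_inv L C0 a hd0 oh (set xs1) s" and oh: "hd0 \<le> oh" "oh < var s vOt"
    and y: "var s vX = y" and L: "L (arr s aOrd oh) = xs1 @ y # xs2"
  shows "WP comp_visit (\<lambda>s'. comp_inv L C0 a hd0 oh (set (xs1 @ [y])) s' \<and> var s vOt \<le> var s' vOt \<and>
    (\<forall>i<var s vOt. arr s' aOrd i = arr s aOrd i) \<and> var s' vX = (case xs2 of [] => 0 | y # _ => y) \<and> ticks s' \<le> ticks s + 6) s"
proof -
  define ord ot M seen where d: "ord = arr s aOrd" "ot = var s vOt" "M = arr s aG" "seen = arr s aSeen"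
  let ?U = "ord ` {..<ot}"
  have rp: "rep M L" and se: "\<forall>v<n. seen v = (if v \<in> ?U then 1 else 0)" and inj: "inj_on ord {..<ot}" and on: "\<forall>i<ot. ord i < n"
    and hd: "hd0 < ot" "ord ` {..<hd0} = C0" "ord hd0 = a"
    and par: "\<And>i. hd0 < i ==> i < ot ==> \<exists>j. hd0 \<le> j \<and> j < i \<and> {ord j, ord i} \<in> edges L"
    and sc: "\<And>i x. hd0 \<le> i ==> i < oh ==> x \<in> set (L (ord i)) ==> nb x \<in> ?U" "\<And>x. x \<in> set xs1 ==> nb x \<in> ?U"
    using I unfolding comp_inv_def Let_def d by blast+
  have wf: "wf_lists L" using rp by (simp add: rep_def)
  have un: "ord oh < n" using on oh by (simp add: d)
  have Ly: "L (ord oh) = xs1 @ y # xs2" "y \<in> set (L (ord oh))" using L by (auto simp: d)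
  note Y = wf_listsD[OF wf un Ly(2)]
  have M: "M y = nb y" using rp Y(1) by (auto simp: rep_def)
  have nxt: "M (y + 1) = (case xs2 of [] => 0 | y # _ => y)" using linked_list_next[OF rp un Ly(1)] .
  have otn: "ot \<le> n" using comp_inv_ot[OF I] by (simp add: d)
  have b: "y < Z" "Suc y < Z" "Suc y < W" "nb y < Z" "ot < Z" "Suc ot < W" "1 < W"
    using node_less[OF Y(1)] Z_less[of y] vertex_less[OF Y(2)] otn Z W by auto
  define Q where "Q = (\<lambda>s' :: store. comp_inv L C0 a hd0 oh (set (xs1 @ [y])) s' \<and> ot \<le> var s' vOt \<and>
    (\<forall>i<ot. arr s' aOrd i = ord i) \<and> var s' vX = (case xs2 of [] => 0 | y # _ => y) \<and> ticks s' \<le> ticks s + 6)"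
  have "WP comp_visit Q s"
  proof (cases "nb y \<in> ?U")
    case True
    have "Q s'" if "arr s' = arr s" "var s' vOt = ot" "var s' vX = (case xs2 of [] => 0 | y # _ => y)" "ticks s' \<le> ticks s + 6" for s' :: store
      unfolding Q_def comp_inv_def Let_def that(1,2) d(1,3,4)[symmetric] using rp se inj on hd par sc True that(3,4) by auto
    moreover have "seen (nb y) = 1" using se Y(2) True by simp
    ultimately show ?thesis unfolding comp_visit_def using y M nxt b by (simp add: d[symmetric])
  next
    case False
    let ?o = "ord(ot := nb y)"
    have im0: "?o ` {..<ot} = ?U" by (intro image_cong) auto
    have im: "?o ` {..<Suc ot} = insert (nb y) ?U" unfolding lessThan_Suc image_insert im0 by simp
    have inj': "inj_on ?o {..<Suc ot}" using inj False unfolding lessThan_Suc inj_on_insert by (auto simp: inj_on_def)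
    have hd': "?o ` {..<hd0} = C0" using hd by auto
    have hdo: "?o hd0 = a" "hd0 < Suc ot" using hd by auto
    have par': "\<exists>j. hd0 \<le> j \<and> j < i \<and> {?o j, ?o i} \<in> edges L" if i: "hd0 < i" "i < Suc ot" for i
    proof (cases "i = ot")
      case True
      have "{ord oh, nb y} \<in> edges L" using ed_in_edges[OF wf un Ly(2)] Y(10) by simp
      then show ?thesis using True oh by (intro exI[of _ oh]) (auto simp: d)
    next
      case False
      then obtain j where "hd0 \<le> j" "j < i" "{ord j, ord i} \<in> edges L" using par[of i] i by auto
      then show ?thesis using False i by (intro exI[of _ j]) auto
    qed
    have "Q s'" if "arr s' = (arr s)(aSeen := seen(nb y := 1), aOrd := ?o)" "var s' vOt = Suc ot" "var s' vX = (case xs2 of [] => 0 | y # _ => y)"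
      "ticks s' \<le> ticks s + 6" for s' :: store
    proof -
      have "arr s' aOrd = ?o" "arr s' aSeen = seen(nb y := 1)" "arr s' aG = M" using that(1) by (simp_all add: d)
      moreover have "\<forall>i<Suc ot. ?o i < n" using on Y(2) by (auto simp: less_Suc_eq)
      moreover have "\<forall>i. hd0 \<le> i --> i < oh --> (\<forall>x\<in>set (L (?o i)). nb x \<in> insert (nb y) ?U)" using sc(1) oh by (auto simp: d)
      moreover have "\<forall>x\<in>set (xs1 @ [y]). nb x \<in> insert (nb y) ?U" using sc(2) by auto
      moreover have "\<forall>v<n. (seen(nb y := 1)) v = (if v \<in> insert (nb y) ?U then 1 else 0)" using se by auto
      ultimately have "comp_inv L C0 a hd0 oh (set (xs1 @ [y])) s'"
        unfolding comp_inv_def Let_def that(2) using rp inj' hd' par' hdo by (simp add: im del: fun_upd_apply)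
      then show ?thesis unfolding Q_def using that by simp
    qed
    moreover have "seen (nb y) = 0" using se Y(2) False by simp
    ultimately show ?thesis unfolding comp_visit_def using y M nxt b by (simp add: d[symmetric] fun_upd_twist)
  qed
  then show ?thesis unfolding Q_def d .
qed

lemma wp_comp_scan:
  assumes I: "comp_inv L C0 a hd0 oh {} s" and oh: "hd0 \<le> oh" "oh < var s vOt" and x: "var s vX = arr s aG (arr s aOrd oh)"
  shows "WP (While (Var vX) comp_visit) (\<lambda>s'. comp_inv L C0 a hd0 oh (set (L (arr s aOrd oh))) s' \<and> var s vOt \<le> var s' vOt \<and>
    (\<forall>i<var s vOt. arr s' aOrd i = arr s aOrd i) \<and> ticks s' \<le> ticks s + 7 * length (L (arr s aOrd oh)) + 1) s"
proof -
  define v where "v = arr s aOrd oh"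
  have wf: "wf_lists L" "v < n" "rep (arr s aG) L" using I oh by (auto simp: comp_inv_def rep_def Let_def v_def)
  let ?I = "\<lambda>l s'. \<exists>xs1 xs2. l = length xs2 \<and> L v = xs1 @ xs2 \<and> comp_inv L C0 a hd0 oh (set xs1) s' \<and>
    var s' vX = (case xs2 of [] => 0 | y # _ => y) \<and>
    var s vOt \<le> var s' vOt \<and> (\<forall>i<var s vOt. arr s' aOrd i = arr s aOrd i) \<and> ticks s' \<le> ticks s + 7 * length xs1"
  show ?thesis
    unfolding v_def[symmetric]
  proof (rule wp_While[where I = ?I and f = id])
    have "var s vX = (case L v of [] => 0 | y # _ => y)"
      using linked_list_first[OF wf(3,2)] x by (simp add: v_def)
    then show "?I (length (L v)) s" using I by (intro exI[of _ "[]"] exI[of _ "L v"]) auto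
  next
    fix l and s' :: store assume inv: "?I l s'" and e: "ev (Var vX) s' = 0"
    then obtain xs1 xs2 where *: "L v = xs1 @ xs2" "comp_inv L C0 a hd0 oh (set xs1) s'" "var s' vX = (case xs2 of [] => 0 | y # _ => y)"
      "var s vOt \<le> var s' vOt" "\<forall>i<var s vOt. arr s' aOrd i = arr s aOrd i" "ticks s' \<le> ticks s + 7 * length xs1" by blast
    have "xs2 = []"
    proof (cases xs2)
      case (Cons y ys)
      then show ?thesis using wf_listsD(12)[OF wf(1,2), of y] * e by simp
    qed simp
    then show "comp_inv L C0 a hd0 oh (set (L v)) (tick s') \<and> var s vOt \<le> var (tick s') vOt \<and>
      (\<forall>i<var s vOt. arr (tick s') aOrd i = arr s aOrd i) \<and> ticks (tick s') \<le> ticks s + 7 * length (L v) + 1"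
      using * by (simp add: comp_inv_def)
  next
    fix l and s' :: store assume inv: "?I l s'" and e: "ev (Var vX) s' \<noteq> 0"
    then obtain xs1 xs2 where *: "l = length xs2" "L v = xs1 @ xs2" "comp_inv L C0 a hd0 oh (set xs1) s'" "var s' vX = (case xs2 of [] => 0 | y # _ => y)"
      "var s vOt \<le> var s' vOt" "\<forall>i<var s vOt. arr s' aOrd i = arr s aOrd i" "ticks s' \<le> ticks s + 7 * length xs1" by blast
    obtain y ys where xs2: "xs2 = y # ys" using e *(4) by (cases xs2) auto
    have v: "arr s' aOrd oh = v" using *(6) oh by (simp add: v_def)
    have I': "comp_inv L C0 a hd0 oh (set xs1) (tick s')" using *(3) by (simp add: comp_inv_def)
    show "WP comp_visit (\<lambda>s'. \<exists>l'. ?I l' s' \<and> id l' < id l) (tick s')"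
    proof (rule wp_mono[OF wp_comp_visit[OF I' oh(1), of y ys]])
      fix s'' :: store
      assume a: "comp_inv L C0 a hd0 oh (set (xs1 @ [y])) s'' \<and> var (tick s') vOt \<le> var s'' vOt \<and>
        (\<forall>i<var (tick s') vOt. arr s'' aOrd i = arr (tick s') aOrd i) \<and> var s'' vX = (case ys of [] => 0 | y # _ => y) \<and> ticks s'' \<le> ticks (tick s') + 6"
      have "?I (length ys) s''" using a * xs2 by (intro exI[of _ "xs1 @ [y]"] exI[of _ ys]) auto
      then show "\<exists>l'. ?I l' s'' \<and> id l' < id l" using * xs2 by (intro exI[of _ "length ys"]) auto
    qed (use * xs2 v oh in auto)
  qed auto
qed

lemma wp_comp:
  assumes R: "rep (arr s aG) L" and C0: "arr s aOrd ` {..<var s vOt} = C0" "inj_on (arr s aOrd) {..<var s vOt}" "\<forall>i<var s vOt. arr s aOrd i < n"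
    "\<forall>v<n. arr s aSeen v = (if v \<in> C0 then 1 else 0)" and a: "var s vA = a" "a < n" "a \<notin> C0" and hd: "var s vOt = hd0"
  shows "WP comp_com (\<lambda>s'. comp_inv L C0 a hd0 (var s' vOt) {} s' \<and> var s' vHd = hd0 \<and> (\<forall>i<hd0. arr s' aOrd i = arr s aOrd i) \<and>
    ticks s' \<le> ticks s + 10 + 6 * (var s' vOt - hd0) + 7 * (\<Sum>i=hd0..<var s' vOt. length (L (arr s' aOrd i)))) s"
proof -
  have "card (insert a C0) \<le> card {..<n}" using C0 a by (intro card_mono) auto
  moreover have "card C0 = hd0" "finite C0" using C0(1) card_image[OF C0(2)] hd by auto
  ultimately have hn: "hd0 < n" using a by simp
  let ?o = "(arr s aOrd)(hd0 := a)"
  define s1 where "s1 = s\<lparr>arr := (arr s)(aSeen := (arr s aSeen)(a := 1), aOrd := ?o), var := (var s)(vHd := hd0, vOh := hd0, vOt := Suc hd0), ticks := Suc (Suc (Suc (Suc (Suc (ticks s)))))\<rparr>"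
  have im0: "?o ` {..<hd0} = C0" using C0(1) hd by auto
  have im: "?o ` {..<Suc hd0} = insert a C0" unfolding lessThan_Suc image_insert im0 by simp
  have inj': "inj_on ?o {..<Suc hd0}" using C0 a hd unfolding lessThan_Suc inj_on_insert by (auto simp: inj_on_def)
  have I1: "comp_inv L C0 a hd0 hd0 {} s1"
  proof -
    have "arr s1 aOrd = ?o" "arr s1 aSeen = (arr s aSeen)(a := 1)" "arr s1 aG = arr s aG" "var s1 vOt = Suc hd0" by (simp_all add: s1_def)
    moreover have "\<forall>v<n. ((arr s aSeen)(a := 1)) v = (if v \<in> insert a C0 then 1 else 0)" using C0(4) by auto
    moreover have "\<forall>i<Suc hd0. ?o i < n" using C0(3) a hd by (auto simp: less_Suc_eq)
    ultimately show ?thesis unfolding comp_inv_def Let_def using R inj' im0 by (simp add: im del: fun_upd_apply) simp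
  qed
  let ?S = "\<lambda>s' oh. (\<Sum>i=hd0..<oh. length (L (arr s' aOrd i)))"
  let ?I = "\<lambda>l s'. \<exists>oh. l = n - oh \<and> hd0 \<le> oh \<and> oh \<le> var s' vOt \<and> var s' vOh = oh \<and> var s' vHd = hd0 \<and> comp_inv L C0 a hd0 oh {} s' \<and>
     (\<forall>i<hd0. arr s' aOrd i = arr s aOrd i) \<and> ticks s' \<le> ticks s + 5 + 5 * (oh - hd0) + 7 * ?S s' oh"
  define Q where "Q = (\<lambda>s' :: store. comp_inv L C0 a hd0 (var s' vOt) {} s' \<and> var s' vHd = hd0 \<and> (\<forall>i<hd0. arr s' aOrd i = arr s aOrd i) \<and>
    ticks s' \<le> ticks s + 10 + 6 * (var s' vOt - hd0) + 7 * (\<Sum>i=hd0..<var s' vOt. length (L (arr s' aOrd i))))"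
  have "WP (While (Minus (Var vOt) (Var vOh)) (Assign vU (Arr aOrd (Var vOh)) ;; Assign vX (Arr aG (Var vU)) ;; While (Var vX) comp_visit ;; inc vOh)) Q s1"
  proof (rule wp_While[where I = ?I and f = id])
    show "?I (n - hd0) s1" using I1 by (intro exI[of _ hd0]) (auto simp: s1_def)
  next
    fix l and s' :: store assume inv: "?I l s'" and e: "ev (Minus (Var vOt) (Var vOh)) s' = 0"
    then obtain oh where *: "hd0 \<le> oh" "oh = var s' vOt" "var s' vHd = hd0" "comp_inv L C0 a hd0 oh {} s'" "\<forall>i<hd0. arr s' aOrd i = arr s aOrd i"
      "ticks s' \<le> ticks s + 5 + 5 * (oh - hd0) + 7 * ?S s' oh" by auto
    then show "Q (tick s')" by (simp add: Q_def comp_inv_def)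
  next
    fix l and s' :: store assume inv: "?I l s'" and e: "ev (Minus (Var vOt) (Var vOh)) s' \<noteq> 0"
    then obtain oh where *: "l = n - oh" "hd0 \<le> oh" "oh < var s' vOt" "var s' vOh = oh" "var s' vHd = hd0" "comp_inv L C0 a hd0 oh {} s'" "\<forall>i<hd0. arr s' aOrd i = arr s aOrd i"
      "ticks s' \<le> ticks s + 5 + 5 * (oh - hd0) + 7 * ?S s' oh" by auto
    let ?v = "arr s' aOrd oh"
    have b: "oh < n" "oh < Z" "?v < n" "?v < Z" "Suc oh < W"
      using comp_inv_ot[OF *(6)] *(3,6) vertex_less W by (auto simp: comp_inv_def Let_def)
    let ?s = "s'\<lparr>var := (var s')(vU := ?v, vX := arr s' aG ?v), ticks := Suc (Suc (Suc (ticks s')))\<rparr>"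
    have I': "comp_inv L C0 a hd0 oh {} ?s" using *(6) by (simp add: comp_inv_def)
    define Q' where "Q' = (\<lambda>s' :: store. \<exists>l'. ?I l' s' \<and> id l' < id l)"
    have "WP (While (Var vX) comp_visit) (WP (inc vOh) Q') ?s"
    proof (rule wp_frame[OF wp_comp_scan[OF I' *(2)]])
      fix s2 :: store
      assume c: "comp_inv L C0 a hd0 oh (set (L (arr ?s aOrd oh))) s2 \<and> var ?s vOt \<le> var s2 vOt \<and>
        (\<forall>i<var ?s vOt. arr s2 aOrd i = arr ?s aOrd i) \<and> ticks s2 \<le> ticks ?s + 7 * length (L (arr ?s aOrd oh)) + 1"
        and fr: "\<And>r. r \<notin> mods (While (Var vX) comp_visit) ==> var s2 r = var ?s r"
      have v2: "var s2 vOh = oh" "var s2 vHd = hd0" using fr[of vOh] fr[of vHd] * by (auto simp: comp_visit_def)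
      have oe: "\<And>i. i \<le> oh ==> arr s2 aOrd i = arr s' aOrd i" using c *(3) by auto
      define s3 where "s3 = s2\<lparr>var := (var s2)(vOh := Suc oh), ticks := Suc (ticks s2)\<rparr>"
      have "comp_inv L C0 a hd0 (Suc oh) {} s3"
        using c oe[of oh] unfolding comp_inv_def Let_def s3_def by (auto simp: less_Suc_eq)
      moreover have "?S s3 (Suc oh) = ?S s' oh + length (L ?v)"
      proof -
        have "?S s3 (Suc oh) = (\<Sum>i=hd0..<Suc oh. length (L (arr s' aOrd i)))" using oe by (intro sum.cong) (auto simp: s3_def)
        then show ?thesis using *(2) by simp
      qed
      moreover have "\<forall>i<hd0. arr s3 aOrd i = arr s aOrd i" using oe *(2,7) by (simp add: s3_def)
      ultimately have "?I (n - Suc oh) s3"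
        using * c v2 by (intro exI[of _ "Suc oh"]) (auto simp: s3_def)
      then have "Q' s3" unfolding Q'_def using *(1) b by (intro exI[of _ "n - Suc oh"]) auto
      then show "WP (inc vOh) Q' s2" using v2 b W unfolding s3_def by simp
    qed (use *(3) in simp_all)
    then show "WP (Assign vU (Arr aOrd (Var vOh)) ;; Assign vX (Arr aG (Var vU)) ;; While (Var vX) comp_visit ;; inc vOh) (\<lambda>s'. \<exists>l'. ?I l' s' \<and> id l' < id l) (tick s')"
      unfolding Q'_def[symmetric] using *(4) b by simp
  qed auto
  moreover have "hd0 < Z" "a < Z" "Suc hd0 < W" using hn a vertex_less W by auto
  ultimately show ?thesis
    unfolding comp_com_def Q_def[symmetric] using hd a W unfolding s1_def by (simp add: fun_upd_twist)
qed

text \<open>The lists of vertices not adjacent to \<open>r\<close> do not change at all, which keeps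
  later components in their original form.\<close>

lemma wp_isolate:
  assumes R: "rep (arr s aG) L" and r: "var s vR = r" "r < n"
  shows "WP isolate_com (\<lambda>s'. \<exists>L'. rep (arr s' aG) L' \<and> edges L' = {e \<in> edges L. r \<notin> e} \<and>
     (\<forall>v<n. v \<noteq> r --> {v, r} \<notin> edges L --> L' v = L v) \<and> (\<forall>v<n. length (L' v) \<le> length (L v)) \<and>
     ticks s' \<le> ticks s + 11 * length (L r) + 1) s"
proof -
  let ?I = "\<lambda>l s'. \<exists>L'. l = length (L' r) \<and> rep (arr s' aG) L' \<and> edges L' \<subseteq> edges L \<and> {e \<in> edges L'. r \<notin> e} = {e \<in> edges L. r \<notin> e} \<and>
     (\<forall>v<n. v \<noteq> r --> {v, r} \<notin> edges L --> L' v = L v) \<and> (\<forall>v<n. length (L' v) \<le> length (L v)) \<and> var s' vR = r \<and>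
     ticks s' + 11 * length (L' r) \<le> ticks s + 11 * length (L r)"
  show ?thesis
    unfolding isolate_com_def
  proof (rule wp_While[where I = ?I and f = id])
    show "?I (length (L r)) s" using R r by (intro exI[of _ L]) auto
  next
    fix l and s' :: store assume "?I l s'" then show "safe W Z (Arr aG (Var vR)) s'" using r vertex_less by auto
  next
    fix l and s' :: store assume "?I l s'" and e: "ev (Arr aG (Var vR)) s' = 0"
    then obtain L' where *: "rep (arr s' aG) L'" "edges L' \<subseteq> edges L" "{e \<in> edges L'. r \<notin> e} = {e \<in> edges L. r \<notin> e}"
      "\<forall>v<n. v \<noteq> r --> {v, r} \<notin> edges L --> L' v = L v" "\<forall>v<n. length (L' v) \<le> length (L v)" "var s' vR = r"
      "ticks s' + 11 * length (L' r) \<le> ticks s + 11 * length (L r)" by blast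
    have wf: "wf_lists L'" using *(1) by (simp add: rep_def)
    have nil: "L' r = []"
    proof (cases "L' r")
      case (Cons y ys)
      then show ?thesis using linked_list_first[OF *(1) r(2)] wf_listsD(12)[OF wf r(2), of y] e *(6) by simp
    qed
    have "r \<notin> e" if "e \<in> edges L'" for e using edges_at[OF wf r(2) that] nil by auto
    then have "edges L' = {e \<in> edges L. r \<notin> e}" using *(3) by auto
    then show "\<exists>L'. rep (arr (tick s') aG) L' \<and> edges L' = {e \<in> edges L. r \<notin> e} \<and>
     (\<forall>v<n. v \<noteq> r --> {v, r} \<notin> edges L --> L' v = L v) \<and> (\<forall>v<n. length (L' v) \<le> length (L v)) \<and>
     ticks (tick s') \<le> ticks s + 11 * length (L r) + 1"
      using * by (intro exI[of _ L']) simp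
  next
    fix l and s' :: store assume "?I l s'" and e: "ev (Arr aG (Var vR)) s' \<noteq> 0"
    then obtain L' where *: "l = length (L' r)" "rep (arr s' aG) L'" "edges L' \<subseteq> edges L" "{e \<in> edges L'. r \<notin> e} = {e \<in> edges L. r \<notin> e}"
      "\<forall>v<n. v \<noteq> r --> {v, r} \<notin> edges L --> L' v = L v" "\<forall>v<n. length (L' v) \<le> length (L v)" "var s' vR = r"
      "ticks s' + 11 * length (L' r) \<le> ticks s + 11 * length (L r)" by blast
    have wf: "wf_lists L'" using *(2) by (simp add: rep_def)
    obtain y ys where Ly: "L' r = y # ys" using linked_list_first[OF *(2) r(2)] e *(7) by (cases "L' r") auto
    have y: "y \<in> set (L' r)" "arr s' aG r = y" using Ly linked_list_first[OF *(2) r(2)] by auto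
    note Y = wf_listsD[OF wf r(2) y(1)]
    let ?L = "del L' y"
    have eL: "edges ?L = edges L' - {ed y}" using wf_del(2)[OF wf r(2) y(1)] .
    have len: "length (?L v) \<le> length (L' v)" for v by (simp add: del_def)
    have lenr: "length (?L r) < length (L' r)" using y(1) unfolding del_def by (intro length_filter_less[of y]) auto
    have keep: "?L v = L' v" if v: "v < n" "v \<noteq> r" "{v, r} \<notin> edges L" for v
    proof -
      have "y \<notin> set (L' v)" using wf_listsD(5)[OF wf v(1), of y] Y(5) v(2) by auto
      moreover have "tw y \<notin> set (L' v)"
      proof
        assume "tw y \<in> set (L' v)"
        then have "v = nb y" using wf_listsD(5)[OF wf v(1), of "tw y"] Y(6) by simp
        then have "{v, r} \<in> edges L'" using ed_in_edges[OF wf r(2) y(1)] Y(10) by (simp add: insert_commute)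
        then show False using v(3) *(3) by auto
      qed
      ultimately show ?thesis unfolding del_def by (auto simp: filter_id_conv)
    qed
    let ?s = "s'\<lparr>var := (var s')(vX := y), ticks := Suc (Suc (ticks s'))\<rparr>"
    define Q where "Q = (\<lambda>s' :: store. \<exists>l'. ?I l' s' \<and> id l' < id l)"
    have "WP (delete_com vX) Q ?s"
    proof (rule wp_frame[OF wp_delete[of ?s L' r vX y]])
      show "rep (arr ?s aG) L'" "r < n" "var ?s vX = y" "y \<in> set (L' r)" "vX \<noteq> vZ" using * r y by simp_all
      fix s2 :: store assume a: "arr s2 = (arr ?s)(aG := delete (arr ?s aG) y) \<and> ticks s2 \<le> ticks ?s + 9"
        and fr: "\<And>r. r \<notin> mods (delete_com vX) ==> var s2 r = var ?s r"
      have v2: "var s2 vR = r" using fr[of vR] *(7) by (simp add: delete_com_def unlink_com_def)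
      have "?I (length (?L r)) s2"
      proof (rule exI[of _ ?L], intro conjI)
        show "rep (arr s2 aG) ?L" using a rep_delete(1)[OF *(2) r(2) y(1)] by simp
        show "edges ?L \<subseteq> edges L" "{e \<in> edges ?L. r \<notin> e} = {e \<in> edges L. r \<notin> e}" using eL *(3,4) Y(10) by auto
        show "\<forall>v<n. v \<noteq> r --> {v, r} \<notin> edges L --> ?L v = L v" using keep *(5) by simp
        show "\<forall>v<n. length (?L v) \<le> length (L v)" using len *(6) order_trans by blast
        show "ticks s2 + 11 * length (?L r) \<le> ticks s + 11 * length (L r)" using a *(8) lenr by simp
      qed (use v2 in simp_all)
      then show "Q s2" unfolding Q_def using lenr *(1) by (intro exI[of _ "length (?L r)"]) simp
    qed
    then show "WP (Assign vX (Arr aG (Var vR)) ;; delete_com vX) (\<lambda>s'. \<exists>l'. ?I l' s' \<and> id l' < id l) (tick s')"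
      unfolding Q_def[symmetric] using *(7) y(2) vertex_less[OF r(2)] by simp
  qed
qed

lemma wp_reset:
  assumes t: "tidy sz s"
  shows "WP reset_com (\<lambda>s'. (\<forall>v<n. arr s' aVis v = 0) \<and> ticks s' \<le> ticks s + 3 * Suc k + 1) s"
proof -
  obtain z where z: "z \<le> n" "z \<le> Suc k" "var s vS = z" "marks (arr s aQ) z z (arr s aVis)" "inj_on (arr s aQ) {..<z}" "\<forall>i<z. arr s aQ i < n"
    using t by (auto simp: tidy_def)
  define q where "q = arr s aQ"
  let ?I = "\<lambda>l s'. l \<le> z \<and> var s' vS = l \<and> arr s' aQ = q \<and> marks q l l (arr s' aVis) \<and> ticks s' + 3 * l \<le> ticks s + 3 * z"
  show ?thesis
    unfolding reset_com_def
  proof (rule wp_While[where I = ?I and f = id])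
    show "?I z s" using z by (simp add: q_def)
  next
    fix l and s' :: store assume "?I l s'" "ev (Var vS) s' = 0"
    then show "(\<forall>v<n. arr (tick s') aVis v = 0) \<and> ticks (tick s') \<le> ticks s + 3 * Suc k + 1" using z by (auto simp: marks_def)
  next
    fix l and s' :: store assume I: "?I l s'" and e: "ev (Var vS) s' \<noteq> 0"
    then obtain l' where l': "l = Suc l'" by (cases l) auto
    have qn: "q l' < n" "l' < n" using z I l' by (auto simp: q_def)
    have nm: "q l' \<notin> q ` {..<l'}"
    proof
      assume "q l' \<in> q ` {..<l'}"
      then obtain i where "i < l'" "q l' = q i" by blast
      then show False using inj_onD[OF z(5), of l' i] I l' by (auto simp: q_def)
    qed
    have "marks q l' l' ((arr s' aVis)(q l' := 0))" using I nm unfolding marks_def l' lessThan_Suc by auto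
    then show "WP (dec vS ;; Write aVis (Arr aQ (Var vS)) (Lit 0)) (\<lambda>s'. \<exists>a'. ?I a' s' \<and> id a' < id l) (tick s')"
      using I l' vertex_less[OF qn(1)] vertex_less[OF qn(2)] W by (auto intro!: exI[of _ l'])
  qed auto
qed

end

definition root_com :: com where
  "root_com = dec vB ;; Assign vR (Arr aOrd (Var vB)) ;; Write aQ (Lit 0) (Var vR) ;; Write aVis (Var vR) (Lit 1) ;;
     Assign vS (Lit 1) ;; Assign vP (Lit 0) ;; Assign vGo (Lit 1) ;; Assign vMode (Lit 1) ;; enum_com ;; reset_com ;; isolate_com"

text \<open>The loop stops when only \<open>k\<close> vertices of the component are left, since
  these cannot carry a tree with \<open>k\<close> edges.\<close>

definition roots_com :: com where
  "roots_com = Assign vB (Var vOt) ;; While (Minus (Var vB) (Plus (Var vHd) (Var vK))) root_com"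

lemmas roots_com_defs =
  roots_com_def root_com_def reset_com_def isolate_com_def enum_com_defs

text \<open>For \<open>k = 0\<close> the only solution is the empty edge set, written as the single
  word \<open>0\<close>. It contains no vertex and thus no root, so it is treated apart.\<close>

definition main_com :: com where
  "main_com = Cond (Var vK)
     (Assign vA (Lit 0) ;; Assign vOt (Lit 0) ;;
      While (Minus (Var vN) (Var vA)) (Cond (Arr aSeen (Var vA)) Skip (comp_com ;; roots_com) ;; inc vA))
     (Emit (Lit 0))"

context machine
begin

lemma tedges_one: "tedges q par 1 = {}"
  by (auto simp: tedges_def)

text \<open>For positive \<open>k\<close>, \<open>Suc k\<close> is at most \<open>2 * k\<close>, so
  \<open>600 * Suc k * (2 * N)\<close> is at most \<open>2400 * (k * N)\<close>, and the potential
  adds \<open>60 * (k * N)\<close>. The subtracted \<open>600 * Suc k\<close> absorbs most of the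
  remaining terms.\<close>

lemma bound_root:
  assumes "0 < k" "0 < N"
  shows "bound 1 N + 3 * Suc k + 20 \<le> 2500 * (k * N) + 4"
proof -
  obtain j i where *: "k = Suc j" "N = Suc i" using assms by (metis gr0_implies_Suc)
  show ?thesis unfolding bound_def *(2) unfolding *(1) by (simp add: algebra_simps)
qed

text \<open>The search from a root is entered with an empty stack, so after the enumeration
  \<open>back_com\<close> switches \<open>vGo\<close> off and the loop ends.\<close>

lemma wp_enum_root:
  assumes E: "est L 1 s" and v: "var s vP = 0" "var s vMode = 1" "var s vGo = 1" and m: "card (edges L) \<le> m"
  shows "WP enum_com (\<lambda>s'. arr s' aG = arr s aG \<and> tidy 1 s' \<and>
    (\<exists>ws. emitted s' = emitted s @ ws \<and> enumerates ws (Sol (edges L) k (arr s aQ 0) {})) \<and>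
    ticks s' \<le> ticks s + bound 1 (card (Sol (edges L) k (arr s aQ 0) {})) + 5) s"
    (is "WP enum_com ?Q s")
proof (rule enum_correct[OF E v(2,3)])
  show "var s vP + card (edges L) \<le> m + 1" using v m by simp
  fix s1 :: store assume P: "enum_post L 1 s s1"
  define Q where "Q = ?Q"
  have p: "var s1 vP = 0" "var s1 vGo = 1" "var s1 vMode = 0" using P v(1) by (auto simp: enum_post_def Let_def keeps_def)
  have "Q s'" if "arr s' = arr s1" "var s' vS = var s1 vS" "emitted s' = emitted s1" "ticks s' \<le> ticks s1 + 5" for s' :: store
    using P that unfolding Q_def enum_post_def Let_def tedges_one by (auto simp: tidy_def)
  then have "WP enum_com Q (s1\<lparr>var := (var s1)(vGo := 0), ticks := Suc (Suc (Suc (Suc (ticks s1))))\<rparr>)"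
    unfolding enum_com_def by (intro wp_While_unfold) simp_all
  then show "WP enum_com ?Q s1"
    unfolding Q_def[symmetric] using p W by (intro enum_step) (simp_all add: back_com_def)
qed

section \<open>All subtrees\<close>

abbreviation "KS E \<equiv> k_subtrees ({..<n}, E) k"

lemma KS_mono: "E \<subseteq> E' ==> KS E \<subseteq> KS E'"
  by (auto simp: k_subtrees_def)

text \<open>Deleting each root after use partitions the k-subtrees by the root at which they are
  found, so none is printed twice.\<close>

lemma KS_split:
  assumes "0 < k" "finite E" "\<And>e. e \<in> E ==> card e = 2"
  shows "KS E = KS {e \<in> E. r \<notin> e} \<union> Sol E k r {}" "KS {e \<in> E. r \<notin> e} \<inter> Sol E k r {} = {}"
proof -
  have S: "Sol E k r {} = {T \<in> KS E. r \<in> \<Union>T}" using Sol_root[OF assms] .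
  have N: "KS {e \<in> E. r \<notin> e} = {T \<in> KS E. r \<notin> \<Union>T}" by (auto simp: k_subtrees_def)
  show "KS E = KS {e \<in> E. r \<notin> e} \<union> Sol E k r {}" "KS {e \<in> E. r \<notin> e} \<inter> Sol E k r {} = {}" unfolding S N by blast+
qed

lemma finite_KS: "finite E ==> finite (KS E)"
  by (rule finite_subset[of _ "Pow E"]) (auto simp: k_subtrees_def)

lemma card_image_interval: "inj_on f {..<c} ==> b \<le> c ==> card (f ` {a..<b}) = b - a" for f :: "nat => nat"
  using card_image[OF inj_on_subset[of f "{..<c}" "{a..<b}"]] by (simp add: subset_iff)

lemma injection_le:
  assumes "inj_on f {..<c}" "\<forall>i<c. f i < n"
  shows "c \<le> n"
proof -
  have "f ` {..<c} \<subseteq> {..<n}" using assms(2) by auto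
  then show ?thesis using card_mono[of "{..<n}" "f ` {..<c}"] card_image[OF assms(1)] by simp
qed

lemma ord_notin:
  fixes f :: "nat => nat"
  assumes "inj_on f {..<c}" "i < b" "b \<le> c"
  shows "f i \<notin> f ` {b..<c}"
proof
  assume "f i \<in> f ` {b..<c}"
  then obtain j where j: "b \<le> j" "j < c" "f i = f j" by auto
  have "i = j" by (rule inj_onD[OF assms(1) j(3)]) (use j assms in auto)
  then show False using j assms by simp
qed

lemma wp_root:
  fixes ord :: "nat => nat" and hd ot b :: nat
  defines "K \<equiv> ord ` {hd..<ot}"
  assumes k: "0 < k" and ord: "inj_on ord {..<ot}" "\<forall>i<ot. ord i < n"
    and par: "\<And>i. hd < i ==> i < ot ==> \<exists>j. hd \<le> j \<and> j < i \<and> {ord j, ord i} \<in> edges L1"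
    and cl: "\<And>u w. u \<in> K ==> {u, w} \<in> edges L1 ==> w \<in> K" and m: "card (edges L1) \<le> m" and wf1: "wf_lists L1"
    and b: "hd + k \<le> b" "b < ot" "var s vB = Suc b" "arr s aOrd = ord" "var s vK = k"
    and Lb: "rep (arr s aG) Lb" "edges Lb = {e \<in> edges L1. e \<inter> ord ` {Suc b..<ot} = {}}" "\<forall>v<n. v \<notin> K --> Lb v = L1 v"
      "\<forall>v<n. length (Lb v) \<le> length (L1 v)" "\<forall>v<n. arr s aVis v = 0"
  shows "WP root_com (\<lambda>s'. (\<exists>L. rep (arr s' aG) L \<and> edges L = {e \<in> edges L1. e \<inter> ord ` {b..<ot} = {}} \<and> (\<forall>v<n. v \<notin> K --> L v = L1 v) \<and>
      (\<forall>v<n. length (L v) \<le> length (L1 v)) \<and>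
      (\<exists>ws. emitted s' = emitted s @ ws \<and> enumerates ws (KS (edges Lb) - KS (edges L))) \<and>
      ticks s' \<le> ticks s + 2500 * (k * card (KS (edges Lb) - KS (edges L))) + 11 * length (L1 (ord b)) + 20) \<and>
      (\<forall>v<n. arr s' aVis v = 0) \<and> var s' vB = b \<and> arr s' aOrd = ord \<and> var s' vK = k \<and> var s' vHd = var s vHd) s"
    (is "WP root_com ?Q s")
proof -
  define r where "r = ord b"
  have rn: "r < n" using ord b by (simp add: r_def)
  have wf: "wf_lists Lb" using Lb(1) by (simp add: rep_def)
  have sub: "edges Lb \<subseteq> edges L1" using Lb(2) by auto
  let ?A = "Sol (edges Lb) k r {}"
  note fin = finite_edges[OF wf]
  note KS = KS_split[OF k fin, of r]
  \<comment> \<open>Vertices up to position \<open>b\<close> stay connected to the start of the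
    component, because the edge to an earlier vertex involves no vertex removed so far.\<close>
  have reach_root: "ord i \<in> reach (edges Lb) {ord hd}" if "hd \<le> i" "i \<le> b" for i
    using that
  proof (induction i rule: less_induct)
    case (less i)
    show ?case
    proof (cases "i = hd")
      case False
      then obtain j where j: "hd \<le> j" "j < i" "{ord j, ord i} \<in> edges L1" using par[of i] less.prems b by auto
      have "{ord j, ord i} \<in> edges Lb"
        using j less.prems b ord_notin[OF ord(1), of j "Suc b"] ord_notin[OF ord(1), of i "Suc b"] unfolding Lb(2) by simp
      moreover have "ord j \<in> reach (edges Lb) {ord hd}" using less.IH[of j] j less.prems by simp
      ultimately show ?thesis by (rule reach_step[rotated])
    qed (auto intro: reach_base)
  qed
  have "ord hd \<in> reach (edges Lb) {r}" using reach_sym[OF reach_root[of b]] b by (simp add: r_def)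
  then have "reach (edges Lb) {ord hd} \<subseteq> reach (edges Lb) {r}" by (intro reach_idem) simp
  then have "ord ` {hd..<Suc b} \<subseteq> reach (edges Lb) {r}" using reach_root by auto
  moreover have "reach (edges Lb) {r} \<subseteq> {..<n}" using reach_subset_Union[of "edges Lb" "{r}"] edges_wf[OF wf] rn by blast
  ultimately have "card (ord ` {hd..<Suc b}) \<le> card (reach (edges Lb) {r})" by (intro card_mono) (auto intro: finite_subset)
  \<comment> \<open>Since \<open>b\<close> is at least \<open>hd + k\<close>, the positions from
    \<open>hd\<close> to \<open>b\<close> provide at least \<open>k + 1\<close> vertices.\<close>
  then have reach: "Suc k \<le> card (reach (edges Lb) {r})" using card_image_interval[OF ord(1), of "Suc b" hd] b by simp
  have no_loop: "\<not> e \<subseteq> {r}" if "e \<in> edges Lb" for e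
  proof
    assume "e \<subseteq> {r}"
    then have "card e \<le> 1" using card_mono[of "{r}" e] by simp
    then show False using edges_wf[OF wf that] by simp
  qed
  define s1 where "s1 = s\<lparr>arr := (arr s)(aQ := (arr s aQ)(0 := r), aVis := (arr s aVis)(r := 1)),
    var := (var s)(vB := b, vR := r, vS := 1, vP := 0, vGo := 1, vMode := 1), ticks := Suc (Suc (Suc (Suc (Suc (Suc (Suc (Suc (ticks s)))))))) \<rparr>"
  have a1: "arr s1 aG = arr s aG" "arr s1 aOrd = ord" "arr s1 aQ 0 = r" "arr s1 aVis = (arr s aVis)(r := 1)" "var s1 vS = 1" "var s1 vK = k"
    "var s1 vP = 0" "var s1 vMode = 1" "var s1 vGo = 1" "var s1 vB = b" "var s1 vR = r" "var s1 vHd = var s vHd" "emitted s1 = emitted s" using b by (simp_all add: s1_def)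
  have im: "arr s1 aQ ` {..<1} = {r}" using a1(3) by auto
  have "qtree Lb (arr s1 aQ) (arr s1 aPar) 1" unfolding qtree_def using a1(3) rn by (auto simp: inj_on_def)
  moreover have "good Lb (arr s1 aQ) (arr s1 aPar) 1" unfolding good_def im using calculation reach no_loop by auto
  moreover have "marks (arr s1 aQ) 1 1 (arr s1 aVis)" unfolding marks_def im a1(4) using Lb(5) by simp
  ultimately have E: "est Lb 1 s1" unfolding est_def using a1 Lb(1) by simp
  have cm: "card (edges Lb) \<le> m" using card_mono[OF finite_edges[OF wf1] sub] m by simp
  have Apos: "0 < card ?A" using Sol_est_pos[OF E] unfolding a1(3) tedges_one .
  have bk: "bound 1 (card ?A) + 3 * Suc k + 20 \<le> 2500 * (k * card ?A) + 4"
    using bound_root[OF k Apos] .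
  define Q where "Q = ?Q"
  have fr_e: "vB \<notin> mods enum_com" "vR \<notin> mods enum_com" "vK \<notin> mods enum_com" "vHd \<notin> mods enum_com" "aOrd \<notin> amods enum_com"
    by (simp_all add: enum_com_defs)
  have "WP enum_com (WP (reset_com ;; isolate_com) Q) s1"
  proof (rule wp_frame[OF wp_enum_root[OF E a1(7-9) cm]])
    fix s2 :: store
    assume P2: "arr s2 aG = arr s1 aG \<and> tidy 1 s2 \<and> (\<exists>ws. emitted s2 = emitted s1 @ ws \<and> enumerates ws (Sol (edges Lb) k (arr s1 aQ 0) {})) \<and>
      ticks s2 \<le> ticks s1 + bound 1 (card (Sol (edges Lb) k (arr s1 aQ 0) {})) + 5"
      and fr: "\<And>r. r \<notin> mods enum_com ==> var s2 r = var s1 r" "\<And>a. a \<notin> amods enum_com ==> arr s2 a = arr s1 a"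
    have v2: "var s2 vB = b" "var s2 vR = r" "var s2 vK = k" "var s2 vHd = var s vHd" "arr s2 aOrd = ord"
      using fr(1)[OF fr_e(1)] fr(1)[OF fr_e(2)] fr(1)[OF fr_e(3)] fr(1)[OF fr_e(4)] fr(2)[OF fr_e(5)] a1 by simp_all
    have t2: "tidy 1 s2" using P2 by blast
    show "WP (reset_com ;; isolate_com) Q s2"
      unfolding wp_Seq
    proof (rule wp_frame[OF wp_reset[OF t2]])
      fix s3 :: store
      assume P3: "(\<forall>v<n. arr s3 aVis v = 0) \<and> ticks s3 \<le> ticks s2 + 3 * Suc k + 1"
        and fr: "\<And>r. r \<notin> mods reset_com ==> var s3 r = var s2 r" "\<And>a. a \<notin> amods reset_com ==> arr s3 a = arr s2 a"
          "silent reset_com ==> emitted s3 = emitted s2"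
      have v3: "var s3 vB = b" "var s3 vR = r" "var s3 vK = k" "var s3 vHd = var s vHd" "arr s3 aOrd = ord" "arr s3 aG = arr s aG" "emitted s3 = emitted s2"
        using fr(1)[of vB] fr(1)[of vR] fr(1)[of vK] fr(1)[of vHd] fr(2)[of aOrd] fr(2)[of aG] fr(3) v2 P2 a1(1) by (simp_all add: reset_com_def)
      have R3: "rep (arr s3 aG) Lb" using Lb(1) v3 by simp
      show "WP isolate_com Q s3"
      proof (rule wp_frame[OF wp_isolate[OF R3 v3(2) rn]])
        fix s4 :: store
        assume P4: "\<exists>L'. rep (arr s4 aG) L' \<and> edges L' = {e \<in> edges Lb. r \<notin> e} \<and> (\<forall>v<n. v \<noteq> r --> {v, r} \<notin> edges Lb --> L' v = Lb v) \<and>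
            (\<forall>v<n. length (L' v) \<le> length (Lb v)) \<and> ticks s4 \<le> ticks s3 + 11 * length (Lb r) + 1"
          and fr: "\<And>r. r \<notin> mods isolate_com ==> var s4 r = var s3 r" "\<And>a. a \<notin> amods isolate_com ==> arr s4 a = arr s3 a"
            "silent isolate_com ==> emitted s4 = emitted s3"
        have v4: "var s4 vB = b" "var s4 vK = k" "var s4 vHd = var s vHd" "arr s4 aOrd = ord" "arr s4 aVis = arr s3 aVis" "emitted s4 = emitted s2"
          using fr(1)[of vB] fr(1)[of vK] fr(1)[of vHd] fr(2)[of aOrd] fr(2)[of aVis] fr(3) v3
          by (simp_all add: isolate_com_def delete_com_def unlink_com_def)
        from P4 obtain L where L: "rep (arr s4 aG) L" "edges L = {e \<in> edges Lb. r \<notin> e}" "\<forall>v<n. v \<noteq> r --> {v, r} \<notin> edges Lb --> L v = Lb v"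
          "\<forall>v<n. length (L v) \<le> length (Lb v)" "ticks s4 \<le> ticks s3 + 11 * length (Lb r) + 1" by blast
        have rc: "r \<in> K" using b by (auto simp: r_def K_def)
        have keep: "L v = L1 v" if v: "v < n" "v \<notin> K" for v
        proof -
          have "{v, r} \<notin> edges Lb" using cl[OF rc, of v] v(2) sub by (auto simp: insert_commute)
          then show ?thesis using L(3) Lb(3) v rc by auto
        qed
        have len: "length (L v) \<le> length (L1 v)" if "v < n" for v using L(4) Lb(4) that order_trans by blast
        have ivl: "{b..<ot} = insert b {Suc b..<ot}" using b by auto
        have eL: "edges L = {e \<in> edges L1. e \<inter> ord ` {b..<ot} = {}}" unfolding L(2) Lb(2) ivl by (auto simp: r_def)
        have diff: "KS (edges Lb) - KS (edges L) = ?A" unfolding L(2) using KS edges_wf[OF wf] by blast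
        obtain ws where ws: "emitted s2 = emitted s @ ws" "enumerates ws ?A" using P2 a1(3,13) by auto
        have "length (Lb r) \<le> length (L1 r)" using Lb(4) rn by blast
        moreover have "ticks s2 \<le> ticks s + 13 + bound 1 (card ?A)" using P2 a1(3) by (simp add: s1_def)
        ultimately have tk: "ticks s4 \<le> ticks s + 2500 * (k * card ?A) + 11 * length (L1 r) + 20"
          using L(5) P3 bk by linarith
        have "?Q s4"
        proof (intro conjI exI[of _ L] exI[of _ ws])
          show "ticks s4 \<le> ticks s + 2500 * (k * card (KS (edges Lb) - KS (edges L))) + 11 * length (L1 (ord b)) + 20"
            using tk unfolding diff r_def .
          show "enumerates ws (KS (edges Lb) - KS (edges L))" using ws(2) unfolding diff .
          show "edges L = {e \<in> edges L1. e \<inter> ord ` {b..<ot} = {}}" by (rule eL)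
        qed (use L(1) keep len ws(1) v4 P3 in simp_all)
        then show "Q s4" unfolding Q_def .
      qed
    qed
  qed
  moreover have "b < Z" "r < Z" "1 < W" "0 < Z" using vertex_less[OF rn] b(2) injection_le[OF ord] W Z by auto
  ultimately show ?thesis
    unfolding root_com_def Q_def[symmetric] s1_def using b by (simp add: r_def fun_upd_twist)
qed

lemma roots_frame:
  "vA \<notin> mods roots_com" "vN \<notin> mods roots_com" "vK \<notin> mods roots_com" "vOt \<notin> mods roots_com" "aOrd \<notin> amods roots_com" "aSeen \<notin> amods roots_com"
  by (simp_all add: roots_com_defs)

text \<open>Each root pays for its removal by its degree and a constant, and for its search by the
  solutions that contain it and no root used before.\<close>

lemma wp_roots:
  fixes ord :: "nat => nat" and hd ot :: nat
  defines "K \<equiv> ord ` {hd..<ot}"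
  assumes k: "0 < k" and ord: "inj_on ord {..<ot}" "\<forall>i<ot. ord i < n" "hd \<le> ot"
    and par: "\<And>i. hd < i ==> i < ot ==> \<exists>j. hd \<le> j \<and> j < i \<and> {ord j, ord i} \<in> edges L"
    and cl: "\<And>u w. u \<in> K ==> {u, w} \<in> edges L ==> w \<in> K" and m: "card (edges L) \<le> m" and R: "rep (arr s aG) L"
    and s: "var s vHd = hd" "var s vOt = ot" "arr s aOrd = ord" "var s vK = k" "\<forall>v<n. arr s aVis v = 0"
  shows "WP roots_com (\<lambda>s'. \<exists>L'. rep (arr s' aG) L' \<and> edges L' \<subseteq> edges L \<and> (\<forall>v<n. v \<notin> K --> L' v = L v) \<and>
      (\<forall>T\<in>KS (edges L'). \<Union>T \<inter> K = {}) \<and> (\<forall>v<n. arr s' aVis v = 0) \<and>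
      (\<exists>ws. emitted s' = emitted s @ ws \<and> enumerates ws (KS (edges L) - KS (edges L'))) \<and>
      ticks s' \<le> ticks s + 2500 * (k * card (KS (edges L) - KS (edges L'))) + (\<Sum>i=hd..<ot. 11 * length (L (ord i)) + 21) + 2) s"
    (is "WP roots_com ?Q s")
proof -
  have wf: "wf_lists L" using R by (simp add: rep_def)
  let ?T = "\<lambda>b. (\<Sum>i=b..<ot. 11 * length (L (ord i)) + 21)"
  let ?I = "\<lambda>b s'. hd \<le> b \<and> b \<le> ot \<and> (\<exists>Lb. rep (arr s' aG) Lb \<and> edges Lb = {e \<in> edges L. e \<inter> ord ` {b..<ot} = {}} \<and>
      (\<forall>v<n. v \<notin> K --> Lb v = L v) \<and> (\<forall>v<n. length (Lb v) \<le> length (L v)) \<and>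
      (\<exists>ws. emitted s' = emitted s @ ws \<and> enumerates ws (KS (edges L) - KS (edges Lb))) \<and>
      ticks s' \<le> ticks s + 2500 * (k * card (KS (edges L) - KS (edges Lb))) + ?T b + 1) \<and>
      (\<forall>v<n. arr s' aVis v = 0) \<and> var s' vB = b \<and> arr s' aOrd = ord \<and> var s' vK = k \<and> var s' vHd = hd"
  define s1 where "s1 = s\<lparr>var := (var s)(vB := ot), ticks := Suc (ticks s)\<rparr>"
  define Q where "Q = ?Q"
  have otn: "ot \<le> n" using injection_le[OF ord(1,2)] .
  have "WP (While (Minus (Var vB) (Plus (Var vHd) (Var vK))) root_com) Q s1"
  proof (rule wp_While[where I = ?I and f = id])
    have e0: "enumerates [] {}" unfolding enumerates_def by (intro exI[of _ "[]"]) simp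
    show "?I ot s1" using s ord(3) R e0 unfolding s1_def by (intro conjI exI[of _ L] exI[of _ "[]"]) simp_all
  next
    fix b and s' :: store assume "?I b s'"
    then show "safe W Z (Minus (Var vB) (Plus (Var vHd) (Var vK))) s'" using ord(3) otn W by auto
  next
    fix b and s' :: store assume I: "?I b s'" and e: "ev (Minus (Var vB) (Plus (Var vHd) (Var vK))) s' = 0"
    then obtain Lb ws where *: "rep (arr s' aG) Lb" "edges Lb = {e \<in> edges L. e \<inter> ord ` {b..<ot} = {}}"
      "\<forall>v<n. v \<notin> K --> Lb v = L v" "emitted s' = emitted s @ ws" "enumerates ws (KS (edges L) - KS (edges Lb))"
      "ticks s' \<le> ticks s + 2500 * (k * card (KS (edges L) - KS (edges Lb))) + ?T b + 1" by blast
    have b: "hd \<le> b" "b \<le> ot" "b \<le> hd + k" "\<forall>v<n. arr s' aVis v = 0" using I e by auto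
    have wfb: "wf_lists Lb" using *(1) by (simp add: rep_def)
    \<comment> \<open>A tree touching the component stays within the at most \<open>k\<close>
      vertices that were not removed, too few for \<open>k\<close> edges.\<close>
    have no: "\<Union>T \<inter> K = {}" if T: "T \<in> KS (edges Lb)" for T
    proof (rule ccontr)
      assume "\<Union>T \<inter> K \<noteq> {}"
      then obtain e v where v: "e \<in> T" "v \<in> e" "v \<in> K" by blast
      have TE: "T \<subseteq> edges Lb" using T by (auto simp: k_subtrees_def)
      have "Sol (edges Lb) k v {} = {T \<in> KS (edges Lb). v \<in> \<Union>T}" using edges_wf[OF wfb] by (intro Sol_root[OF k finite_edges[OF wfb]]) blast
      then have "T \<in> Sol (edges Lb) k v {}" using T v by blast
      then obtain V where V: "tree v V T" "card T = k" by (auto simp: Sol_def)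
      have out: "u \<in> ord ` {hd..<b}" if "u \<in> K" "u \<in> e" "e \<in> edges Lb" for u e
        using that unfolding *(2) K_def by (auto simp: disjoint_iff) (metis atLeastLessThan_iff imageI not_le)
      have "reach (edges Lb) {v} \<subseteq> ord ` {hd..<b}"
      proof (rule reach_least)
        show "{v} \<subseteq> ord ` {hd..<b}" using out[OF v(3,2)] v(1) TE by blast
        fix u w assume u: "u \<in> ord ` {hd..<b}" "{u, w} \<in> edges Lb"
        have "u \<in> K" using u(1) b by (auto simp: K_def)
        moreover have "{u, w} \<in> edges L" using u(2) *(2) by simp
        ultimately have "w \<in> K" by (rule cl)
        then show "w \<in> ord ` {hd..<b}" using out[of w "{u, w}"] u(2) by simp
      qed
      then have "V \<subseteq> ord ` {hd..<b}" using tree_reach[OF V(1) TE] by blast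
      then have "card V \<le> b - hd" using card_mono[of "ord ` {hd..<b}" V] card_image_interval[OF ord(1) b(2), of hd] by simp
      then show False using tree_facts(3)[OF V(1)] V(2) b(3) by simp
    qed
    have "?T b \<le> ?T hd" using b by (intro sum_mono2) auto
    then have tk: "ticks (tick s') \<le> ticks s + 2500 * (k * card (KS (edges L) - KS (edges Lb))) + ?T hd + 2" using *(6) by simp
    have "?Q (tick s')"
    proof (intro exI[of _ Lb] exI[of _ ws] conjI)
      show "ticks (tick s') \<le> ticks s + 2500 * (k * card (KS (edges L) - KS (edges Lb))) + ?T hd + 2" by (rule tk)
      show "enumerates ws (KS (edges L) - KS (edges Lb))" by (rule *(5))
      show "\<forall>T\<in>KS (edges Lb). \<Union>T \<inter> K = {}" using no by blast
      show "edges Lb \<subseteq> edges L" using *(2) by blast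
    qed (use *(1,3,4) b(4) in simp_all)
    then show "Q (tick s')" unfolding Q_def .
  next
    fix b and s' :: store assume I: "?I b s'" and e: "ev (Minus (Var vB) (Plus (Var vHd) (Var vK))) s' \<noteq> 0"
    then obtain Lb ws where *: "rep (arr s' aG) Lb" "edges Lb = {e \<in> edges L. e \<inter> ord ` {b..<ot} = {}}"
      "\<forall>v<n. v \<notin> K --> Lb v = L v" "\<forall>v<n. length (Lb v) \<le> length (L v)"
      "emitted s' = emitted s @ ws" "enumerates ws (KS (edges L) - KS (edges Lb))"
      "ticks s' \<le> ticks s + 2500 * (k * card (KS (edges L) - KS (edges Lb))) + ?T b + 1" by blast
    obtain b' where b': "b = Suc b'" "hd + k \<le> b'" "b' < ot" using I e by (cases b) auto
    have v: "var (tick s') vB = Suc b'" "arr (tick s') aOrd = ord" "var (tick s') vK = k" "\<forall>v<n. arr (tick s') aVis v = 0" "rep (arr (tick s') aG) Lb"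
      "var s' vHd = hd" using I b' *(1) by simp_all
    show "WP root_com (\<lambda>s'. \<exists>b'. ?I b' s' \<and> id b' < id b) (tick s')"
    proof (rule wp_mono[OF wp_root[OF k ord(1,2) par cl[unfolded K_def] m wf b'(2,3) v(1,2,3,5) *(2)[unfolded b'(1)] *(3)[unfolded K_def] *(4) v(4)]])
      fix s'' :: store
      assume P: "(\<exists>L'. rep (arr s'' aG) L' \<and> edges L' = {e \<in> edges L. e \<inter> ord ` {b'..<ot} = {}} \<and> (\<forall>v<n. v \<notin> ord ` {hd..<ot} --> L' v = L v) \<and>
      (\<forall>v<n. length (L' v) \<le> length (L v)) \<and>
      (\<exists>ws. emitted s'' = emitted (tick s') @ ws \<and> enumerates ws (KS (edges Lb) - KS (edges L'))) \<and>
      ticks s'' \<le> ticks (tick s') + 2500 * (k * card (KS (edges Lb) - KS (edges L'))) + 11 * length (L (ord b')) + 20) \<and>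
      (\<forall>v<n. arr s'' aVis v = 0) \<and> var s'' vB = b' \<and> arr s'' aOrd = ord \<and> var s'' vK = k \<and> var s'' vHd = var (tick s') vHd"
      then obtain L' ws' where L': "rep (arr s'' aG) L'" "edges L' = {e \<in> edges L. e \<inter> ord ` {b'..<ot} = {}}" "\<forall>v<n. v \<notin> K --> L' v = L v"
        "\<forall>v<n. length (L' v) \<le> length (L v)" "emitted s'' = emitted s' @ ws'" "enumerates ws' (KS (edges Lb) - KS (edges L'))"
        "ticks s'' \<le> ticks s' + 1 + 2500 * (k * card (KS (edges Lb) - KS (edges L'))) + 11 * length (L (ord b')) + 20"
        unfolding K_def by auto
      have "edges L' \<subseteq> edges Lb" "edges Lb \<subseteq> edges L" using L'(2) *(2) b'(1) by auto
      then have ks: "KS (edges L') \<subseteq> KS (edges Lb)" "KS (edges Lb) \<subseteq> KS (edges L)" by (simp_all add: KS_mono)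
      let ?A = "KS (edges L) - KS (edges Lb)" let ?B = "KS (edges Lb) - KS (edges L')"
      have un: "KS (edges L) - KS (edges L') = ?A \<union> ?B" "?A \<inter> ?B = {}" using ks by auto
      have cd: "card (KS (edges L) - KS (edges L')) = card ?A + card ?B"
        unfolding un(1) using finite_KS[OF finite_edges[OF wf]] ks by (intro card_Un_disjoint un(2)) (auto intro: finite_subset)
      have Tb: "?T b' = (11 * length (L (ord b')) + 21) + ?T b" using b' by (simp add: sum.atLeast_Suc_lessThan)
      have en: "enumerates (ws @ ws') (KS (edges L) - KS (edges L'))" unfolding un(1) by (rule enumerates_append[OF *(6) L'(6) un(2)])
      have tk: "ticks s'' \<le> ticks s + 2500 * (k * card (KS (edges L) - KS (edges L'))) + ?T b' + 1"
        unfolding cd Tb using L'(7) *(7) by (simp add: algebra_simps)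
      have "?I b' s''"
      proof (intro exI[of _ L'] exI[of _ "ws @ ws'"] conjI)
        show "ticks s'' \<le> ticks s + 2500 * (k * card (KS (edges L) - KS (edges L'))) + ?T b' + 1" by (rule tk)
        show "enumerates (ws @ ws') (KS (edges L) - KS (edges L'))" by (rule en)
        show "edges L' = {e \<in> edges L. e \<inter> ord ` {b'..<ot} = {}}" by (rule L'(2))
      qed (use P L'(1,3,4,5) *(5) b' v(6) in simp_all)
      then show "\<exists>b'. ?I b' s'' \<and> id b' < id b" using b'(1) by (intro exI[of _ b']) (rule conjI, assumption, simp)
    qed
  qed
  then show ?thesis unfolding roots_com_def Q_def[symmetric] s1_def using s by simp
qed

lemma sum_length_le:
  assumes wf: "wf_lists L"
  shows "(\<Sum>v<n. length (L v)) \<le> 2 * card (edges L)"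
proof -
  have "(\<Sum>v<n. length (L v)) = (\<Sum>v<n. card (set (L v)))"
    using wf by (intro sum.cong) (auto simp: wf_lists_def distinct_card)
  also have "\<dots> = card (\<Union>v<n. set (L v))"
    using wf_listsD(5)[OF wf] by (intro card_UN_disjoint[symmetric]) auto
  also have "\<dots> \<le> 2 * card (edges L)"
    by (rule card_nodes_le(2)[OF wf finite_edges[OF wf]]) (use ed_in_edges[OF wf] in auto)
  finally show ?thesis .
qed

text \<open>\<open>C\<close> contains the vertices of finished components. No remaining k-subtree
  meets it, and outside it the lists are still those of the input \<open>L0\<close>, so the lengths
  paid for add up to at most \<open>2 * card (edges L0)\<close>.\<close>

definition scan_inv where
  "scan_inv L0 t0 a L s \<longleftrightarrow> (let ord = arr s aOrd; ot = var s vOt; C = ord ` {..<ot} in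
     a \<le> n \<and> var s vA = a \<and> var s vN = n \<and> var s vK = k \<and> rep (arr s aG) L \<and> edges L \<subseteq> edges L0 \<and>
     inj_on ord {..<ot} \<and> (\<forall>i<ot. ord i < n) \<and> (\<forall>v<n. arr s aSeen v = (if v \<in> C then 1 else 0)) \<and> (\<forall>v<n. arr s aVis v = 0) \<and>
     {..<a} \<subseteq> C \<and> (\<forall>u w. u \<in> C --> {u, w} \<in> edges L0 --> w \<in> C) \<and> (\<forall>v<n. v \<notin> C --> L v = L0 v) \<and>
     (\<forall>T\<in>KS (edges L). \<Union>T \<inter> C = {}) \<and> enumerates (emitted s) (KS (edges L0) - KS (edges L)) \<and>
     ticks s \<le> t0 + 50 * (a + ot + (\<Sum>i<ot. length (L0 (ord i)))) + 2500 * (k * card (KS (edges L0) - KS (edges L))))"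

lemma wp_scan:
  assumes I: "scan_inv L0 t0 a L s" and a: "a < n" and k: "0 < k" and wf0: "wf_lists L0" and m: "card (edges L0) \<le> m"
  shows "WP (Cond (Arr aSeen (Var vA)) Skip (comp_com ;; roots_com) ;; inc vA) (\<lambda>s'. \<exists>L'. scan_inv L0 t0 (Suc a) L' s') (tick s)"
proof -
  define ord ot C where d: "ord = arr s aOrd" "ot = var s vOt" "C = ord ` {..<ot}"
  have v: "var s vA = a" "var s vN = n" "var s vK = k" and R: "rep (arr s aG) L" and sub: "edges L \<subseteq> edges L0"
    and ord: "inj_on ord {..<ot}" "\<forall>i<ot. ord i < n" and seen: "\<forall>v<n. arr s aSeen v = (if v \<in> C then 1 else 0)" and vis: "\<forall>v<n. arr s aVis v = 0"
    and aC: "{..<a} \<subseteq> C" and cl: "\<forall>u w. u \<in> C --> {u, w} \<in> edges L0 --> w \<in> C" and L: "\<forall>v<n. v \<notin> C --> L v = L0 v"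
    and noC: "\<forall>T\<in>KS (edges L). \<Union>T \<inter> C = {}" and en: "enumerates (emitted s) (KS (edges L0) - KS (edges L))"
    and tk: "ticks s \<le> t0 + 50 * (a + ot + (\<Sum>i<ot. length (L0 (ord i)))) + 2500 * (k * card (KS (edges L0) - KS (edges L)))"
    using I unfolding scan_inv_def Let_def d by - (elim conjE, assumption)+
  have b: "a < Z" "Suc a < W" using vertex_less[OF a] a W by auto
  define Q where "Q = (\<lambda>s' :: store. \<exists>L'. scan_inv L0 t0 (Suc a) L' s')"
  have "WP (Cond (Arr aSeen (Var vA)) Skip (comp_com ;; roots_com)) (WP (inc vA) Q) (tick s)"
  proof (cases "a \<in> C")
    case True
    have "{..<Suc a} \<subseteq> C" using aC True by (auto simp: less_Suc_eq)
    moreover define s1 where "s1 = s\<lparr>var := (var s)(vA := Suc a), ticks := Suc (Suc (Suc (ticks s)))\<rparr>"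
    moreover have o1: "arr s1 aOrd = ord" "var s1 vOt = ot" by (simp_all add: s1_def d)
    ultimately have "scan_inv L0 t0 (Suc a) L s1"
      unfolding scan_inv_def Let_def o1 d(3)[symmetric]
    proof (intro conjI)
      show "\<forall>u w. u \<in> C --> {u, w} \<in> edges L0 --> w \<in> C" using cl by blast
      show "\<forall>T\<in>KS (edges L). \<Union>T \<inter> C = {}" by (rule noC)
    qed (use a v R sub ord seen vis L en tk in \<open>simp_all add: s1_def\<close>)
    then have "Q (s\<lparr>var := (var s)(vA := Suc a), ticks := Suc (Suc (Suc (ticks s)))\<rparr>)" unfolding Q_def s1_def by blast
    then show ?thesis using v b seen a True by simp
  next
    case False
    let ?s = "tick (tick s)"
    have "WP comp_com (WP roots_com (WP (inc vA) Q)) ?s"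
    proof (rule wp_frame[OF wp_comp[of ?s L C a ot]])
      show "rep (arr ?s aG) L" "arr ?s aOrd ` {..<var ?s vOt} = C" "inj_on (arr ?s aOrd) {..<var ?s vOt}" "\<forall>i<var ?s vOt. arr ?s aOrd i < n"
        "\<forall>v<n. arr ?s aSeen v = (if v \<in> C then 1 else 0)" "var ?s vA = a" "a < n" "a \<notin> C" "var ?s vOt = ot"
        using R ord seen v a False by (simp_all add: d)
      fix s1 :: store
      assume P1: "comp_inv L C a ot (var s1 vOt) {} s1 \<and> var s1 vHd = ot \<and> (\<forall>i<ot. arr s1 aOrd i = arr ?s aOrd i) \<and>
        ticks s1 \<le> ticks ?s + 10 + 6 * (var s1 vOt - ot) + 7 * (\<Sum>i=ot..<var s1 vOt. length (L (arr s1 aOrd i)))"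
        and fr: "\<And>r. r \<notin> mods comp_com ==> var s1 r = var ?s r" "\<And>a. a \<notin> amods comp_com ==> arr s1 a = arr ?s a"
          "silent comp_com ==> emitted s1 = emitted ?s"
      have v1: "var s1 vA = a" "var s1 vN = n" "var s1 vK = k" "arr s1 aVis = arr s aVis" "arr s1 aG = arr s aG" "emitted s1 = emitted s"
        using fr(1)[of vA] fr(1)[of vN] fr(1)[of vK] fr(2)[of aVis] fr(2)[of aG] fr(3) v by (simp_all add: comp_com_def comp_visit_def)
      define ord1 ot1 K where d1: "ord1 = arr s1 aOrd" "ot1 = var s1 vOt" "K = ord1 ` {ot..<ot1}"
      have eqo: "\<And>i. i < ot ==> ord1 i = ord i" using P1 by (simp add: d1 d)
      have ci: "inj_on ord1 {..<ot1}" "\<forall>i<ot1. ord1 i < n" "ot < ot1" "ord1 ot = a"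
        and seen1: "\<forall>v<n. arr s1 aSeen v = (if v \<in> ord1 ` {..<ot1} then 1 else 0)"
        and par: "\<And>i. ot < i ==> i < ot1 ==> \<exists>j. ot \<le> j \<and> j < i \<and> {ord1 j, ord1 i} \<in> edges L"
        and sc: "\<And>i x. ot \<le> i ==> i < ot1 ==> x \<in> set (L (ord1 i)) ==> nb x \<in> ord1 ` {..<ot1}"
        using conjunct1[OF P1] unfolding comp_inv_def Let_def d1 by blast+
      have ivl: "{..<ot1} = {..<ot} \<union> {ot..<ot1}" using ci(3) by auto
      have C1: "ord1 ` {..<ot1} = C \<union> K" unfolding ivl image_Un d1(3) d(3) using eqo by (auto simp: image_iff)
      have dis: "C \<inter> K = {}"
      proof -
        have "ord1 i \<notin> K" if "i < ot" for i using ord_notin[OF ci(1) that] ci(3) by (simp add: d1)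
        then show ?thesis unfolding d(3) using eqo by auto
      qed
      have Kn: "u < n" if "u \<in> K" for u using that ci(2) by (auto simp: d1)
      \<comment> \<open>The lists of a fresh component are still the original ones, so scanning them
        saw all original edges.\<close>
      have clK0: "w \<in> C \<union> K" if u: "u \<in> K" "{u, w} \<in> edges L0" for u w
      proof -
        obtain x where x: "x \<in> set (L0 u)" "nb x = w" using edgesD[OF wf0 u(2)] by blast
        have "L u = L0 u" using L Kn[OF u(1)] u(1) dis by blast
        then have x': "x \<in> set (L u)" using x by simp
        obtain i where i: "ot \<le> i" "i < ot1" "u = ord1 i" using u(1) by (auto simp: d1)
        show ?thesis using sc[OF i(1,2)] x' x(2) i(3) C1 by blast
      qed
      have clK: "w \<in> K" if u: "u \<in> K" "{u, w} \<in> edges L" for u w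
      proof -
        have e: "{u, w} \<in> edges L0" "{w, u} \<in> edges L0" using u(2) sub by (auto simp: insert_commute)
        then have "w \<notin> C" using cl dis u(1) by blast
        then show ?thesis using clK0[OF u(1) e(1)] by blast
      qed
      have m1: "card (edges L) \<le> m" using card_mono[OF finite_edges[OF wf0] sub] m by simp
      have R1: "rep (arr s1 aG) L" using R v1 by simp
      have h1: "var s1 vHd = ot" "ot \<le> ot1" using P1 ci(3) by auto
      have vis1: "\<forall>v<n. arr s1 aVis v = 0" using vis v1 by simp
      show "WP roots_com (WP (inc vA) Q) s1"
      proof (rule wp_frame[OF wp_roots[OF k ci(1,2) h1(2) par clK[unfolded d1(3)] m1 R1 h1(1) d1(2)[symmetric] d1(1)[symmetric] v1(3) vis1]])
        fix s2 :: store
        assume P2: "\<exists>L'. rep (arr s2 aG) L' \<and> edges L' \<subseteq> edges L \<and> (\<forall>v<n. v \<notin> ord1 ` {ot..<ot1} --> L' v = L v) \<and>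
          (\<forall>T\<in>KS (edges L'). \<Union>T \<inter> ord1 ` {ot..<ot1} = {}) \<and> (\<forall>v<n. arr s2 aVis v = 0) \<and>
          (\<exists>ws. emitted s2 = emitted s1 @ ws \<and> enumerates ws (KS (edges L) - KS (edges L'))) \<and>
          ticks s2 \<le> ticks s1 + 2500 * (k * card (KS (edges L) - KS (edges L'))) + (\<Sum>i=ot..<ot1. 11 * length (L (ord1 i)) + 21) + 2"
          and fr: "\<And>r. r \<notin> mods roots_com ==> var s2 r = var s1 r" "\<And>a. a \<notin> amods roots_com ==> arr s2 a = arr s1 a"
        have v2: "var s2 vA = a" "var s2 vN = n" "var s2 vK = k" "var s2 vOt = ot1" "arr s2 aOrd = ord1" "arr s2 aSeen = arr s1 aSeen"
          using fr(1)[of vA] fr(1)[of vN] fr(1)[of vK] fr(1)[of vOt] fr(2)[of aOrd] fr(2)[of aSeen] v1 roots_frame by (simp_all add: d1)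
        from P2 obtain L' ws where L': "rep (arr s2 aG) L'" "edges L' \<subseteq> edges L" "\<forall>v<n. v \<notin> K --> L' v = L v"
          "\<forall>T\<in>KS (edges L'). \<Union>T \<inter> K = {}" "\<forall>v<n. arr s2 aVis v = 0" "emitted s2 = emitted s @ ws" "enumerates ws (KS (edges L) - KS (edges L'))"
          "ticks s2 \<le> ticks s1 + 2500 * (k * card (KS (edges L) - KS (edges L'))) + (\<Sum>i=ot..<ot1. 11 * length (L (ord1 i)) + 21) + 2"
          unfolding d1(3)[symmetric] v1(6) by - (elim exE conjE, (rule that; assumption))
        have ks: "KS (edges L') \<subseteq> KS (edges L)" "KS (edges L) \<subseteq> KS (edges L0)" using L'(2) sub by (simp_all add: KS_mono)
        let ?A = "KS (edges L0) - KS (edges L)" let ?B = "KS (edges L) - KS (edges L')"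
        have un: "KS (edges L0) - KS (edges L') = ?A \<union> ?B" "?A \<inter> ?B = {}" using ks by auto
        have cd: "card (KS (edges L0) - KS (edges L')) = card ?A + card ?B"
          unfolding un(1) using finite_KS[OF finite_edges[OF wf0]] ks by (intro card_Un_disjoint un(2)) (auto intro: finite_subset)
        have en': "enumerates (emitted s2) (KS (edges L0) - KS (edges L'))" unfolding un(1) L'(6) by (rule enumerates_append[OF en L'(7) un(2)])
        define X where "X = (\<Sum>i=ot..<ot1. length (L0 (ord1 i)))"
        have LK: "L (ord1 i) = L0 (ord1 i)" if "ot \<le> i" "i < ot1" for i
        proof -
          have "ord1 i \<in> K" using that by (simp add: d1)
          then show ?thesis using L Kn dis by blast
        qed
        have X1: "(\<Sum>i=ot..<ot1. length (L (ord1 i))) = X" unfolding X_def using LK by (intro sum.cong) auto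
        have X2: "(\<Sum>i=ot..<ot1. 11 * length (L (ord1 i)) + 21) = 11 * X + 21 * (ot1 - ot)"
          unfolding X1[symmetric] by (simp add: sum.distrib sum_distrib_left)
        have X3: "(\<Sum>i<ot1. length (L0 (ord1 i))) = (\<Sum>i<ot. length (L0 (ord i))) + X"
        proof -
          have "(\<Sum>i<ot1. length (L0 (ord1 i))) = (\<Sum>i<ot. length (L0 (ord1 i))) + X"
            unfolding ivl X_def by (rule sum.union_disjoint) auto
          then show ?thesis using eqo by simp
        qed
        have "ticks s1 \<le> ticks s + 12 + 6 * (ot1 - ot) + 7 * X" using P1 X1 by (simp add: d1)
        then have t2: "ticks s2 + 2 \<le> ticks s + 16 + 27 * (ot1 - ot) + 18 * X + 2500 * (k * card ?B)" using L'(8) X2 by simp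
        have t3: "Suc (ticks s2) \<le> t0 + 50 * (Suc a + ot1 + (\<Sum>i<ot1. length (L0 (ord1 i)))) + 2500 * (k * card (KS (edges L0) - KS (edges L')))"
          unfolding X3 cd using tk t2 ci(3) by (simp add: algebra_simps)
        define s3 where "s3 = s2\<lparr>var := (var s2)(vA := Suc a), ticks := Suc (ticks s2)\<rparr>"
        have o3: "arr s3 aOrd = ord1" "var s3 vOt = ot1" using v2 by (simp_all add: s3_def)
        have "a \<in> K" using ci(3,4) by (auto simp: d1)
        then have aC1: "{..<Suc a} \<subseteq> C \<union> K" using aC by (auto simp: less_Suc_eq)
        have cl1: "w \<in> C \<union> K" if "u \<in> C \<union> K" "{u, w} \<in> edges L0" for u w
          using that(1) cl[rule_format, OF _ that(2)] clK0[OF _ that(2)] by (elim UnE) simp_all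
        have no1: "\<forall>T\<in>KS (edges L'). \<Union>T \<inter> (C \<union> K) = {}"
        proof
          fix T assume T: "T \<in> KS (edges L')"
          then have "T \<in> KS (edges L)" using ks(1) by blast
          then show "\<Union>T \<inter> (C \<union> K) = {}" using bspec[OF L'(4) T] bspec[OF noC] unfolding Int_Un_distrib by simp
        qed
        have LL: "\<forall>v<n. v \<notin> C \<union> K --> L' v = L0 v" using L'(3) L by auto
        have "scan_inv L0 t0 (Suc a) L' s3"
          unfolding scan_inv_def Let_def o3 C1
        proof (intro conjI)
          show "enumerates (emitted s3) (KS (edges L0) - KS (edges L'))" using en' by (simp add: s3_def)
          show "\<forall>u w. u \<in> C \<union> K --> {u, w} \<in> edges L0 --> w \<in> C \<union> K" using cl1 by blast
          show "ticks s3 \<le> t0 + 50 * (Suc a + ot1 + (\<Sum>i<ot1. length (L0 (ord1 i)))) + 2500 * (k * card (KS (edges L0) - KS (edges L')))"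
            using t3 by (simp add: s3_def)
          show "\<forall>T\<in>KS (edges L'). \<Union>T \<inter> (C \<union> K) = {}" by (rule no1)
          show "edges L' \<subseteq> edges L0" using L'(2) sub by blast
          show "\<forall>v<n. arr s3 aSeen v = (if v \<in> C \<union> K then 1 else 0)" using seen1 v2(6) unfolding C1 by (simp add: s3_def)
        qed (use a v2 L'(1,5) ci(1,2) aC1 LL in \<open>simp_all add: s3_def\<close>)
        then have "Q s3" unfolding Q_def by blast
        then show "WP (inc vA) Q s2" using v2 b W unfolding s3_def by simp
      qed
    qed
    then show ?thesis using v b seen a False by simp
  qed
  then show ?thesis unfolding Q_def wp_Seq[of _ _ "Cond _ _ _"] .
qed

lemma wp_main:
  assumes R: "rep (arr s aG) L0" and m: "card (edges L0) \<le> m" and s: "var s vN = n" "var s vK = k" "emitted s = []"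
    "\<forall>v<n. arr s aSeen v = 0" "\<forall>v<n. arr s aVis v = 0"
  shows "WP main_com (\<lambda>s'. enumerates (emitted s') (KS (edges L0)) \<and> ticks s' \<le> ticks s + 2500 * (n + m + k * card (KS (edges L0)) + 1)) s"
    (is "WP main_com ?Q s")
proof (cases "k = 0")
  case True
  have "KS (edges L0) = {{}}" using finite_edges[of L0] R True
    by (auto simp: k_subtrees_def rep_def edge_induced_def connected_graph_def acyclic_graph_def is_cycle_def walk_def dest: finite_subset)
  moreover have "enumerates [0] {{}}" unfolding enumerates_def by (intro exI[of _ "[[]]"]) (simp add: encode_edges_def listed_edges_def)
  ultimately show ?thesis unfolding main_com_def using s True W by simp
next
  case False
  then have k: "0 < k" by simp
  have wf: "wf_lists L0" using R by (simp add: rep_def)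
  define Q where "Q = ?Q"
  define t0 where "t0 = ticks s + 3"
  define s1 where "s1 = s\<lparr>var := (var s)(vA := 0, vOt := 0), ticks := Suc (Suc (Suc (ticks s)))\<rparr>"
  let ?I = "\<lambda>l s'. \<exists>L. l \<le> n \<and> scan_inv L0 t0 (n - l) L s'"
  have "WP (While (Minus (Var vN) (Var vA)) (Cond (Arr aSeen (Var vA)) Skip (comp_com ;; roots_com) ;; inc vA)) Q s1"
  proof (rule wp_While[where I = ?I and f = id])
    have e0: "enumerates [] {}" unfolding enumerates_def by (intro exI[of _ "[]"]) simp
    show "?I n s1" unfolding scan_inv_def Let_def using R s e0 by (intro exI[of _ L0]) (simp add: s1_def t0_def)
  next
    fix l and s' :: store assume "?I l s'"
    then show "safe W Z (Minus (Var vN) (Var vA)) s'" using W by (auto simp: scan_inv_def Let_def)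
  next
    fix l and s' :: store assume "?I l s'" and e: "ev (Minus (Var vN) (Var vA)) s' = 0"
    then obtain L where l: "l \<le> n" and I: "scan_inv L0 t0 (n - l) L s'" by blast
    define ord ot where d: "ord = arr s' aOrd" "ot = var s' vOt"
    have l0: "l = 0" using I e l by (auto simp: scan_inv_def Let_def)
    have *: "rep (arr s' aG) L" "inj_on ord {..<ot}" "\<forall>i<ot. ord i < n" "{..<n} \<subseteq> ord ` {..<ot}" "\<forall>T\<in>KS (edges L). \<Union>T \<inter> ord ` {..<ot} = {}"
      "enumerates (emitted s') (KS (edges L0) - KS (edges L))"
      "ticks s' \<le> t0 + 50 * (n + ot + (\<Sum>i<ot. length (L0 (ord i)))) + 2500 * (k * card (KS (edges L0) - KS (edges L)))"
      using I unfolding l0 scan_inv_def Let_def d by simp_all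
    have wfL: "wf_lists L" using *(1) by (simp add: rep_def)
    \<comment> \<open>By now every vertex belongs to a finished component, and a k-subtree with
      positive \<open>k\<close> has some vertex.\<close>
    have none: "KS (edges L) = {}"
    proof (rule ccontr)
      assume "KS (edges L) \<noteq> {}"
      then obtain T where T: "T \<in> KS (edges L)" by blast
      then have "T \<subseteq> edges L" "card T = k" by (auto simp: k_subtrees_def)
      moreover obtain e where e: "e \<in> T" using \<open>card T = k\<close> k by fastforce
      ultimately have "card e = 2" "e \<subseteq> {..<n}" using edges_wf[OF wfL] by blast+
      then obtain v where "v \<in> e" "v < n" by (cases "e = {}") auto
      then show False using *(4,5) T e by blast
    qed
    have im: "ord ` {..<ot} = {..<n}" using *(3,4) by auto
    have ot: "ot = n" using card_image[OF *(2)] im by simp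
    have "(\<Sum>i<ot. length (L0 (ord i))) = (\<Sum>v<n. length (L0 v))"
      unfolding im[symmetric] by (simp add: sum.reindex[OF *(2)])
    then have "(\<Sum>i<ot. length (L0 (ord i))) \<le> 2 * m" using sum_length_le[OF wf] m by simp
    then have "?Q (tick s')" using *(6,7) unfolding none ot t0_def by simp
    then show "Q (tick s')" unfolding Q_def .
  next
    fix l and s' :: store assume "?I l s'" and e: "ev (Minus (Var vN) (Var vA)) s' \<noteq> 0"
    then obtain L where l: "l \<le> n" and I: "scan_inv L0 t0 (n - l) L s'" by blast
    have l0: "n - l < n" using I e by (auto simp: scan_inv_def Let_def)
    show "WP (Cond (Arr aSeen (Var vA)) Skip (comp_com ;; roots_com) ;; inc vA) (\<lambda>s'. \<exists>l'. ?I l' s' \<and> id l' < id l) (tick s')"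
    proof (rule wp_mono[OF wp_scan[OF I l0 k wf m]])
      fix s'' :: store assume "\<exists>L'. scan_inv L0 t0 (Suc (n - l)) L' s''"
      moreover have "Suc (n - l) = n - (l - 1)" "l - 1 < l" using l0 l by auto
      ultimately show "\<exists>l'. ?I l' s'' \<and> id l' < id l" using l by (intro exI[of _ "l - 1"]) auto
    qed
  qed
  then show ?thesis unfolding main_com_def Q_def[symmetric] s1_def using s False W by simp
qed

end

section \<open>The input memory\<close>

context adjacency
begin

lemma card_nodes: "card nodes = 2 * m"
proof -
  have "nodes = (\<lambda>i. n + 4 * i) ` {..<2 * m}" by (auto simp: nodes_def)
  then show ?thesis by (simp add: card_image inj_on_def)
qed

lemma two_nodes_per_edge:
  assumes wf: "wf_lists L"
  shows "2 * card (edges L) \<le> card (\<Union>v<n. set (L v))"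
proof -
  let ?U = "\<Union>v<n. set (L v)"
  have fib: "2 \<le> card {x \<in> ?U. ed x = e}" if e: "e \<in> edges L" for e
  proof -
    obtain v x where x: "v < n" "x \<in> set (L v)" "e = ed x" using edgesE[OF wf e] by metis
    note X = wf_listsD[OF wf x(1,2)]
    have "{x, tw x} \<subseteq> {x \<in> ?U. ed x = e}" using x X by auto
    then have "card {x, tw x} \<le> card {x \<in> ?U. ed x = e}" by (intro card_mono) auto
    then show ?thesis using X(7) by auto
  qed
  have "2 * card (edges L) \<le> (\<Sum>e\<in>edges L. card {x \<in> ?U. ed x = e})"
    using sum_bounded_below[of "edges L" 2 "\<lambda>e. card {x \<in> ?U. ed x = e}"] fib by (simp add: mult.commute)
  also have "\<dots> = card (\<Union>e\<in>edges L. {x \<in> ?U. ed x = e})"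
    using finite_edges[OF wf] by (intro card_UN_disjoint[symmetric]) auto
  also have "\<dots> \<le> card ?U" by (intro card_mono) auto
  finally show ?thesis .
qed

text \<open>The word bound speaks of every cell, not only of those reached through lists. The
  \<open>2 * m\<close> node places are all occupied by the nodes of \<open>m\<close> edges, so each
  cell of the input is a list head, a neighbour or a pointer of some listed node.\<close>

lemma rep_cell_bound:
  assumes R: "rep M L" and E: "card (edges L) = m" and z: "\<forall>a\<ge>n + 8 * m. M a = 0"
  shows "M a \<le> n + 8 * m"
proof -
  have wf: "wf_lists L" and ll: "\<And>v. v < n ==> linked_list M 0 (M v) (L v)" using R by (auto simp: rep_def)
  have sub: "(\<Union>v<n. set (L v)) \<subseteq> nodes" using wf by (auto simp: wf_lists_def)
  moreover have "finite nodes" by (simp add: nodes_def)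
  ultimately have U: "(\<Union>v<n. set (L v)) = nodes"
    using two_nodes_per_edge[OF wf] E card_nodes by (intro card_seteq) auto
  consider "a < n" | "n \<le> a" "a < n + 8 * m" | "n + 8 * m \<le> a" by linarith
  then show ?thesis
  proof cases
    case 1
    show ?thesis
    proof (cases "L a")
      case Nil
      then show ?thesis using ll[OF 1] by simp
    next
      case (Cons y ys)
      then have "M a = y" "y \<in> nodes" using ll[OF 1] wf_listsD(1)[OF wf 1, of y] by simp_all
      then show ?thesis using node_bounds[of y] by simp
    qed
  next
    case 2
    define x j where xj: "x = n + 4 * ((a - n) div 4)" "j = (a - n) mod 4"
    have a: "a = x + j" "j < 4" using 2 by (simp_all add: xj)
    have "(a - n) div 4 < 2 * m" using 2 by auto
    then have xn: "x \<in> nodes" by (auto simp: nodes_def xj)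
    then obtain v where v: "v < n" "x \<in> set (L v)" using U by blast
    note X = wf_listsD[OF wf v]
    have st: "M x = nb x" "M (x + 3) = tw x" using R xn by (auto simp: rep_def)
    have "nb (tw x) = v" "M (tw x) = nb (tw x)" using X R by (auto simp: rep_def)
    then have "cell_ok M x"
      using wf v X st by (intro cell_okI[OF ll[OF v(1)]]) (auto simp: wf_lists_def)
    then have c: "M (x + 1) \<noteq> 0 ==> M (x + 1) \<in> nodes" "M (x + 2) \<noteq> 0 ==> M (x + 2) \<in> nodes" by (auto simp: cell_ok_def)
    have "M (x + 1) \<le> n + 8 * m" "M (x + 2) \<le> n + 8 * m" "M (x + 3) \<le> n + 8 * m" "M x \<le> n + 8 * m"
      using c node_bounds[of "M (x + 1)"] node_bounds[of "M (x + 2)"] node_bounds[OF X(8)] st X(2)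
      by (cases "M (x + 1) = 0"; cases "M (x + 2) = 0"; simp)+
    moreover have "j = 0 \<or> j = 1 \<or> j = 2 \<or> j = 3" using a(2) by linarith
    ultimately show ?thesis using a(1) by auto
  qed (use z in simp)
qed

end

lemma adjacency_lists_rep:
  assumes G: "simple_graph ({..<n}, E)" and A: "adjacency_lists n E M"
  shows "\<exists>L. adjacency.rep n (card E) M (\<lambda>x. M (x + 3)) M L \<and> adjacency.edges n M L = E"
proof -
  interpret adjacency n "card E" M "\<lambda>x. M (x + 3)" .
  obtain L where L: "\<And>v. v < n ==> linked_list M 0 (M v) (L v) \<and> distinct (L v) \<and> set (L v) \<subseteq> nodes \<and>
      bij_betw M (set (L v)) {w. {v, w} \<in> E} \<and> (\<forall>x\<in>set (L v). M (x + 3) \<in> set (L (M x)) \<and> M (M (x + 3)) = v)"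
    using A unfolding adjacency_lists_def nodes_def by blast
  have E: "\<And>e. e \<in> E ==> e \<subseteq> {..<n} \<and> card e = 2" using G by (auto simp: simple_graph_def)
  have im: "M ` set (L v) = {w. {v, w} \<in> E}" "inj_on M (set (L v))" if "v < n" for v using L[OF that] by (auto simp: bij_betw_def)
  have nb: "{v, M x} \<in> E \<and> M x < n \<and> M x \<noteq> v" if "v < n" "x \<in> set (L v)" for v x
  proof -
    have e: "{v, M x} \<in> E" using im(1)[OF that(1)] that(2) by blast
    then show ?thesis using E[OF e] by (cases "M x = v") auto
  qed
  have "wf_lists L" unfolding wf_lists_def using L im(2) nb by simp
  moreover have "edges L = E"
  proof
    show "edges L \<subseteq> E" using nb by (auto simp: edges_def)
    show "E \<subseteq> edges L"
    proof
      fix e assume e: "e \<in> E"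
      then obtain u w where uw: "e = {u, w}" using E[OF e] by (auto simp: card_2_iff)
      then have "u < n" using E[OF e] by simp
      moreover obtain x where "x \<in> set (L u)" "w = M x" using im(1)[OF \<open>u < n\<close>] e uw by blast
      ultimately show "e \<in> edges L" using uw by (auto simp: edges_def)
    qed
  qed
  ultimately show ?thesis using L by (intro exI[of _ L]) (simp add: rep_def)
qed

section \<open>The complete machine program\<close>

text \<open>Three doublings of \<open>n + m + 1\<close> give \<open>Z\<close>; the bases of arrays
  \<open>1\<close> to \<open>15\<close> follow by repeated addition, array \<open>0\<close> having
  base \<open>0\<close> already. These are \<open>6 + 15\<close> instructions, hence the start
  address \<open>21\<close> of the main program.\<close>

definition init_code :: "instr list" where
  "init_code = [Add 70 0 1, Const 71 1, Add 70 70 71, Add 70 70 70, Add 70 70 70, Add 70 70 70] @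
     map (\<lambda>a. Add (51 + a) (50 + a) 70) [0..<15]"

definition program :: "instr list" where
  "program = init_code @ ccom 21 main_com"

lemma words_ok_update: "words_ok W c ==> v < W ==> words_ok W (c\<lparr>pc := p, reg := (reg c)(r := v)\<rparr>)"
  by (simp add: words_ok_def)

lemma steps_Add:
  assumes "p < length P" "P ! p = Add i j l" "pc c = p" "words_ok W c" "reg c j + reg c l < W"
  shows "steps P W B c 1 (c\<lparr>pc := Suc p, reg := (reg c)(i := reg c j + reg c l)\<rparr>)"
  using steps_one[of P c "Add i j l" B W] assms words_ok_update[OF assms(4,5), of i "Suc p"] by simp

lemma steps_Const:
  assumes "p < length P" "P ! p = Const i x" "pc c = p" "words_ok W c" "x < W"
  shows "steps P W B c 1 (c\<lparr>pc := Suc p, reg := (reg c)(i := x)\<rparr>)"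
  using steps_one[of P c "Const i x" B W] assms words_ok_update[OF assms(4,5), of i "Suc p"] by simp

lemma steps_bases:
  assumes "code_at P p (map (\<lambda>a. Add (51 + a) (50 + a) 70) [0..<j])" "pc c = p" "words_ok W c" "reg c 50 = 0" "reg c 70 = Z" "16 * Z < W" "j \<le> 15"
  shows "steps P W B c j (c\<lparr>pc := p + j, reg := (\<lambda>r. if 50 < r \<and> r \<le> 50 + j then (r - 50) * Z else reg c r)\<rparr>)"
  using assms(1,7)
proof (induction j)
  case 0
  have "(\<lambda>r. if 50 < r \<and> r \<le> 50 + (0::nat) then (r - 50) * Z else reg c r) = reg c" by auto
  then show ?case using assms(2,3) by auto
next
  case (Suc j)
  let ?c = "c\<lparr>pc := p + j, reg := (\<lambda>r. if 50 < r \<and> r \<le> 50 + j then (r - 50) * Z else reg c r)\<rparr>"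
  have 1: "steps P W B c j ?c" using Suc by simp
  have j: "reg ?c (50 + j) = j * Z" "reg ?c 70 = Z" using assms(4,5) Suc.prems(2) by auto
  have "Suc j * Z \<le> 16 * Z" using Suc.prems(2) by (intro mult_right_mono) auto
  then have "Z + j * Z \<le> 16 * Z" by (simp only: mult_Suc)
  then have "j * Z + Z < W" using assms(6) by linarith
  then have b: "reg ?c (50 + j) + reg ?c 70 < W" unfolding j .
  have "steps P W B ?c 1 (?c\<lparr>pc := Suc (p + j), reg := (reg ?c)(51 + j := reg ?c (50 + j) + reg ?c 70)\<rparr>)"
    using Suc.prems(1) steps_words[OF 1] b by (intro steps_Add) auto
  moreover have "(reg ?c)(51 + j := reg ?c (50 + j) + reg ?c 70) = (\<lambda>r. if 50 < r \<and> r \<le> 50 + Suc j then (r - 50) * Z else reg c r)"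
    unfolding j by (auto simp: fun_eq_iff)
  ultimately show ?case using steps_trans[OF 1] by fastforce
qed

lemma steps_init:
  assumes code: "code_at P 0 init_code" and c: "pc c = 0" "words_ok W c" "reg c 0 = n" "reg c 1 = m" "reg c 50 = 0"
    and W: "16 * (8 * (n + m + 1)) < W"
  shows "\<exists>c'. steps P W B c 21 c' \<and> pc c' = 21 \<and> mem c' = mem c \<and> out c' = out c \<and> (\<forall>r<50. reg c' r = reg c r) \<and>
    (\<forall>a<16. reg c' (50 + a) = a * (8 * (n + m + 1)))"
proof -
  have P: "0 < length P" "P ! 0 = Add 70 0 1" "1 < length P" "P ! 1 = Const 71 1" "2 < length P" "P ! 2 = Add 70 70 71"
    "3 < length P" "P ! 3 = Add 70 70 70" "4 < length P" "P ! 4 = Add 70 70 70" "5 < length P" "P ! 5 = Add 70 70 70"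
    and code': "code_at P 6 (map (\<lambda>a. Add (51 + a) (50 + a) 70) [0..<15])"
    using code unfolding init_code_def code_at_append code_at_Cons by (simp_all add: eval_nat_numeral)
  define c1 where "c1 = c\<lparr>pc := 1, reg := (reg c)(70 := n + m)\<rparr>"
  have 1: "steps P W B c 1 c1" using steps_Add[OF P(1,2) c(1,2), of B] c(3,4) W by (simp add: c1_def)
  define c2 where "c2 = c1\<lparr>pc := 2, reg := (reg c1)(71 := 1)\<rparr>"
  have 2: "steps P W B c1 1 c2" using steps_Const[OF P(3,4) _ steps_words[OF 1], of B] W by (simp add: c1_def c2_def numeral_2_eq_2)
  define c3 where "c3 = c2\<lparr>pc := 3, reg := (reg c2)(70 := n + m + 1)\<rparr>"
  have 3: "steps P W B c2 1 c3" using steps_Add[OF P(5,6) _ steps_words[OF 2], of B] W by (simp add: c1_def c2_def c3_def)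
  have r3: "pc c3 = 3" "reg c3 70 = n + m + 1" by (simp_all add: c3_def)
  define c4 where "c4 = c3\<lparr>pc := 4, reg := (reg c3)(70 := reg c3 70 + reg c3 70)\<rparr>"
  have 4: "steps P W B c3 1 c4" using steps_Add[OF P(7,8) r3(1) steps_words[OF 3], of B] r3(2) W by (simp add: c4_def)
  have r4: "pc c4 = 4" "reg c4 70 = 2 * (n + m + 1)" using r3 by (simp_all add: c4_def)
  define c5 where "c5 = c4\<lparr>pc := 5, reg := (reg c4)(70 := reg c4 70 + reg c4 70)\<rparr>"
  have 5: "steps P W B c4 1 c5" using steps_Add[OF P(9,10) r4(1) steps_words[OF 4], of B] r4(2) W by (simp add: c5_def)
  have r5: "pc c5 = 5" "reg c5 70 = 4 * (n + m + 1)" using r4 by (simp_all add: c5_def)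
  define c6 where "c6 = c5\<lparr>pc := 6, reg := (reg c5)(70 := reg c5 70 + reg c5 70)\<rparr>"
  have 6: "steps P W B c5 1 c6" using steps_Add[OF P(11,12) r5(1) steps_words[OF 5], of B] r5(2) W by (simp add: c6_def)
  let ?Z = "8 * (n + m + 1)"
  let ?c = "c6\<lparr>pc := 6 + 15, reg := (\<lambda>r. if 50 < r \<and> r \<le> 50 + 15 then (r - 50) * ?Z else reg c6 r)\<rparr>"
  have r6: "reg c6 = (reg c)(70 := ?Z, 71 := 1)" "mem c6 = mem c" "out c6 = out c" by (auto simp: c1_def c2_def c3_def c4_def c5_def c6_def)
  have 7: "steps P W B c6 15 ?c"
    by (rule steps_bases[OF code' _ steps_words[OF 6]]) (use r6 c W in \<open>simp_all add: c6_def\<close>)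
  have "steps P W B c 21 ?c"
    using steps_trans[OF steps_trans[OF steps_trans[OF steps_trans[OF steps_trans[OF steps_trans[OF 1 2] 3] 4] 5] 6] 7] by simp
  moreover have "\<forall>a<16. reg ?c (50 + a) = a * ?Z" using c(5) r6(1) by auto
  ultimately show ?thesis using r6 by (intro exI[of _ ?c]) auto
qed

lemma wfc_main: "wfc main_com"
  by (simp add: main_com_def comp_com_def comp_visit_def roots_com_defs)

lemma program_correct:
  assumes G: "simple_graph ({..<n}, E)" and A: "adjacency_lists n E M" and W: "200 * (n + card E + k + 2) \<le> W"
  defines "N \<equiv> card (k_subtrees ({..<n}, E) k)"
  shows "\<exists>t c. steps program W (128 * (n + card E + 1)) (initial_config n (card E) k M) t c \<and>
    t \<le> 21 + 2500 * length program * (n + card E + k * N + 1) \<and> pc c = length program \<and> enumerates (out c) (k_subtrees ({..<n}, E) k)"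
proof -
  define m Z where d: "m = card E" "Z = 8 * (n + m + 1)"
  interpret machine n m M "\<lambda>x. M (x + 3)" W Z k
    by unfold_locales (use W d in auto)
  obtain L where L: "rep M L" "edges L = E" using adjacency_lists_rep[OF G A] d by auto
  have z: "\<forall>a\<ge>n + 8 * m. M a = 0" using A by (simp add: adjacency_lists_def d)
  have Mb: "M a < W" for a using rep_cell_bound[OF L(1) _ z, of a] L(2) W by (auto simp: d)
  let ?c0 = "initial_config n m k M"
  have ok0: "words_ok W ?c0" using Mb W by (auto simp: words_ok_def initial_config_def d)
  have "length init_code = 21" by (simp add: init_code_def)
  then have code: "code_at program 0 init_code" "code_at program 21 (ccom 21 main_com)"
    by (auto simp: program_def code_at_def nth_append)
  obtain c1 where c1: "steps program W (16 * Z) ?c0 21 c1" "pc c1 = 21" "mem c1 = M" "out c1 = []" "\<forall>r<50. reg c1 r = reg ?c0 r"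
    "\<forall>a<16. reg c1 (50 + a) = a * Z"
    using steps_init[OF code(1) _ ok0, of n m "16 * Z"] W by (auto simp: d initial_config_def)
  define s where "s = \<lparr>var = reg ?c0, arr = (\<lambda>a i. M (a * Z + i)), emitted = [], ticks = 0\<rparr>"
  have sim: "sim W Z s c1" using c1 steps_words[OF c1(1)] by (simp add: sim_def s_def)
  \<comment> \<open>All arrays except the graph lie beyond the input, where the memory is
    \<open>0\<close>, so no time is spent on initialising them.\<close>
  have zero: "arr s a i = 0" if "0 < a" for a i
  proof -
    have "Z \<le> a * Z" using that by simp
    moreover have "n + 8 * m \<le> Z" by (simp add: d)
    ultimately have "n + 8 * m \<le> a * Z + i" by linarith
    then show ?thesis using z by (simp add: s_def)
  qed
  have "WP main_com (\<lambda>s'. enumerates (emitted s') (KS (edges L)) \<and> ticks s' \<le> ticks s + 2500 * (n + m + k * card (KS (edges L)) + 1)) s"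
  proof (rule wp_main)
    show "rep (arr s aG) L" using L by (simp add: s_def)
    show "\<forall>v<n. arr s aSeen v = 0" "\<forall>v<n. arr s aVis v = 0" using zero by simp_all
  qed (use L zero in \<open>simp_all add: s_def initial_config_def d\<close>)
  then obtain s' where s': "big W Z main_com s s'" "enumerates (emitted s') (KS E)" "ticks s' \<le> 2500 * (n + m + k * N + 1)"
    unfolding wp_def L(2) N_def by (auto simp: s_def)
  have "16 * Z \<le> W" using W by (simp add: d)
  then obtain t c where t: "steps program W (16 * Z) c1 t c" "t + length program * ticks s \<le> length program * ticks s'"
    "pc c = 21 + clen main_com" "sim W Z s' c"
    using ccom_correct[OF s'(1) code(2) sim c1(2) wfc_main _ order_refl] by blast
  have "length program * ticks s' \<le> length program * (2500 * (n + m + k * N + 1))" using s'(3) by (rule mult_le_mono2)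
  then have "t \<le> length program * (2500 * (n + m + k * N + 1))" using t(2) by linarith
  then have "21 + t \<le> 21 + 2500 * length program * (n + m + k * N + 1)" by (simp only: ac_simps nat_add_left_cancel_le)
  moreover have "length program = 21 + clen main_com" by (simp add: program_def init_code_def)
  moreover have "out c = emitted s'" using t(4) by (simp add: sim_def)
  moreover have "16 * Z = 128 * (n + m + 1)" by (simp add: d)
  ultimately show ?thesis
    using steps_trans[OF c1(1) t(1)] t(3) s'(2) unfolding d(1)[symmetric] by (intro exI[of _ "21 + t"] exI[of _ c]) simp
qed

theorem theorem10:
  shows "\<exists>(P :: instr list) (c :: nat). \<forall>(n :: nat) (E :: nat set set) (k :: nat) (M :: nat \<Rightarrow> nat).
    simple_graph ({..<n}, E) \<longrightarrow> adjacency_lists n E M \<longrightarrow>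
      (let m = card E;
           N = card (k_subtrees ({..<n}, E) k);
           s = initial_config n m k M
       in \<exists>t \<le> c * (n + m + k * N + 1).
            halted P (run P t s) \<and>
            enumerates (out (run P t s)) (k_subtrees ({..<n}, E) k) \<and>
            runs_within_space P s t (c * (n + m + 1)) \<and>
            runs_within_words P s t ((n + m + k + 2) ^ c))"
proof -
  \<comment> \<open>\<open>2500 * length program\<close> bounds the time up to a constant;
    \<open>200\<close> covers the \<open>21\<close> initial instructions, the factor
    \<open>128\<close> of the space bound and the exponent of the word bound.\<close>
  define c where "c = 200 + 2500 * length program"
  have "\<exists>t \<le> c * (n + card E + k * card (k_subtrees ({..<n}, E) k) + 1).
      halted program (run program t (initial_config n (card E) k M)) \<and>
      enumerates (out (run program t (initial_config n (card E) k M))) (k_subtrees ({..<n}, E) k) \<and>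
      runs_within_space program (initial_config n (card E) k M) t (c * (n + card E + 1)) \<and>
      runs_within_words program (initial_config n (card E) k M) t ((n + card E + k + 2) ^ c)"
    if G: "simple_graph ({..<n}, E)" and A: "adjacency_lists n E M" for n E k M
  proof -
    define X where "X = n + card E + k + 2"
    \<comment> \<open>The linear bound on words is turned into the required power of
      \<open>X\<close>: as \<open>X\<close> is at least \<open>2\<close>, eight factors outweigh
      \<open>200\<close>.\<close>
    have "200 \<le> (2::nat) ^ 8" by simp
    also have "\<dots> \<le> X ^ 8" by (intro power_mono) (simp_all add: X_def)
    also have "\<dots> \<le> X ^ (c - 1)" by (intro power_increasing) (simp_all add: X_def c_def)
    finally have "200 * X \<le> X ^ (c - 1) * X" by (rule mult_le_mono1)
    also have "\<dots> = X ^ c" by (simp add: power_eq_if c_def)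
    finally have W: "200 * (n + card E + k + 2) \<le> (n + card E + k + 2) ^ c" by (simp only: X_def)
    obtain t c' where t: "steps program ((n + card E + k + 2) ^ c) (128 * (n + card E + 1)) (initial_config n (card E) k M) t c'"
      "t \<le> 21 + 2500 * length program * (n + card E + k * card (k_subtrees ({..<n}, E) k) + 1)"
      "pc c' = length program" "enumerates (out c') (k_subtrees ({..<n}, E) k)"
      using program_correct[OF G A W] by blast
    have "128 * (n + card E + 1) \<le> c * (n + card E + 1)" by (intro mult_le_mono1) (simp add: c_def)
    then have "{..<128 * (n + card E + 1)} \<subseteq> {..<c * (n + card E + 1)}" by (simp only: lessThan_subset_iff)
    then have "runs_within_space program (initial_config n (card E) k M) t (c * (n + card E + 1))"
      using t(1) unfolding steps_def runs_within_space_def by (meson subset_trans)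
    moreover have "t \<le> c * (n + card E + k * card (k_subtrees ({..<n}, E) k) + 1)"
    proof -
      have "21 + 2500 * length program * Y \<le> c * Y" if "1 \<le> Y" for Y using that by (simp add: c_def algebra_simps)
      then show ?thesis using t(2) by (meson le_add2 order_trans)
    qed
    ultimately show ?thesis using t(1,3,4) unfolding steps_def by (intro exI[of _ t] conjI) (simp_all add: halted_def)
  qed
  then show ?thesis unfolding Let_def by (intro exI[of _ program], intro exI[of _ c], intro allI impI)
qed

end
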